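(* Let $m\ge 0$ be an integer and let $q\in W_1^m[0,1]$ be a complex-valued function such that $q^{(j)}(0)=q^{(j)}(1)$ for $j=0,\ldots,m-1$ (no endpoint condition if $m=0$). Fix one of the two cases: case 1 (periodic boundary conditions $u(0)-u(1)=0$, $u'(0)-u'(1)=0$) or case 2 (antiperiodic boundary conditions $u(0)+u(1)=0$, $u'(0)+u'(1)=0$). Put $$\alpha_n=\int_0^1 q(x)e^{2\pi i n x}\,dx,\qquad \beta_n=\int_0^1 q(x)e^{-2\pi i n x}\,dx .$$ Suppose there exist a constant $c_0>0$ and a sequence of natural numbers $n_k$ $(k=1,2,\ldots)$, all even (in case 1), respectively all odd (in case 2), such that for all $k$ $$|\alpha_{n_k}|>\frac{c_0}{n_k^{m+1}},\qquad |\beta_{n_k}|>\frac{c_0}{n_k^{m+1}},$$ and moreover $$\lim_{k\to\infty}\left(\left|\frac{\alpha_{n_k}}{\beta_{n_k}}\right|+\left|\frac{\beta_{n_k}}{\alpha_{n_k}}\right|\right)=\infty .$$ Then the system $\{u_n(x)\}$ of root functions of the operator $Lu=u''-q(x)u$ on $(0,1)$ with the boundary conditions of the chosen case is not a basis for $L_2(0,1)$.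
   Context: $W_1^m[0,1]$ is the Sobolev space of functions whose derivatives up to order $m$ belong to $L_1(0,1)$; $W_1^0[0,1]=L_1(0,1)$. For a complex-valued $q\in L_1(0,1)$, the operator $Lu=u''-q(x)u$ with the given boundary conditions acts in $L_2(0,1)$ on the functions $u$ such that $u,u'$ are absolutely continuous on $[0,1]$, $u''-qu\in L_2(0,1)$, and $u$ satisfies the boundary conditions. Its root functions are its eigenfunctions and associated (generalized eigen-) functions. The root function system $\{u_n(x)\}$ is a union, over all eigenvalues, of bases of the corresponding root subspaces (generalized eigenspaces), consisting of eigenfunctions and associated functions. This system is known to be complete and minimal in $L_2(0,1)$. "Basis" means Schauder basis. *)

theory Defs
  imports "HOL-Analysis.Analysis" "HOL-Library.Function_Algebras"
begin

abbreviation leb01 :: "real measure" where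
  "leb01 \<equiv> lebesgue_on {0..1}"

text \<open>
  Elements of L_1(0,1) and L_2(0,1) are represented by functions on the reals, of which only the
  values on [0,1] matter, up to null sets.
\<close>

definition L2 :: "(real \<Rightarrow> complex) \<Rightarrow> bool" where
  "L2 f \<longleftrightarrow> f \<in> borel_measurable leb01 \<and> integrable leb01 (\<lambda>x. (cmod (f x))\<^sup>2)"

definition L2_norm :: "(real \<Rightarrow> complex) \<Rightarrow> real" where
  "L2_norm f = sqrt (\<integral>x. (cmod (f x))\<^sup>2 \<partial>leb01)"

definition schauder_basis_L2 :: "(nat \<Rightarrow> real \<Rightarrow> complex) \<Rightarrow> bool" where
  "schauder_basis_L2 u \<longleftrightarrow>
     (\<forall>n. L2 (u n)) \<and>
     (\<forall>f. L2 f \<longrightarrow>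
        (\<exists>!c :: nat \<Rightarrow> complex. (\<lambda>N. L2_norm (\<lambda>x. f x - (\<Sum>n<N. c n * u n x))) \<longlonglongrightarrow> 0))"

definition abs_continuous_01 :: "(real \<Rightarrow> complex) \<Rightarrow> bool" where
  "abs_continuous_01 f \<longleftrightarrow>
     (\<forall>\<epsilon>>0. \<exists>\<delta>>0. \<forall>I :: (real \<times> real) set.
        finite I \<and> (\<forall>(s, t) \<in> I. 0 \<le> s \<and> s < t \<and> t \<le> 1) \<and>
        disjoint_family_on (\<lambda>(s, t). {s<..<t}) I \<and> (\<Sum>(s, t)\<in>I. t - s) < \<delta>
        \<longrightarrow> (\<Sum>(s, t)\<in>I. cmod (f t - f s)) < \<epsilon>)"

text \<open>
  The derivative on [0,1], one-sided at the endpoints. Where the derivative does not exist the value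
  is unspecified; for an absolutely continuous function this happens on a null set only.
\<close>

definition deriv_01 :: "(real \<Rightarrow> complex) \<Rightarrow> real \<Rightarrow> complex" where
  "deriv_01 f x = vector_derivative f (at x within {0..1})"

text \<open>
  For m > 0 an element of the Sobolev space is identified with its absolutely continuous
  representative, so that the derivatives of order below m have values at the endpoints; the
  derivative of order m exists almost everywhere.
\<close>

definition sobolev_W1 :: "nat \<Rightarrow> (real \<Rightarrow> complex) \<Rightarrow> bool" where
  "sobolev_W1 m f \<longleftrightarrow>
     (\<forall>j<m. abs_continuous_01 ((deriv_01 ^^ j) f)) \<and>
     (\<forall>j. Suc j < m \<longrightarrow> (deriv_01 ^^ j) f differentiable_on {0..1}) \<and>
     (\<forall>j\<le>m. integrable leb01 ((deriv_01 ^^ j) f))"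

datatype boundary_type = Periodic | Antiperiodic

fun boundary_cond :: "boundary_type \<Rightarrow> (real \<Rightarrow> complex) \<Rightarrow> bool" where
  "boundary_cond Periodic u \<longleftrightarrow> u 0 - u 1 = 0 \<and> deriv_01 u 0 - deriv_01 u 1 = 0"
| "boundary_cond Antiperiodic u \<longleftrightarrow> u 0 + u 1 = 0 \<and> deriv_01 u 0 + deriv_01 u 1 = 0"

definition schroedinger :: "(real \<Rightarrow> complex) \<Rightarrow> (real \<Rightarrow> complex) \<Rightarrow> real \<Rightarrow> complex" where
  "schroedinger q u x = deriv_01 (deriv_01 u) x - q x * u x"

text \<open>
  Functions in the domain are set to 0 outside [0,1]. As they are continuous on [0,1], each is then
  determined by its class in L_2(0,1), and the domain is a subspace of the functions on the reals.
\<close>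

definition op_domain :: "boundary_type \<Rightarrow> (real \<Rightarrow> complex) \<Rightarrow> (real \<Rightarrow> complex) set" where
  "op_domain b q = {u. (\<forall>x. x \<notin> {0..1} \<longrightarrow> u x = 0) \<and>
     abs_continuous_01 u \<and> u differentiable_on {0..1} \<and> abs_continuous_01 (deriv_01 u) \<and>
     L2 (schroedinger q u) \<and> boundary_cond b u}"

definition eigenvalue :: "boundary_type \<Rightarrow> (real \<Rightarrow> complex) \<Rightarrow> complex \<Rightarrow> bool" where
  "eigenvalue b q \<mu> \<longleftrightarrow>
     (\<exists>u \<in> op_domain b q. u \<noteq> (\<lambda>x. 0) \<and> (AE x in leb01. schroedinger q u x = \<mu> * u x))"

text \<open>The kernel of the k-th power of the unbounded operator L - \<open>\<mu>\<close>.\<close>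

fun root_kernel ::
    "boundary_type \<Rightarrow> (real \<Rightarrow> complex) \<Rightarrow> complex \<Rightarrow> nat \<Rightarrow> (real \<Rightarrow> complex) set" where
  "root_kernel b q \<mu> 0 = {\<lambda>x. 0}"
| "root_kernel b q \<mu> (Suc k) =
     {u \<in> op_domain b q. \<exists>v \<in> root_kernel b q \<mu> k.
        AE x in leb01. schroedinger q u x - \<mu> * u x = v x}"

definition root_subspace ::
    "boundary_type \<Rightarrow> (real \<Rightarrow> complex) \<Rightarrow> complex \<Rightarrow> (real \<Rightarrow> complex) set" where
  "root_subspace b q \<mu> = (\<Union>k. root_kernel b q \<mu> k)"

definition cscale :: "complex \<Rightarrow> (real \<Rightarrow> complex) \<Rightarrow> real \<Rightarrow> complex" where
  "cscale c f = (\<lambda>x. c * f x)"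

global_interpretation cfun: vector_space cscale
  by standard (auto simp: cscale_def fun_eq_iff algebra_simps)

text \<open>
  The order of enumeration and the choice of the basis in each root subspace are arbitrary.
\<close>

definition root_function_system ::
    "boundary_type \<Rightarrow> (real \<Rightarrow> complex) \<Rightarrow> (nat \<Rightarrow> real \<Rightarrow> complex) \<Rightarrow> bool" where
  "root_function_system b q u \<longleftrightarrow> inj u \<and>
     (\<exists>B :: complex \<Rightarrow> (real \<Rightarrow> complex) set.
        (\<forall>\<mu>. eigenvalue b q \<mu> \<longrightarrow>
           cfun.independent (B \<mu>) \<and> cfun.span (B \<mu>) = root_subspace b q \<mu>) \<and>
        range u = (\<Union>\<mu>\<in>{\<mu>. eigenvalue b q \<mu>}. B \<mu>))"

definition alpha :: "(real \<Rightarrow> complex) \<Rightarrow> nat \<Rightarrow> complex" where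
  "alpha q n = (\<integral>x. q x * exp (2 * pi * \<i> * n * x) \<partial>leb01)"

definition beta :: "(real \<Rightarrow> complex) \<Rightarrow> nat \<Rightarrow> complex" where
  "beta q n = (\<integral>x. q x * exp (- (2 * pi * \<i> * n * x)) \<partial>leb01)"

end

theory Submission
  imports Defs
begin

text \<open>
  Write a solution of \<open>u'' - q u = \<mu> u\<close> satisfying the boundary conditions as \<open>e\<^sup>i\<^sup>\<pi>\<^sup>n\<^sup>x\<close> times a
  1-periodic function with Fourier coefficients \<open>y\<^sub>j\<close>. For \<open>\<mu>\<close> near \<open>- (\<pi> n)\<^sup>2\<close> all coefficients
  except the resonant ones \<open>y\<^sub>0 = A\<close> and \<open>y\<^sub>-\<^sub>n = B\<close> can be eliminated by a contraction, which leaves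
  \<open>(z + s) A + \<beta>' B = 0\<close> and \<open>(z + s) B + \<alpha>' A = 0\<close> with \<open>\<alpha>'\<close>, \<open>\<beta>'\<close> equal to \<open>\<alpha>\<^sub>n\<close>, \<open>\<beta>\<^sub>n\<close> up to
  \<open>o (1 / n\<^sup>m\<^sup>+\<^sup>1)\<close>; the diagonal terms agree because the problem is symmetric. Brouwer's theorem
  provides a root of \<open>z + s = sqrt (\<alpha>' \<beta>')\<close>, and for it \<open>\<bar>B / A\<bar>\<^sup>2\<close> is comparable to \<open>\<bar>\<alpha>\<^sub>n / \<beta>\<^sub>n\<bar>\<close>.
  Along the given sequence \<open>\<integral> u\<^sup>2 = 2 A B + \<dots>\<close> is nonzero, so that the eigenvalue is simple and the
  coefficient functional of \<open>u\<close> in any basis of root functions is \<open>f \<mapsto> \<integral> f u / \<integral> u\<^sup>2\<close>, but it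
  is \<open>o (max \<bar>A\<bar> \<bar>B\<bar>)\<^sup>2\<close>. Hence the functionals, scaled by the norm of \<open>u\<close>, are not bounded uniformly,
  whereas for a Schauder basis the principle of uniform boundedness requires them to be.
\<close>

section \<open>Lebesgue points\<close>

text \<open>Absolute continuity is given by epsilon and delta and derivatives are pointwise, so
  integration by parts rests on the fundamental theorem of calculus for absolutely continuous
  functions; Lebesgue points and the Radon-Nikodym derivative of a Stieltjes measure supply it. The
  delicate estimate is that of the couplings for \<open>m = 0\<close>: the first correction, a sum
  of \<open>a j * a (p - j) / (j * (p - j))\<close>, must be \<open>o (1 / p)\<close>, and estimates
  by absolute values lose a logarithm. It is a Fourier coefficient of the square of an
  antiderivative of \<open>q\<close>, and the Riemann-Lebesgue lemma supplies the cancellation.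
  Moreover \<open>2 A B\<close> may itself be small: the decay of the coefficients limits the
  imbalance, so \<open>\<bar>A B\<bar>\<close> is at least of order \<open>n powr (-1/2)\<close>
  times the square of the larger modulus, and the remainder, of order \<open>gap_sum n ^ 2\<close>,
  must stay below that. Both needs are met by \<open>gap_sum n = O (n powr (-3/4))\<close>. In the
  last step the functionals act on continuous functions and sizes are measured in the
  \<open>L1\<close> norm, so that completeness is needed only for the sup norm.\<close>

lemma L1_approx_continuous:
  fixes g :: "real \<Rightarrow> 'a::{euclidean_space}"
  assumes "integrable lebesgue g" "e > 0"
  shows "\<exists>c M. continuous_on UNIV c \<and> (\<forall>x. norm (c x) \<le> M) \<and> integrable lebesgue c \<and>
     (\<integral>x. norm (g x - c x) \<partial>lebesgue) < e"
  using assms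
proof (induction g arbitrary: e rule: integrable_induct)
  case (base A v)
  have A: "A \<in> lmeasurable" using base by (simp add: fmeasurable_def)
  \<comment> \<open>Each of \<open>T - A\<close> and \<open>A - K\<close> gets measure below
    \<open>e'\<close>, hence the factor 2; adding 1 to \<open>norm v\<close> covers
    \<open>v = 0\<close>.\<close>
  define e' where "e' = e / (2 * (norm v + 1))"
  have e': "e' > 0" using base by (simp add: e'_def add_nonneg_pos)
  obtain T where T: "open T" "A \<subseteq> T" "T - A \<in> lmeasurable" "emeasure lebesgue (T - A) < ennreal e'"
    using sets_lebesgue_outer_open[OF base(1) e'] by blast
  obtain K where K: "closed K" "K \<subseteq> A" "A - K \<in> lmeasurable" "emeasure lebesgue (A - K) < ennreal e'"
    using sets_lebesgue_inner_closed[OF base(1) e'] by blast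
  \<comment> \<open>Urysohn's function for the closed sets \<open>- T\<close> and \<open>K\<close>
    differs from the indicator of \<open>A\<close> only on \<open>T - K\<close>.\<close>
  obtain \<phi> :: "real \<Rightarrow> real" where \<phi>: "continuous_on UNIV \<phi>" "\<And>x. \<phi> x \<in> closed_segment 0 1"
     "\<And>x. x \<in> -T \<Longrightarrow> \<phi> x = 0" "\<And>x. x \<in> K \<Longrightarrow> \<phi> x = 1"
  proof -
    have "closed (- T)" "closed K" "- T \<inter> K = {}" using T K by auto
    from Urysohn[OF this, of 0 1] show ?thesis using that by blast
  qed
  have \<phi>01: "0 \<le> \<phi> x \<and> \<phi> x \<le> 1" for x
    using \<phi>(2)[of x] by (simp add: closed_segment_eq_real_ivl)
  have TK: "T - K \<in> lmeasurable"
  proof -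
    have "T - K = (T - A) \<union> (A - K)" using T K by auto
    thus ?thesis using T K by (simp add: fmeasurable.Un)
  qed
  have mTK: "measure lebesgue (T - K) < 2 * e'"
  proof -
    have eq: "T - K = (T - A) \<union> (A - K)" using T K by auto
    have "measure lebesgue (T - K) \<le> measure lebesgue (T - A) + measure lebesgue (A - K)"
      unfolding eq using T K by (intro measure_Un_le) auto
    moreover have "measure lebesgue (T - A) < e'"
      using T e' by (simp add: emeasure_eq_measure2 ennreal_less_iff)
    moreover have "measure lebesgue (A - K) < e'"
      using K e' by (simp add: emeasure_eq_measure2 ennreal_less_iff)
    ultimately show ?thesis by simp
  qed
  have Tm: "T \<in> lmeasurable"
  proof -
    have "T = A \<union> (T - A)" using T by auto
    thus ?thesis using A T(3) by (metis fmeasurable.Un)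
  qed
  let ?c = "\<lambda>x. \<phi> x *\<^sub>R v"
  have mphi: "\<phi> \<in> borel_measurable lebesgue"
    using borel_measurable_continuous_onI[OF \<phi>(1)] by (simp add: measurable_completion)
  have int\<phi>: "integrable lebesgue \<phi>"
    apply (rule Bochner_Integration.integrable_bound[of _ "indicator T :: real \<Rightarrow> real"])
    using Tm \<phi>01 \<phi>(3) mphi by (auto simp: indicator_def fmeasurable_def)
  have intc: "integrable lebesgue ?c" using int\<phi> by simp
  have bd: "norm (indicator A x *\<^sub>R v - ?c x) \<le> norm v * indicator (T - K) x" for x
  proof -
    have "\<bar>indicator A x - \<phi> x\<bar> \<le> indicator (T - K) x"
      using \<phi>01[of x] \<phi>(3)[of x] \<phi>(4)[of x] T(2) K(2) by (auto simp: indicator_def)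
    thus ?thesis by (metis norm_scaleR scaleR_left.diff mult.commute mult_right_mono norm_ge_zero)
  qed
  have "(\<integral>x. norm (indicator A x *\<^sub>R v - ?c x) \<partial>lebesgue) \<le> (\<integral>x. norm v * indicator (T - K) x \<partial>lebesgue)"
    apply (rule integral_mono)
    using intc A TK bd by (auto simp: fmeasurable_def intro!: Bochner_Integration.integrable_norm Bochner_Integration.integrable_diff)
  also have "\<dots> = norm v * measure lebesgue (T - K)" by simp
  also have "\<dots> \<le> norm v * (2 * e')" using mTK by (intro mult_left_mono) auto
  also have "\<dots> < e"
  proof -
    have "norm v * (2 * e') = e * (norm v / (norm v + 1))"
      using norm_ge_zero[of v] by (simp add: e'_def field_simps add_nonneg_eq_0_iff)
    also have "\<dots> < e * 1" using base(3) by (intro mult_strict_left_mono) (auto simp: add_nonneg_pos)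
    finally show ?thesis by simp
  qed
  finally have "(\<integral>x. norm (indicator A x *\<^sub>R v - ?c x) \<partial>lebesgue) < e" .
  moreover have "continuous_on UNIV ?c" using \<phi>(1) by (intro continuous_intros)
  moreover have "norm (?c x) \<le> norm v" for x using \<phi>01[of x] by (simp add: mult_left_le_one_le)
  ultimately show ?case using intc by blast
next
  case (add f g)
  have e2: "e/2 > 0" using add by simp
  obtain c M d N where c: "continuous_on UNIV c" "\<forall>x. norm (c x) \<le> M" "integrable lebesgue c" "(\<integral>x. norm (f x - c x) \<partial>lebesgue) < e/2"
    and d: "continuous_on UNIV d" "\<forall>x. norm (d x) \<le> N" "integrable lebesgue d" "(\<integral>x. norm (g x - d x) \<partial>lebesgue) < e/2"
    using add(3)[OF e2] add(4)[OF e2] by blast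
  have "(\<integral>x. norm (f x + g x - (c x + d x)) \<partial>lebesgue) \<le> (\<integral>x. norm (f x - c x) + norm (g x - d x) \<partial>lebesgue)"
    apply (rule integral_mono)
    using add c d by (auto intro!: Bochner_Integration.integrable_add Bochner_Integration.integrable_norm Bochner_Integration.integrable_diff simp: add_diff_add norm_triangle_ineq)
  also have "\<dots> = (\<integral>x. norm (f x - c x) \<partial>lebesgue) + (\<integral>x. norm (g x - d x) \<partial>lebesgue)"
    using add c d by (intro Bochner_Integration.integral_add Bochner_Integration.integrable_norm Bochner_Integration.integrable_diff) auto
  also have "\<dots> < e" using c d by simp
  finally have *: "(\<integral>x. norm (f x + g x - (c x + d x)) \<partial>lebesgue) < e" .
  have "norm (c x + d x) \<le> M + N" for x using c(2) d(2) by (meson add_mono norm_triangle_le)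
  moreover have "continuous_on UNIV (\<lambda>x. c x + d x)" using c d by (intro continuous_intros)
  moreover have "integrable lebesgue (\<lambda>x. c x + d x)" using c d by auto
  ultimately show ?case using * by (intro exI[of _ "\<lambda>x. c x + d x"] exI[of _ "M+N"]) auto
next
  case (lim f s)
  have "(\<lambda>i. \<integral>x. norm (f x - s i x) \<partial>lebesgue) \<longlonglongrightarrow> (\<integral>x. norm (0::'a) \<partial>(lebesgue :: real measure))"
  \<comment> \<open>The approximations satisfy \<open>norm (s i x) \<le> 2 * norm (f x)\<close>, so
    three times \<open>norm (f x)\<close> dominates the difference.\<close>
  proof (rule integral_dominated_convergence[where w = "\<lambda>x. 3 * norm (f x)" and f = "\<lambda>x. norm (0::'a)" and s = "\<lambda>i x. norm (f x - s i x)"])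
    show "AE x in lebesgue. (\<lambda>i. norm (f x - s i x)) \<longlonglongrightarrow> norm (0::'a)"
    proof (rule AE_I2)
      fix x :: real
      have "(\<lambda>i. norm (f x - s i x)) \<longlonglongrightarrow> norm (f x - f x)" by (intro tendsto_norm tendsto_diff tendsto_const) (use lim in auto)
      thus "(\<lambda>i. norm (f x - s i x)) \<longlonglongrightarrow> norm (0::'a)" by simp
    qed
    show "AE x in lebesgue. norm (norm (f x - s i x)) \<le> 3 * norm (f x)" for i
    proof (rule AE_I2)
      fix x :: real
      have "norm (f x - s i x) \<le> norm (f x) + norm (s i x)" by (rule norm_triangle_ineq4)
      thus "norm (norm (f x - s i x)) \<le> 3 * norm (f x)" using lim(3)[of x i] by simp
    qed
  qed (use lim in auto)
  hence "(\<lambda>i. \<integral>x. norm (f x - s i x) \<partial>lebesgue) \<longlonglongrightarrow> 0" by simp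
  hence "eventually (\<lambda>i. (\<integral>x. norm (f x - s i x) \<partial>lebesgue) < e/2) sequentially"
    using lim(6) by (intro order_tendstoD(2)) auto
  then obtain i where i: "(\<integral>x. norm (f x - s i x) \<partial>lebesgue) < e/2" by (auto simp: eventually_sequentially)
  obtain c M where c: "continuous_on UNIV c" "\<forall>x. norm (c x) \<le> M" "integrable lebesgue c" "(\<integral>x. norm (s i x - c x) \<partial>lebesgue) < e/2"
    using lim(5)[of "e/2" i] lim(6) by auto
  have "(\<integral>x. norm (f x - c x) \<partial>lebesgue) \<le> (\<integral>x. norm (f x - s i x) + norm (s i x - c x) \<partial>lebesgue)"
  proof (rule integral_mono)
    fix x
    show "norm (f x - c x) \<le> norm (f x - s i x) + norm (s i x - c x)"
      using norm_triangle_ineq[of "f x - s i x" "s i x - c x"] by simp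
  qed (use lim c in \<open>auto intro!: Bochner_Integration.integrable_add Bochner_Integration.integrable_norm Bochner_Integration.integrable_diff\<close>)
  also have "\<dots> = (\<integral>x. norm (f x - s i x) \<partial>lebesgue) + (\<integral>x. norm (s i x - c x) \<partial>lebesgue)"
    using lim c by (intro Bochner_Integration.integral_add Bochner_Integration.integrable_norm Bochner_Integration.integrable_diff) auto
  also have "\<dots> < e" using c i by simp
  finally show ?case using c by blast
qed

section \<open>The maximal inequality and Lebesgue's differentiation theorem\<close>

definition maximal_set :: "(real \<Rightarrow> 'a::euclidean_space) \<Rightarrow> real \<Rightarrow> real set" where
  "maximal_set h l = {x. \<exists>r>0. r \<le> 1 \<and> 2 * r * l < (\<integral>y. indicator (cball x r) y * norm (h y) \<partial>lebesgue)}"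

text \<open>Vitali's covering lemma, which asks for bounded radii (hence \<open>r \<le> 1\<close> in
  \<open>maximal_set\<close>), selects disjoint balls whose fivefold enlargements cover the set;
  this is the constant 5. Enclosing the set in a measurable \<open>T\<close> avoids the question of
  its own measurability.\<close>

lemma Hardy_Littlewood_maximal:
  fixes h :: "real \<Rightarrow> 'a::euclidean_space"
  assumes h: "integrable lebesgue h" and l: "l > 0"
  shows "\<exists>T. maximal_set h l \<subseteq> T \<and> T \<in> lmeasurable \<and> measure lebesgue T \<le> 5 * (\<integral>y. norm (h y) \<partial>lebesgue) / l"
proof -
  let ?S = "maximal_set h l"
  have "\<forall>x\<in>?S. \<exists>r. r>0 \<and> r \<le> 1 \<and> 2 * r * l < (\<integral>y. indicator (cball x r) y * norm (h y) \<partial>lebesgue)"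
    by (auto simp: maximal_set_def)
  then obtain r where r: "\<And>x. x \<in> ?S \<Longrightarrow> 0 < r x \<and> r x \<le> 1"
     "\<And>x. x \<in> ?S \<Longrightarrow> 2 * r x * l < (\<integral>y. indicator (cball x (r x)) y * norm (h y) \<partial>lebesgue)" by metis
  have cov: "?S \<subseteq> (\<Union>x\<in>?S. cball x (r x))"
  proof
    fix x assume "x \<in> ?S"
    thus "x \<in> (\<Union>x\<in>?S. cball x (r x))" using r(1)[of x] by (intro UN_I[of x]) auto
  qed
  obtain C where C: "countable C" "C \<subseteq> ?S" "pairwise (\<lambda>i j. disjnt (cball i (r i)) (cball j (r j))) C"
     "?S \<subseteq> (\<Union>i\<in>C. cball i (5 * r i))"
    using Vitali_covering_lemma_cballs[where S="?S" and K="?S" and a="\<lambda>x. x" and r=r and B=1, OF cov r(1)] that by blast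
  let ?T = "(\<Union>i\<in>C. cball i (5 * r i))"
  have ih: "integrable lebesgue (\<lambda>y. indicator (cball x r) y * norm (h y))" for x r
    using integrable_mult_indicator[of "cball x r" lebesgue "\<lambda>y. norm (h y)"] h by simp
  \<comment> \<open>Finite subfamilies first: the bound does not depend on \<open>D\<close> and so
    passes to the countable union, whose finite measure comes out as well.\<close>
  have bound: "measure lebesgue (\<Union>i\<in>D. cball i (5 * r i)) \<le> 5 * (\<integral>y. norm (h y) \<partial>lebesgue) / l"
    if D: "D \<subseteq> C" "finite D" for D
  proof -
    have "measure lebesgue (\<Union>i\<in>D. cball i (5 * r i)) \<le> (\<Sum>i\<in>D. measure lebesgue (cball i (5 * r i)))"
      using D by (intro measure_UNION_le) auto
    also have "\<dots> = (\<Sum>i\<in>D. 10 * r i)"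
    proof (rule sum.cong)
      fix i assume "i \<in> D"
      hence "0 < r i" using D C r by blast
      thus "measure lebesgue (cball i (5 * r i)) = 10 * r i" by (simp add: cball_eq_atLeastAtMost)
    qed simp
    also have "\<dots> \<le> (\<Sum>i\<in>D. 5 / l * (\<integral>y. indicator (cball i (r i)) y * norm (h y) \<partial>lebesgue))"
    proof (rule sum_mono)
      fix i assume "i \<in> D"
      hence "2 * r i * l < (\<integral>y. indicator (cball i (r i)) y * norm (h y) \<partial>lebesgue)" using D C r by blast
      thus "10 * r i \<le> 5 / l * (\<integral>y. indicator (cball i (r i)) y * norm (h y) \<partial>lebesgue)"
        using l by (simp add: field_simps)
    qed
    also have "\<dots> = 5 / l * (\<integral>y. (\<Sum>i\<in>D. indicator (cball i (r i)) y * norm (h y)) \<partial>lebesgue)"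
      using ih by (subst Bochner_Integration.integral_sum) (auto simp: sum_distrib_left)
    also have "\<dots> \<le> 5 / l * (\<integral>y. norm (h y) \<partial>lebesgue)"
    proof (intro mult_left_mono integral_mono)
      fix y
      have "(\<Sum>i\<in>D. indicator (cball i (r i)) y :: real) = indicator (\<Union>i\<in>D. cball i (r i)) y"
        using C(3) D by (intro indicator_UN_disjoint[symmetric]) (auto simp: disjoint_family_on_def pairwise_def disjnt_def subset_iff)
      hence "(\<Sum>i\<in>D. indicator (cball i (r i)) y * norm (h y)) = indicator (\<Union>i\<in>D. cball i (r i)) y * norm (h y)"
        by (simp flip: sum_distrib_right)
      also have "\<dots> \<le> norm (h y)" by (simp add: indicator_def)
      finally show "(\<Sum>i\<in>D. indicator (cball i (r i)) y * norm (h y)) \<le> norm (h y)" .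
    qed (use h l ih in \<open>auto intro!: Bochner_Integration.integrable_sum\<close>)
    finally show ?thesis by simp
  qed
  have "?T \<in> lmeasurable" by (rule fmeasurable_UN_bound[OF C(1) _ bound]) simp
  moreover have "measure lebesgue ?T \<le> 5 * (\<integral>y. norm (h y) \<partial>lebesgue) / l"
    by (rule measure_UN_bound[OF C(1) _ bound]) simp
  ultimately show ?thesis using C(4) by blast
qed

lemma Markov_L1:
  fixes h :: "real \<Rightarrow> 'a::euclidean_space"
  assumes h: "integrable lebesgue h" and l: "l > 0"
  shows "{x. norm (h x) > l} \<in> lmeasurable" "measure lebesgue {x. norm (h x) > l} \<le> (\<integral>y. norm (h y) \<partial>lebesgue) / l"
proof -
  have "{x \<in> space lebesgue. norm (h x) > l} \<in> sets lebesgue"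
    using h by measurable
  hence m: "{x. norm (h x) > l} \<in> sets lebesgue" by simp
  have "emeasure lebesgue {x. norm (h x) > l} \<le> emeasure lebesgue {x\<in>space lebesgue. norm (h x) \<ge> l}"
    by (rule emeasure_mono, force, use h in measurable)
  also have "\<dots> \<le> ennreal ((1/l) * (\<integral>y. norm (h y) \<partial>lebesgue))"
    using integral_Markov_inequality[of lebesgue "\<lambda>x. norm (h x)" l] h l by auto
  finally have *: "emeasure lebesgue {x. norm (h x) > l} \<le> ennreal ((\<integral>y. norm (h y) \<partial>lebesgue) / l)" by simp
  show 1: "{x. norm (h x) > l} \<in> lmeasurable" using m * by (auto simp: fmeasurable_def top_unique intro: le_less_trans)
  show "measure lebesgue {x. norm (h x) > l} \<le> (\<integral>y. norm (h y) \<partial>lebesgue) / l"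
    using * 1 l by (simp add: emeasure_eq_measure2)
qed

definition lebesgue_point :: "(real \<Rightarrow> 'a::euclidean_space) \<Rightarrow> real \<Rightarrow> bool" where
  "lebesgue_point g x \<longleftrightarrow> (\<forall>e>0. \<exists>d>0. \<forall>r. 0 < r \<and> r < d \<longrightarrow>
     (\<integral>y. indicator (cball x r) y * norm (g y - g x) \<partial>lebesgue) \<le> 2 * r * e)"

lemma integrable_cball_indicator: "integrable lebesgue (indicator (cball x r) :: real \<Rightarrow> real)"
  using lmeasurable_cball[of x r] by (intro integrable_real_indicator) (auto simp: fmeasurable_def)

lemma integrable_cball_diff:
  fixes g :: "real \<Rightarrow> 'a::euclidean_space"
  assumes "integrable lebesgue g"
  shows "integrable lebesgue (\<lambda>y. indicator (cball x r) y * norm (g y - v))"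
proof -
  have "integrable lebesgue (\<lambda>y. indicator (cball x r) y *\<^sub>R (g y - v))"
  proof -
    have "integrable lebesgue (\<lambda>y. indicator (cball x r) y *\<^sub>R g y - indicator (cball x r) y *\<^sub>R v)"
      using assms integrable_cball_indicator
      by (intro Bochner_Integration.integrable_diff integrable_mult_indicator integrable_scaleR_left) auto
    thus ?thesis by (simp add: scaleR_diff_right)
  qed
  from integrable_norm[OF this] show ?thesis by simp
qed

text \<open>Every point is a Lebesgue point of a continuous function, so write
  \<open>g = c + h\<close> with \<open>c\<close> continuous and \<open>h\<close> small in
  \<open>L1\<close>. Where averages of the oscillation of \<open>g\<close> exceed \<open>e\<close>
  at arbitrarily small radii, either some average of \<open>\<bar>h\<bar>\<close> or
  \<open>\<bar>h x\<bar>\<close> itself exceeds \<open>e / 3\<close>; the maximal inequality and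
  Markov's inequality make both sets small.\<close>

theorem Lebesgue_differentiation:
  fixes g :: "real \<Rightarrow> 'a::euclidean_space"
  assumes g: "integrable lebesgue g"
  shows "negligible {x. \<not> lebesgue_point g x}"
proof -
  define B where "B e = {x. \<forall>d>0. \<exists>r. 0 < r \<and> r < d \<and> 2 * r * e < (\<integral>y. indicator (cball x r) y * norm (g y - g x) \<partial>lebesgue)}" for e :: real
  have negB: "negligible (B e)" if e: "e > 0" for e
    unfolding negligible_outer_le
  proof (intro allI impI)
    fix \<epsilon> :: real assume \<epsilon>: "\<epsilon> > 0"
    \<comment> \<open>The maximal inequality at level \<open>e / 3\<close> contributes
      \<open>15 / e\<close> and Markov's inequality \<open>3 / e\<close>, together
      \<open>18 / e\<close> times the norm of \<open>h\<close>.\<close>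
    define \<eta> where "\<eta> = \<epsilon> * e / 18"
    have \<eta>: "\<eta> > 0" using e \<epsilon> by (simp add: \<eta>_def)
    obtain c M where c: "continuous_on UNIV c" "integrable lebesgue c" "(\<integral>x. norm (g x - c x) \<partial>lebesgue) < \<eta>"
      using L1_approx_continuous[OF g \<eta>] by blast
    define h where "h = (\<lambda>x. g x - c x)"
    have h: "integrable lebesgue h" using g c by (simp add: h_def)
    have nh: "(\<integral>x. norm (h x) \<partial>lebesgue) < \<eta>" using c by (simp add: h_def)
    have e3: "e/3 > 0" using e by simp
    obtain T where T: "maximal_set h (e/3) \<subseteq> T" "T \<in> lmeasurable" "measure lebesgue T \<le> 5 * (\<integral>y. norm (h y) \<partial>lebesgue) / (e/3)"
      using Hardy_Littlewood_maximal[OF h e3] by blast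
    note Mk = Markov_L1[OF h e3]
    let ?U = "T \<union> {x. norm (h x) > e/3}"
    have "B e \<subseteq> ?U"
    proof
      fix x assume x: "x \<in> B e"
      show "x \<in> ?U"
      proof (rule ccontr)
        assume "x \<notin> ?U"
        hence h1: "norm (h x) \<le> e/3" and h2: "x \<notin> maximal_set h (e/3)" using T(1) by auto
        have "isCont c x" using c(1) by (simp add: continuous_on_eq_continuous_at)
        then obtain d where d: "d > 0" "\<And>y. dist y x < d \<Longrightarrow> norm (c y - c x) < e/3"
          using e3 unfolding continuous_at_eps_delta dist_norm by blast
        obtain r where r: "0 < r" "r < min d 1" "2 * r * e < (\<integral>y. indicator (cball x r) y * norm (g y - g x) \<partial>lebesgue)"
          using x d(1) unfolding B_def by (auto dest!: spec[of _ "min d 1"])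
        have ih: "integrable lebesgue (\<lambda>y. indicator (cball x r) y * norm (h y))"
          using integrable_cball_diff[OF h, of x r 0] by simp
        have ii: "integrable lebesgue (\<lambda>y. indicator (cball x r) y * (2 * e / 3))"
          by (intro integrable_mult_left integrable_cball_indicator)
        have "(\<integral>y. indicator (cball x r) y * norm (g y - g x) \<partial>lebesgue) \<le>
           (\<integral>y. indicator (cball x r) y * norm (h y) + indicator (cball x r) y * (2 * e / 3) \<partial>lebesgue)"
        proof (rule integral_mono)
          fix y
          show "indicator (cball x r) y * norm (g y - g x) \<le> indicator (cball x r) y * norm (h y) + indicator (cball x r) y * (2 * e / 3)"
          proof (cases "y \<in> cball x r")
            case True
            have eq: "g y - g x = h y + (c y - c x) + (- h x)" by (simp add: h_def)
            have "norm (g y - g x) \<le> norm (h y) + norm (c y - c x) + norm (h x)"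
              unfolding eq by (smt (verit) norm_minus_cancel norm_triangle_ineq)
            moreover have "norm (c y - c x) < e/3" using True r by (intro d(2)) (simp add: dist_commute)
            ultimately show ?thesis using True h1 by simp
          qed simp
        qed (use integrable_cball_diff[OF g] ih ii in auto)
        also have "\<dots> = (\<integral>y. indicator (cball x r) y * norm (h y) \<partial>lebesgue) + (\<integral>y. indicator (cball x r) y * (2 * e / 3) \<partial>lebesgue)"
          by (rule Bochner_Integration.integral_add[OF ih ii])
        also have "(\<integral>y. indicator (cball x r) y * (2 * e / 3) \<partial>lebesgue) = 2 * r * (2 * e/3)"
          using r by (simp add: cball_eq_atLeastAtMost)
        also have "(\<integral>y. indicator (cball x r) y * norm (h y) \<partial>lebesgue) \<le> 2 * r * (e/3)"
          using h2 r unfolding maximal_set_def by force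
        finally show False using r by (simp add: field_simps)
      qed
    qed
    moreover have "?U \<in> lmeasurable" using T Mk by (intro fmeasurable.Un) auto
    moreover have "measure lebesgue ?U \<le> \<epsilon>"
    proof -
      have "measure lebesgue ?U \<le> measure lebesgue T + measure lebesgue {x. norm (h x) > e/3}"
        using T Mk by (intro measure_Un_le) auto
      also have "\<dots> \<le> 5 * (\<integral>y. norm (h y) \<partial>lebesgue) / (e/3) + (\<integral>y. norm (h y) \<partial>lebesgue) / (e/3)"
        using T(3) Mk(2) by (rule add_mono)
      also have "\<dots> = 18 / e * (\<integral>y. norm (h y) \<partial>lebesgue)" using e by (simp add: field_simps)
      also have "\<dots> \<le> 18 / e * \<eta>" using nh e by (intro mult_left_mono) auto
      also have "\<dots> = \<epsilon>" using e by (simp add: \<eta>_def)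
      finally show ?thesis .
    qed
    ultimately show "\<exists>T. B e \<subseteq> T \<and> T \<in> lmeasurable \<and> measure lebesgue T \<le> \<epsilon>" by blast
  qed
  have "negligible (\<Union>k. B (1 / real (Suc k)))"
    using negB by (intro negligible_countable_Union) auto
  moreover have "{x. \<not> lebesgue_point g x} \<subseteq> (\<Union>k. B (1 / real (Suc k)))"
  proof
    fix x assume "x \<in> {x. \<not> lebesgue_point g x}"
    then obtain e where e: "e > 0" "\<forall>d>0. \<exists>r. 0 < r \<and> r < d \<and> \<not> (\<integral>y. indicator (cball x r) y * norm (g y - g x) \<partial>lebesgue) \<le> 2 * r * e"
      unfolding lebesgue_point_def by auto
    obtain k where k: "1 / real (Suc k) < e" using e(1) by (meson nat_approx_posE)
    have "x \<in> B (1 / real (Suc k))" unfolding B_def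
    proof (intro CollectI allI impI)
      fix d :: real assume "d > 0"
      then obtain r where r: "0 < r" "r < d" "2 * r * e < (\<integral>y. indicator (cball x r) y * norm (g y - g x) \<partial>lebesgue)"
        using e(2) by force
      have "2 * r * (1 / real (Suc k)) \<le> 2 * r * e" using k r by (intro mult_left_mono) auto
      thus "\<exists>r. 0 < r \<and> r < d \<and> 2 * r * (1 / real (Suc k)) < (\<integral>y. indicator (cball x r) y * norm (g y - g x) \<partial>lebesgue)"
        using r by (intro exI[of _ r]) auto
    qed
    thus "x \<in> (\<Union>k. B (1 / real (Suc k)))" by blast
  qed
  ultimately show ?thesis by (rule negligible_subset)
qed

section \<open>Primitives of integrable functions\<close>

definition prim :: "(real \<Rightarrow> 'a::euclidean_space) \<Rightarrow> real \<Rightarrow> 'a" where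
  "prim g x = (\<integral>t. indicator {0..x} t *\<^sub>R g t \<partial>leb01)"

text \<open>The condition \<open>abs_continuous_01\<close> for values in any normed space: densities
  are first constructed for real-valued functions.\<close>

definition ac01 :: "(real \<Rightarrow> 'a::real_normed_vector) \<Rightarrow> bool" where
  "ac01 f \<longleftrightarrow>
     (\<forall>\<epsilon>>0. \<exists>\<delta>>0. \<forall>I :: (real \<times> real) set.
        finite I \<and> (\<forall>(s, t) \<in> I. 0 \<le> s \<and> s < t \<and> t \<le> 1) \<and>
        disjoint_family_on (\<lambda>(s, t). {s<..<t}) I \<and> (\<Sum>(s, t)\<in>I. t - s) < \<delta>
        \<longrightarrow> (\<Sum>(s, t)\<in>I. norm (f t - f s)) < \<epsilon>)"

lemma abs_continuous_01_eq: "abs_continuous_01 f = ac01 f"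
  by (simp add: abs_continuous_01_def ac01_def)

lemma integrable_leb01_ext:
  fixes g :: "real \<Rightarrow> 'a::euclidean_space"
  shows "integrable leb01 g \<longleftrightarrow> integrable lebesgue (\<lambda>x. indicator {0..1} x *\<^sub>R g x)"
  by (simp add: integrable_restrict_space)

lemma integral_leb01_ext:
  fixes g :: "real \<Rightarrow> 'a::euclidean_space"
  shows "integral\<^sup>L leb01 g = (\<integral>x. indicator {0..1} x *\<^sub>R g x \<partial>lebesgue)"
  by (simp add: integral_restrict_space)

lemma integrable_indicator_leb01:
  fixes g :: "real \<Rightarrow> 'a::euclidean_space"
  assumes "integrable leb01 g" "A \<in> sets lebesgue"
  shows "integrable leb01 (\<lambda>t. indicator A t *\<^sub>R g t)"
proof -
  have "integrable lebesgue (\<lambda>x. indicator A x *\<^sub>R (indicator {0..1} x *\<^sub>R g x))"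
    using assms(1) by (intro integrable_mult_indicator[OF assms(2)]) (simp only: integrable_leb01_ext)
  thus ?thesis by (simp add: integrable_leb01_ext mult.commute)
qed

lemma AE_leb01_neq: "AE t in leb01. t \<noteq> a"
proof -
  have "AE t in lebesgue. t \<noteq> a"
    using AE_lborel_singleton[of a] by (rule AE_completion)
  thus ?thesis by (auto simp: AE_restrict_space_iff elim: eventually_mono)
qed

lemma prim_diff:
  fixes g :: "real \<Rightarrow> 'a::euclidean_space"
  assumes g: "integrable leb01 g" and xy: "0 \<le> x" "x \<le> y"
  shows "prim g y - prim g x = (\<integral>t. indicator {x<..<y} t *\<^sub>R g t \<partial>leb01)"
proof -
  have "prim g y - prim g x = (\<integral>t. indicator {0..y} t *\<^sub>R g t - indicator {0..x} t *\<^sub>R g t \<partial>leb01)"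
    unfolding prim_def using g by (intro Bochner_Integration.integral_diff[symmetric] integrable_indicator_leb01) auto
  also have "\<dots> = (\<integral>t. indicator {x<..y} t *\<^sub>R g t \<partial>leb01)"
    using xy by (intro Bochner_Integration.integral_cong) (auto simp: indicator_def)
  also have "\<dots> = (\<integral>t. indicator {x<..<y} t *\<^sub>R g t \<partial>leb01)"
  proof (rule integral_cong_AE)
    show "AE t in leb01. indicator {x<..y} t *\<^sub>R g t = indicator {x<..<y} t *\<^sub>R g t"
      using AE_leb01_neq[of y] by eventually_elim (auto simp: indicator_def)
    show "(\<lambda>t. indicator {x<..y} t *\<^sub>R g t) \<in> borel_measurable leb01"
      using integrable_indicator_leb01[OF g, of "{x<..y}"] by auto
    show "(\<lambda>t. indicator {x<..<y} t *\<^sub>R g t) \<in> borel_measurable leb01"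
      using integrable_indicator_leb01[OF g, of "{x<..<y}"] by auto
  qed
  finally show ?thesis .
qed

lemma integral_indicator_const01:
  fixes v :: "'a::euclidean_space"
  assumes "0 \<le> x" "x \<le> y" "y \<le> 1"
  shows "(\<integral>t. indicator {x<..<y} t *\<^sub>R v \<partial>leb01) = (y - x) *\<^sub>R v"
proof -
  have "(\<integral>t. indicator {x<..<y} t *\<^sub>R v \<partial>leb01) = (\<integral>t. indicator {x<..<y} t *\<^sub>R v \<partial>lebesgue)"
    unfolding integral_leb01_ext using assms by (intro Bochner_Integration.integral_cong) (auto simp: indicator_def)
  also have "\<dots> = measure lebesgue {x<..<y} *\<^sub>R v"
    using assms by (subst integral_scaleR_left) (auto intro!: integrable_real_indicator)
  finally show ?thesis using assms by simp
qed

lemma integrable_const01: "integrable leb01 (\<lambda>t. v::'a::euclidean_space)"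
  unfolding integrable_leb01_ext
  by (intro integrable_scaleR_left integrable_real_indicator) auto

text \<open>The error of the linear approximation is the integral of \<open>g t - g x\<close>
  between \<open>x\<close> and \<open>y\<close>; enlarging the range to a ball around
  \<open>x\<close> turns its bound into the quantity in \<open>lebesgue_point\<close>. Extension by
  zero lets the ball leave [0,1].\<close>

lemma prim_deriv_bound:
  fixes g :: "real \<Rightarrow> 'a::euclidean_space"
  assumes g: "integrable leb01 g" and x: "0 \<le> x" "x \<le> 1" and y: "0 \<le> y" "y \<le> 1"
  defines "G \<equiv> (\<lambda>x. indicator {0..1} x *\<^sub>R g x)"
  shows "norm (prim g y - prim g x - (y - x) *\<^sub>R g x) \<le> (\<integral>t. indicator (cball x \<bar>y - x\<bar>) t * norm (G t - G x) \<partial>lebesgue)"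
proof -
  have G: "integrable lebesgue G" using g by (simp add: G_def integrable_leb01_ext)
  have main: "norm (prim g b - prim g a - (b - a) *\<^sub>R g x) \<le> (\<integral>t. indicator (cball x r) t * norm (G t - G x) \<partial>lebesgue)"
    if ab: "0 \<le> a" "a \<le> b" "b \<le> 1" "{a<..<b} \<subseteq> cball x r" for a b r
  proof -
    have i1: "integrable leb01 (\<lambda>t. indicator {a<..<b} t *\<^sub>R g t)"
      by (rule integrable_indicator_leb01[OF g]) auto
    have i2: "integrable leb01 (\<lambda>t. indicator {a<..<b} t *\<^sub>R g x)"
      by (rule integrable_indicator_leb01[OF integrable_const01]) auto
    have "prim g b - prim g a - (b - a) *\<^sub>R g x = (\<integral>t. indicator {a<..<b} t *\<^sub>R g t - indicator {a<..<b} t *\<^sub>R g x \<partial>leb01)"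
      using i1 i2 ab by (simp add: prim_diff[OF g] integral_indicator_const01)
    also have "norm \<dots> \<le> (\<integral>t. norm (indicator {a<..<b} t *\<^sub>R g t - indicator {a<..<b} t *\<^sub>R g x) \<partial>leb01)"
      by (rule integral_norm_bound)
    also have "\<dots> = (\<integral>t. indicator {0..1} t *\<^sub>R norm (indicator {a<..<b} t *\<^sub>R g t - indicator {a<..<b} t *\<^sub>R g x) \<partial>lebesgue)"
      by (rule integral_leb01_ext)
    also have "\<dots> \<le> (\<integral>t. indicator (cball x r) t * norm (G t - G x) \<partial>lebesgue)"
    proof (rule integral_mono)
      show "integrable lebesgue (\<lambda>t. indicator {0..1} t *\<^sub>R norm (indicator {a<..<b} t *\<^sub>R g t - indicator {a<..<b} t *\<^sub>R g x))"
        using integrable_norm[OF Bochner_Integration.integrable_diff[OF i1 i2]] unfolding integrable_leb01_ext .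
      show "integrable lebesgue (\<lambda>t. indicator (cball x r) t * norm (G t - G x))"
        by (rule integrable_cball_diff[OF G])
      fix t show "indicator {0..1} t *\<^sub>R norm (indicator {a<..<b} t *\<^sub>R g t - indicator {a<..<b} t *\<^sub>R g x) \<le> indicator (cball x r) t * norm (G t - G x)"
        using ab x by (auto simp: indicator_def G_def)
    qed
    finally show ?thesis .
  qed
  show ?thesis
  proof (cases "x \<le> y")
    case True
    thus ?thesis using x y by (intro main) (auto simp: dist_real_def)
  next
    case False
    have "norm (prim g y - prim g x - (y - x) *\<^sub>R g x) = norm (prim g x - prim g y - (x - y) *\<^sub>R g x)"
      by (subst norm_minus_commute[symmetric]) (simp add: algebra_simps)
    also have "\<dots> \<le> (\<integral>t. indicator (cball x \<bar>y - x\<bar>) t * norm (G t - G x) \<partial>lebesgue)"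
      using False x y by (intro main) (auto simp: dist_real_def)
    finally show ?thesis .
  qed
qed

lemma prim_has_derivative_AE:
  fixes g :: "real \<Rightarrow> 'a::euclidean_space"
  assumes g: "integrable leb01 g"
  shows "AE x in leb01. (prim g has_vector_derivative g x) (at x within {0..1})"
proof -
  define G where "G = (\<lambda>x. indicator {0..1} x *\<^sub>R g x)"
  have G: "integrable lebesgue G" using g by (simp add: G_def integrable_leb01_ext)
  have "AE x in lebesgue. lebesgue_point G x"
    using Lebesgue_differentiation[OF G] by (auto simp: negligible_iff_null_sets intro: AE_I')
  hence "AE x in lebesgue. x \<in> {0..1} \<longrightarrow> (prim g has_vector_derivative g x) (at x within {0..1})"
  proof eventually_elim
    fix x assume L: "lebesgue_point G x"
    show "x \<in> {0..1} \<longrightarrow> (prim g has_vector_derivative g x) (at x within {0..1})"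
    proof
      assume x: "x \<in> {0..1}"
      show "(prim g has_vector_derivative g x) (at x within {0..1})"
        unfolding has_vector_derivative_def has_derivative_within_alt
      proof (intro conjI allI impI)
        show "bounded_linear (\<lambda>h. h *\<^sub>R g x)" by (rule bounded_linear_scaleR_left)
        fix e :: real assume "e > 0"
        \<comment> \<open>Half of \<open>e\<close>, because the ball is twice as long as the
          interval from \<open>x\<close> to \<open>y\<close>.\<close>
        hence "e/2 > 0" by simp
        then obtain d where d: "d > 0" "\<And>r. 0 < r \<Longrightarrow> r < d \<Longrightarrow> (\<integral>y. indicator (cball x r) y * norm (G y - G x) \<partial>lebesgue) \<le> 2 * r * (e/2)"
          using L unfolding lebesgue_point_def by blast
        show "\<exists>d>0. \<forall>y\<in>{0..1}. norm (y - x) < d \<longrightarrow> norm (prim g y - prim g x - (y - x) *\<^sub>R g x) \<le> e * norm (y - x)"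
        proof (intro exI[of _ d] conjI ballI impI d(1))
          fix y assume y: "y \<in> {0..1}" "norm (y - x) < d"
          show "norm (prim g y - prim g x - (y - x) *\<^sub>R g x) \<le> e * norm (y - x)"
          proof (cases "y = x")
            case False
            have "norm (prim g y - prim g x - (y - x) *\<^sub>R g x) \<le> (\<integral>t. indicator (cball x \<bar>y - x\<bar>) t * norm (G t - G x) \<partial>lebesgue)"
              using prim_deriv_bound[OF g, of x y] x y by (simp add: G_def)
            also have "\<dots> \<le> 2 * \<bar>y - x\<bar> * (e/2)" using False y by (intro d(2)) auto
            finally show ?thesis by (simp add: mult.commute)
          qed simp
        qed
      qed
    qed
  qed
  thus ?thesis by (simp add: AE_restrict_space_iff)
qed

lemma sum_integral_disjoint_le:
  fixes h :: "real \<Rightarrow> 'a::euclidean_space"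
  assumes h: "integrable lebesgue h" and I: "finite I" "disjoint_family_on (\<lambda>(s, t). {s<..<t}) I"
  shows "(\<Sum>(s,t)\<in>I. \<integral>y. indicator {s<..<t} y * norm (h y) \<partial>lebesgue) \<le> (\<integral>y. norm (h y) \<partial>lebesgue)"
proof -
  have ih: "integrable lebesgue (\<lambda>y. indicator {s<..<t} y * norm (h y))" for s t :: real
    using integrable_mult_indicator[of "{s<..<t}" lebesgue "\<lambda>y. norm (h y)"] h by simp
  have "(\<Sum>(s,t)\<in>I. \<integral>y. indicator {s<..<t} y * norm (h y) \<partial>lebesgue)
     = (\<integral>y. (\<Sum>p\<in>I. indicator {fst p<..<snd p} y * norm (h y)) \<partial>lebesgue)"
    using ih by (subst Bochner_Integration.integral_sum) (auto simp: case_prod_unfold)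
  also have "\<dots> \<le> (\<integral>y. norm (h y) \<partial>lebesgue)"
  proof (intro integral_mono)
    fix y
    have "(\<Sum>p\<in>I. indicator {fst p<..<snd p} y :: real) = indicator (\<Union>p\<in>I. {fst p<..<snd p}) y"
      using I by (intro indicator_UN_disjoint[symmetric]) (auto simp: case_prod_unfold)
    hence "(\<Sum>p\<in>I. indicator {fst p<..<snd p} y * norm (h y)) = indicator (\<Union>p\<in>I. {fst p<..<snd p}) y * norm (h y)"
      by (simp flip: sum_distrib_right)
    also have "\<dots> \<le> norm (h y)" by (simp add: indicator_def)
    finally show "(\<Sum>p\<in>I. indicator {fst p<..<snd p} y * norm (h y)) \<le> norm (h y)" .
  qed (use h ih in \<open>auto intro!: Bochner_Integration.integrable_sum\<close>)
  finally show ?thesis .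
qed

text \<open>Split \<open>g\<close> into a bounded part, whose integral is controlled by the total
  length of the intervals, and a part of small \<open>L1\<close> norm, which contributes little over
  any disjoint family.\<close>

lemma ac01_prim:
  fixes g :: "real \<Rightarrow> 'a::euclidean_space"
  assumes g: "integrable leb01 g"
  shows "ac01 (prim g)"
  unfolding ac01_def
proof (intro allI impI)
  fix e :: real assume e: "e > 0"
  define G where "G = (\<lambda>x. indicator {0..1} x *\<^sub>R g x)"
  have G: "integrable lebesgue G" using g by (simp add: G_def integrable_leb01_ext)
  have e2: "e/2 > 0" using e by simp
  obtain c M where c: "\<And>x. norm (c x) \<le> M" "integrable lebesgue c" "(\<integral>x. norm (G x - c x) \<partial>lebesgue) < e/2"
    using L1_approx_continuous[OF G e2] by blast
  have M: "M \<ge> 0" using c(1)[of 0] norm_ge_zero order_trans by blast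
  define h where "h = (\<lambda>x. G x - c x)"
  have h: "integrable lebesgue h" using G c by (simp add: h_def)
  define d where "d = e / (2 * (M + 1))"
  have d: "d > 0" using e M by (simp add: d_def)
  show "\<exists>\<delta>>0. \<forall>I. finite I \<and> (\<forall>(s, t)\<in>I. 0 \<le> s \<and> s < t \<and> t \<le> 1) \<and> disjoint_family_on (\<lambda>(s, t). {s<..<t}) I \<and> (\<Sum>(s, t)\<in>I. t - s) < \<delta> \<longrightarrow>
            (\<Sum>(s, t)\<in>I. norm (prim g t - prim g s)) < e"
  proof (intro exI[of _ d] conjI allI impI d)
    fix I :: "(real \<times> real) set"
    assume I: "finite I \<and> (\<forall>(s, t)\<in>I. 0 \<le> s \<and> s < t \<and> t \<le> 1) \<and> disjoint_family_on (\<lambda>(s, t). {s<..<t}) I \<and> (\<Sum>(s, t)\<in>I. t - s) < d"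
    have bd: "norm (prim g t - prim g s) \<le> (\<integral>y. indicator {s<..<t} y * norm (h y) \<partial>lebesgue) + (t - s) * M"
      if st: "0 \<le> s" "s < t" "t \<le> 1" for s t
    proof -
      have ih: "integrable lebesgue (\<lambda>y. indicator {s<..<t} y * norm (h y))" for s t :: real
        using integrable_mult_indicator[of "{s<..<t}" lebesgue "\<lambda>y. norm (h y)"] h by simp
      have iM: "integrable lebesgue (\<lambda>y. indicator {s<..<t} y * M)"
        by (intro integrable_mult_left integrable_real_indicator) (use st in auto)
      have "norm (prim g t - prim g s) = norm (\<integral>y. indicator {s<..<t} y *\<^sub>R g y \<partial>leb01)"
        using prim_diff[OF g, of s t] st by simp
      also have "\<dots> \<le> (\<integral>y. norm (indicator {s<..<t} y *\<^sub>R g y) \<partial>leb01)"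
        by (rule integral_norm_bound)
      also have "\<dots> = (\<integral>y. indicator {0..1} y *\<^sub>R norm (indicator {s<..<t} y *\<^sub>R g y) \<partial>lebesgue)"
        by (rule integral_leb01_ext)
      also have "\<dots> \<le> (\<integral>y. indicator {s<..<t} y * norm (h y) + indicator {s<..<t} y * M \<partial>lebesgue)"
      proof (rule integral_mono)
        show "integrable lebesgue (\<lambda>y. indicator {0..1} y *\<^sub>R norm (indicator {s<..<t} y *\<^sub>R g y))"
        proof -
          have "integrable leb01 (\<lambda>y. norm (indicator {s<..<t} y *\<^sub>R g y))"
            by (intro integrable_norm integrable_indicator_leb01 g) simp
          thus ?thesis unfolding integrable_leb01_ext .
        qed
        fix y
        have "norm (G y) \<le> norm (h y) + norm (c y)" unfolding h_def using norm_triangle_sub[of "G y" "c y"] by linarith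
        hence "norm (G y) \<le> norm (h y) + M" using c(1)[of y] by simp
        thus "indicator {0..1} y *\<^sub>R norm (indicator {s<..<t} y *\<^sub>R g y) \<le> indicator {s<..<t} y * norm (h y) + indicator {s<..<t} y * M"
          using st by (auto simp: indicator_def G_def)
      qed (use ih iM in auto)
      also have "\<dots> = (\<integral>y. indicator {s<..<t} y * norm (h y) \<partial>lebesgue) + (t - s) * M"
        using ih iM st by (subst Bochner_Integration.integral_add) auto
      finally show ?thesis .
    qed
    have "(\<Sum>(s, t)\<in>I. norm (prim g t - prim g s)) \<le> (\<Sum>(s, t)\<in>I. (\<integral>y. indicator {s<..<t} y * norm (h y) \<partial>lebesgue) + (t - s) * M)"
      using bd I by (intro sum_mono) (auto simp: case_prod_unfold)
    also have "\<dots> = (\<Sum>(s, t)\<in>I. (\<integral>y. indicator {s<..<t} y * norm (h y) \<partial>lebesgue)) + (\<Sum>(s, t)\<in>I. t - s) * M"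
      by (simp add: case_prod_unfold sum.distrib sum_distrib_right)
    also have "\<dots> \<le> (\<integral>y. norm (h y) \<partial>lebesgue) + d * M"
      using I M by (intro add_mono sum_integral_disjoint_le[OF h] mult_right_mono) auto
    also have "d * M \<le> e/2" using M e by (simp add: d_def field_simps)
    finally show "(\<Sum>(s, t)\<in>I. norm (prim g t - prim g s)) < e" using c(3) by (simp add: h_def)
  qed
qed

section \<open>Absolutely continuous functions\<close>

text \<open>Partitions are monotone but not strictly monotone, and need not reach the endpoints:
  clipping by \<open>min\<close> and \<open>max\<close> or repeating points then stays inside the
  class.\<close>

definition variations :: "(real \<Rightarrow> real) \<Rightarrow> real \<Rightarrow> real \<Rightarrow> real set" where
  "variations f a b = {(\<Sum>i<N. \<bar>f (x (Suc i)) - f (x i)\<bar>) | N x. mono (x :: nat \<Rightarrow> real) \<and> range x \<subseteq> {a..b}}"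

lemma variations_nonempty: "a \<le> b \<Longrightarrow> 0 \<in> variations f a b"
  unfolding variations_def by (intro CollectI exI[of _ 0] exI[of _ "\<lambda>_. a"]) (auto simp: mono_def)

text \<open>Clip the partition at \<open>b\<close> from above and from below. An increment across
  \<open>b\<close> is divided there by the triangle inequality; any other increment survives on one
  side and becomes zero on the other.\<close>

lemma variations_split:
  assumes "v \<in> variations f a c" "a \<le> b" "b \<le> c"
  obtains v1 v2 where "v1 \<in> variations f a b" "v2 \<in> variations f b c" "v \<le> v1 + v2"
proof -
  obtain N x where x: "mono x" "range x \<subseteq> {a..c}" "v = (\<Sum>i<N. \<bar>f (x (Suc i)) - f (x i)\<bar>)"
    using assms by (auto simp: variations_def)
  let ?y = "\<lambda>i. min (x i) b" and ?z = "\<lambda>i. max (x i) b"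
  have xr: "a \<le> x i" "x i \<le> c" for i using x(2) by (auto simp: image_subset_iff)
  have "(\<Sum>i<N. \<bar>f (?y (Suc i)) - f (?y i)\<bar>) \<in> variations f a b"
  proof -
    have "mono ?y"
    proof (rule monoI)
      fix i j :: nat assume "i \<le> j"
      hence "x i \<le> x j" using x(1) by (simp add: mono_def)
      thus "?y i \<le> ?y j" by auto
    qed
    moreover have "range ?y \<subseteq> {a..b}"
      unfolding image_subset_iff
    proof
      fix i show "?y i \<in> {a..b}" using xr[of i] assms(2,3) by auto
    qed
    ultimately show ?thesis unfolding variations_def by (intro CollectI exI[of _ N] exI[of _ ?y] conjI refl)
  qed
  moreover have "(\<Sum>i<N. \<bar>f (?z (Suc i)) - f (?z i)\<bar>) \<in> variations f b c"
  proof -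
    have "mono ?z"
    proof (rule monoI)
      fix i j :: nat assume "i \<le> j"
      hence "x i \<le> x j" using x(1) by (simp add: mono_def)
      thus "?z i \<le> ?z j" by auto
    qed
    moreover have "range ?z \<subseteq> {b..c}"
      unfolding image_subset_iff
    proof
      fix i show "?z i \<in> {b..c}" using xr[of i] assms(2,3) by auto
    qed
    ultimately show ?thesis unfolding variations_def by (intro CollectI exI[of _ N] exI[of _ ?z] conjI refl)
  qed
  moreover have "v \<le> (\<Sum>i<N. \<bar>f (?y (Suc i)) - f (?y i)\<bar>) + (\<Sum>i<N. \<bar>f (?z (Suc i)) - f (?z i)\<bar>)"
    unfolding x(3) sum.distrib[symmetric]
  proof (rule sum_mono)
    fix i
    have "x i \<le> x (Suc i)" using x(1) by (simp add: mono_def)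
    thus "\<bar>f (x (Suc i)) - f (x i)\<bar> \<le> \<bar>f (?y (Suc i)) - f (?y i)\<bar> + \<bar>f (?z (Suc i)) - f (?z i)\<bar>"
      by (auto simp: min_def max_def)
  qed
  ultimately show ?thesis using that by blast
qed

lemma variations_extend:
  assumes "v \<in> variations f a b" "a \<le> b" "b \<le> c"
  shows "\<exists>w \<in> variations f a c. v + \<bar>f c - f b\<bar> \<le> w"
proof -
  obtain N x where x: "mono x" "range x \<subseteq> {a..b}" "v = (\<Sum>i<N. \<bar>f (x (Suc i)) - f (x i)\<bar>)"
    using assms by (auto simp: variations_def)
  have xr: "a \<le> x i" "x i \<le> b" for i using x(2) by (auto simp: image_subset_iff)
  define y where "y i = (if i \<le> N then x i else if i = Suc N then b else c)" for i
  have "(\<Sum>i<N + 2. \<bar>f (y (Suc i)) - f (y i)\<bar>) = (\<Sum>i<N. \<bar>f (y (Suc i)) - f (y i)\<bar>) + \<bar>f b - f (x N)\<bar> + \<bar>f c - f b\<bar>"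
    by (simp add: y_def)
  also have "(\<Sum>i<N. \<bar>f (y (Suc i)) - f (y i)\<bar>) = v" unfolding x(3) by (intro sum.cong) (auto simp: y_def)
  finally have "v + \<bar>f c - f b\<bar> \<le> (\<Sum>i<N + 2. \<bar>f (y (Suc i)) - f (y i)\<bar>)" by simp
  moreover have "(\<Sum>i<N + 2. \<bar>f (y (Suc i)) - f (y i)\<bar>) \<in> variations f a c"
  proof -
    have xm: "x i \<le> x (Suc i)" for i using x(1) by (simp add: mono_def)
    have "mono y"
    proof (rule incseq_SucI)
      fix i show "y i \<le> y (Suc i)"
        using xm[of i] xr[of i] xr[of "Suc i"] assms(3) by (auto simp: y_def)
    qed
    moreover have "range y \<subseteq> {a..c}"
      unfolding image_subset_iff
    proof
      fix i show "y i \<in> {a..c}" using xr[of i] assms(2,3) by (auto simp: y_def)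
    qed
    ultimately show ?thesis unfolding variations_def by (intro CollectI exI[of _ "N + 2"] exI[of _ y] conjI refl)
  qed
  ultimately show ?thesis by blast
qed

text \<open>Refining every interval of the family by a partition yields again disjoint intervals of
  no greater total length, so the bound for \<open>f\<close> applies to all the variation sums at
  once.\<close>

lemma variations_family:
  assumes ac: "\<And>I. finite I \<Longrightarrow> (\<forall>(s, t) \<in> I. 0 \<le> s \<and> s < t \<and> t \<le> 1) \<Longrightarrow>
        disjoint_family_on (\<lambda>(s, t). {s<..<t}) I \<Longrightarrow> (\<Sum>(s, t)\<in>I. t - s) < \<delta> \<Longrightarrow> (\<Sum>(s, t)\<in>I. \<bar>f t - f s\<bar>) < \<epsilon>"
    and I: "finite I" "\<And>s t. (s,t) \<in> I \<Longrightarrow> 0 \<le> s \<and> s < t \<and> t \<le> 1"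
        "disjoint_family_on (\<lambda>(s, t). {s<..<t}) I" "(\<Sum>(s, t)\<in>I. t - s) < \<delta>"
    and v: "\<And>p. p \<in> I \<Longrightarrow> v p \<in> variations f (fst p) (snd p)"
  shows "(\<Sum>p\<in>I. v p) < \<epsilon>"
proof -
  have Nex: "\<forall>p\<in>I. \<exists>N x. mono x \<and> range x \<subseteq> {fst p..snd p} \<and> v p = (\<Sum>i<N. \<bar>f (x (Suc i)) - f (x i)\<bar>)"
  proof
    fix p assume "p \<in> I"
    from v[OF this] show "\<exists>N x. mono x \<and> range x \<subseteq> {fst p..snd p} \<and> v p = (\<Sum>i<N. \<bar>f (x (Suc i)) - f (x i)\<bar>)"
      unfolding variations_def by (elim CollectE exE conjE) (intro exI conjI)
  qed
  obtain N where "\<forall>p\<in>I. \<exists>x. mono x \<and> range x \<subseteq> {fst p..snd p} \<and> v p = (\<Sum>i<N p. \<bar>f (x (Suc i)) - f (x i)\<bar>)"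
    using bchoice[OF Nex] by (elim exE) (rule that)
  from bchoice[OF this] obtain x where x0: "\<forall>p\<in>I. mono (x p) \<and> range (x p) \<subseteq> {fst p..snd p} \<and> v p = (\<Sum>i<N p. \<bar>f (x p (Suc i)) - f (x p i)\<bar>)"
    by (elim exE) (rule that)
  have x: "\<And>p. p \<in> I \<Longrightarrow> mono (x p)" "\<And>p. p \<in> I \<Longrightarrow> range (x p) \<subseteq> {fst p..snd p}"
     "\<And>p. p \<in> I \<Longrightarrow> v p = (\<Sum>i<N p. \<bar>f (x p (Suc i)) - f (x p i)\<bar>)" using x0 by simp_all
  have xr: "fst p \<le> x p i" "x p i \<le> snd p" if "p \<in> I" for p i using x(2)[OF that] by (auto simp: image_subset_iff)
  have xm: "x p i \<le> x p j" if "p \<in> I" "i \<le> j" for p i j using x(1)[OF that(1)] that(2) by (simp add: mono_def)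
  \<comment> \<open>Steps of length zero are discarded: the condition requires \<open>s < t\<close>,
    and for nonempty intervals disjointness makes \<open>\<phi>\<close> injective.\<close>
  define A where "A = {(p,i). p \<in> I \<and> i < N p \<and> x p i < x p (Suc i)}"
  define \<phi> where "\<phi> = (\<lambda>(p,i). (x p i, x p (Suc i)))"
  have finS: "finite (Sigma I (\<lambda>p. {..<N p}))" using I(1) by auto
  have AS: "A \<subseteq> Sigma I (\<lambda>p. {..<N p})" by (auto simp: A_def)
  have finA: "finite A" using finite_subset[OF AS finS] .
  have dis: "{x p i<..<x p (Suc i)} \<inter> {x q j<..<x q (Suc j)} = {}" if "(p,i) \<in> A" "(q,j) \<in> A" "(p,i) \<noteq> (q,j)" for p i q j
  proof (cases "p = q")
    case True
    have pI: "p \<in> I" using that by (auto simp: A_def)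
    from True that have "Suc i \<le> j \<or> Suc j \<le> i" by auto
    thus ?thesis using xm[OF pI, of "Suc i" j] xm[OF pI, of "Suc j" i] True by auto
  next
    case False
    have pI: "p \<in> I" "q \<in> I" using that by (auto simp: A_def)
    have "{fst p<..<snd p} \<inter> {fst q<..<snd q} = {}"
      using I(3) pI False by (auto simp: disjoint_family_on_def case_prod_unfold)
    moreover have "{x p i<..<x p (Suc i)} \<subseteq> {fst p<..<snd p}" "{x q j<..<x q (Suc j)} \<subseteq> {fst q<..<snd q}"
      using xr(1)[OF pI(1), of i] xr(2)[OF pI(1), of "Suc i"] xr(1)[OF pI(2), of j] xr(2)[OF pI(2), of "Suc j"] by auto
    ultimately show ?thesis by blast
  qed
  have ne: "{x p i<..<x p (Suc i)} \<noteq> {}" if "(p,i) \<in> A" for p i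
    using that by (auto simp: A_def)
  have inj: "inj_on \<phi> A"
  proof (rule inj_onI, clarify)
    fix p i q j assume h: "(p,i) \<in> A" "(q,j) \<in> A" "\<phi> (p,i) = \<phi> (q,j)"
    have "(p, i) = (q, j)"
    proof (rule ccontr)
      assume "(p, i) \<noteq> (q, j)"
      from dis[OF h(1,2) this] ne[OF h(1)] h(3) show False by (auto simp: \<phi>_def)
    qed
    thus "p = q \<and> i = j" by simp
  qed
  have sumA: "(\<Sum>(s,t)\<in>\<phi> ` A. g s t) = (\<Sum>p\<in>I. \<Sum>i<N p. g (x p i) (x p (Suc i)))"
    if g0: "\<And>s. g s s = (0::real)" for g
  proof -
    have "(\<Sum>(s,t)\<in>\<phi> ` A. g s t) = (\<Sum>(p,i)\<in>A. g (x p i) (x p (Suc i)))"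
      by (subst sum.reindex[OF inj]) (auto simp: \<phi>_def case_prod_unfold o_def)
    also have "\<dots> = (\<Sum>(p,i)\<in>Sigma I (\<lambda>p. {..<N p}). g (x p i) (x p (Suc i)))"
    proof (rule sum.mono_neutral_left[OF finS AS], clarify)
      fix p i assume h: "p \<in> I" "i < N p" "(p,i) \<notin> A"
      have "x p i \<le> x p (Suc i)" using xm[OF h(1)] by simp
      hence "x p i = x p (Suc i)" using h by (auto simp: A_def)
      thus "g (x p i) (x p (Suc i)) = 0" using g0 by metis
    qed
    also have "\<dots> = (\<Sum>p\<in>I. \<Sum>i<N p. g (x p i) (x p (Suc i)))"
      using I(1) by (subst sum.Sigma) auto
    finally show ?thesis .
  qed
  have "(\<Sum>(s,t)\<in>\<phi> ` A. \<bar>f t - f s\<bar>) < \<epsilon>"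
  proof (rule ac)
    show "finite (\<phi> ` A)" using finA by simp
    show "\<forall>(s, t)\<in>\<phi> ` A. 0 \<le> s \<and> s < t \<and> t \<le> 1"
    proof clarify
      fix s t p i assume h: "(s,t) = \<phi> (p,i)" "(p,i) \<in> A"
      have pI: "p \<in> I" using h by (auto simp: A_def)
      have "0 \<le> fst p" "snd p \<le> 1" using I(2)[of "fst p" "snd p"] pI by auto
      thus "0 \<le> s \<and> s < t \<and> t \<le> 1" using h xr[OF pI, of i] xr[OF pI, of "Suc i"] by (auto simp: A_def \<phi>_def)
    qed
    show "disjoint_family_on (\<lambda>(s, t). {s<..<t}) (\<phi> ` A)"
      unfolding disjoint_family_on_def
    proof (intro ballI impI)
      fix P Q assume "P \<in> \<phi> ` A" "Q \<in> \<phi> ` A" and PQ: "P \<noteq> Q"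
      then obtain p i q j where h: "P = \<phi> (p,i)" "(p,i) \<in> A" "Q = \<phi> (q,j)" "(q,j) \<in> A" by auto
      have "(p,i) \<noteq> (q,j)" using h PQ by auto
      from dis[OF h(2,4) this] h show "(case P of (s, t) \<Rightarrow> {s<..<t}) \<inter> (case Q of (s, t) \<Rightarrow> {s<..<t}) = {}"
        by (simp add: \<phi>_def)
    qed
    have "(\<Sum>(s, t)\<in>\<phi> ` A. t - s) = (\<Sum>p\<in>I. \<Sum>i<N p. x p (Suc i) - x p i)"
      by (rule sumA) simp
    also have "\<dots> \<le> (\<Sum>p\<in>I. snd p - fst p)"
    proof (rule sum_mono)
      fix p assume p: "p \<in> I"
      have "(\<Sum>i<N p. x p (Suc i) - x p i) = x p (N p) - x p 0" by (rule sum_lessThan_telescope)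
      thus "(\<Sum>i<N p. x p (Suc i) - x p i) \<le> snd p - fst p" using xr[OF p, of "N p"] xr[OF p, of 0] by simp
    qed
    also have "\<dots> < \<delta>" using I(4) by (simp add: case_prod_unfold)
    finally show "(\<Sum>(s, t)\<in>\<phi> ` A. t - s) < \<delta>" .
  qed
  also have "(\<Sum>(s,t)\<in>\<phi> ` A. \<bar>f t - f s\<bar>) = (\<Sum>p\<in>I. \<Sum>i<N p. \<bar>f (x p (Suc i)) - f (x p i)\<bar>)"
    by (rule sumA) simp
  also have "\<dots> = (\<Sum>p\<in>I. v p)" using x(3) by (intro sum.cong) auto
  finally show ?thesis .
qed

text \<open>With \<open>d\<close> chosen for the bound 1, an interval shorter than \<open>d\<close>
  has variation at most 1, and every interval consists of finitely many of these; the induction cuts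
  off one piece at a time.\<close>

lemma ac01_variations_bdd:
  assumes f: "ac01 f" and ab: "0 \<le> a" "a \<le> b" "b \<le> 1"
  shows "bdd_above (variations f a b)"
proof -
  obtain d where d: "d > 0" "\<And>I. finite I \<Longrightarrow> (\<forall>(s, t) \<in> I. 0 \<le> s \<and> s < t \<and> t \<le> 1) \<Longrightarrow>
        disjoint_family_on (\<lambda>(s, t). {s<..<t}) I \<Longrightarrow> (\<Sum>(s, t)\<in>I. t - s) < d \<Longrightarrow> (\<Sum>(s, t)\<in>I. \<bar>f t - f s\<bar>) < 1"
    using f[unfolded ac01_def, rule_format, of 1] by (auto simp: real_norm_def)
  have short: "v \<le> 1" if st: "0 \<le> s" "s \<le> t" "t \<le> 1" "t - s < d" "v \<in> variations f s t" for s t v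
  proof (cases "s = t")
    case True
    obtain N x where x: "range x \<subseteq> {s..t}" "v = (\<Sum>i<N. \<bar>f (x (Suc i)) - f (x i)\<bar>)"
      using st(5) by (auto simp: variations_def)
    have "x i = s" for i using x(1) True by auto
    thus ?thesis using x by simp
  next
    case False
    have "(\<Sum>p\<in>{(s,t)}. v) < 1"
      by (rule variations_family[where f=f and \<delta>=d]) (use d st False in \<open>auto simp: disjoint_family_on_def\<close>)
    thus ?thesis by simp
  qed
  have *: "\<forall>a b v. 0 \<le> a \<and> a \<le> b \<and> b \<le> 1 \<and> b - a < real (Suc n) * d \<and> v \<in> variations f a b \<longrightarrow> v \<le> real (Suc n)" for n
  proof (induction n)
    case 0 thus ?case using short by auto
  next
    case (Suc n)
    show ?case
    proof (intro allI impI, elim conjE)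
      fix a b v assume h: "0 \<le> a" "a \<le> b" "b \<le> 1" "b - a < real (Suc (Suc n)) * d" "v \<in> variations f a b"
      \<comment> \<open>Cutting off the fraction \<open>1 / (n + 2)\<close> leaves a first piece
        shorter than \<open>d\<close> and a rest shorter than \<open>(n + 1) * d\<close>.\<close>
      define c where "c = a + (b - a) / real (Suc (Suc n))"
      have "(b - a) / real (Suc (Suc n)) \<le> (b - a) / 1" using h by (intro divide_left_mono) auto
      hence c: "a \<le> c" "c \<le> b" using h by (auto simp: c_def)
      have c1: "c - a < d" using h(4) by (simp add: c_def field_simps)
      have "b - c = (b - a) * (real (Suc n) / real (Suc (Suc n)))" by (simp add: c_def field_simps)
      also have "\<dots> < real (Suc (Suc n)) * d * (real (Suc n) / real (Suc (Suc n)))"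
        by (intro mult_strict_right_mono h(4)) auto
      also have "\<dots> = real (Suc n) * d" by (simp add: field_simps)
      finally have c2: "b - c < real (Suc n) * d" .
      obtain v1 v2 where v: "v1 \<in> variations f a c" "v2 \<in> variations f c b" "v \<le> v1 + v2"
        using variations_split[OF h(5) c] by blast
      have "v1 \<le> 1" using short[of a c v1] h c c1 v by auto
      moreover have "v2 \<le> real (Suc n)"
      proof -
        have "0 \<le> c" using h c by linarith
        thus ?thesis using Suc h c c2 v by blast
      qed
      ultimately show "v \<le> real (Suc (Suc n))" using v by simp
    qed
  qed
  obtain n where "b - a < real n * d" using reals_Archimedean3[OF d(1)] by blast
  hence "b - a < real (Suc n) * d" using d(1) by (simp add: field_simps)
  thus ?thesis using * ab by (intro bdd_aboveI[of _ "real (Suc n)"]) blast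
qed

text \<open>\<open>V\<close> is the variation function. It inherits absolute continuity because the
  variations over the members of a short family are approached by partitions, to which
  \<open>variations_family\<close> applies.\<close>

lemma ac01_monotone_majorant:
  assumes f: "ac01 (f :: real \<Rightarrow> real)"
  shows "\<exists>V :: real \<Rightarrow> real. ac01 V \<and> (\<forall>x y. 0 \<le> x \<and> x \<le> y \<and> y \<le> 1 \<longrightarrow> \<bar>f y - f x\<bar> \<le> V y - V x)"
proof -
  define V where "V b = Sup (variations f 0 b)" for b
  note bdd = ac01_variations_bdd[OF f]
  have up: "V t \<le> V s + Sup (variations f s t)" if st: "0 \<le> s" "s \<le> t" "t \<le> 1" for s t
    unfolding V_def
  proof (rule cSup_least)
    show "variations f 0 t \<noteq> {}" using variations_nonempty[of 0 t] st by auto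
    fix v assume "v \<in> variations f 0 t"
    then obtain v1 v2 where "v1 \<in> variations f 0 s" "v2 \<in> variations f s t" "v \<le> v1 + v2"
      using variations_split[of v f 0 t s] st by auto
    moreover have "v1 \<le> Sup (variations f 0 s)" using calculation bdd[of 0 s] st by (intro cSup_upper) auto
    moreover have "v2 \<le> Sup (variations f s t)" using calculation bdd[of s t] st by (intro cSup_upper) auto
    ultimately show "v \<le> Sup (variations f 0 s) + Sup (variations f s t)" by simp
  qed
  have low: "\<bar>f y - f x\<bar> \<le> V y - V x" if st: "0 \<le> x" "x \<le> y" "y \<le> 1" for x y
  proof -
    have "V x \<le> V y - \<bar>f y - f x\<bar>" unfolding V_def
    proof (rule cSup_least)
      show "variations f 0 x \<noteq> {}" using variations_nonempty[of 0 x] st by auto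
      fix v assume "v \<in> variations f 0 x"
      then obtain w where "w \<in> variations f 0 y" "v + \<bar>f y - f x\<bar> \<le> w"
        using variations_extend[of v f 0 x y] st by auto
      moreover have "w \<le> Sup (variations f 0 y)" using calculation bdd[of 0 y] st by (intro cSup_upper) auto
      ultimately show "v \<le> Sup (variations f 0 y) - \<bar>f y - f x\<bar>" by simp
    qed
    thus ?thesis by simp
  qed
  have "ac01 V"
    unfolding ac01_def
  proof (intro allI impI)
    fix e :: real assume "e > 0"
    \<comment> \<open>Taking suprema weakens the strict bound; halving \<open>e\<close> restores
      strictness.\<close>
    hence e2: "e/2 > 0" by simp
    obtain d where d: "d > 0" "\<And>I. finite I \<Longrightarrow> (\<forall>(s, t) \<in> I. 0 \<le> s \<and> s < t \<and> t \<le> 1) \<Longrightarrow>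
        disjoint_family_on (\<lambda>(s, t). {s<..<t}) I \<Longrightarrow> (\<Sum>(s, t)\<in>I. t - s) < d \<Longrightarrow> (\<Sum>(s, t)\<in>I. \<bar>f t - f s\<bar>) < e/2"
      using f[unfolded ac01_def, rule_format, OF e2] by (auto simp: real_norm_def)
    show "\<exists>\<delta>>0. \<forall>I. finite I \<and> (\<forall>(s, t)\<in>I. 0 \<le> s \<and> s < t \<and> t \<le> 1) \<and> disjoint_family_on (\<lambda>(s, t). {s<..<t}) I \<and> (\<Sum>(s, t)\<in>I. t - s) < \<delta> \<longrightarrow>
            (\<Sum>(s, t)\<in>I. norm (V t - V s)) < e"
    proof (intro exI[of _ d] conjI allI impI d(1), elim conjE)
      fix I :: "(real \<times> real) set"
      assume I: "finite I" "\<forall>(s, t)\<in>I. 0 \<le> s \<and> s < t \<and> t \<le> 1" "disjoint_family_on (\<lambda>(s, t). {s<..<t}) I" "(\<Sum>(s, t)\<in>I. t - s) < d"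
      have "(\<Sum>(s, t)\<in>I. norm (V t - V s)) \<le> (\<Sum>p\<in>I. Sup (variations f (fst p) (snd p)))"
      proof (rule sum_mono)
        fix p assume p: "p \<in> I"
        hence h: "0 \<le> fst p" "fst p \<le> snd p" "snd p \<le> 1" using I(2) by auto
        have "norm (V (snd p) - V (fst p)) = V (snd p) - V (fst p)" using low[OF h] by simp
        thus "(case p of (s, t) \<Rightarrow> norm (V t - V s)) \<le> Sup (variations f (fst p) (snd p))"
          using up[OF h] by (simp add: case_prod_unfold)
      qed
      also have "\<dots> \<le> e/2"
      proof (rule field_le_epsilon)
        fix \<eta> :: real assume \<eta>: "\<eta> > 0"
        \<comment> \<open>The slack \<open>\<eta>\<close> is shared by the members of
          \<open>I\<close>; adding 1 keeps the denominator positive for empty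
          \<open>I\<close>.\<close>
        define \<eta>' where "\<eta>' = \<eta> / (real (card I) + 1)"
        have \<eta>': "\<eta>' > 0" using \<eta> by (simp add: \<eta>'_def)
        have "\<exists>v. v \<in> variations f (fst p) (snd p) \<and> Sup (variations f (fst p) (snd p)) - \<eta>' < v" if "p \<in> I" for p
        proof -
          have h: "0 \<le> fst p" "fst p \<le> snd p" "snd p \<le> 1" using I(2) that by auto
          have "variations f (fst p) (snd p) \<noteq> {}" using variations_nonempty[OF h(2), of f] by auto
          thus ?thesis using less_cSup_iff[OF _ bdd[OF h], of "Sup (variations f (fst p) (snd p)) - \<eta>'"] \<eta>' by auto
        qed
        then obtain v where v: "\<And>p. p \<in> I \<Longrightarrow> v p \<in> variations f (fst p) (snd p)" "\<And>p. p \<in> I \<Longrightarrow> Sup (variations f (fst p) (snd p)) - \<eta>' < v p"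
          by metis
        have "(\<Sum>p\<in>I. v p) < e/2"
          by (rule variations_family[where f=f and \<delta>=d, OF d(2)]) (use I v in auto)
        moreover have "(\<Sum>p\<in>I. Sup (variations f (fst p) (snd p))) \<le> (\<Sum>p\<in>I. v p + \<eta>')"
          using v(2) by (intro sum_mono) (simp add: less_imp_le diff_less_eq)
        moreover have "(\<Sum>p\<in>I. v p + \<eta>') = (\<Sum>p\<in>I. v p) + real (card I) * \<eta>'" by (simp add: sum.distrib)
        moreover have "real (card I) * \<eta>' \<le> \<eta>" using \<eta> by (simp add: \<eta>'_def field_simps)
        ultimately show "(\<Sum>p\<in>I. Sup (variations f (fst p) (snd p))) \<le> e/2 + \<eta>" by linarith
      qed
      also have "\<dots> < e" using e2 by simp
      finally show "(\<Sum>(s, t)\<in>I. norm (V t - V s)) < e" .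
    qed
  qed
  thus ?thesis using low by blast
qed

section \<open>Densities of absolutely continuous functions\<close>

lemma ac01_continuous_on:
  assumes "ac01 f"
  shows "continuous_on {0..1} f"
  unfolding continuous_on_iff
proof (intro ballI allI impI)
  fix x e :: real assume x: "x \<in> {0..1}" and e: "e > 0"
  obtain d where d: "d > 0" "\<And>I. finite I \<Longrightarrow> (\<forall>(s, t) \<in> I. 0 \<le> s \<and> s < t \<and> t \<le> 1) \<Longrightarrow>
        disjoint_family_on (\<lambda>(s, t). {s<..<t}) I \<Longrightarrow> (\<Sum>(s, t)\<in>I. t - s) < d \<Longrightarrow> (\<Sum>(s, t)\<in>I. norm (f t - f s)) < e"
    using assms[unfolded ac01_def, rule_format, OF e] by auto
  have *: "norm (f t - f s) < e" if "0 \<le> s" "s < t" "t \<le> 1" "t - s < d" for s t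
    using d(2)[of "{(s,t)}"] that by (auto simp: disjoint_family_on_def)
  show "\<exists>d>0. \<forall>x'\<in>{0..1}. dist x' x < d \<longrightarrow> dist (f x') (f x) < e"
  proof (intro exI[of _ d] conjI ballI impI d(1))
    fix y assume y: "y \<in> {0..1}" "dist y x < d"
    show "dist (f y) (f x) < e"
    proof (cases "y = x")
      case False
      hence "x < y \<or> y < x" by auto
      thus ?thesis using *[of x y] *[of y x] x y by (auto simp: dist_norm norm_minus_commute)
    qed (use e in simp)
  qed
qed

text \<open>A null set lies in an open set of measure below \<open>d\<close>, and countably many
  nonoverlapping intervals inside that open set still cover it. Finite sums of their Stieltjes
  measures are sums of increments of \<open>F\<close>, hence below \<open>e\<close>.\<close>

lemma mono_ac01_null_sets:
  fixes F :: "real \<Rightarrow> real"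
  assumes F: "ac01 F" and mono: "mono Fe" "continuous_on UNIV Fe" "\<And>x. x \<in> {0..1} \<Longrightarrow> Fe x = F x"
    and N: "N \<in> null_sets lborel" "N \<subseteq> {0..1}"
  shows "emeasure (interval_measure Fe) N = 0"
proof -
  let ?M = "interval_measure Fe"
  have mF: "\<And>x y. x \<le> y \<Longrightarrow> Fe x \<le> Fe y" using mono(1) by (simp add: mono_def)
  have Icc: "emeasure ?M {a..b} = ennreal (Fe b - Fe a)" if "a \<le> b" for a b
    by (rule emeasure_interval_measure_Icc[OF that mF mono(2)])
  have Nb: "N \<in> sets ?M" using N by auto
  have NL: "N \<in> null_sets lebesgue" using N(1) by (rule null_sets_completionI)
  have fin: "emeasure ?M N \<le> ennreal (Fe 1 - Fe 0)"
    using emeasure_mono[OF N(2), of ?M] Icc[of 0 1] by simp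
  have "emeasure ?M N \<le> ennreal e" if e: "e > 0" for e
  proof -
    obtain d where d: "d > 0" "\<And>I. finite I \<Longrightarrow> (\<forall>(s, t) \<in> I. 0 \<le> s \<and> s < t \<and> t \<le> 1) \<Longrightarrow>
        disjoint_family_on (\<lambda>(s, t). {s<..<t}) I \<Longrightarrow> (\<Sum>(s, t)\<in>I. t - s) < d \<Longrightarrow> (\<Sum>(s, t)\<in>I. \<bar>F t - F s\<bar>) < e"
      using F[unfolded ac01_def, rule_format, OF e] by (auto simp: real_norm_def)
    obtain T where T: "open T" "N \<subseteq> T" "T - N \<in> lmeasurable" "emeasure lebesgue (T - N) < ennreal d"
      using sets_lebesgue_outer_open[of N d] NL d(1) by (auto simp: null_sets_def)
    have eqT: "T = (T - N) \<union> N" using T by auto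
    have NLm: "N \<in> lmeasurable" using NL by (auto simp: fmeasurable_def null_sets_def)
    have TL: "T \<in> lmeasurable" by (subst eqT) (intro fmeasurable.Un T(3) NLm)
    have mT: "measure lebesgue T < d"
    proof -
      have "measure lebesgue ((T - N) \<union> N) \<le> measure lebesgue (T - N) + measure lebesgue N"
        by (rule measure_Un_le) (use T NLm in auto)
      hence "measure lebesgue T \<le> measure lebesgue (T - N) + measure lebesgue N" using eqT by simp
      also have "measure lebesgue N = 0" using NL by (auto simp: null_sets_def measure_def)
      finally show ?thesis using T(3,4) d(1) by (simp add: emeasure_eq_measure2 ennreal_less_iff)
    qed
    \<comment> \<open>Each interval of the covering lies in the gauge set of one of its points in
      \<open>N\<close>, which is \<open>T\<close>; off \<open>T\<close> the value is a
      default.\<close>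
    have g: "gauge (\<lambda>x. if x \<in> T then T else UNIV)" using T(1) by (auto simp: gauge_def)
    have Nc: "N \<subseteq> cbox 0 1" "box 0 (1::real) \<noteq> {}" using N(2) by auto
    obtain D where D: "countable D" "\<Union>D \<subseteq> cbox 0 1"
      "\<And>K. K \<in> D \<Longrightarrow> interior K \<noteq> {} \<and> (\<exists>c d. K = cbox c d)"
      "pairwise (\<lambda>A B. interior A \<inter> interior B = {}) D"
      "\<And>K. K \<in> D \<Longrightarrow> \<exists>x \<in> N \<inter> K. K \<subseteq> (if x \<in> T then T else UNIV)"
      "N \<subseteq> \<Union>D"
      by (rule covering_lemma[OF Nc g]) blast
    have KT: "K \<subseteq> T" if KD: "K \<in> D" for K
    proof -
      obtain x where "x \<in> N \<inter> K" "K \<subseteq> (if x \<in> T then T else UNIV)" using D(5)[OF KD] by blast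
      moreover have "x \<in> T" using calculation(1) T(2) by blast
      ultimately show ?thesis by simp
    qed
    have Kint: "\<exists>c d. K = {c..d} \<and> c < d \<and> 0 \<le> c \<and> d \<le> 1" if KD: "K \<in> D" for K
    proof -
      obtain c d where cd: "K = {c..d}" using D(3)[OF KD] by auto
      have "c < d" using D(3)[OF KD] cd by (auto simp: interior_atLeastAtMost_real)
      moreover have "{c..d} \<subseteq> {0..1}" using order_trans[OF Union_upper[OF KD] D(2)] unfolding cd cbox_interval .
      ultimately show ?thesis using cd by auto
    qed
    define lo hi where "lo K = Inf K" and "hi K = Sup K" for K :: "real set"
    have K: "K = {lo K..hi K}" "lo K < hi K" "0 \<le> lo K" "hi K \<le> 1" if KD: "K \<in> D" for K
    proof -
      obtain c d where "K = {c..d} \<and> c < d \<and> 0 \<le> c \<and> d \<le> 1" using Kint[OF KD] by blast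
      thus "K = {lo K..hi K}" "lo K < hi K" "0 \<le> lo K" "hi K \<le> 1" by (auto simp: lo_def hi_def)
    qed
    have Kdis: "{lo K<..<hi K} \<inter> {lo L<..<hi L} = {}" if "K \<in> D" "L \<in> D" "K \<noteq> L" for K L
    proof -
      have "interior K \<inter> interior L = {}" using D(4) that by (auto simp: pairwise_def)
      moreover have "interior K = {lo K<..<hi K}" by (subst K(1)[OF that(1)]) simp
      moreover have "interior L = {lo L<..<hi L}" by (subst K(1)[OF that(2)]) simp
      ultimately show ?thesis by simp
    qed
    have Kfin: "K \<in> fmeasurable ?M" if "K \<in> D" for K
      by (subst K(1)[OF that]) (use Icc[of "lo K" "hi K"] K(2)[OF that] in \<open>auto simp: fmeasurable_def\<close>)
    have bound: "measure ?M (\<Union>C) \<le> e" if C: "C \<subseteq> D" "finite C" for C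
    proof -
      have CD: "\<And>K. K \<in> C \<Longrightarrow> K \<in> D" using C by auto
      define \<phi> where "\<phi> = (\<lambda>K. (lo K, hi K))"
      have inj: "inj_on \<phi> C"
        by (rule inj_onI) (metis CD K(1) \<phi>_def prod.inject)
      have "(\<Sum>(s,t)\<in>\<phi> ` C. \<bar>F t - F s\<bar>) < e"
      proof (rule d(2))
        show "finite (\<phi> ` C)" using C by simp
        show "\<forall>(s, t)\<in>\<phi> ` C. 0 \<le> s \<and> s < t \<and> t \<le> 1" using K CD by (auto simp: \<phi>_def)
        show "disjoint_family_on (\<lambda>(s, t). {s<..<t}) (\<phi> ` C)"
          unfolding disjoint_family_on_def
        proof (intro ballI impI)
          fix p q assume "p \<in> \<phi> ` C" "q \<in> \<phi> ` C" "p \<noteq> q"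
          then obtain K L where KL: "p = \<phi> K" "q = \<phi> L" "K \<in> C" "L \<in> C" "K \<noteq> L" by auto
          show "(case p of (s, t) \<Rightarrow> {s<..<t}) \<inter> (case q of (s, t) \<Rightarrow> {s<..<t}) = {}"
            using Kdis[OF CD[OF KL(3)] CD[OF KL(4)] KL(5)] KL by (simp add: \<phi>_def)
        qed
        have "(\<Sum>(s, t)\<in>\<phi> ` C. t - s) = (\<Sum>K\<in>C. hi K - lo K)"
          by (subst sum.reindex[OF inj]) (simp add: \<phi>_def)
        also have "\<dots> = (\<Sum>K\<in>C. measure lebesgue {lo K<..<hi K})"
          by (intro sum.cong) (use K(2) CD in \<open>auto simp: less_imp_le\<close>)
        also have "\<dots> = measure lebesgue (\<Union>K\<in>C. {lo K<..<hi K})"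

        proof (rule measure_finite_Union[symmetric])
          fix L assume "L \<in> C"
          thus "emeasure lebesgue {lo L<..<hi L} \<noteq> \<infinity>" using K(2)[OF CD] by (simp add: less_imp_le)
        qed (use C Kdis CD in \<open>auto simp: disjoint_family_on_def simp del: Int_greaterThanLessThan\<close>)
        also have "\<dots> \<le> measure lebesgue T"
        proof (rule measure_mono_fmeasurable[OF _ _ TL])
          show "(\<Union>K\<in>C. {lo K<..<hi K}) \<subseteq> T"
          proof (rule UN_least)
            fix L assume "L \<in> C"
            hence "{lo L..hi L} \<subseteq> T" using K(1)[of L] KT[of L] CD by metis
            thus "{lo L<..<hi L} \<subseteq> T" by auto
          qed
        qed (use C in auto)
        finally show "(\<Sum>(s, t)\<in>\<phi> ` C. t - s) < d" using mT by simp
      qed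
      also have "(\<Sum>(s,t)\<in>\<phi> ` C. \<bar>F t - F s\<bar>) = (\<Sum>K\<in>C. \<bar>F (hi K) - F (lo K)\<bar>)"
        by (subst sum.reindex[OF inj]) (simp add: \<phi>_def)
      also have "\<dots> = (\<Sum>K\<in>C. measure ?M K)"
      proof (rule sum.cong)
        fix L assume "L \<in> C"
        note L = K[OF CD[OF this]]
        have "measure ?M L = Fe (hi L) - Fe (lo L)"
          using Icc[of "lo L" "hi L"] L mF[of "lo L" "hi L"] by (subst L(1)) (simp add: measure_def)
        moreover have "Fe (hi L) = F (hi L)" "Fe (lo L) = F (lo L)" using L by (auto intro!: mono(3))
        ultimately show "\<bar>F (hi L) - F (lo L)\<bar> = measure ?M L" using mF[of "lo L" "hi L"] L by simp
      qed simp
      finally have "(\<Sum>K\<in>C. measure ?M K) < e" .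
      moreover have "measure ?M (\<Union>C) \<le> (\<Sum>K\<in>C. measure ?M K)"
        using measure_UNION_le[OF C(2), of "\<lambda>x. x" ?M] Kfin CD by (auto simp: fmeasurable_def)
      ultimately show ?thesis by simp
    qed
    have UD: "(\<Union>K\<in>D. K) \<in> fmeasurable ?M" "measure ?M (\<Union>K\<in>D. K) \<le> e"
      using fmeasurable_UN_bound[OF D(1), of "\<lambda>K. K" ?M e] measure_UN_bound[OF D(1), of "\<lambda>K. K" ?M e] Kfin bound by simp_all
    have "emeasure ?M N \<le> emeasure ?M (\<Union>K\<in>D. K)"
      using UD(1) D(6) by (intro emeasure_mono) auto
    also have "\<dots> \<le> ennreal e" using UD by (simp add: emeasure_eq_measure2 ennreal_leI)
    finally show ?thesis .
  qed
  thus ?thesis by (metis ennreal_le_epsilon add_0 le_zero_eq)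
qed

lemma integrable_leb01_of_lborel:
  fixes g :: "real \<Rightarrow> real"
  assumes "integrable lborel g"
  shows "integrable leb01 g"
proof -
  have "integrable lebesgue g" using assms by (simp add: integrable_completion)
  thus ?thesis unfolding integrable_leb01_ext by (intro integrable_mult_indicator) auto
qed

text \<open>The density is the Radon-Nikodym derivative of the Stieltjes measure of \<open>F\<close>
  with respect to Lebesgue measure.\<close>

lemma mono_ac01_density:
  fixes F :: "real \<Rightarrow> real"
  assumes F: "ac01 F" and mono: "\<And>x y. 0 \<le> x \<Longrightarrow> x \<le> y \<Longrightarrow> y \<le> 1 \<Longrightarrow> F x \<le> F y"
  shows "\<exists>g. integrable leb01 g \<and> (\<forall>x\<in>{0..1}. F x = F 0 + prim g x)"
proof -
  \<comment> \<open>Constant continuation gives a monotone continuous function on the line whose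
    Stieltjes measure is carried by [0,1].\<close>
  define Fe where "Fe x = F (max 0 (min 1 x))" for x
  have mFe: "\<And>x y. x \<le> y \<Longrightarrow> Fe x \<le> Fe y" unfolding Fe_def by (intro mono) auto
  have cFe: "continuous_on UNIV Fe" unfolding Fe_def
    by (rule continuous_on_compose2[OF ac01_continuous_on[OF F]]) (auto intro!: continuous_intros)
  have rc: "\<And>a. continuous (at_right a) Fe"
    using cFe continuous_on_eq_continuous_at continuous_at_imp_continuous_at_within by blast
  have FeF: "\<And>x. x \<in> {0..1} \<Longrightarrow> Fe x = F x" by (auto simp: Fe_def)
  let ?M = "interval_measure Fe"
  have Ioc: "emeasure ?M {a<..b} = ennreal (Fe b - Fe a)" if "a \<le> b" for a b
    by (rule emeasure_interval_measure_Ioc[OF that mFe rc])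
  have out: "- {0..1::real} \<subseteq> (\<Union>k::nat. {- real k<..0} \<union> {1<..real k + 1})"
  proof
    fix x :: real assume "x \<in> - {0..1}"
    moreover obtain k where "\<bar>x\<bar> < real k" using reals_Archimedean2 by blast
    ultimately show "x \<in> (\<Union>k::nat. {- real k<..0} \<union> {1<..real k + 1})" by (intro UN_I[of k]) auto
  qed
  have "emeasure ?M (\<Union>k::nat. {- real k<..0} \<union> {1<..real k + 1}) = 0"
  proof -
    have "(\<Union>k::nat. {- real k<..0} \<union> {1<..real k + 1}) \<in> null_sets ?M"
    proof (rule null_sets_UN)
      fix k :: nat
      have "{- real k<..0} \<in> null_sets ?M" using Ioc[of "- real k" 0] by (intro null_setsI) (auto simp: Fe_def)
      moreover have "{1<..real k + 1} \<in> null_sets ?M" using Ioc[of 1 "real k + 1"] by (intro null_setsI) (auto simp: Fe_def)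
      ultimately show "{- real k<..0} \<union> {1<..real k + 1} \<in> null_sets ?M" by auto
    qed
    thus ?thesis by auto
  qed
  hence out0: "emeasure ?M (- {0..1}) = 0"
    using emeasure_mono[OF out, of ?M] by (auto simp: le_zero_eq)
  have "absolutely_continuous lborel ?M"
    unfolding absolutely_continuous_def
  proof
    fix N :: "real set" assume N: "N \<in> null_sets lborel"
    have "N \<inter> {0..1} \<in> null_sets lborel" using N by (intro null_set_Int2) auto
    hence "emeasure ?M (N \<inter> {0..1}) = 0"
      by (intro mono_ac01_null_sets[OF F _ cFe FeF]) (use mFe in \<open>auto simp: mono_def\<close>)
    moreover have "emeasure ?M (N \<inter> - {0..1}) = 0"
    proof -
      have "emeasure ?M (N \<inter> - {0..1}) \<le> emeasure ?M (- {0..1})" by (intro emeasure_mono) auto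
      thus ?thesis using out0 by simp
    qed
    moreover have "N = (N \<inter> {0..1}) \<union> (N \<inter> - {0..1})" by auto
    moreover have "N \<in> sets borel" using N by auto
    ultimately have "N \<inter> {0..1} \<in> null_sets ?M" "N \<inter> - {0..1} \<in> null_sets ?M" "N = (N \<inter> {0..1}) \<union> (N \<inter> - {0..1})"
      by (auto intro!: null_setsI)
    thus "N \<in> null_sets ?M" by (metis null_sets.Un)
  qed
  then obtain f where f: "f \<in> borel_measurable lborel" "density lborel f = ?M"
    using sigma_finite_measure.Radon_Nikodym[OF sigma_finite_lborel, of ?M] by auto
  \<comment> \<open>Restriction to (0,1] makes the total integral \<open>F 1 - F 0\<close>, hence
    finite. It also makes the density vanish at 0, so that \<open>{0..x}\<close> and
    \<open>{0<..x}\<close> give the same integrand.\<close>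
  define f1 where "f1 x = f x * indicator {0<..1} x" for x
  have f1m: "f1 \<in> borel_measurable lborel" unfolding f1_def using f(1) by measurable
  have nn: "(\<integral>\<^sup>+x. f1 x * indicator {a<..b} x \<partial>lborel) = ennreal (F b - F a)" if "0 \<le> a" "a \<le> b" "b \<le> 1" for a b
  proof -
    have "(\<integral>\<^sup>+x. f1 x * indicator {a<..b} x \<partial>lborel) = (\<integral>\<^sup>+x. f x * indicator {a<..b} x \<partial>lborel)"
      using that by (intro nn_integral_cong) (auto simp: f1_def indicator_def)
    also have "\<dots> = emeasure (density lborel f) {a<..b}"
      using f(1) by (subst emeasure_density) auto
    also have "\<dots> = ennreal (F b - F a)" using f(2) Ioc[of a b] FeF that by simp
    finally show ?thesis .
  qed
  have f1int: "(\<integral>\<^sup>+x. f1 x \<partial>lborel) = ennreal (F 1 - F 0)"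
  proof -
    have "(\<integral>\<^sup>+x. f1 x \<partial>lborel) = (\<integral>\<^sup>+x. f1 x * indicator {0<..1} x \<partial>lborel)"
      by (intro nn_integral_cong) (auto simp: f1_def indicator_def)
    thus ?thesis using nn[of 0 1] by simp
  qed
  have fin: "AE x in lborel. f1 x \<noteq> \<infinity>"
    by (rule nn_integral_noteq_infinite[OF f1m]) (simp add: f1int)
  define g where "g x = enn2real (f1 x)" for x
  have gm: "g \<in> borel_measurable lborel" unfolding g_def using f1m by measurable
  have eg: "AE x in lborel. ennreal (g x) = f1 x"
    using fin by eventually_elim (simp add: g_def less_top)
  have gi: "integrable lborel g"
  proof (rule integrableI_nonneg[OF gm])
    show "AE x in lborel. 0 \<le> g x" by (simp add: g_def)
    have "(\<integral>\<^sup>+x. ennreal (g x) \<partial>lborel) = (\<integral>\<^sup>+x. f1 x \<partial>lborel)" by (rule nn_integral_cong_AE[OF eg])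
    thus "(\<integral>\<^sup>+x. ennreal (g x) \<partial>lborel) < \<infinity>" by (simp add: f1int)
  qed
  have gl: "integrable leb01 g" by (rule integrable_leb01_of_lborel[OF gi])
  have "F x = F 0 + prim g x" if x: "x \<in> {0..1}" for x
  proof -
    have "prim g x = (\<integral>t. indicator {0..1} t *\<^sub>R (indicator {0..x} t *\<^sub>R g t) \<partial>lebesgue)"
      unfolding prim_def integral_leb01_ext ..
    also have "\<dots> = (\<integral>t. g t * indicator {0<..x} t \<partial>lebesgue)"
      using x by (intro Bochner_Integration.integral_cong) (auto simp: indicator_def g_def f1_def)
    also have "\<dots> = (\<integral>t. g t * indicator {0<..x} t \<partial>lborel)"
      using gm by (intro integral_completion borel_measurable_times borel_measurable_indicator) auto
    also have "\<dots> = enn2real (\<integral>\<^sup>+t. ennreal (g t * indicator {0<..x} t) \<partial>lborel)"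

    proof (rule integral_eq_nn_integral)
      show "(\<lambda>t. g t * indicator {0<..x} t) \<in> borel_measurable lborel"
        using gm by (intro borel_measurable_times borel_measurable_indicator) auto
    qed (auto simp: g_def)
    also have "(\<integral>\<^sup>+t. ennreal (g t * indicator {0<..x} t) \<partial>lborel) = (\<integral>\<^sup>+t. f1 t * indicator {0<..x} t \<partial>lborel)"
      using eg by (intro nn_integral_cong_AE) (auto elim!: eventually_mono simp: indicator_def)
    also have "\<dots> = ennreal (F x - F 0)" using x by (intro nn) auto
    also have "enn2real \<dots> = F x - F 0" using mono[of 0 x] x by simp
    finally show ?thesis by simp
  qed
  thus ?thesis using gl by blast
qed

text \<open>Sums, products and real or imaginary parts of absolutely continuous functions all reduce
  to this comparison of increments.\<close>

lemma ac01_dominated2: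
  fixes f :: "real \<Rightarrow> 'a::real_normed_vector" and g :: "real \<Rightarrow> 'b::real_normed_vector" and h :: "real \<Rightarrow> 'c::real_normed_vector"
  assumes "ac01 f" "ac01 g" and C: "C \<ge> 0"
    and h: "\<And>s t. 0 \<le> s \<Longrightarrow> s < t \<Longrightarrow> t \<le> 1 \<Longrightarrow> norm (h t - h s) \<le> C * (norm (f t - f s) + norm (g t - g s))"
  shows "ac01 h"
  unfolding ac01_def
proof (intro allI impI)
  fix e' :: real assume e': "e' > 0"
  define e where "e = e' / (C + 1)"
  have "e > 0" using e' C by (simp add: e_def)
  hence e: "e/2 > 0" by simp
  obtain d1 where d1: "d1 > 0" "\<And>I. finite I \<and> (\<forall>(s, t) \<in> I. 0 \<le> s \<and> s < t \<and> t \<le> 1) \<and>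
        disjoint_family_on (\<lambda>(s, t). {s<..<t}) I \<and> (\<Sum>(s, t)\<in>I. t - s) < d1 \<Longrightarrow> (\<Sum>(s, t)\<in>I. norm (f t - f s)) < e/2"
    using assms(1)[unfolded ac01_def, rule_format, OF e] by blast
  obtain d2 where d2: "d2 > 0" "\<And>I. finite I \<and> (\<forall>(s, t) \<in> I. 0 \<le> s \<and> s < t \<and> t \<le> 1) \<and>
        disjoint_family_on (\<lambda>(s, t). {s<..<t}) I \<and> (\<Sum>(s, t)\<in>I. t - s) < d2 \<Longrightarrow> (\<Sum>(s, t)\<in>I. norm (g t - g s)) < e/2"
    using assms(2)[unfolded ac01_def, rule_format, OF e] by blast
  show "\<exists>\<delta>>0. \<forall>I. finite I \<and> (\<forall>(s, t)\<in>I. 0 \<le> s \<and> s < t \<and> t \<le> 1) \<and> disjoint_family_on (\<lambda>(s, t). {s<..<t}) I \<and> (\<Sum>(s, t)\<in>I. t - s) < \<delta> \<longrightarrow>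
            (\<Sum>(s, t)\<in>I. norm (h t - h s)) < e'"
  proof (intro exI[of _ "min d1 d2"] conjI allI impI)
    fix I :: "(real \<times> real) set"
    assume I: "finite I \<and> (\<forall>(s, t) \<in> I. 0 \<le> s \<and> s < t \<and> t \<le> 1) \<and>
        disjoint_family_on (\<lambda>(s, t). {s<..<t}) I \<and> (\<Sum>(s, t)\<in>I. t - s) < min d1 d2"
    have "(\<Sum>(s, t)\<in>I. norm (h t - h s)) \<le> C * ((\<Sum>(s, t)\<in>I. norm (f t - f s)) + (\<Sum>(s, t)\<in>I. norm (g t - g s)))"
      unfolding sum.distrib[symmetric] sum_distrib_left case_prod_unfold
      using I h by (intro sum_mono) (auto simp: case_prod_unfold)
    also have "\<dots> \<le> C * (e/2 + e/2)"
    proof (intro mult_left_mono add_mono C)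
      show "(\<Sum>(s, t)\<in>I. norm (f t - f s)) \<le> e/2" using I by (intro less_imp_le d1(2)) auto
      show "(\<Sum>(s, t)\<in>I. norm (g t - g s)) \<le> e/2" using I by (intro less_imp_le d2(2)) auto
    qed
    also have "\<dots> < (C + 1) * e" using \<open>e > 0\<close> by (simp add: algebra_simps)
    also have "\<dots> = e'" using C by (simp add: e_def)
    finally show "(\<Sum>(s, t)\<in>I. norm (h t - h s)) < e'" .
  qed (use d1 d2 in auto)
qed

lemma ac01_add:
  fixes f g :: "real \<Rightarrow> 'a::real_normed_vector"
  assumes "ac01 f" "ac01 g"
  shows "ac01 (\<lambda>x. f x + g x)"
  by (rule ac01_dominated2[OF assms, of 1]) (auto simp: add_diff_add norm_triangle_ineq)

lemma ac01_dominated: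
  fixes f :: "real \<Rightarrow> 'a::real_normed_vector" and g :: "real \<Rightarrow> 'b::real_normed_vector"
  assumes g: "ac01 g" and C: "C \<ge> 0" and fg: "\<And>s t. 0 \<le> s \<Longrightarrow> s < t \<Longrightarrow> t \<le> 1 \<Longrightarrow> norm (f t - f s) \<le> C * norm (g t - g s)"
  shows "ac01 f"
proof (rule ac01_dominated2[OF g g C])
  fix s t :: real assume st: "0 \<le> s" "s < t" "t \<le> 1"
  have "norm (f t - f s) \<le> C * norm (g t - g s)" by (rule fg[OF st])
  also have "\<dots> \<le> C * (norm (g t - g s) + norm (g t - g s))" by (intro mult_left_mono C) simp
  finally show "norm (f t - f s) \<le> C * (norm (g t - g s) + norm (g t - g s))" .
qed

lemma prim_add:
  fixes f g :: "real \<Rightarrow> 'a::euclidean_space"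
  assumes "integrable leb01 f" "integrable leb01 g"
  shows "prim (\<lambda>x. f x + g x) x = prim f x + prim g x"
  unfolding prim_def scaleR_add_right
  by (intro Bochner_Integration.integral_add integrable_indicator_leb01 assms) auto

lemma prim_linear:
  fixes f :: "real \<Rightarrow> 'a::euclidean_space" and T :: "'a \<Rightarrow> 'b::euclidean_space"
  assumes "integrable leb01 f" "bounded_linear T"
  shows "prim (\<lambda>x. T (f x)) x = T (prim f x)"
proof -
  interpret T: bounded_linear T by fact
  show ?thesis unfolding prim_def T.scaleR[symmetric]
    by (intro integral_bounded_linear assms integrable_indicator_leb01) auto
qed

text \<open>Both \<open>f + V\<close> and \<open>V\<close> are nondecreasing for the majorant
  \<open>V\<close>, so the density of \<open>f\<close> is a difference of two densities of monotone
  functions.\<close>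

lemma ac01_density_real:
  fixes f :: "real \<Rightarrow> real"
  assumes f: "ac01 f"
  shows "\<exists>g. integrable leb01 g \<and> (\<forall>x\<in>{0..1}. f x = f 0 + prim g x)"
proof -
  obtain V :: "real \<Rightarrow> real" where V: "ac01 V" "\<And>x y. 0 \<le> x \<Longrightarrow> x \<le> y \<Longrightarrow> y \<le> 1 \<Longrightarrow> \<bar>f y - f x\<bar> \<le> V y - V x"
    using ac01_monotone_majorant[OF f] by blast
  have 1: "ac01 (\<lambda>x. f x + V x)" by (rule ac01_add[OF f V(1)])
  obtain g1 where g1: "integrable leb01 g1" and g1p: "\<forall>x\<in>{0..1}. f x + V x = f 0 + V 0 + prim g1 x"
  proof -
    have "\<exists>g. integrable leb01 g \<and> (\<forall>x\<in>{0..1}. f x + V x = f 0 + V 0 + prim g x)"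
    proof (rule mono_ac01_density[OF 1])
      fix x y :: real assume "0 \<le> x" "x \<le> y" "y \<le> 1"
      from V(2)[OF this] show "f x + V x \<le> f y + V y" by linarith
    qed
    thus ?thesis by (elim exE conjE) (rule that)
  qed
  obtain g2 where g2: "integrable leb01 g2" and g2p: "\<forall>x\<in>{0..1}. V x = V 0 + prim g2 x"
  proof -
    have "\<exists>g. integrable leb01 g \<and> (\<forall>x\<in>{0..1}. V x = V 0 + prim g x)"
    proof (rule mono_ac01_density[OF V(1)])
      fix x y :: real assume "0 \<le> x" "x \<le> y" "y \<le> 1"
      from V(2)[OF this] show "V x \<le> V y" by linarith
    qed
    thus ?thesis by (elim exE conjE) (rule that)
  qed
  have "f x = f 0 + prim (\<lambda>t. g1 t + (- g2 t)) x" if "x \<in> {0..1}" for x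
  proof -
    have "prim (\<lambda>t. g1 t + (- g2 t)) x = prim g1 x + prim (\<lambda>t. - g2 t) x"
      using g1 g2 by (intro prim_add) auto
    moreover have "prim (\<lambda>t. - g2 t) x = - prim g2 x"
      by (rule prim_linear[OF g2, of uminus]) (intro bounded_linear_minus bounded_linear_ident)
    ultimately show ?thesis using bspec[OF g1p that] bspec[OF g2p that] by linarith
  qed
  thus ?thesis using g1 g2 by (intro exI[of _ "\<lambda>t. g1 t + (- g2 t)"] conjI ballI Bochner_Integration.integrable_add Bochner_Integration.integrable_minus)
qed

lemma ac01_density:
  fixes f :: "real \<Rightarrow> complex"
  assumes f: "ac01 f"
  shows "\<exists>g. integrable leb01 g \<and> (\<forall>x\<in>{0..1}. f x = f 0 + prim g x)"
proof -
  have re: "ac01 (\<lambda>x. Re (f x))"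
  proof (rule ac01_dominated[OF f, of 1])
    fix s t :: real
    show "norm (Re (f t) - Re (f s)) \<le> 1 * norm (f t - f s)" using abs_Re_le_cmod[of "f t - f s"] by simp
  qed simp
  have im: "ac01 (\<lambda>x. Im (f x))"
  proof (rule ac01_dominated[OF f, of 1])
    fix s t :: real
    show "norm (Im (f t) - Im (f s)) \<le> 1 * norm (f t - f s)" using abs_Im_le_cmod[of "f t - f s"] by simp
  qed simp
  obtain g1 where g1: "integrable leb01 g1" "\<And>x. x\<in>{0..1} \<Longrightarrow> Re (f x) = Re (f 0) + prim g1 x"
    using ac01_density_real[OF re] by blast
  obtain g2 where g2: "integrable leb01 g2" "\<And>x. x\<in>{0..1} \<Longrightarrow> Im (f x) = Im (f 0) + prim g2 x"
    using ac01_density_real[OF im] by blast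
  define g where "g t = complex_of_real (g1 t) + \<i> * complex_of_real (g2 t)" for t
  have gi: "integrable leb01 g" unfolding g_def using g1 g2 by (intro Bochner_Integration.integrable_add integrable_mult_right integrable_of_real) auto
  have "f x = f 0 + prim g x" if "x \<in> {0..1}" for x
  proof -
    have "Re (prim g x) = prim (\<lambda>x. Re (g x)) x" by (rule prim_linear[OF gi bounded_linear_Re, symmetric])
    moreover have "Im (prim g x) = prim (\<lambda>x. Im (g x)) x" by (rule prim_linear[OF gi bounded_linear_Im, symmetric])
    moreover have "(\<lambda>x. Re (g x)) = g1" "(\<lambda>x. Im (g x)) = g2" by (auto simp: g_def)
    ultimately show ?thesis using g1(2)[OF that] g2(2)[OF that] by (intro complex_eqI) auto
  qed
  thus ?thesis using gi by blast
qed

section \<open>Fundamental theorem of calculus and integration by parts\<close>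

lemma deriv_01_eq:
  assumes "x \<in> {0..1}" "(f has_vector_derivative d) (at x within {0..1})"
  shows "deriv_01 f x = d"
  using vector_derivative_within_cbox[of 0 1 x f d] assms by (simp add: deriv_01_def)

lemma deriv_01_works:
  assumes "f differentiable (at x within {0..1})"
  shows "(f has_vector_derivative deriv_01 f x) (at x within {0..1})"
  using assms by (simp add: deriv_01_def vector_derivative_works[symmetric])

lemma prim_cong_AE:
  fixes f g :: "real \<Rightarrow> complex"
  assumes "AE t in leb01. f t = g t" "integrable leb01 f" "integrable leb01 g"
  shows "prim f x = prim g x"
  unfolding prim_def
proof (rule integral_cong_AE)
  show "(\<lambda>t. indicator {0..x} t *\<^sub>R f t) \<in> borel_measurable leb01" "(\<lambda>t. indicator {0..x} t *\<^sub>R g t) \<in> borel_measurable leb01"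
    by (intro borel_measurable_integrable integrable_indicator_leb01 assms; simp)+
  show "AE t in leb01. indicator {0..x} t *\<^sub>R f t = indicator {0..x} t *\<^sub>R g t"
    using assms(1) by eventually_elim simp
qed

text \<open>Measurability of \<open>g\<close> is a conclusion, since Lebesgue measure is complete.
  This makes \<open>deriv_01\<close>, whose values on a null set are unspecified, an integrable
  function.\<close>

lemma integrable_leb01_cong_AE:
  fixes f g :: "real \<Rightarrow> complex"
  assumes f: "integrable leb01 f" and eq: "AE t in leb01. f t = g t"
  shows "integrable leb01 g"
proof -
  have abs: "h absolutely_integrable_on {0..1} \<longleftrightarrow> integrable leb01 h" for h :: "real \<Rightarrow> complex"
    unfolding set_integrable_def integrable_leb01_ext ..
  have "AE t in lebesgue. t \<in> {0..1} \<longrightarrow> f t = g t" using eq by (simp add: AE_restrict_space_iff)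
  then obtain N where N: "{t. \<not> (t \<in> {0..1} \<longrightarrow> f t = g t)} \<subseteq> N" "N \<in> null_sets lebesgue"
    by (auto elim!: AE_E simp: null_sets_def)
  have "g absolutely_integrable_on {0..1}"
  proof (rule absolutely_integrable_spike)
    show "f absolutely_integrable_on {0..1}" using f abs by simp
    show "negligible N" using N(2) by (simp add: negligible_iff_null_sets)
    show "g x = f x" if "x \<in> {0..1} - N" for x using N(1) that by auto
  qed
  thus ?thesis using abs by simp
qed

lemma prim_0 [simp]: "prim g 0 = 0" for g :: "real \<Rightarrow> 'a::euclidean_space"
proof -
  have "prim g 0 = (\<integral>t. 0 \<partial>leb01)" unfolding prim_def
  proof (rule integral_cong_AE)
    have ae: "AE t in leb01. indicator {0..0} t *\<^sub>R g t = 0"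
      using AE_leb01_neq[of 0] by eventually_elim (auto simp: indicator_def)
    show "AE t in leb01. indicator {0..0} t *\<^sub>R g t = 0" by (rule ae)
    \<comment> \<open>\<open>g\<close> is arbitrary here, so measurability is read off from the
      single value \<open>g 0\<close>.\<close>
    have "(\<lambda>t::real. if t \<in> {0} then g t else 0) \<in> borel_measurable leb01"
    proof -
      have "(\<lambda>t::real. if t \<in> {0} then g t else 0) = (\<lambda>t. indicator {0} t *\<^sub>R g 0)" by (auto simp: indicator_def)
      moreover have "(\<lambda>t. indicator {0::real} t *\<^sub>R g 0) \<in> borel_measurable leb01"
        by (intro borel_measurable_scaleR borel_measurable_indicator borel_measurable_const) (auto simp: sets_restrict_space_iff)
      ultimately show ?thesis by simp
    qed
    moreover have "(\<lambda>t. indicator {0..0} t *\<^sub>R g t) = (\<lambda>t::real. if t \<in> {0} then g t else 0)" by (auto simp: indicator_def)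
    ultimately show "(\<lambda>t. indicator {0..0} t *\<^sub>R g t) \<in> borel_measurable leb01" by simp
  qed simp
  thus ?thesis by simp
qed

lemma prim_1: "prim g 1 = integral\<^sup>L leb01 g" for g :: "real \<Rightarrow> 'a::euclidean_space"
  unfolding prim_def by (intro Bochner_Integration.integral_cong) auto

theorem ac01_FTC:
  fixes F :: "real \<Rightarrow> complex"
  assumes F: "ac01 F"
  shows "AE x in leb01. (F has_vector_derivative deriv_01 F x) (at x within {0..1})"
    and "integrable leb01 (deriv_01 F)"
    and "x \<in> {0..1} \<Longrightarrow> F x = F 0 + prim (deriv_01 F) x"
proof -
  obtain g where g: "integrable leb01 g" and gp: "\<forall>x\<in>{0..1}. F x = F 0 + prim g x"
    using ac01_density[OF F] by blast
  have 1: "AE x in leb01. x \<in> {0..1} \<and> (F has_vector_derivative g x) (at x within {0..1})"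
    using prim_has_derivative_AE[OF g] AE_space
  proof eventually_elim
    fix x assume h: "(prim g has_vector_derivative g x) (at x within {0..1})" "x \<in> space leb01"
    have x: "x \<in> {0..1}" using h(2) by simp
    have d: "((\<lambda>x. F 0 + prim g x) has_vector_derivative 0 + g x) (at x within {0..1})"
      by (intro has_vector_derivative_add has_vector_derivative_const h(1))
    have "(F has_vector_derivative 0 + g x) (at x within {0..1})"
      by (rule has_vector_derivative_transform[OF x _ d]) (rule bspec[OF gp])
    thus "x \<in> {0..1} \<and> (F has_vector_derivative g x) (at x within {0..1})" using x by simp
  qed
  have 2: "AE x in leb01. g x = deriv_01 F x" using 1 by eventually_elim (auto simp: deriv_01_eq)
  show "AE x in leb01. (F has_vector_derivative deriv_01 F x) (at x within {0..1})"
    using 1 2 by eventually_elim simp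
  show 3: "integrable leb01 (deriv_01 F)" by (rule integrable_leb01_cong_AE[OF g 2])
  show "F x = F 0 + prim (deriv_01 F) x" if "x \<in> {0..1}"
    using bspec[OF gp that] prim_cong_AE[OF 2 g 3] by simp
qed

text \<open>The form in which the theorem is applied: derivatives are mostly known through a formula
  \<open>h\<close> valid almost everywhere, not through \<open>deriv_01\<close>.\<close>

lemma FTC_AE:
  fixes F h :: "real \<Rightarrow> complex"
  assumes F: "ac01 F" and h: "AE x in leb01. (F has_vector_derivative h x) (at x within {0..1})"
  shows "integrable leb01 h" "integral\<^sup>L leb01 h = F 1 - F 0" "x \<in> {0..1} \<Longrightarrow> F x = F 0 + prim h x"
    "AE x in leb01. deriv_01 F x = h x"
proof -
  show eq: "AE x in leb01. deriv_01 F x = h x" using h AE_space by eventually_elim (auto simp: deriv_01_eq)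
  show hi: "integrable leb01 h" by (rule integrable_leb01_cong_AE[OF ac01_FTC(2)[OF F] eq])
  show p: "F x = F 0 + prim h x" if "x \<in> {0..1}" for x
    using ac01_FTC(3)[OF F that] prim_cong_AE[OF eq ac01_FTC(2)[OF F] hi] by simp
  show "integral\<^sup>L leb01 h = F 1 - F 0" using p[of 1] by (simp add: prim_1)
qed

lemma continuous_measurable_leb01:
  fixes g :: "real \<Rightarrow> 'a::euclidean_space"
  shows "continuous_on {0..1} g \<Longrightarrow> g \<in> borel_measurable leb01"
  by (intro continuous_imp_measurable_on_sets_lebesgue) auto

lemma integrable_leb01_mult_bounded:
  fixes f g :: "real \<Rightarrow> complex"
  assumes f: "integrable leb01 f" and g: "g \<in> borel_measurable leb01" "\<And>x. x \<in> {0..1} \<Longrightarrow> cmod (g x) \<le> M"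
  shows "integrable leb01 (\<lambda>x. f x * g x)"
proof (rule Bochner_Integration.integrable_bound[of _ "\<lambda>x. of_real M * f x"])
  show "integrable leb01 (\<lambda>x. of_real M * f x)" using f by (rule integrable_mult_right)
  show "(\<lambda>x. f x * g x) \<in> borel_measurable leb01" using f g(1) by (intro borel_measurable_times) auto
  show "AE x in leb01. norm (f x * g x) \<le> norm (of_real M * f x)"
    using AE_space
  proof eventually_elim
    fix x assume "x \<in> space leb01"
    hence "cmod (g x) \<le> M" using g(2) by simp
    moreover have "M \<le> \<bar>M\<bar>" by simp
    ultimately have "cmod (g x) \<le> \<bar>M\<bar>" by linarith
    from mult_left_mono[OF this, of "cmod (f x)"] show "norm (f x * g x) \<le> norm (of_real M * f x)" by (simp add: norm_mult mult.commute)
  qed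
qed

lemma continuous_01_bounded:
  fixes g :: "real \<Rightarrow> complex"
  assumes "continuous_on {0..1} g"
  shows "\<exists>M\<ge>0. \<forall>x\<in>{0..1}. cmod (g x) \<le> M"
proof -
  have "bounded (g ` {0..1})" by (intro compact_imp_bounded compact_continuous_image assms) auto
  then obtain M where "\<forall>x\<in>{0..1}. cmod (g x) \<le> M" by (auto simp: bounded_iff)
  moreover have "M \<ge> 0" using calculation norm_ge_zero[of "g 0"] by (meson atLeastAtMost_iff order_trans zero_le_one order_refl)
  ultimately show ?thesis by blast
qed

lemma integrable_leb01_mult_continuous:
  fixes f g :: "real \<Rightarrow> complex"
  assumes f: "integrable leb01 f" and g: "continuous_on {0..1} g"
  shows "integrable leb01 (\<lambda>x. f x * g x)" "integrable leb01 (\<lambda>x. g x * f x)"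
proof -
  obtain M where M: "\<forall>x\<in>{0..1}. cmod (g x) \<le> M" using continuous_01_bounded[OF g] by blast
  show "integrable leb01 (\<lambda>x. f x * g x)"
    by (rule integrable_leb01_mult_bounded[OF f continuous_measurable_leb01[OF g]]) (use M in auto)
  thus "integrable leb01 (\<lambda>x. g x * f x)" by (simp add: mult.commute)
qed

lemma integrable_leb01_continuous:
  fixes g :: "real \<Rightarrow> complex"
  assumes g: "continuous_on {0..1} g"
  shows "integrable leb01 g"
  using integrable_leb01_mult_continuous(1)[OF integrable_const01[of 1] g] by simp

lemma ac01_mult:
  fixes f g :: "real \<Rightarrow> complex"
  assumes f: "ac01 f" and g: "ac01 g"
  shows "ac01 (\<lambda>x. f x * g x)"
proof -
  obtain M where M: "\<forall>x\<in>{0..1}. cmod (f x) \<le> M" "M \<ge> 0" using continuous_01_bounded[OF ac01_continuous_on[OF f]] by blast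
  obtain N where N: "\<forall>x\<in>{0..1}. cmod (g x) \<le> N" "N \<ge> 0" using continuous_01_bounded[OF ac01_continuous_on[OF g]] by blast
  show ?thesis
  proof (rule ac01_dominated2[OF f g, of "M + N"])
    fix s t :: real assume st: "0 \<le> s" "s < t" "t \<le> 1"
    have "f t * g t - f s * g s = (f t - f s) * g t + f s * (g t - g s)" by (simp add: algebra_simps)
    also have "cmod \<dots> \<le> cmod (f t - f s) * cmod (g t) + cmod (f s) * cmod (g t - g s)"
      by (rule order_trans[OF norm_triangle_ineq]) (simp add: norm_mult)
    also have "\<dots> \<le> cmod (f t - f s) * (M + N) + (M + N) * cmod (g t - g s)"
    proof -
      have "cmod (g t) \<le> M + N" "cmod (f s) \<le> M + N" using bspec[OF N(1), of t] bspec[OF M(1), of s] M(2) N(2) st by auto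
      thus ?thesis by (intro add_mono mult_left_mono mult_right_mono) auto
    qed
    finally show "cmod (f t * g t - f s * g s) \<le> (M + N) * (cmod (f t - f s) + cmod (g t - g s))" by (simp add: algebra_simps)
  qed (use M N in auto)
qed

theorem integration_by_parts_01:
  fixes f g f' g' :: "real \<Rightarrow> complex"
  assumes f: "ac01 f" "AE x in leb01. (f has_vector_derivative f' x) (at x within {0..1})"
    and g: "ac01 g" "AE x in leb01. (g has_vector_derivative g' x) (at x within {0..1})"
  shows "(\<integral>x. f' x * g x \<partial>leb01) = f 1 * g 1 - f 0 * g 0 - (\<integral>x. f x * g' x \<partial>leb01)"
proof -
  have "AE x in leb01. ((\<lambda>x. f x * g x) has_vector_derivative f x * g' x + f' x * g x) (at x within {0..1})"
    using f(2) g(2) by eventually_elim (rule has_vector_derivative_mult)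
  from FTC_AE(2)[OF ac01_mult[OF f(1) g(1)] this]
  have "(\<integral>x. f x * g' x + f' x * g x \<partial>leb01) = f 1 * g 1 - f 0 * g 0" .
  moreover have "(\<integral>x. f x * g' x + f' x * g x \<partial>leb01) = (\<integral>x. f x * g' x \<partial>leb01) + (\<integral>x. f' x * g x \<partial>leb01)"
    by (intro Bochner_Integration.integral_add integrable_leb01_mult_continuous FTC_AE(1)[OF f] FTC_AE(1)[OF g] ac01_continuous_on f(1) g(1))
  ultimately show ?thesis by (simp add: algebra_simps)
qed

lemma ac01_Lipschitz:
  fixes f :: "real \<Rightarrow> 'a::real_normed_vector"
  assumes "\<And>s t. 0 \<le> s \<Longrightarrow> s < t \<Longrightarrow> t \<le> 1 \<Longrightarrow> norm (f t - f s) \<le> C * (t - s)" "C \<ge> 0"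
  shows "ac01 f"
proof (rule ac01_dominated[of "\<lambda>x. x :: real" C])
  show "ac01 (\<lambda>x::real. x)" unfolding ac01_def
  proof (intro allI impI)
    fix e :: real assume e0: "e > 0"
    show "\<exists>\<delta>>0. \<forall>I. finite I \<and> (\<forall>(s, t)\<in>I. 0 \<le> s \<and> s < t \<and> t \<le> 1) \<and> disjoint_family_on (\<lambda>(s, t). {s<..<t}) I \<and> (\<Sum>(s, t)\<in>I. t - s) < \<delta> \<longrightarrow>
            (\<Sum>(s, t)\<in>I. norm (t - s :: real)) < e"
    proof (intro exI[of _ e] conjI allI impI e0)
      fix I :: "(real \<times> real) set" assume I: "finite I \<and> (\<forall>(s, t)\<in>I. 0 \<le> s \<and> s < t \<and> t \<le> 1) \<and> disjoint_family_on (\<lambda>(s, t). {s<..<t}) I \<and> (\<Sum>(s, t)\<in>I. t - s) < e"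
      have "(\<Sum>(s, t)\<in>I. norm (t - s)) = (\<Sum>(s, t)\<in>I. t - s)" using I by (intro sum.cong) auto
      thus "(\<Sum>(s, t)\<in>I. norm (t - s)) < e" using I by simp
    qed
  qed
qed (use assms in auto)

lemma ac01_C1:
  fixes f f' :: "real \<Rightarrow> complex"
  assumes d: "\<And>x. x \<in> {0..1} \<Longrightarrow> (f has_vector_derivative f' x) (at x within {0..1})"
    and c: "continuous_on {0..1} f'"
  shows "ac01 f"
proof -
  obtain M where M: "M \<ge> 0" "\<forall>x\<in>{0..1}. cmod (f' x) \<le> M" using c continuous_01_bounded by blast
  show ?thesis
  proof (rule ac01_Lipschitz[OF _ M(1)])
    fix s t :: real assume st: "0 \<le> s" "s < t" "t \<le> 1"
    have "norm (f t - f s) \<le> M * norm (t - s)"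
    proof (rule differentiable_bound[where S="{0..1}"])
      show "(f has_derivative (\<lambda>h. h *\<^sub>R f' x)) (at x within {0..1})" if "x \<in> {0..1}" for x
        using d[OF that] unfolding has_vector_derivative_def .
      show "onorm (\<lambda>h. h *\<^sub>R f' x) \<le> M" if "x \<in> {0..1}" for x
      proof (rule onorm_le)
        fix h :: real
        from mult_left_mono[OF bspec[OF M(2) that], of "\<bar>h\<bar>"]
        show "norm (h *\<^sub>R f' x) \<le> M * norm h" by (simp add: mult.commute)
      qed
    qed (use st in auto)
    thus "norm (f t - f s) \<le> M * (t - s)" using st by simp
  qed
qed

lemma exp_has_deriv: "((\<lambda>x. exp (c * complex_of_real x)) has_vector_derivative c * exp (c * complex_of_real x)) (at x within S)"
proof -
  have "((\<lambda>z. exp (c * z)) has_field_derivative c * exp (c * of_real x)) (at (complex_of_real x))"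
    by (auto intro!: derivative_eq_intros)
  from has_vector_derivative_real_field[OF this] show ?thesis by (simp add: has_vector_derivative_at_within)
qed

lemma ac01_exp: "ac01 (\<lambda>x. exp (c * complex_of_real x))"
  by (rule ac01_C1[OF exp_has_deriv]) (intro continuous_intros)

lemma ac01_const: "ac01 (\<lambda>x. c)"
  by (rule ac01_Lipschitz[of _ 0]) auto

text \<open>Cauchy-Schwarz on a space of measure 1, obtained from the nonnegative variance of
  \<open>cmod (f x)\<close>.\<close>

lemma L1_le_L2_norm:
  assumes "L2 f"
  shows "integrable leb01 f" "(\<integral>x. cmod (f x) \<partial>leb01) \<le> L2_norm f"
proof -
  have fm: "f \<in> borel_measurable leb01" and f2: "integrable leb01 (\<lambda>x. (cmod (f x))\<^sup>2)" using assms by (auto simp: L2_def)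
  have c1: "integrable leb01 (\<lambda>x. 1::real)" by (rule integrable_const01)
  have fi: "integrable leb01 (\<lambda>x. cmod (f x))"
  proof (rule Bochner_Integration.integrable_bound[of _ "\<lambda>x. 1 + (cmod (f x))\<^sup>2"])
    show "integrable leb01 (\<lambda>x. 1 + (cmod (f x))\<^sup>2)" using c1 f2 by (rule Bochner_Integration.integrable_add)
    show "AE x in leb01. norm (cmod (f x)) \<le> norm (1 + (cmod (f x))\<^sup>2)"
    proof (rule AE_I2)
      fix x
      have "0 \<le> (cmod (f x) - 1)\<^sup>2" by simp
      hence "2 * cmod (f x) \<le> 1 + (cmod (f x))\<^sup>2" by (simp add: power2_eq_square algebra_simps)
      hence "cmod (f x) \<le> 1 + (cmod (f x))\<^sup>2" using norm_ge_zero[of "f x"] by linarith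
      thus "norm (cmod (f x)) \<le> norm (1 + (cmod (f x))\<^sup>2)" by (simp add: abs_of_nonneg)
    qed
  qed (use fm in measurable)
  show "integrable leb01 f" using fi fm by (rule integrable_norm_cancel)
  define m where "m = (\<integral>x. cmod (f x) \<partial>leb01)"
  have one: "(\<integral>x. (1::real) \<partial>leb01) = 1" unfolding integral_leb01_ext by simp
  have "0 \<le> (\<integral>x. (cmod (f x) - m)\<^sup>2 \<partial>leb01)" by simp
  also have "\<dots> = (\<integral>x. (cmod (f x))\<^sup>2 - (2 * m) * cmod (f x) + m\<^sup>2 * 1 \<partial>leb01)"
    by (intro Bochner_Integration.integral_cong refl) (simp add: power2_eq_square algebra_simps)
  also have "\<dots> = (\<integral>x. (cmod (f x))\<^sup>2 \<partial>leb01) - 2 * m * m + m\<^sup>2 * 1"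
    using fi f2 c1 one by (subst Bochner_Integration.integral_add, simp, simp, subst Bochner_Integration.integral_diff) (auto simp: m_def)
  finally have "m\<^sup>2 \<le> (\<integral>x. (cmod (f x))\<^sup>2 \<partial>leb01)" by (simp add: power2_eq_square)
  thus "(\<integral>x. cmod (f x) \<partial>leb01) \<le> L2_norm f" unfolding L2_norm_def m_def[symmetric] by (rule real_le_rsqrt)
qed

lemma L2_continuous:
  assumes g: "continuous_on {0..1} g"
  shows "L2 g"
proof -
  have "integrable leb01 (\<lambda>x. g x * cnj (g x))"
    by (intro integrable_leb01_mult_continuous integrable_leb01_continuous g continuous_intros)
  from integrable_norm[OF this] have "integrable leb01 (\<lambda>x. (cmod (g x))\<^sup>2)"
    by (simp add: norm_mult power2_eq_square)
  thus ?thesis using continuous_measurable_leb01[OF g] by (simp add: L2_def)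
qed

section \<open>Fourier coefficients\<close>

definition fexp :: "int \<Rightarrow> real \<Rightarrow> complex" where
  "fexp k x = exp ((2 * pi * \<i> * of_int k) * complex_of_real x)"

definition fcoeff :: "(real \<Rightarrow> complex) \<Rightarrow> int \<Rightarrow> complex" where
  "fcoeff f k = (\<integral>x. f x * fexp (- k) x \<partial>leb01)"

lemma fexp_0 [simp]: "fexp 0 x = 1" by (simp add: fexp_def)
lemma fexp_add: "fexp (j + k) x = fexp j x * fexp k x" by (simp add: fexp_def exp_add[symmetric] algebra_simps)
lemma fexp_at_0 [simp]: "fexp k 0 = 1" by (simp add: fexp_def)
lemma fexp_at_1 [simp]: "fexp k 1 = 1"
proof -
  have "fexp k 1 = exp ((2 * of_int k * pi) * \<i>)" by (simp add: fexp_def mult_ac)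
  also have "\<dots> = 1" by (rule exp_integer_2pi) simp
  finally show ?thesis .
qed
lemma norm_fexp [simp]: "cmod (fexp k x) = 1" by (simp add: fexp_def)
lemma cnj_fexp: "cnj (fexp k x) = fexp (- k) x" by (simp add: fexp_def exp_cnj)
lemma ac01_fexp: "ac01 (fexp k)" unfolding fexp_def[abs_def] by (rule ac01_exp)
lemma fexp_deriv: "(fexp k has_vector_derivative (2 * pi * \<i> * of_int k) * fexp k x) (at x within S)"
  unfolding fexp_def[abs_def] by (rule exp_has_deriv)
lemma continuous_fexp [continuous_intros]: "continuous_on S (fexp k)"
  unfolding fexp_def[abs_def] by (intro continuous_intros)

lemma integrable_mult_fexp: "integrable leb01 f \<Longrightarrow> integrable leb01 (\<lambda>x. f x * fexp k x)"
  by (intro integrable_leb01_mult_continuous continuous_fexp)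

lemma fcoeff_add: "integrable leb01 f \<Longrightarrow> integrable leb01 g \<Longrightarrow> fcoeff (\<lambda>x. f x + g x) k = fcoeff f k + fcoeff g k"
  unfolding fcoeff_def distrib_right by (intro Bochner_Integration.integral_add integrable_mult_fexp)

lemma fcoeff_diff: "integrable leb01 f \<Longrightarrow> integrable leb01 g \<Longrightarrow> fcoeff (\<lambda>x. f x - g x) k = fcoeff f k - fcoeff g k"
  unfolding fcoeff_def left_diff_distrib by (intro Bochner_Integration.integral_diff integrable_mult_fexp)

lemma fcoeff_cmult: "fcoeff (\<lambda>x. c * f x) k = c * fcoeff f k"
  unfolding fcoeff_def by (simp add: mult.assoc)

lemma fcoeff_mult_fexp: "fcoeff (\<lambda>x. f x * fexp l x) k = fcoeff f (k - l)"
  unfolding fcoeff_def by (simp add: mult.assoc fexp_add[symmetric])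

lemma fcoeff_bound:
  assumes "integrable leb01 f"
  shows "cmod (fcoeff f k) \<le> (\<integral>x. cmod (f x) \<partial>leb01)"
proof -
  have "cmod (fcoeff f k) \<le> (\<integral>x. cmod (f x * fexp (-k) x) \<partial>leb01)"
    unfolding fcoeff_def by (rule integral_norm_bound)
  thus ?thesis by (simp add: norm_mult)
qed

lemma fcoeff_by_parts:
  assumes f: "ac01 f" "AE x in leb01. (f has_vector_derivative f' x) (at x within {0..1})"
  shows "fcoeff f' k = f 1 - f 0 + (2 * pi * \<i> * of_int k) * fcoeff f k"
proof -
  have "fcoeff f' k = f 1 * fexp (-k) 1 - f 0 * fexp (-k) 0 - (\<integral>x. f x * ((2 * pi * \<i> * of_int (-k)) * fexp (-k) x) \<partial>leb01)"
    unfolding fcoeff_def by (rule integration_by_parts_01[OF f ac01_fexp]) (intro AE_I2 fexp_deriv)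
  also have "(\<integral>x. f x * ((2 * pi * \<i> * of_int (-k)) * fexp (-k) x) \<partial>leb01) = (2 * pi * \<i> * of_int (-k)) * fcoeff f k"
    unfolding fcoeff_def by (subst integral_mult_right_zero[symmetric]) (simp add: mult_ac)
  finally show ?thesis by simp
qed

lemma fcoeff_const: "fcoeff (\<lambda>x. 1) k = (if k = 0 then 1 else 0)"
proof (cases "k = 0")
  case True
  have "(\<integral>x. (1::complex) \<partial>leb01) = 1" unfolding integral_leb01_ext by simp
  thus ?thesis using True by (simp add: fcoeff_def)
next
  case False
  have "fcoeff (\<lambda>x. 0) k = 1 - 1 + (2 * pi * \<i> * of_int k) * fcoeff (\<lambda>x. 1) k"
    by (rule fcoeff_by_parts[OF ac01_const]) simp
  thus ?thesis using False by (simp add: fcoeff_def)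
qed

lemma polynomial_function_ac01:
  fixes p :: "real \<Rightarrow> complex"
  assumes "polynomial_function p"
  shows "ac01 p" "\<exists>p'. continuous_on {0..1} p' \<and> (\<forall>x. (p has_vector_derivative p' x) (at x within {0..1}))"
proof -
  obtain p' where p': "polynomial_function p'" "\<And>x. (p has_vector_derivative p' x) (at x)"
    using has_vector_derivative_polynomial_function[OF assms] by blast
  have c: "continuous_on {0..1} p'" by (rule continuous_on_polymonial_function[OF p'(1)])
  have d: "(p has_vector_derivative p' x) (at x within {0..1})" for x using p'(2) has_vector_derivative_at_within by blast
  show "ac01 p" by (rule ac01_C1[OF d c])
  show "\<exists>p'. continuous_on {0..1} p' \<and> (\<forall>x. (p has_vector_derivative p' x) (at x within {0..1}))"
    using c d by blast
qed

text \<open>Approximate \<open>f\<close> in \<open>L1\<close> by a continuous function and that one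
  uniformly by a polynomial; one integration by parts bounds the coefficients of the polynomial by a
  multiple of \<open>1 / \<bar>k\<bar>\<close>.\<close>

theorem Riemann_Lebesgue:
  assumes f: "integrable leb01 f" and e: "e > 0"
  shows "\<exists>N. \<forall>k. \<bar>k\<bar> \<ge> N \<longrightarrow> cmod (fcoeff f k) < e"
proof -
  define G where "G = (\<lambda>x. indicator {0..1} x *\<^sub>R f x)"
  have G: "integrable lebesgue G" using f by (simp add: G_def integrable_leb01_ext)
  have e3: "e/3 > 0" using e by simp
  obtain c M where c: "continuous_on UNIV c" "integrable lebesgue c" "(\<integral>x. norm (G x - c x) \<partial>lebesgue) < e/3"
    using L1_approx_continuous[OF G e3] by blast
  have cc: "continuous_on {0..1} c" using c(1) continuous_on_subset by blast
  have ci: "integrable leb01 c" by (rule integrable_leb01_continuous[OF cc])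
  obtain p where p: "polynomial_function p" "\<forall>x\<in>{0..1}. norm (c x - p x) < e/3"
    using Stone_Weierstrass_polynomial_function[of "{0..1}" c "e/3"] cc e3 by auto
  note pa = polynomial_function_ac01[OF p(1)]
  have pc: "continuous_on {0..1} p" by (rule ac01_continuous_on[OF pa(1)])
  have pint: "integrable leb01 p" by (rule integrable_leb01_continuous[OF pc])
  obtain p' where p': "continuous_on {0..1} p'" "\<And>x. (p has_vector_derivative p' x) (at x within {0..1})" using pa(2) by blast
  \<comment> \<open>A bound for \<open>2 * pi * \<bar>k\<bar>\<close> times the coefficient of
    \<open>p\<close>: the boundary term plus the \<open>L1\<close> norm of
    \<open>p'\<close>.\<close>
  define B where "B = cmod (p 1 - p 0) + (\<integral>x. cmod (p' x) \<partial>leb01)"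
  have B0: "B \<ge> 0" by (simp add: B_def)
  obtain N :: nat where N: "B / (e/3) < real N" using reals_Archimedean2 by blast
  show ?thesis
  proof (intro exI[of _ "int N + 1"] allI impI)
    fix k :: int assume k: "int N + 1 \<le> \<bar>k\<bar>"
    have 1: "cmod (fcoeff (\<lambda>x. f x - c x) k) < e/3"
    proof -
      have "cmod (fcoeff (\<lambda>x. f x - c x) k) \<le> (\<integral>x. cmod (f x - c x) \<partial>leb01)"
        by (rule fcoeff_bound) (use f ci in auto)
      also have "\<dots> = (\<integral>x. indicator {0..1} x *\<^sub>R cmod (f x - c x) \<partial>lebesgue)" by (rule integral_leb01_ext)
      also have "\<dots> \<le> (\<integral>x. norm (G x - c x) \<partial>lebesgue)"
      proof (rule integral_mono)
        have "integrable leb01 (\<lambda>x. cmod (f x - c x))" using f ci by auto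
        thus "integrable lebesgue (\<lambda>x. indicator {0..1} x *\<^sub>R cmod (f x - c x))" unfolding integrable_leb01_ext .
      qed (use G c in \<open>auto simp: G_def indicator_def\<close>)
      finally show ?thesis using c(3) by simp
    qed
    have 2: "cmod (fcoeff (\<lambda>x. c x - p x) k) \<le> e/3"
    proof -
      have "cmod (fcoeff (\<lambda>x. c x - p x) k) \<le> (\<integral>x. cmod (c x - p x) \<partial>leb01)"
        by (rule fcoeff_bound) (use pint ci in auto)
      also have "\<dots> \<le> (\<integral>x. e/3 \<partial>leb01)"
      proof (rule integral_mono)
        fix x assume "x \<in> space leb01"
        thus "cmod (c x - p x) \<le> e/3" using p(2) by (intro less_imp_le) auto
      qed (use ci pint in \<open>auto intro!: integrable_const01\<close>)
      also have "\<dots> = e/3" unfolding integral_leb01_ext by simp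
      finally show ?thesis .
    qed
    have 3: "cmod (fcoeff p k) < e/3"
    proof -
      have eq: "fcoeff p' k = p 1 - p 0 + (2 * pi * \<i> * of_int k) * fcoeff p k"
        by (rule fcoeff_by_parts[OF pa(1)]) (simp add: p'(2))
      have "(2 * pi * \<bar>of_int k\<bar>) * cmod (fcoeff p k) = cmod ((2 * pi * \<i> * of_int k) * fcoeff p k)"
        by (simp add: norm_mult)
      also have "\<dots> = cmod (fcoeff p' k - (p 1 - p 0))" using eq by simp
      also have "\<dots> \<le> cmod (fcoeff p' k) + cmod (p 1 - p 0)" by (rule norm_triangle_ineq4)
      also have "\<dots> \<le> B" using fcoeff_bound[OF integrable_leb01_continuous[OF p'(1)], of k] by (simp add: B_def)
      finally have b: "(2 * pi * \<bar>real_of_int k\<bar>) * cmod (fcoeff p k) \<le> B" .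
      have kN: "real N + 1 \<le> \<bar>real_of_int k\<bar>" using k by linarith
      have "(real N + 1) * cmod (fcoeff p k) \<le> (2 * pi * \<bar>real_of_int k\<bar>) * cmod (fcoeff p k)"
        using kN mult_right_mono[of 1 "2 * pi" "\<bar>real_of_int k\<bar>"] pi_ge_two by (intro mult_right_mono order_trans[OF kN]) auto
      hence "(real N + 1) * cmod (fcoeff p k) \<le> B" using b by linarith
      also have "B < real N * (e/3)" using N e3 by (simp add: field_simps)
      also have "\<dots> \<le> (real N + 1) * (e/3)" using e3 by (intro mult_right_mono) auto
      finally show ?thesis by (simp add: mult_less_cancel_left_pos)
    qed
    have "fcoeff f k = fcoeff (\<lambda>x. f x - c x) k + fcoeff (\<lambda>x. c x - p x) k + fcoeff p k"
      using f ci pint by (simp add: fcoeff_diff)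
    also have "cmod \<dots> \<le> cmod (fcoeff (\<lambda>x. f x - c x) k) + cmod (fcoeff (\<lambda>x. c x - p x) k) + cmod (fcoeff p k)"
      by (meson add_mono_thms_linordered_semiring(3) norm_triangle_ineq order_trans)
    finally show "cmod (fcoeff f k) < e" using 1 2 3 by linarith
  qed
qed

text \<open>A real linear form in \<open>z\<close> is a combination of \<open>z\<close> and
  \<open>cnj z\<close>, and multiplication by \<open>fexp 1\<close> or \<open>fexp (-1)\<close>
  merely shifts coefficients, so vanishing of all of them is preserved. The induction runs over all
  \<open>g\<close> simultaneously, so that a product of polynomials is treated one factor after the
  other.\<close>

lemma real_polynomial_on_circle_preserves:
  fixes p :: "complex \<Rightarrow> real" and f :: "real \<Rightarrow> complex"
  assumes p: "real_polynomial_function p" and f: "continuous_on {0..1} f"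
    and g: "continuous_on {0..1} g" "\<And>k. fcoeff (\<lambda>x. f x * g x) k = 0"
  shows "continuous_on {0..1} (\<lambda>x. g x * of_real (p (fexp 1 x)))" "fcoeff (\<lambda>x. f x * (g x * of_real (p (fexp 1 x)))) k = 0"
proof -
  have "\<forall>g. continuous_on {0..1} g \<and> (\<forall>k. fcoeff (\<lambda>x. f x * g x) k = 0) \<longrightarrow>
     continuous_on {0..1} (\<lambda>x. g x * of_real (p (fexp 1 x))) \<and> (\<forall>k. fcoeff (\<lambda>x. f x * (g x * of_real (p (fexp 1 x)))) k = 0)"
    using p
  proof (induction rule: real_polynomial_function.induct)
    case (linear p)
    show ?case
    proof (intro allI impI conjI, elim conjE)
      fix g assume g: "continuous_on {0..1} g" "\<forall>k. fcoeff (\<lambda>x. f x * g x) k = 0"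
      show "continuous_on {0..1} (\<lambda>x. g x * complex_of_real (p (fexp 1 x)))"
        by (intro continuous_intros g bounded_linear.continuous_on[OF linear])
    next
      fix g k assume "continuous_on {0..1} g \<and> (\<forall>k. fcoeff (\<lambda>x. f x * g x) k = 0)"
      hence g: "continuous_on {0..1} g" "\<And>k. fcoeff (\<lambda>x. f x * g x) k = 0" by auto
      interpret p: bounded_linear p by (rule linear)
      \<comment> \<open>\<open>\<alpha>\<close> and \<open>\<beta>\<close> are the coefficients of
        the form with respect to \<open>z\<close> and \<open>cnj z\<close>.\<close>
      define \<alpha> where "\<alpha> = (of_real (p 1) - \<i> * of_real (p \<i>)) / 2"
      define \<beta> where "\<beta> = (of_real (p 1) + \<i> * of_real (p \<i>)) / 2"
      have pz: "of_real (p z) = \<alpha> * z + \<beta> * cnj z" for z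
      proof -
        have "z = Re z *\<^sub>R 1 + Im z *\<^sub>R \<i>" by (simp add: complex_eq_iff)
        hence "p z = Re z * p 1 + Im z * p \<i>" using p.add p.scaleR by (metis real_scaleR_def)
        thus ?thesis by (simp add: \<alpha>_def \<beta>_def complex_eq_iff field_simps)
      qed
      have "(\<lambda>x. f x * (g x * of_real (p (fexp 1 x)))) = (\<lambda>x. \<alpha> * ((f x * g x) * fexp 1 x) + \<beta> * ((f x * g x) * fexp (-1) x))"
        by (simp add: pz cnj_fexp algebra_simps)
      moreover have "integrable leb01 (\<lambda>x. \<alpha> * ((f x * g x) * fexp 1 x))" "integrable leb01 (\<lambda>x. \<beta> * ((f x * g x) * fexp (-1) x))"
        by (intro integrable_leb01_continuous continuous_intros f g)+
      ultimately show "fcoeff (\<lambda>x. f x * (g x * of_real (p (fexp 1 x)))) k = 0"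
        by (simp add: fcoeff_add fcoeff_cmult fcoeff_mult_fexp g(2))
    qed
  next
    case (const c)
    show ?case
    proof (intro allI impI conjI, elim conjE)
      fix g k assume g: "continuous_on {0..1} g \<and> (\<forall>k. fcoeff (\<lambda>x. f x * g x) k = 0)"
      have "(\<lambda>x. f x * (g x * of_real c)) = (\<lambda>x. of_real c * (f x * g x))" by (simp add: algebra_simps)
      thus "fcoeff (\<lambda>x. f x * (g x * of_real c)) k = 0" using g by (simp only: fcoeff_cmult) simp
    qed (auto intro!: continuous_intros)
  next
    case (add p1 p2)
    show ?case
    proof (intro allI impI)
      fix g assume g: "continuous_on {0..1} g \<and> (\<forall>k. fcoeff (\<lambda>x. f x * g x) k = 0)"
      note h1 = add.IH(1)[rule_format, OF g] and h2 = add.IH(2)[rule_format, OF g]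
      have eq: "(\<lambda>x. g x * complex_of_real (p1 (fexp 1 x) + p2 (fexp 1 x))) = (\<lambda>x. g x * of_real (p1 (fexp 1 x)) + g x * of_real (p2 (fexp 1 x)))"
        "(\<lambda>x. f x * (g x * complex_of_real (p1 (fexp 1 x) + p2 (fexp 1 x)))) = (\<lambda>x. f x * (g x * of_real (p1 (fexp 1 x))) + f x * (g x * of_real (p2 (fexp 1 x))))"
        by (simp_all add: algebra_simps)
      have i1: "integrable leb01 (\<lambda>x. f x * (g x * of_real (p1 (fexp 1 x))))" using h1 by (intro integrable_leb01_continuous continuous_on_mult[OF f]) blast
      have i2: "integrable leb01 (\<lambda>x. f x * (g x * of_real (p2 (fexp 1 x))))" using h2 by (intro integrable_leb01_continuous continuous_on_mult[OF f]) blast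
      show "continuous_on {0..1} (\<lambda>x. g x * complex_of_real (p1 (fexp 1 x) + p2 (fexp 1 x))) \<and>
             (\<forall>k. fcoeff (\<lambda>x. f x * (g x * complex_of_real (p1 (fexp 1 x) + p2 (fexp 1 x)))) k = 0)"
        unfolding eq using h1 h2 by (auto simp: fcoeff_add[OF i1 i2] intro!: continuous_on_add)
    qed
  next
    case (mult p1 p2)
    show ?case
    proof (intro allI impI)
      fix g assume g: "continuous_on {0..1} g \<and> (\<forall>k. fcoeff (\<lambda>x. f x * g x) k = 0)"
      from mult.IH(2)[rule_format, OF mult.IH(1)[rule_format, OF g]]
      show "continuous_on {0..1} (\<lambda>x. g x * complex_of_real (p1 (fexp 1 x) * p2 (fexp 1 x))) \<and>
             (\<forall>k. fcoeff (\<lambda>x. f x * (g x * complex_of_real (p1 (fexp 1 x) * p2 (fexp 1 x)))) k = 0)"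
        by (simp add: mult.assoc)
    qed
  qed
  thus "continuous_on {0..1} (\<lambda>x. g x * of_real (p (fexp 1 x)))" "fcoeff (\<lambda>x. f x * (g x * of_real (p (fexp 1 x)))) k = 0"
    using g by blast+
qed

lemma circle_param: "fexp 1 ` {0..1} = sphere 0 1"
proof
  show "fexp 1 ` {0..1} \<subseteq> sphere 0 1" by auto
  show "sphere 0 1 \<subseteq> fexp 1 ` {0..1}"
  proof
    fix z :: complex assume "z \<in> sphere 0 1"
    hence z: "cmod z = 1" by simp
    have "z = of_real (cmod z) * exp (\<i> * of_real (Arg2pi z))" by (rule Arg2pi_eq)
    hence "z = fexp 1 (Arg2pi z / (2 * pi))" using z by (simp add: fexp_def)
    moreover have "Arg2pi z / (2 * pi) \<in> {0..1}" using Arg2pi_ge_0[of z] Arg2pi_lt_2pi[of z] by (auto simp: field_simps)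
    ultimately show "z \<in> fexp 1 ` {0..1}" by blast
  qed
qed

lemma fexp_1_eq_iff:
  assumes "x \<in> {0..1}" "y \<in> {0..1}" "fexp 1 x = fexp 1 y"
  shows "x = y \<or> {x,y} = {0,1}"
proof -
  obtain n :: int where n: "(2 * pi * \<i> * of_int 1) * complex_of_real x = (2 * pi * \<i> * of_int 1) * complex_of_real y + (of_int (2 * n) * pi) * \<i>"
    using assms(3) unfolding fexp_def exp_eq by blast
  hence "2 * pi * x = 2 * pi * y + 2 * of_int n * pi" by (simp add: complex_eq_iff)
  hence "2 * pi * x = 2 * pi * (y + of_int n)" by (simp add: algebra_simps)
  hence "x = y + of_int n" using pi_gt_zero by simp
  moreover have "n = -1 \<or> n = 0 \<or> n = 1" using calculation assms(1,2) by auto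
  ultimately show ?thesis using assms(1,2) by (auto simp: doubleton_eq_iff)
qed

text \<open>By the preceding lemma \<open>f\<close> is orthogonal to every polynomial on the circle,
  and by Stone-Weierstrass one of them approximates \<open>cnj f\<close> within \<open>e\<close>.
  Hence the integral of \<open>\<bar>f\<bar>\<^sup>2\<close> is at most \<open>e\<close> times the
  \<open>L1\<close> norm of \<open>f\<close>, for every \<open>e\<close>.\<close>

theorem fcoeff_unique:
  assumes f: "continuous_on {0..1} f" and per: "f 0 = f 1" and z: "\<And>k. fcoeff f k = 0" and x: "x \<in> {0..1}"
  shows "f x = 0"
proof -
  \<comment> \<open>The conjugate of \<open>f\<close> transported to the circle; only the parameters
    0 and 1 share a point, and there the values agree by \<open>per\<close>.\<close>
  define F where "F z = cnj (f (SOME t. t \<in> {0..1} \<and> fexp 1 t = z))" for z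
  have Fex: "F (fexp 1 t) = cnj (f t)" if t: "t \<in> {0..1}" for t
  proof -
    define s where "s = (SOME s. s \<in> {0..1} \<and> fexp 1 s = fexp 1 t)"
    have "s \<in> {0..1} \<and> fexp 1 s = fexp 1 t" unfolding s_def by (rule someI[of _ t]) (use t in auto)
    hence "f s = f t" using fexp_1_eq_iff[of s t] t per by (auto simp: doubleton_eq_iff)
    thus ?thesis by (simp add: F_def s_def)
  qed
  \<comment> \<open>Preimages of closed sets are images under \<open>fexp 1\<close> of compact sets
    of parameters, hence closed.\<close>
  have "continuous_on (sphere 0 1) F"
    unfolding continuous_on_closed_vimage[OF closed_sphere]
  proof (intro allI impI)
    fix B :: "complex set" assume B: "closed B"
    have cf: "continuous_on {0..1} (\<lambda>t. cnj (f t))" using f by (intro continuous_intros)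
    have "closed ((\<lambda>t. cnj (f t)) -` B \<inter> {0..1})"
      using cf B by (simp add: continuous_on_closed_vimage)
    hence "compact ((\<lambda>t. cnj (f t)) -` B \<inter> {0..1})"
      by (metis compact_Icc closed_Int_compact inf.right_idem)
    hence "compact (fexp 1 ` ((\<lambda>t. cnj (f t)) -` B \<inter> {0..1}))" by (intro compact_continuous_image continuous_fexp)
    moreover have "fexp 1 ` ((\<lambda>t. cnj (f t)) -` B \<inter> {0..1}) = F -` B \<inter> sphere 0 1"
    proof (intro equalityI subsetI)
      fix z assume "z \<in> fexp 1 ` ((\<lambda>t. cnj (f t)) -` B \<inter> {0..1})"
      then obtain t where t: "z = fexp 1 t" "t \<in> {0..1}" "cnj (f t) \<in> B" by auto
      thus "z \<in> F -` B \<inter> sphere 0 1" using Fex[OF t(2)] by simp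
    next
      fix z assume z: "z \<in> F -` B \<inter> sphere 0 1"
      hence "z \<in> fexp 1 ` {0..1}" using circle_param by blast
      then obtain t where t: "z = fexp 1 t" "t \<in> {0..1}" by auto
      thus "z \<in> fexp 1 ` ((\<lambda>t. cnj (f t)) -` B \<inter> {0..1})" using z Fex[OF t(2)] by auto
    qed
    ultimately show "closed (F -` B \<inter> sphere 0 1)" by (simp add: compact_imp_closed)
  qed
  hence FC: "continuous_on (sphere 0 1) F" .
  have fi: "integrable leb01 f" by (rule integrable_leb01_continuous[OF f])
  define I where "I = (\<integral>x. (cmod (f x))\<^sup>2 \<partial>leb01)"
  have Ile: "I \<le> e * (\<integral>x. cmod (f x) \<partial>leb01)" if e: "e > 0" for e
  proof -
    obtain g where g: "polynomial_function g" "\<forall>x\<in>sphere 0 1. norm (F x - g x) < e"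
      using Stone_Weierstrass_polynomial_function[of "sphere 0 1" F e] FC e by auto
    have "real_polynomial_function (Re \<circ> g)" "real_polynomial_function (Im \<circ> g)"
      using g(1) bounded_linear_Re bounded_linear_Im unfolding polynomial_function_def by blast+
    note pr = real_polynomial_on_circle_preserves[OF this(1) f continuous_on_const, of 1] and pim = real_polynomial_on_circle_preserves[OF this(2) f continuous_on_const, of 1]
    have z1: "\<And>k. fcoeff (\<lambda>x. f x * 1) k = 0" using z by simp
    define h where "h x = g (fexp 1 x)" for x
    have hre: "h = (\<lambda>x. 1 * of_real ((Re \<circ> g) (fexp 1 x)) + \<i> * (1 * of_real ((Im \<circ> g) (fexp 1 x))))"
      by (auto simp: h_def fun_eq_iff complex_eq_iff)
    have hc: "continuous_on {0..1} h" unfolding hre by (intro continuous_on_add continuous_on_mult continuous_on_const pr(1)[unfolded mult_1] pim(1)[unfolded mult_1] z1[unfolded mult_1_right] ; simp add: z)+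
    have "(\<lambda>x. f x * h x) = (\<lambda>x. f x * (1 * of_real ((Re \<circ> g) (fexp 1 x))) + \<i> * (f x * (1 * of_real ((Im \<circ> g) (fexp 1 x)))))"
      by (subst hre) (simp add: algebra_simps)
    hence "fcoeff (\<lambda>x. f x * h x) 0 = fcoeff (\<lambda>x. f x * (1 * of_real ((Re \<circ> g) (fexp 1 x))) + \<i> * (f x * (1 * of_real ((Im \<circ> g) (fexp 1 x))))) 0" by simp
    also have "\<dots> = fcoeff (\<lambda>x. f x * (1 * of_real ((Re \<circ> g) (fexp 1 x)))) 0 + \<i> * fcoeff (\<lambda>x. f x * (1 * of_real ((Im \<circ> g) (fexp 1 x)))) 0"
    proof -
      have "integrable leb01 (\<lambda>x. f x * (1 * of_real ((Re \<circ> g) (fexp 1 x))))"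
        by (intro integrable_leb01_continuous continuous_on_mult f pr(1) z1)
      moreover have "integrable leb01 (\<lambda>x. \<i> * (f x * (1 * of_real ((Im \<circ> g) (fexp 1 x)))))"
        by (intro integrable_leb01_continuous continuous_on_mult f pim(1) z1 continuous_on_const)
      ultimately show ?thesis by (subst fcoeff_add) (auto simp only: fcoeff_cmult)
    qed
    also have "\<dots> = 0" using pr(2)[OF z1, of 0] pim(2)[OF z1, of 0] by simp
    finally have fh: "(\<integral>x. f x * h x \<partial>leb01) = 0" by (simp add: fcoeff_def)
    have fcf: "integrable leb01 (\<lambda>x. f x * cnj (f x))" by (intro integrable_leb01_continuous continuous_intros f)
    have fhi: "integrable leb01 (\<lambda>x. f x * h x)" by (intro integrable_leb01_continuous continuous_on_mult f hc)
    have Ic: "complex_of_real I = (\<integral>x. f x * cnj (f x) \<partial>leb01)"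
      unfolding I_def by (subst integral_complex_of_real[symmetric]) (simp only: complex_norm_square)
    also have "\<dots> = (\<integral>x. f x * cnj (f x) - f x * h x \<partial>leb01)" using fcf fhi fh by simp
    finally have "cmod (complex_of_real I) \<le> (\<integral>x. cmod (f x * cnj (f x) - f x * h x) \<partial>leb01)" by (metis integral_norm_bound)
    also have "\<dots> \<le> (\<integral>x. e * cmod (f x) \<partial>leb01)"
    proof (rule integral_mono)
      fix x assume "x \<in> space leb01"
      hence x: "x \<in> {0..1}" by simp
      have "cmod (cnj (f x) - h x) \<le> e" using g(2)[rule_format, of "fexp 1 x"] Fex[OF x] by (simp add: h_def less_imp_le)
      from mult_left_mono[OF this, of "cmod (f x)"] show "cmod (f x * cnj (f x) - f x * h x) \<le> e * cmod (f x)"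
        by (simp add: right_diff_distrib[symmetric] norm_mult mult.commute)
    qed (use fcf fhi fi in auto)
    finally show ?thesis by simp
  qed
  have "I \<le> 0"
  proof (rule field_le_epsilon)
    fix e :: real assume e: "e > 0"
    define m where "m = (\<integral>x. cmod (f x) \<partial>leb01)"
    have m: "m \<ge> 0" by (simp add: m_def)
    have "I \<le> e / (m + 1) * m"
    proof -
      have "e / (m + 1) > 0" using e m by simp
      from Ile[OF this] show ?thesis by (simp add: m_def)
    qed
    also have "\<dots> \<le> e" using e m by (simp add: field_simps)
    finally show "I \<le> 0 + e" by simp
  qed
  moreover have "I \<ge> 0" by (simp add: I_def)
  ultimately have I0: "I = 0" by simp
  have c2: "continuous_on (cbox 0 1) (\<lambda>x. (cmod (f x))\<^sup>2)" using f by (auto intro!: continuous_intros)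
  have "integrable leb01 (\<lambda>x. (cmod (f x))\<^sup>2)" using L2_continuous[OF f] by (simp add: L2_def)
  hence "I = integral {0..1} (\<lambda>x. (cmod (f x))\<^sup>2)" unfolding I_def by (intro lebesgue_integral_eq_integral) auto
  hence "integral (cbox 0 1) (\<lambda>x. (cmod (f x))\<^sup>2) = 0" using I0 by simp
  hence "\<forall>x\<in>cbox 0 1. (cmod (f x))\<^sup>2 = 0" using integral_cbox_eq_0_iff[OF c2] by auto
  thus ?thesis using x by auto
qed

text \<open>Integrate by parts \<open>m\<close> times; the endpoint conditions remove every boundary
  term, and the Riemann-Lebesgue lemma applies to the last derivative.\<close>

lemma fcoeff_sobolev_decay:
  assumes W: "sobolev_W1 m q" and bc: "\<And>j. j < m \<Longrightarrow> (deriv_01 ^^ j) q 0 = (deriv_01 ^^ j) q 1" and e: "e > 0"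
  shows "\<exists>N. \<forall>k. \<bar>k\<bar> \<ge> N \<longrightarrow> \<bar>real_of_int k\<bar> ^ m * cmod (fcoeff q k) < e"
proof -
  have fcj: "j \<le> m \<Longrightarrow> fcoeff ((deriv_01 ^^ j) q) k = (2 * pi * \<i> * of_int k) ^ j * fcoeff q k" for j k
  proof (induction j)
    case (Suc j)
    have ac: "ac01 ((deriv_01 ^^ j) q)" using W Suc by (auto simp: sobolev_W1_def abs_continuous_01_eq)
    have "fcoeff ((deriv_01 ^^ Suc j) q) k = (2 * pi * \<i> * of_int k) * fcoeff ((deriv_01 ^^ j) q) k"
      using fcoeff_by_parts[OF ac ac01_FTC(1)[OF ac], of k] bc[of j] Suc by simp
    thus ?case using Suc by simp
  qed simp
  have "integrable leb01 ((deriv_01 ^^ m) q)" using W by (auto simp: sobolev_W1_def)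
  from Riemann_Lebesgue[OF this e] obtain N where N: "\<And>k. \<bar>k\<bar> \<ge> N \<Longrightarrow> cmod (fcoeff ((deriv_01 ^^ m) q) k) < e" by blast
  show ?thesis
  proof (intro exI[of _ N] allI impI)
    fix k assume k: "N \<le> \<bar>k\<bar>"
    have "\<bar>real_of_int k\<bar> ^ m * cmod (fcoeff q k) \<le> (2 * pi * \<bar>real_of_int k\<bar>) ^ m * cmod (fcoeff q k)"
      using mult_right_mono[of 1 "2 * pi" "\<bar>real_of_int k\<bar>"] pi_ge_two by (intro mult_right_mono power_mono) auto
    also have "\<dots> = cmod (fcoeff ((deriv_01 ^^ m) q) k)" by (simp add: fcj norm_mult norm_power)
    also have "\<dots> < e" by (rule N[OF k])
    finally show "\<bar>real_of_int k\<bar> ^ m * cmod (fcoeff q k) < e" .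
  qed
qed

section \<open>Absolutely convergent Fourier series\<close>

definition fseries :: "(int \<Rightarrow> complex) \<Rightarrow> real \<Rightarrow> complex" where
  "fseries y x = (\<Sum>\<^sub>\<infinity>l. y l * fexp l x)"

lemma fseries_uniform:
  assumes "(\<lambda>l. cmod (y l)) summable_on UNIV"
  shows "uniform_limit UNIV (\<lambda>F x. \<Sum>l\<in>F. y l * fexp l x) (fseries y) (finite_subsets_at_top UNIV)"
  unfolding fseries_def[abs_def]
  by (rule Weierstrass_m_test_general[OF _ assms]) (simp add: norm_mult)

lemma fseries_continuous:
  assumes "(\<lambda>l. cmod (y l)) summable_on UNIV"
  shows "continuous_on S (fseries y)"
proof -
  have "continuous_on UNIV (fseries y)"
    by (rule uniform_limit_theorem[OF _ fseries_uniform[OF assms]]) (auto intro!: always_eventually continuous_intros)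
  thus ?thesis using continuous_on_subset by blast
qed

lemma fseries_periodic: "fseries y 0 = fseries y 1"
  by (simp add: fseries_def)

lemma fseries_bound:
  assumes "(\<lambda>l. cmod (y l)) summable_on UNIV"
  shows "cmod (fseries y x) \<le> (\<Sum>\<^sub>\<infinity>l. cmod (y l))"
proof -
  have "cmod (fseries y x) \<le> (\<Sum>\<^sub>\<infinity>l. cmod (y l * fexp l x))"
    unfolding fseries_def by (rule norm_infsum_bound) (use assms in \<open>simp add: norm_mult\<close>)
  thus ?thesis by (simp add: norm_mult)
qed

text \<open>Uniform convergence of the series lets the integral against a merely integrable
  \<open>q\<close> pass to the limit.\<close>

lemma fcoeff_mult_fseries:
  assumes q: "integrable leb01 q" and y: "(\<lambda>l. cmod (y l)) summable_on UNIV"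
  shows "((\<lambda>l. y l * fcoeff q (j - l)) has_sum fcoeff (\<lambda>x. q x * fseries y x) j) UNIV"
  unfolding has_sum_def
proof (rule tendstoI)
  fix e :: real assume e: "e > 0"
  define m where "m = (\<integral>x. cmod (q x) \<partial>leb01)"
  have m: "m \<ge> 0" by (simp add: m_def)
  have "e / (m + 1) > 0" using e m by simp
  note ev = uniform_limitD[OF fseries_uniform[OF y] this]
  show "\<forall>\<^sub>F F in finite_subsets_at_top UNIV. dist (\<Sum>l\<in>F. y l * fcoeff q (j - l)) (fcoeff (\<lambda>x. q x * fseries y x) j) < e"
  proof (rule eventually_mono[OF ev])
    fix F :: "int set" assume elim: "\<forall>x\<in>UNIV. dist (\<Sum>l\<in>F. y l * fexp l x) (fseries y x) < e / (m + 1)"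
    define s where "s x = (\<Sum>l\<in>F. y l * fexp l x)" for x
    have sc: "continuous_on {0..1} s" unfolding s_def by (intro continuous_intros)
    have iq1: "integrable leb01 (\<lambda>x. q x * s x)" by (rule integrable_leb01_mult_continuous[OF q sc])
    have iq2: "integrable leb01 (\<lambda>x. q x * fseries y x)" by (rule integrable_leb01_mult_continuous[OF q fseries_continuous[OF y]])
    have "(\<Sum>l\<in>F. y l * fcoeff q (j - l)) = (\<Sum>l\<in>F. \<integral>x. y l * (q x * fexp l x * fexp (-j) x) \<partial>leb01)"
    proof (rule sum.cong)
      fix l
      have "fcoeff q (j - l) = (\<integral>x. q x * fexp l x * fexp (-j) x \<partial>leb01)" by (subst fcoeff_mult_fexp[symmetric]) (simp add: fcoeff_def)
      thus "y l * fcoeff q (j - l) = (\<integral>x. y l * (q x * fexp l x * fexp (-j) x) \<partial>leb01)" by simp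
    qed simp
    also have "\<dots> = (\<integral>x. (\<Sum>l\<in>F. y l * (q x * fexp l x * fexp (-j) x)) \<partial>leb01)"
      by (subst Bochner_Integration.integral_sum) (auto intro!: integrable_mult_right integrable_mult_fexp q)
    also have "\<dots> = fcoeff (\<lambda>x. q x * s x) j"
      unfolding fcoeff_def s_def by (intro Bochner_Integration.integral_cong refl) (simp add: sum_distrib_left sum_distrib_right mult_ac)
    finally have "dist (\<Sum>l\<in>F. y l * fcoeff q (j - l)) (fcoeff (\<lambda>x. q x * fseries y x) j) = cmod (fcoeff (\<lambda>x. q x * s x - q x * fseries y x) j)"
      using iq1 iq2 by (simp add: fcoeff_diff dist_norm)
    also have "\<dots> \<le> (\<integral>x. cmod (q x * s x - q x * fseries y x) \<partial>leb01)"
      by (rule fcoeff_bound) (intro Bochner_Integration.integrable_diff iq1 iq2)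
    also have "\<dots> \<le> (\<integral>x. (e / (m + 1)) * cmod (q x) \<partial>leb01)"
    proof (rule integral_mono)
      fix x
      have "cmod (s x - fseries y x) \<le> e / (m + 1)" using elim by (simp add: s_def dist_norm less_imp_le)
      from mult_left_mono[OF this, of "cmod (q x)"]
      show "cmod (q x * s x - q x * fseries y x) \<le> (e / (m + 1)) * cmod (q x)"
        by (simp add: right_diff_distrib[symmetric] norm_mult mult.commute)
    qed (use iq1 iq2 q in auto)
    also have "\<dots> = (e / (m + 1)) * m" by (simp add: m_def)
    also have "\<dots> < e" using e m by (simp add: field_simps)
    finally show "dist (\<Sum>l\<in>F. y l * fcoeff q (j - l)) (fcoeff (\<lambda>x. q x * fseries y x) j) < e" .
  qed
qed

lemma fcoeff_fseries:
  assumes y: "(\<lambda>l. cmod (y l)) summable_on UNIV"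
  shows "fcoeff (fseries y) j = y j"
proof -
  have "((\<lambda>l. y l * fcoeff (\<lambda>x. 1) (j - l)) has_sum fcoeff (\<lambda>x. 1 * fseries y x) j) UNIV"
    by (rule fcoeff_mult_fseries[OF integrable_const01 y])
  hence 1: "((\<lambda>l. y l * fcoeff (\<lambda>x. 1) (j - l)) has_sum fcoeff (fseries y) j) UNIV" by simp
  have "((\<lambda>l. y l * fcoeff (\<lambda>x. 1) (j - l)) has_sum (\<Sum>l\<in>{j}. y l * fcoeff (\<lambda>x. 1) (j - l))) UNIV"
    by (rule has_sum_finite_neutralI[of "{j}"]) (auto simp: fcoeff_const)
  from has_sum_unique[OF 1 this] show ?thesis by (simp add: fcoeff_const)
qed

lemma fseries_unique:
  assumes f: "continuous_on {0..1} f" "f 0 = f 1" and y: "(\<lambda>l. cmod (y l)) summable_on UNIV"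
    and fy: "\<And>k. fcoeff f k = y k" and x: "x \<in> {0..1}"
  shows "f x = fseries y x"
proof -
  have "f x - fseries y x = 0"
  proof (rule fcoeff_unique[OF _ _ _ x])
    show "continuous_on {0..1} (\<lambda>x. f x - fseries y x)" by (intro continuous_intros f fseries_continuous[OF y])
    show "f 0 - fseries y 0 = f 1 - fseries y 1" using f(2) fseries_periodic by simp
    show "fcoeff (\<lambda>x. f x - fseries y x) k = 0" for k
      using fcoeff_diff[OF integrable_leb01_continuous[OF f(1)] integrable_leb01_continuous[OF fseries_continuous[OF y]]] fcoeff_fseries[OF y] fy by simp
  qed
  thus ?thesis by simp
qed

section \<open>The square of an antiderivative\<close>

lemma summable_int_powr:
  assumes "s < -1"
  shows "(\<lambda>k::int. \<bar>real_of_int k\<bar> powr s) summable_on UNIV"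
proof -
  have "summable (\<lambda>n. real n powr s)" using assms by (simp add: summable_real_powr_iff)
  hence n: "(\<lambda>n. real n powr s) summable_on UNIV" by (intro norm_summable_imp_summable_on) simp
  have 1: "(\<lambda>k::int. \<bar>real_of_int k\<bar> powr s) summable_on range int"
    by (subst summable_on_reindex) (use n in \<open>auto simp: o_def inj_on_def\<close>)
  have 2: "(\<lambda>k::int. \<bar>real_of_int k\<bar> powr s) summable_on range (\<lambda>n. - int n)"
    by (subst summable_on_reindex) (use n in \<open>auto simp: o_def inj_on_def\<close>)
  have "range int \<union> range (\<lambda>n. - int n) = UNIV"
  proof -
    have "k \<in> range int \<union> range (\<lambda>n. - int n)" for k
    proof -
      have "k = int (nat k) \<or> k = - int (nat (- k))" by linarith
      thus ?thesis by blast
    qed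
    thus ?thesis by blast
  qed
  thus ?thesis using summable_on_union[OF 1 2] by simp
qed

text \<open>Division by zero drops the singular terms; the others are dominated by the sum of two
  inverse squares.\<close>

lemma summable_int_inverse_square_pair:
  "(\<lambda>k::int. 1 / (\<bar>real_of_int k\<bar> * \<bar>real_of_int (k + p)\<bar>)) summable_on UNIV"
proof -
  have sq: "\<bar>real_of_int k\<bar> powr (-2) = 1 / (real_of_int k)\<^sup>2" for k
    by (simp add: powr_minus_divide powr_numeral[of "\<bar>real_of_int k\<bar>" "num.Bit0 num.One"] powr_realpow')
  have s1: "(\<lambda>k::int. 1 / (real_of_int k)\<^sup>2) summable_on UNIV"
    using summable_int_powr[of "-2"] by (simp add: sq)
  have "bij (\<lambda>k::int. k + p)" by (rule bij_plus_right)
  hence s2: "(\<lambda>k::int. 1 / (real_of_int (k + p))\<^sup>2) summable_on UNIV"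
    using summable_on_reindex_bij_betw[of "\<lambda>k. k + p" UNIV UNIV "\<lambda>k. 1 / (real_of_int k)\<^sup>2"] s1 by simp
  have s: "(\<lambda>k::int. 1 / (real_of_int k)\<^sup>2 + 1 / (real_of_int (k + p))\<^sup>2) summable_on UNIV"
    by (rule summable_on_add[OF s1 s2])
  show ?thesis
  proof (rule summable_on_comparison_test[OF s])
    fix k :: int
    define a b where "a = 1 / \<bar>real_of_int k\<bar>" and "b = 1 / \<bar>real_of_int (k + p)\<bar>"
    have "0 \<le> (a - b)\<^sup>2 + a\<^sup>2 + b\<^sup>2" by simp
    hence "a * b \<le> a\<^sup>2 + b\<^sup>2" by (simp add: power2_eq_square algebra_simps)
    thus "1 / (\<bar>real_of_int k\<bar> * \<bar>real_of_int (k + p)\<bar>) \<le> 1 / (real_of_int k)\<^sup>2 + 1 / (real_of_int (k + p))\<^sup>2"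
      by (simp add: a_def b_def power_divide)
  qed auto
qed

lemma integral_by_parts_zero_mean:
  assumes g: "integrable leb01 g"
  shows "ac01 (prim g)" "AE x in leb01. (prim g has_vector_derivative g x) (at x within {0..1})" "continuous_on {0..1} (prim g)"
  by (rule ac01_prim[OF g], rule prim_has_derivative_AE[OF g], rule ac01_continuous_on[OF ac01_prim[OF g]])

text \<open>Up to the factor \<open>(2 * pi * \<i>)\<^sup>2\<close>, \<open>T p\<close> is the
  coefficient of \<open>Q\<^sup>2\<close> for the periodic antiderivative \<open>Q\<close> of
  \<open>q\<close> minus its mean. The derivative \<open>2 * Q * q0\<close> of the square is
  integrable, so the Riemann-Lebesgue lemma gains the decay \<open>o (1 / p)\<close> that bounds of
  the single terms cannot give.\<close>

theorem fcoeff_antiderivative_square: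
  assumes q: "integrable leb01 q" and a: "\<And>k. a k = (if k = 0 then 0 else fcoeff q k)"
  shows "\<exists>T. (\<forall>p. ((\<lambda>j. (a j / of_int j) * (a (p - j) / of_int (p - j))) has_sum T p) UNIV) \<and>
     (\<forall>e>0. \<exists>N. \<forall>p. \<bar>p\<bar> \<ge> N \<longrightarrow> \<bar>real_of_int p\<bar> * cmod (T p) < e)"
proof -
  define q0 where "q0 x = q x - fcoeff q 0" for x
  have q0: "integrable leb01 q0" unfolding q0_def using q integrable_const01[of "fcoeff q 0"] by auto
  have fcq0: "fcoeff q0 k = a k" for k
  proof -
    have "fcoeff q0 k = fcoeff q k - fcoeff (\<lambda>x. fcoeff q 0 * 1) k" unfolding q0_def using fcoeff_diff[OF q integrable_const01[of "fcoeff q 0"], of k] by simp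
    also have "\<dots> = a k" by (subst fcoeff_cmult) (simp add: fcoeff_const a)
    finally show ?thesis .
  qed
  have a0: "a 0 = 0" by (simp add: a)
  define P where "P = prim q0"
  \<comment> \<open>With mean zero, \<open>Q\<close> has coefficient 0 at index 0, in agreement with
    the default \<open>a 0 / of_int 0 = 0\<close>.\<close>
  define Q where "Q x = P x - fcoeff P 0" for x
  note P = integral_by_parts_zero_mean[OF q0, folded P_def]
  have P01: "P 0 = 0" "P 1 = 0" unfolding P_def using fcq0[of 0] a0 by (simp_all add: prim_1 fcoeff_def)
  have Qac: "ac01 Q"
    by (rule ac01_dominated[OF P(1), of 1]) (auto simp: Q_def)
  have Qd: "AE x in leb01. (Q has_vector_derivative q0 x) (at x within {0..1})"
    using P(2)
  proof eventually_elim
    fix x assume "(P has_vector_derivative q0 x) (at x within {0..1})"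
    from has_vector_derivative_diff[OF this has_vector_derivative_const[of "fcoeff P 0"]]
    show "(Q has_vector_derivative q0 x) (at x within {0..1})" by (simp add: Q_def[abs_def])
  qed
  have Qc: "continuous_on {0..1} Q" by (rule ac01_continuous_on[OF Qac])
  have Qi: "integrable leb01 Q" by (rule integrable_leb01_continuous[OF Qc])
  have Qper: "Q 0 = Q 1" by (simp add: Q_def P01)
  have fcQ0: "fcoeff Q 0 = 0"
  proof -
    have "fcoeff Q 0 = fcoeff P 0 - fcoeff (\<lambda>x. fcoeff P 0 * 1) 0" unfolding Q_def
      using fcoeff_diff[OF integrable_leb01_continuous[OF P(3)] integrable_const01[of "fcoeff P 0"], of 0] by simp
    also have "\<dots> = 0" by (subst fcoeff_cmult) (simp add: fcoeff_const)
    finally show ?thesis .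
  qed
  have aQ: "a k = (2 * pi * \<i> * of_int k) * fcoeff Q k" for k
    using fcoeff_by_parts[OF Qac Qd, of k] fcq0 Qper by simp
  have fcQ: "a k / of_int k = (2 * pi * \<i>) * fcoeff Q k" for k
    using aQ[of k] fcQ0 by (cases "k = 0") auto
  define M where "M = (\<integral>x. cmod (q0 x) \<partial>leb01)"
  have M: "cmod (a k) \<le> M" for k using fcoeff_bound[OF q0, of k] fcq0 by (simp add: M_def)
  have fcQb: "cmod (fcoeff Q k) \<le> M / \<bar>real_of_int k\<bar>" for k
  proof (cases "k = 0")
    case False
    have "2 * pi * (\<bar>real_of_int k\<bar> * cmod (fcoeff Q k)) = cmod (a k)" unfolding aQ by (simp add: norm_mult)
    moreover have "1 * (\<bar>real_of_int k\<bar> * cmod (fcoeff Q k)) \<le> 2 * pi * (\<bar>real_of_int k\<bar> * cmod (fcoeff Q k))"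
      using pi_ge_two by (intro mult_right_mono) auto
    ultimately have "\<bar>real_of_int k\<bar> * cmod (fcoeff Q k) \<le> M" using M[of k] by simp
    thus ?thesis using False by (simp add: field_simps)
  qed (simp add: fcQ0)
  \<comment> \<open>The coefficients of \<open>Q\<close> are only known to be
    \<open>O (1 / k)\<close>, which is not summable, so the convolution formula is not applied to
    \<open>Q * Q\<close> but to \<open>q0 * W\<close>, where \<open>W\<close> is an antiderivative
    of \<open>Q * fexp (- p)\<close> minus its mean. The coefficients of \<open>W\<close> are
    \<open>O (1 / (k * (k + p)))\<close>, and integration by parts leads back to
    \<open>Q * Q\<close>.\<close>
  have key: "((\<lambda>j. fcoeff Q j * fcoeff Q (p - j)) has_sum fcoeff (\<lambda>x. Q x * Q x) p) UNIV" for p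
  proof -
    define c where "c = fcoeff Q p"
    define w where "w x = Q x * fexp (-p) x - c" for x
    have wi: "integrable leb01 w" unfolding w_def using integrable_mult_fexp[OF Qi, of "-p"] integrable_const01[of c] by auto
    define W where "W = prim w"
    note W = integral_by_parts_zero_mean[OF wi, folded W_def]
    have fcw: "fcoeff w k = fcoeff Q (k + p) - (if k = 0 then c else 0)" for k
    proof -
      have "fcoeff w k = fcoeff (\<lambda>x. Q x * fexp (-p) x) k - fcoeff (\<lambda>x. c * 1) k" unfolding w_def
        using fcoeff_diff[OF integrable_mult_fexp[OF Qi, of "-p"] integrable_const01[of c], of k] by simp
      also have "\<dots> = fcoeff Q (k + p) - (if k = 0 then c else 0)" by (subst fcoeff_cmult) (simp add: fcoeff_const fcoeff_mult_fexp)
      finally show ?thesis .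
    qed
    have W01: "W 0 = 0" "W 1 = 0" unfolding W_def using fcw[of 0] by (simp_all add: prim_1 fcoeff_def c_def)
    have fcW: "(2 * pi * \<i> * of_int k) * fcoeff W k = fcoeff Q (k + p)" if "k \<noteq> 0" for k
      using fcoeff_by_parts[OF W(1,2), of k] W01 fcw[of k] that by simp
    have Wsum: "(\<lambda>k. cmod (fcoeff W k)) summable_on UNIV"
    proof -
      have s: "(\<lambda>k. M * (1 / (\<bar>real_of_int k\<bar> * \<bar>real_of_int (k + p)\<bar>))) summable_on UNIV"
        by (intro summable_on_cmult_right summable_int_inverse_square_pair)
      have "(\<lambda>k. cmod (fcoeff W k)) summable_on (UNIV - {0})"
      proof (rule summable_on_comparison_test[OF summable_on_subset_banach[OF s]])
        fix k :: int assume "k \<in> UNIV - {0}"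
        hence k: "k \<noteq> 0" by simp
        have "2 * pi * \<bar>real_of_int k\<bar> * cmod (fcoeff W k) = cmod (fcoeff Q (k + p))" unfolding fcW[OF k, symmetric] by (simp add: norm_mult)
        moreover have "1 * (\<bar>real_of_int k\<bar> * cmod (fcoeff W k)) \<le> 2 * pi * (\<bar>real_of_int k\<bar> * cmod (fcoeff W k))"
          using pi_ge_two by (intro mult_right_mono) auto
        ultimately have "\<bar>real_of_int k\<bar> * cmod (fcoeff W k) \<le> M / \<bar>real_of_int (k + p)\<bar>" using fcQb[of "k + p"] by (simp add: mult.assoc)
        hence "cmod (fcoeff W k) \<le> (M / \<bar>real_of_int (k + p)\<bar>) / \<bar>real_of_int k\<bar>" using k by (subst pos_le_divide_eq) (auto simp: mult.commute)
        thus "cmod (fcoeff W k) \<le> M * (1 / (\<bar>real_of_int k\<bar> * \<bar>real_of_int (k + p)\<bar>))" by (simp add: mult.commute)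
      qed auto
      thus ?thesis using summable_on_cofin_subset[of "\<lambda>k. cmod (fcoeff W k)" UNIV "{0}"] by (metis (no_types, lifting) Diff_UNIV finite.emptyI finite_insert insert_UNIV summable_on_insert_iff insert_Diff_single)
    qed
    have Wser: "W x = fseries (fcoeff W) x" if "x \<in> {0..1}" for x
      by (rule fseries_unique[OF W(3) _ Wsum refl that]) (simp add: W01)
    have "((\<lambda>l. fcoeff W l * fcoeff q0 (0 - l)) has_sum fcoeff (\<lambda>x. q0 x * fseries (fcoeff W) x) 0) UNIV"
      by (rule fcoeff_mult_fseries[OF q0 Wsum])
    moreover have "fcoeff (\<lambda>x. q0 x * fseries (fcoeff W) x) 0 = (\<integral>x. q0 x * W x \<partial>leb01)"
      unfolding fcoeff_def[of "\<lambda>x. q0 x * fseries (fcoeff W) x"] by (intro Bochner_Integration.integral_cong refl) (simp add: Wser)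
    moreover have "(\<integral>x. q0 x * W x \<partial>leb01) = - fcoeff (\<lambda>x. Q x * Q x) p"
    proof -
      have "(\<integral>x. q0 x * W x \<partial>leb01) = Q 1 * W 1 - Q 0 * W 0 - (\<integral>x. Q x * w x \<partial>leb01)"
        by (rule integration_by_parts_01[OF Qac Qd W(1,2)])
      also have "(\<integral>x. Q x * w x \<partial>leb01) = (\<integral>x. Q x * Q x * fexp (-p) x - c * Q x \<partial>leb01)"
        by (intro Bochner_Integration.integral_cong refl) (simp add: w_def algebra_simps)
      also have "\<dots> = fcoeff (\<lambda>x. Q x * Q x) p - c * fcoeff Q 0"
        unfolding fcoeff_def using integrable_mult_fexp[OF integrable_leb01_mult_continuous(1)[OF Qi Qc], of "-p"] Qi by simp
      finally show ?thesis by (simp add: W01 fcQ0)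
    qed
    ultimately have "((\<lambda>l. fcoeff W l * fcoeff q0 (0 - l)) has_sum - fcoeff (\<lambda>x. Q x * Q x) p) UNIV" by simp
    moreover have "fcoeff W l * fcoeff q0 (0 - l) = - (fcoeff Q (- l) * fcoeff Q (p - (- l)))" for l
    proof (cases "l = 0")
      case True thus ?thesis by (simp add: fcq0 a0 fcQ0)
    next
      case False
      have "fcoeff W l * fcoeff q0 (0 - l) = fcoeff W l * ((2 * pi * \<i> * of_int (-l)) * fcoeff Q (-l))" using aQ[of "-l"] by (simp add: fcq0)
      also have "\<dots> = - (fcoeff Q (-l) * ((2 * pi * \<i> * of_int l) * fcoeff W l))" by simp
      also have "\<dots> = - (fcoeff Q (- l) * fcoeff Q (p - (- l)))" using fcW[OF False] by (simp add: add.commute)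
      finally show ?thesis .
    qed
    ultimately have "((\<lambda>l. - (fcoeff Q (- l) * fcoeff Q (p - (- l)))) has_sum - fcoeff (\<lambda>x. Q x * Q x) p) UNIV" by simp
    hence "((\<lambda>l. fcoeff Q (- l) * fcoeff Q (p - (- l))) has_sum fcoeff (\<lambda>x. Q x * Q x) p) UNIV" by (simp add: has_sum_uminus)
    moreover have "bij (uminus :: int \<Rightarrow> int)" by (rule bij_uminus)
    ultimately show ?thesis
      using has_sum_reindex_bij_betw[of uminus UNIV UNIV "\<lambda>j. fcoeff Q j * fcoeff Q (p - j)"] by simp
  qed
  define T where "T p = (2 * pi * \<i>) * (2 * pi * \<i>) * fcoeff (\<lambda>x. Q x * Q x) p" for p
  have sumT: "((\<lambda>j. (a j / of_int j) * (a (p - j) / of_int (p - j))) has_sum T p) UNIV" for p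
  proof -
    have "((\<lambda>j. ((2 * pi * \<i>) * (2 * pi * \<i>)) * (fcoeff Q j * fcoeff Q (p - j))) has_sum T p) UNIV"
      unfolding T_def by (rule has_sum_cmult_right[OF key])
    moreover have "((2 * pi * \<i>) * (2 * pi * \<i>)) * (fcoeff Q j * fcoeff Q (p - j)) = (a j / of_int j) * (a (p - j) / of_int (p - j))" for j
      unfolding fcQ by simp
    ultimately show ?thesis by simp
  qed
  have Q2d: "AE x in leb01. ((\<lambda>x. Q x * Q x) has_vector_derivative 2 * Q x * q0 x) (at x within {0..1})"
    using Qd
  proof eventually_elim
    fix x assume h: "(Q has_vector_derivative q0 x) (at x within {0..1})"
    from has_vector_derivative_mult[OF h h] show "((\<lambda>x. Q x * Q x) has_vector_derivative 2 * Q x * q0 x) (at x within {0..1})"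
      by (simp add: algebra_simps)
  qed
  have Q2i: "integrable leb01 (\<lambda>x. 2 * Q x * q0 x)"
    by (rule FTC_AE(1)[OF ac01_mult[OF Qac Qac] Q2d])
  have fcQ2: "fcoeff (\<lambda>x. 2 * Q x * q0 x) p = (2 * pi * \<i> * of_int p) * fcoeff (\<lambda>x. Q x * Q x) p" for p
    using fcoeff_by_parts[OF ac01_mult[OF Qac Qac] Q2d, of p] Qper by simp
  have "\<exists>N. \<forall>p. \<bar>p\<bar> \<ge> N \<longrightarrow> \<bar>real_of_int p\<bar> * cmod (T p) < e" if e: "e > 0" for e
  proof -
    have "e / (2 * pi) > 0" using e by simp
    from Riemann_Lebesgue[OF Q2i this] obtain N where N: "\<And>k. \<bar>k\<bar> \<ge> N \<Longrightarrow> cmod (fcoeff (\<lambda>x. 2 * Q x * q0 x) k) < e / (2 * pi)" by blast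
    show ?thesis
    proof (intro exI[of _ N] allI impI)
      fix p assume "N \<le> \<bar>p\<bar>"
      from N[OF this] have "2 * pi * cmod (fcoeff (\<lambda>x. 2 * Q x * q0 x) p) < e" by (simp add: field_simps)
      moreover have "cmod (fcoeff (\<lambda>x. 2 * Q x * q0 x) p) = 2 * pi * \<bar>real_of_int p\<bar> * cmod (fcoeff (\<lambda>x. Q x * Q x) p)"
        unfolding fcQ2 by (simp add: norm_mult)
      moreover have "cmod (T p) = 4 * pi * pi * cmod (fcoeff (\<lambda>x. Q x * Q x) p)" by (simp add: T_def norm_mult)
      ultimately show "\<bar>real_of_int p\<bar> * cmod (T p) < e" by (simp add: mult_ac)
    qed
  qed
  thus ?thesis using sumT by blast
qed

section \<open>The equation for the Fourier coefficients of an eigenfunction\<close>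

text \<open>Submultiplicative, so that sup bounds weighted by \<open>weight ^ m\<close> survive
  convolution; this carries the decay of order \<open>m\<close> from the potential to the
  solutions.\<close>

definition weight :: "int \<Rightarrow> real" where "weight k = 1 + \<bar>real_of_int k\<bar>"

lemma weight_ge_1: "weight k \<ge> 1" by (simp add: weight_def)
lemma weight_pos [simp]: "weight k > 0" by (simp add: weight_def)
lemma weight_nonneg [simp]: "weight k \<ge> 0" by (simp add: weight_def)
lemma weight_minus [simp]: "weight (- k) = weight k" by (simp add: weight_def)
lemma weight_submult: "weight (j + k) \<le> weight j * weight k"
proof -
  have "\<bar>real_of_int (j + k)\<bar> \<le> \<bar>real_of_int j\<bar> + \<bar>real_of_int k\<bar>" by simp
  moreover have "0 \<le> \<bar>real_of_int j\<bar> * \<bar>real_of_int k\<bar>" by simp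
  moreover have "weight j * weight k = 1 + \<bar>real_of_int j\<bar> + \<bar>real_of_int k\<bar> + \<bar>real_of_int j\<bar> * \<bar>real_of_int k\<bar>" by (simp add: weight_def algebra_simps)
  ultimately show ?thesis unfolding weight_def[of "j + k"] by linarith
qed
lemma weight_power_submult: "weight (j + k) ^ m \<le> weight j ^ m * weight k ^ m"
  unfolding power_mult_distrib[symmetric] by (intro power_mono weight_submult) (simp add: weight_def)

text \<open>Since division by zero yields zero, this vanishes at the two resonant indices.\<close>

definition gap :: "int \<Rightarrow> int \<Rightarrow> real" where
  "gap n j = 1 / (\<bar>real_of_int j\<bar> * \<bar>real_of_int (j + n)\<bar>)"

definition gap_sum :: "int \<Rightarrow> real" where
  "gap_sum n = (\<Sum>\<^sub>\<infinity>j. gap n j)"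

lemma gap_summable: "gap n summable_on UNIV"
  unfolding gap_def[abs_def] by (rule summable_int_inverse_square_pair)
lemma gap_nonneg [simp]: "gap n j \<ge> 0" by (simp add: gap_def)
lemma gap_sum_nonneg: "gap_sum n \<ge> 0" unfolding gap_sum_def by (intro infsum_nonneg) simp
lemma gap_resonant [simp]: "gap n 0 = 0" "gap n (- n) = 0" by (simp_all add: gap_def)
lemma gap_reflect: "gap n (- n - j) = gap n j"
proof -
  have "\<bar>real_of_int (- n - j)\<bar> = \<bar>real_of_int (j + n)\<bar>" "- n - j + n = - j" by simp_all
  thus ?thesis unfolding gap_def by (simp only: ) (simp add: mult.commute)
qed
lemma gap_le_sum: "gap n j \<le> gap_sum n"
proof -
  have "sum (gap n) {j} \<le> gap_sum n" unfolding gap_sum_def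
    by (rule finite_sum_le_infsum[OF gap_summable]) auto
  thus ?thesis by simp
qed
lemma gap_le_1: "gap n j \<le> 1"
proof (cases "j = 0 \<or> j + n = 0")
  case False
  hence "1 \<le> \<bar>real_of_int j\<bar>" "1 \<le> \<bar>real_of_int (j + n)\<bar>" by linarith+
  from mult_mono[OF this] show ?thesis by (simp add: gap_def)
qed (auto simp: gap_def simp del: of_int_add)

text \<open>The true order is \<open>log n / n\<close>. What the applications need is that
  \<open>n * (gap_sum n)\<^sup>2\<close> tends to 0, so any exponent strictly between -1 and -1/2
  would serve; -3/4 leaves the summable power -5/4 for the smaller factor.\<close>

lemma gap_sum_bound: "\<exists>K. \<forall>n\<ge>1. gap_sum n \<le> K * real_of_int n powr (-3/4)"
proof -
  define h where "h j = \<bar>real_of_int j\<bar> powr (-5/4)" for j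
  have hs: "h summable_on UNIV" unfolding h_def[abs_def] by (rule summable_int_powr) simp
  define Z where "Z = infsum h UNIV"
  have "gap_sum n \<le> 4 * Z * real_of_int n powr (-3/4)" if n: "n \<ge> 1" for n
  proof -
    have bij: "bij (\<lambda>k::int. k + n)" by (rule bij_plus_right)
    have hs2: "(\<lambda>j. h (j + n)) summable_on UNIV" using summable_on_reindex_bij_betw[OF bij, of h] hs by simp
    have Z2: "infsum (\<lambda>j. h (j + n)) UNIV = Z" using infsum_reindex_bij_betw[OF bij, of h] by (simp add: Z_def)
    have hh: "(\<lambda>j. h j + h (j + n)) summable_on UNIV" by (rule summable_on_add[OF hs hs2])
    have bd: "gap n j \<le> 2 * real_of_int n powr (-3/4) * (h j + h (j + n))" for j
    proof (cases "j = 0 \<or> j + n = 0")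
      case True thus ?thesis by (auto simp: gap_def h_def simp del: of_int_add)
    next
      case False
      \<comment> \<open>The smaller and the larger of the two distances;
        \<open>M \<ge> n / 2\<close> because they add up to at least \<open>n\<close>.\<close>
      define r M where "r = min \<bar>real_of_int j\<bar> \<bar>real_of_int (j + n)\<bar>" and "M = max \<bar>real_of_int j\<bar> \<bar>real_of_int (j + n)\<bar>"
      have r1: "r \<ge> 1" using False by (auto simp: r_def)
      have rM: "r \<le> M" by (simp add: r_def M_def)
      have Mn: "real_of_int n / 2 \<le> M"
      proof -
        have "real_of_int n \<le> \<bar>real_of_int j\<bar> + \<bar>real_of_int (j + n)\<bar>" by simp
        thus ?thesis unfolding M_def by linarith
      qed
      have n0: "real_of_int n > 0" using n by simp
      have "1 / (r * M) = r powr (-1) * (M powr (-1/4) * M powr (-3/4))"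
        using r1 rM by (simp add: powr_minus_divide powr_add[symmetric])
      \<comment> \<open>A quarter power of \<open>M\<close> is spent on \<open>r \<le> M\<close>,
        the remaining three quarters on \<open>n / 2 \<le> M\<close>.\<close>
      also have "\<dots> \<le> r powr (-1) * (r powr (-1/4) * (real_of_int n / 2) powr (-3/4))"
        using r1 rM Mn n0 by (intro mult_left_mono mult_mono powr_mono2') auto
      also have "\<dots> = r powr (-5/4) * (real_of_int n powr (-3/4) * (1/2) powr (-3/4))"
      proof -
        have "r powr (-5/4) = r powr (-1) * r powr (-1/4)" using powr_add[of r "-1" "-1/4"] by simp
        moreover have "(real_of_int n / 2) powr (-3/4) = real_of_int n powr (-3/4) * (1/2) powr (-3/4)"
          using n0 powr_mult[of "real_of_int n" "1/2" "-3/4"] by simp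
        ultimately show ?thesis by (simp only: mult_ac)
      qed
      also have "\<dots> \<le> r powr (-5/4) * (real_of_int n powr (-3/4) * 2)"
      proof (intro mult_left_mono)
        have "(1/2::real) powr (-3/4) = 2 powr (3/4)" by (simp add: powr_minus_divide powr_divide)
        also have "\<dots> \<le> 2 powr 1" by (intro powr_mono) auto
        finally show "(1/2::real) powr (-3/4) \<le> 2" by simp
      qed auto
      also have "\<dots> \<le> (h j + h (j + n)) * (real_of_int n powr (-3/4) * 2)"
        by (intro mult_right_mono) (auto simp: r_def h_def min_def)
      finally have "1 / (r * M) \<le> 2 * real_of_int n powr (-3/4) * (h j + h (j + n))" by (simp add: mult_ac)
      moreover have "r * M = \<bar>real_of_int j\<bar> * \<bar>real_of_int (j + n)\<bar>" by (auto simp: r_def M_def min_def max_def)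
      ultimately show ?thesis by (simp add: gap_def)
    qed
    have "gap_sum n \<le> (\<Sum>\<^sub>\<infinity>j. 2 * real_of_int n powr (-3/4) * (h j + h (j + n)))"
      unfolding gap_sum_def by (intro infsum_mono gap_summable summable_on_cmult_right hh bd)
    also have "\<dots> = 2 * real_of_int n powr (-3/4) * (Z + Z)"
      by (subst infsum_cmult_right[OF hh]) (simp add: infsum_add[OF hs hs2] Z2 Z_def[symmetric])
    finally show ?thesis by (simp add: mult_ac)
  qed
  thus ?thesis by blast
qed

text \<open>The difference \<open>(pi * (n + 2 * j))\<^sup>2 - (pi * n)\<^sup>2\<close> of the
  squared frequencies; index \<open>j\<close> belongs to the exponential of frequency
  \<open>n + 2 * j\<close>, so the resonant indices 0 and \<open>- n\<close> belong to
  \<open>n\<close> and \<open>- n\<close>.\<close>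

definition detuning :: "int \<Rightarrow> int \<Rightarrow> complex" where
  "detuning n j = of_real (4 * pi\<^sup>2 * of_int j * of_int (j + n))"

lemma detuning_reflect: "detuning n (- n - j) = detuning n j"
  by (simp add: detuning_def algebra_simps)
lemma detuning_resonant [simp]: "detuning n 0 = 0" "detuning n (- n) = 0" by (simp_all add: detuning_def)

text \<open>Away from resonance the modulus of \<open>detuning\<close> is at least 16 times the
  integer product in \<open>gap\<close>, which leaves room for a perturbation \<open>z\<close> of
  modulus at most 1.\<close>

lemma detuning_bound:
  assumes "j \<noteq> 0" "j \<noteq> - n" "cmod z \<le> 1"
  shows "cmod (1 / (detuning n j + z)) \<le> gap n j" "detuning n j + z \<noteq> 0"
proof -
  define \<delta> where "\<delta> = \<bar>real_of_int j\<bar> * \<bar>real_of_int (j + n)\<bar>"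
  have "1 \<le> \<bar>real_of_int j\<bar>" "1 \<le> \<bar>real_of_int (j + n)\<bar>" using assms by linarith+
  from mult_mono[OF this] have d1: "\<delta> \<ge> 1" by (simp add: \<delta>_def)
  have "4 \<le> pi\<^sup>2" using power_mono[OF pi_ge_two, of 2] by simp
  hence "16 * \<delta> \<le> 4 * pi\<^sup>2 * \<delta>" using d1 by (intro mult_right_mono) auto
  also have "\<dots> = cmod (detuning n j)" unfolding detuning_def norm_of_real \<delta>_def by (simp add: abs_mult)
  also have "\<dots> \<le> cmod (detuning n j + z) + cmod z" by (metis add_diff_cancel_right' norm_triangle_ineq4)
  finally have *: "\<delta> \<le> cmod (detuning n j + z)" using assms(3) d1 by linarith
  thus "detuning n j + z \<noteq> 0" using d1 by auto
  show "cmod (1 / (detuning n j + z)) \<le> gap n j" using * d1 by (simp add: norm_divide gap_def \<delta>_def[symmetric] frac_le del: of_int_add)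
qed

section \<open>Elimination of the nonresonant coefficients\<close>

lemma infsum_diff_complex:
  fixes f g :: "int \<Rightarrow> complex"
  assumes "f summable_on UNIV" "g summable_on UNIV"
  shows "(\<Sum>\<^sub>\<infinity>l. f l - g l) = infsum f UNIV - infsum g UNIV"
proof -
  have "(\<lambda>l. - g l) summable_on UNIV" using assms(2) by (simp add: summable_on_uminus)
  from infsum_add[OF assms(1) this] show ?thesis by (simp add: infsum_uminus)
qed

text \<open>The library proves completeness of bounded continuous functions only over metric domains,
  and \<^typ>\<open>int\<close> is not an instance.\<close>

lemma int_bcontfunI:
  fixes g :: "int \<Rightarrow> complex"
  assumes "\<And>x. cmod (g x) \<le> K"
  shows "g \<in> bcontfun"
  unfolding bcontfun_def
proof (intro CollectI conjI)
  show "continuous_on UNIV g" by (subst continuous_on_open_vimage, auto simp: open_discrete)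
  show "bounded (range g)" using assms unfolding bounded_iff by auto
qed

lemma complete_bcontfun_int: "complete (UNIV :: (int \<Rightarrow>\<^sub>C complex) set)"
  unfolding complete_def
proof (intro allI impI, elim conjE)
  fix f :: "nat \<Rightarrow> int \<Rightarrow>\<^sub>C complex" assume f: "Cauchy f"
  have "Cauchy (\<lambda>n. apply_bcontfun (f n) x)" for x
    using f unfolding Cauchy_def by (meson dist_bounded order_le_less_trans)
  hence "\<forall>x. \<exists>l. (\<lambda>n. apply_bcontfun (f n) x) \<longlonglongrightarrow> l" using Cauchy_convergent_iff convergent_def by blast
  then obtain g where g: "\<And>x. (\<lambda>n. apply_bcontfun (f n) x) \<longlonglongrightarrow> g x" by metis
  have lim: "\<exists>N. \<forall>n\<ge>N. \<forall>x. dist (apply_bcontfun (f n) x) (g x) \<le> e" if e: "e > 0" for e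
  proof -
    obtain N where N: "\<And>m n. m \<ge> N \<Longrightarrow> n \<ge> N \<Longrightarrow> dist (f m) (f n) < e" using f e unfolding Cauchy_def by blast
    have "dist (apply_bcontfun (f n) x) (g x) \<le> e" if "n \<ge> N" for n x
    proof (rule tendsto_upperbound[of "\<lambda>k. dist (apply_bcontfun (f n) x) (apply_bcontfun (f k) x)" _ sequentially])
      show "(\<lambda>k. dist (apply_bcontfun (f n) x) (apply_bcontfun (f k) x)) \<longlonglongrightarrow> dist (apply_bcontfun (f n) x) (g x)"
        by (intro tendsto_intros g)
      show "\<forall>\<^sub>F k in sequentially. dist (apply_bcontfun (f n) x) (apply_bcontfun (f k) x) \<le> e"
        unfolding eventually_sequentially
        using N[OF that] dist_bounded[of "f n" x] by (intro exI[of _ N]) (meson less_imp_le order_trans)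
    qed simp
    thus ?thesis by blast
  qed
  obtain N where N: "\<And>x. dist (apply_bcontfun (f N) x) (g x) \<le> 1" using lim[of 1] by auto
  have gb: "cmod (g x) \<le> norm (f N) + 1" for x
    using N[of x] norm_bounded[of "f N" x] norm_triangle_ineq2[of "g x" "apply_bcontfun (f N) x"]
    by (simp add: dist_norm norm_minus_commute)
  have G: "apply_bcontfun (Bcontfun g) = g" by (rule Bcontfun_inverse[OF int_bcontfunI[OF gb]])
  have "f \<longlonglongrightarrow> Bcontfun g"
  proof (rule metric_LIMSEQ_I)
    fix e :: real assume "e > 0"
    then obtain N where N: "\<And>n x. n \<ge> N \<Longrightarrow> dist (apply_bcontfun (f n) x) (g x) \<le> e/2" using lim[of "e/2"] by auto
    have "dist (f n) (Bcontfun g) < e" if "n \<ge> N" for n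
    proof -
      have "dist (f n) (Bcontfun g) \<le> e/2" by (rule dist_bound, unfold G, rule N[OF that])
      thus ?thesis using \<open>e > 0\<close> by simp
    qed
    thus "\<exists>no. \<forall>n\<ge>no. dist (f n) (Bcontfun g) < e" by blast
  qed
  thus "\<exists>l\<in>UNIV. f \<longlonglongrightarrow> l" by blast
qed

text \<open>\<open>a\<close> stands for the coefficients of the potential with the mean moved into
  the spectral parameter, hence \<open>a0\<close>. The bound \<open>half\<close> makes the
  elimination a contraction with factor 1/2.\<close>

locale lattice =
  fixes a :: "int \<Rightarrow> complex" and m :: nat and C :: real and n :: int
  assumes n: "n \<ge> 1" and a0: "a 0 = 0" and aC: "\<And>k. cmod (a k) * weight k ^ m \<le> C" and half: "C * gap_sum n \<le> 1/2"
begin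

text \<open>Together with the index reflection \<open>- n - j\<close>, replacing \<open>a k\<close>
  by \<open>a (- k)\<close> exchanges the two resonant indices, so results for index 0 are available
  for \<open>- n\<close> as well.\<close>

lemma reflect: "lattice (\<lambda>k. a (- k)) m C n"
proof unfold_locales
  show "cmod (a (- k)) * weight k ^ m \<le> C" for k using aC[of "- k"] by simp
qed (use n a0 half in auto)

lemma C_nonneg: "C \<ge> 0" using aC[of 0] by (simp add: a0 weight_def)

lemma a_bound: "cmod (a k) \<le> C / weight k ^ m"
  using aC[of k] by (simp add: field_simps)

lemma a_le_C: "cmod (a k) \<le> C"
proof -
  have "cmod (a k) * 1 \<le> cmod (a k) * weight k ^ m" using one_le_power[OF weight_ge_1] by (intro mult_left_mono) auto
  thus ?thesis using aC[of k] by simp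
qed

text \<open>The weight of \<open>j\<close> is split over \<open>j - l\<close> and \<open>l\<close>,
  and \<open>gap\<close> is left to provide summability; this is the estimate behind the
  contraction.\<close>

lemma conv_term:
  assumes "cmod (w l) \<le> K * gap n l / weight l ^ m" "K \<ge> 0"
  shows "cmod (a (j - l) * w l) * weight j ^ m \<le> C * K * gap n l"
proof -
  have "cmod (a (j - l) * w l) * weight j ^ m \<le> (cmod (a (j - l)) * (K * gap n l / weight l ^ m)) * (weight (j - l) ^ m * weight l ^ m)"
    unfolding norm_mult using assms weight_power_submult[of "j - l" l m]
    by (intro mult_mono mult_left_mono) auto
  also have "\<dots> = (cmod (a (j - l)) * weight (j - l) ^ m) * (K * gap n l)" by (simp add: less_imp_neq[OF weight_pos, symmetric])
  also have "\<dots> \<le> C * (K * gap n l)" using assms aC by (intro mult_right_mono) auto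
  finally show ?thesis by (simp add: mult.assoc)
qed

lemma conv_summable:
  assumes "\<And>l. cmod (w l) \<le> K * gap n l / weight l ^ m" "K \<ge> 0"
  shows "(\<lambda>l. cmod (a (j - l) * w l)) summable_on UNIV" "(\<lambda>l. a (j - l) * w l) summable_on UNIV"
     "cmod (\<Sum>\<^sub>\<infinity>l. a (j - l) * w l) * weight j ^ m \<le> C * K * gap_sum n"
proof -
  have t: "cmod (a (j - l) * w l) \<le> C * K * gap n l / weight j ^ m" for l
    using conv_term[where w = w and l = l, OF assms(1) assms(2), of j] by (simp add: field_simps)
  have s: "(\<lambda>l. C * K * gap n l / weight j ^ m) summable_on UNIV"
    using summable_on_cmult_right[OF gap_summable, of "C * K / weight j ^ m" n] by simp
  show s1: "(\<lambda>l. cmod (a (j - l) * w l)) summable_on UNIV" by (rule summable_on_comparison_test[OF s t]) auto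
  show "(\<lambda>l. a (j - l) * w l) summable_on UNIV" by (rule abs_summable_summable[OF s1])
  have "cmod (\<Sum>\<^sub>\<infinity>l. a (j - l) * w l) \<le> (\<Sum>\<^sub>\<infinity>l. cmod (a (j - l) * w l))" by (rule norm_infsum_bound[OF s1])
  also have "\<dots> \<le> (\<Sum>\<^sub>\<infinity>l. C * K * gap n l / weight j ^ m)" by (rule infsum_mono[OF s1 s t])
  also have "\<dots> = C * K / weight j ^ m * gap_sum n" unfolding gap_sum_def by (subst infsum_cmult_right[OF gap_summable, symmetric]) simp
  finally show "cmod (\<Sum>\<^sub>\<infinity>l. a (j - l) * w l) * weight j ^ m \<le> C * K * gap_sum n" by (simp add: field_simps)
qed

definition res :: "complex \<Rightarrow> int \<Rightarrow> complex" where
  "res z j = (if j = 0 \<or> j = - n then 0 else 1 / (detuning n j + z))"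

lemma res_bound: "cmod z \<le> 1 \<Longrightarrow> cmod (res z j) \<le> gap n j"
  using detuning_bound[of j n z] by (auto simp: res_def)

text \<open>The nonresonant coefficients of a sequence with value 1 at index 0 and value 0 at index
  \<open>- n\<close>; the source term \<open>a j\<close> stems from the value 1.\<close>

definition solves :: "complex \<Rightarrow> (int \<Rightarrow> complex) \<Rightarrow> bool" where
  "solves z w \<longleftrightarrow> (\<forall>j. w j = - res z j * (a j + (\<Sum>\<^sub>\<infinity>l. a (j - l) * w l))) \<and> (\<forall>j. cmod (w j) \<le> 2 * C * gap n j / weight j ^ m)"

text \<open>Banach's fixed point theorem for bounded sequences \<open>V\<close>, where
  \<open>w = gap / weight ^ m * V\<close>: the rescaling builds the required decay of
  \<open>w\<close> into the space.\<close>

lemma solution_exists: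
  assumes z: "cmod z \<le> 1"
  shows "\<exists>w. solves z w"
proof -
  define ww where "ww V l = of_real (gap n l / weight l ^ m) * apply_bcontfun V l" for V :: "int \<Rightarrow>\<^sub>C complex" and l
  have wb: "cmod (ww V l) \<le> norm V * gap n l / weight l ^ m" for V l
  proof -
    have "cmod (ww V l) = gap n l / weight l ^ m * cmod (apply_bcontfun V l)" by (simp add: ww_def norm_mult norm_divide norm_power)
    also have "\<dots> \<le> gap n l / weight l ^ m * norm V" by (intro mult_left_mono norm_bounded) auto
    finally show ?thesis by (simp add: mult.commute)
  qed
  \<comment> \<open>What is left of \<open>res\<close> after splitting off the factor
    \<open>gap\<close>; at the resonant indices both vanish.\<close>
  define \<rho> where "\<rho> j = (if gap n j = 0 then 0 else res z j / of_real (gap n j))" for j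
  have \<rho>: "cmod (\<rho> j) \<le> 1" for j
  proof (cases "gap n j = 0")
    case False
    hence "gap n j > 0" using gap_nonneg[of n j] by linarith
    thus ?thesis using res_bound[OF z, of j] by (simp add: \<rho>_def norm_divide)
  qed (simp add: \<rho>_def)
  have \<rho>res: "of_real (gap n j) * \<rho> j = res z j" for j using res_bound[OF z, of j] by (auto simp: \<rho>_def)
  define F where "F V j = - \<rho> j * of_real (weight j ^ m) * (a j + (\<Sum>\<^sub>\<infinity>l. a (j - l) * ww V l))" for V j
  have F0: "cmod (F V j) \<le> C + C * norm V * gap_sum n" for V j
  proof -
    have "cmod (F V j) = cmod (\<rho> j) * (cmod (a j + (\<Sum>\<^sub>\<infinity>l. a (j - l) * ww V l)) * weight j ^ m)" by (simp add: F_def norm_mult norm_power)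
    also have "\<dots> \<le> 1 * (cmod (a j + (\<Sum>\<^sub>\<infinity>l. a (j - l) * ww V l)) * weight j ^ m)" by (intro mult_right_mono \<rho>) (auto simp: less_imp_le)
    also have "\<dots> \<le> (cmod (a j) + cmod (\<Sum>\<^sub>\<infinity>l. a (j - l) * ww V l)) * weight j ^ m"
      unfolding mult_1 by (intro mult_right_mono norm_triangle_ineq) (auto simp: less_imp_le)
    also have "\<dots> \<le> C + C * norm V * gap_sum n"
      using aC[of j] conv_summable(3)[where w="ww V" and K="norm V" and j=j, OF wb norm_ge_zero] by (simp add: distrib_right)
    finally show ?thesis .
  qed
  define \<Phi> where "\<Phi> V = Bcontfun (F V)" for V
  have \<Phi>: "apply_bcontfun (\<Phi> V) = F V" for V
    unfolding \<Phi>_def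
  proof (rule Bcontfun_inverse)
    show "F V \<in> bcontfun" by (rule int_bcontfunI[OF F0])
  qed
  have contr: "dist (\<Phi> U) (\<Phi> V) \<le> 1/2 * dist U V" for U V
  proof (rule dist_bound)
    fix j
    have ww: "ww U l - ww V l = ww (U - V) l" for l by (simp add: ww_def right_diff_distrib)
    have "F U j - F V j = - \<rho> j * of_real (weight j ^ m) * ((\<Sum>\<^sub>\<infinity>l. a (j - l) * ww U l) - (\<Sum>\<^sub>\<infinity>l. a (j - l) * ww V l))"
      by (simp add: F_def algebra_simps)
    also have "(\<Sum>\<^sub>\<infinity>l. a (j - l) * ww U l) - (\<Sum>\<^sub>\<infinity>l. a (j - l) * ww V l) = (\<Sum>\<^sub>\<infinity>l. a (j - l) * ww (U - V) l)"
      by (subst infsum_diff_complex[symmetric, OF conv_summable(2)[where w="ww U", OF wb norm_ge_zero] conv_summable(2)[where w="ww V", OF wb norm_ge_zero]])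
         (simp add: ww[symmetric] right_diff_distrib)
    finally have "dist (F U j) (F V j) = cmod (\<rho> j) * (cmod (\<Sum>\<^sub>\<infinity>l. a (j - l) * ww (U - V) l) * weight j ^ m)"
      by (simp add: dist_norm norm_mult norm_power)
    also have "\<dots> \<le> 1 * (cmod (\<Sum>\<^sub>\<infinity>l. a (j - l) * ww (U - V) l) * weight j ^ m)" by (intro mult_right_mono \<rho>) (auto simp: less_imp_le)
    also have "\<dots> \<le> C * norm (U - V) * gap_sum n" unfolding mult_1 by (rule conv_summable(3)[OF wb norm_ge_zero])
    also have "\<dots> = (C * gap_sum n) * dist U V" by (simp add: dist_norm)
    also have "\<dots> \<le> 1/2 * dist U V" by (intro mult_right_mono half) auto
    finally show "dist (apply_bcontfun (\<Phi> U) j) (apply_bcontfun (\<Phi> V) j) \<le> 1/2 * dist U V" by (simp add: \<Phi>)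
  qed
  have "\<exists>!V\<in>UNIV. \<Phi> V = V"
    by (rule Banach_fix[OF complete_bcontfun_int, where c="1/2"]) (use contr in auto)
  then obtain V where V: "\<Phi> V = V" by blast
  have VF: "apply_bcontfun V j = F V j" for j using \<Phi>[of V] V by simp
  have "norm V \<le> C + (C * gap_sum n) * norm V"
    by (rule norm_bound) (use F0[of V] in \<open>simp add: VF mult_ac\<close>)
  also have "\<dots> \<le> C + 1/2 * norm V" by (intro add_left_mono mult_right_mono half) auto
  \<comment> \<open>Half of \<open>norm V\<close> is absorbed on the left, the origin of the factor
    2 in \<open>solves\<close>.\<close>
  finally have nV: "norm V \<le> 2 * C" by simp
  have "solves z (ww V)" unfolding solves_def
  proof (intro conjI allI)
    fix j
    have "ww V j = of_real (gap n j / weight j ^ m) * F V j" by (simp add: ww_def VF)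
    also have "\<dots> = - (of_real (gap n j) * \<rho> j) * (a j + (\<Sum>\<^sub>\<infinity>l. a (j - l) * ww V l))"
      using less_imp_neq[OF weight_pos[of j]] by (simp add: F_def)
    finally show "ww V j = - res z j * (a j + (\<Sum>\<^sub>\<infinity>l. a (j - l) * ww V l))" unfolding \<rho>res .
    have "norm V * gap n j / weight j ^ m \<le> 2 * C * gap n j / weight j ^ m"
      using nV by (intro divide_right_mono mult_right_mono) (auto simp: less_imp_le)
    thus "cmod (ww V j) \<le> 2 * C * gap n j / weight j ^ m" using wb[of V j] by linarith
  qed
  thus ?thesis by blast
qed

text \<open>A choice for each \<open>z\<close> separately; continuity in \<open>z\<close> is derived
  afterwards from the equation and the bound in \<open>solves\<close>.\<close>

definition W :: "complex \<Rightarrow> int \<Rightarrow> complex" where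
  "W z = (SOME w. solves z w)"

lemma W_solves: "cmod z \<le> 1 \<Longrightarrow> solves z (W z)"
  unfolding W_def by (rule someI_ex[OF solution_exists])

lemma W_eq: "cmod z \<le> 1 \<Longrightarrow> W z j = - res z j * (a j + (\<Sum>\<^sub>\<infinity>l. a (j - l) * W z l))"
  using W_solves unfolding solves_def by blast

lemma W_bound: "cmod z \<le> 1 \<Longrightarrow> cmod (W z j) \<le> 2 * C * gap n j / weight j ^ m"
  using W_solves unfolding solves_def by blast

lemma W_bound': "cmod z \<le> 1 \<Longrightarrow> cmod (W z j) \<le> 2 * C * gap n j"
proof -
  assume z: "cmod z \<le> 1"
  have "2 * C * gap n j / weight j ^ m \<le> 2 * C * gap n j / 1"
    using C_nonneg one_le_power[OF weight_ge_1, of j m] by (intro divide_left_mono) auto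
  thus ?thesis using W_bound[OF z, of j] by linarith
qed

lemma W_resonant: "cmod z \<le> 1 \<Longrightarrow> W z 0 = 0" "cmod z \<le> 1 \<Longrightarrow> W z (- n) = 0"
  using W_eq[of z 0] W_eq[of z "-n"] by (simp_all add: res_def)

lemma W_summable: "cmod z \<le> 1 \<Longrightarrow> (\<lambda>j. cmod (W z j)) summable_on UNIV"
  by (rule summable_on_comparison_test[OF summable_on_cmult_right[OF gap_summable] W_bound']) auto

lemma W_norm1: "cmod z \<le> 1 \<Longrightarrow> (\<Sum>\<^sub>\<infinity>j. cmod (W z j)) \<le> 2 * C * gap_sum n"
  unfolding gap_sum_def
  by (subst infsum_cmult_right[OF gap_summable, symmetric], rule infsum_mono[OF W_summable summable_on_cmult_right[OF gap_summable] W_bound']) auto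

lemmas W_conv = conv_summable[of "W z" "2 * C" for z, OF W_bound]

lemma mult_bounded_summable:
  assumes "(\<lambda>j. cmod (y j)) summable_on UNIV" "\<And>j. cmod (c j) \<le> K"
  shows "(\<lambda>j. cmod (c j * y j)) summable_on UNIV" "(\<lambda>j. c j * y j) summable_on UNIV"
    "cmod (\<Sum>\<^sub>\<infinity>j. c j * y j) \<le> K * (\<Sum>\<^sub>\<infinity>j. cmod (y j))"
proof -
  have t: "cmod (c j * y j) \<le> K * cmod (y j)" for j unfolding norm_mult by (intro mult_right_mono assms) auto
  have s: "(\<lambda>j. K * cmod (y j)) summable_on UNIV" by (rule summable_on_cmult_right[OF assms(1)])
  show s1: "(\<lambda>j. cmod (c j * y j)) summable_on UNIV" by (rule summable_on_comparison_test[OF s t]) auto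
  show "(\<lambda>j. c j * y j) summable_on UNIV" by (rule abs_summable_summable[OF s1])
  have "cmod (\<Sum>\<^sub>\<infinity>j. c j * y j) \<le> (\<Sum>\<^sub>\<infinity>j. cmod (c j * y j))" by (rule norm_infsum_bound[OF s1])
  also have "\<dots> \<le> (\<Sum>\<^sub>\<infinity>j. K * cmod (y j))" by (rule infsum_mono[OF s1 s t])
  finally show "cmod (\<Sum>\<^sub>\<infinity>j. c j * y j) \<le> K * (\<Sum>\<^sub>\<infinity>j. cmod (y j))" by (simp add: infsum_cmult_right[OF assms(1)])
qed

text \<open>Subtract the two equations: the convolution with the difference is absorbed by
  \<open>half\<close>, and the change of \<open>z\<close> multiplies a sequence bounded by
  \<open>2 * C\<close>.\<close>

lemma W_Lipschitz:
  assumes z: "cmod z \<le> 1" "cmod z' \<le> 1"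
  shows "(\<Sum>\<^sub>\<infinity>j. cmod (W z j - W z' j)) \<le> 4 * C * gap_sum n * cmod (z - z')"
proof -
  define D where "D j = W z j - W z' j" for j
  have Ds: "(\<lambda>j. cmod (D j)) summable_on UNIV"
    by (rule summable_on_comparison_test[OF summable_on_add[OF W_summable[OF z(1)] W_summable[OF z(2)]]]) (auto simp: D_def norm_triangle_ineq4)
  define S where "S = (\<Sum>\<^sub>\<infinity>j. cmod (D j))"
  have conv: "cmod (\<Sum>\<^sub>\<infinity>l. a (j - l) * D l) \<le> C * S" for j
    unfolding S_def by (rule mult_bounded_summable(3)[OF Ds]) (rule a_le_C)
  have Dj: "cmod (D j) \<le> gap n j * (C * S) + cmod (z - z') * (2 * C * gap n j)" for j
  proof (cases "j = 0 \<or> j = - n")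
    case True thus ?thesis using W_resonant[OF z(1)] W_resonant[OF z(2)] by (auto simp: D_def)
  next
    case False
    note nz = detuning_bound(2)[of j n z] detuning_bound(2)[of j n z']
    have e1: "(detuning n j + z) * W z j = - (a j + (\<Sum>\<^sub>\<infinity>l. a (j - l) * W z l))"
      using nz(1) z False by (subst W_eq[OF z(1)]) (simp add: res_def)
    have e2: "(detuning n j + z') * W z' j = - (a j + (\<Sum>\<^sub>\<infinity>l. a (j - l) * W z' l))"
      using nz(2) z False by (subst W_eq[OF z(2)]) (simp add: res_def)
    have XY: "(\<Sum>\<^sub>\<infinity>l. a (j - l) * W z l) - (\<Sum>\<^sub>\<infinity>l. a (j - l) * W z' l) = (\<Sum>\<^sub>\<infinity>l. a (j - l) * D l)"
      by (subst infsum_diff_complex[symmetric]) (auto intro!: W_conv z simp: D_def algebra_simps C_nonneg)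
    have "(detuning n j + z) * D j = (detuning n j + z) * W z j - (detuning n j + z') * W z' j + (z' - z) * W z' j"
      by (simp add: D_def algebra_simps)
    also have "\<dots> = - ((\<Sum>\<^sub>\<infinity>l. a (j - l) * W z l) - (\<Sum>\<^sub>\<infinity>l. a (j - l) * W z' l)) + (z' - z) * W z' j"
      unfolding e1 e2 by simp
    finally have "(detuning n j + z) * D j = - (\<Sum>\<^sub>\<infinity>l. a (j - l) * D l) + (z' - z) * W z' j"
      unfolding XY .
    hence "D j = (1 / (detuning n j + z)) * (- (\<Sum>\<^sub>\<infinity>l. a (j - l) * D l) + (z' - z) * W z' j)"
      using nz(1) z False by (simp add: field_simps)
    hence "cmod (D j) = cmod (1 / (detuning n j + z)) * cmod (- (\<Sum>\<^sub>\<infinity>l. a (j - l) * D l) + (z' - z) * W z' j)" by (simp only: norm_mult)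
    also have "\<dots> \<le> gap n j * (C * S + cmod (z - z') * (2 * C))"
    proof (intro mult_mono)
      show "cmod (1 / (detuning n j + z)) \<le> gap n j" using detuning_bound(1) False z by auto
      have "cmod (W z' j) \<le> 2 * C" using W_bound'[OF z(2), of j] mult_left_mono[OF gap_le_1[of n j], of "2 * C"] C_nonneg by simp
      hence "cmod ((z' - z) * W z' j) \<le> cmod (z - z') * (2 * C)" unfolding norm_mult norm_minus_commute[of z' z] by (intro mult_left_mono) auto
      thus "cmod (- (\<Sum>\<^sub>\<infinity>l. a (j - l) * D l) + (z' - z) * W z' j) \<le> C * S + cmod (z - z') * (2 * C)"
        using conv[of j] norm_triangle_ineq[of "- (\<Sum>\<^sub>\<infinity>l. a (j - l) * D l)" "(z' - z) * W z' j"] by simp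
    qed auto
    finally show ?thesis by (simp add: algebra_simps)
  qed
  have gs: "(\<lambda>j. (C * S + cmod (z - z') * (2 * C)) * gap n j) summable_on UNIV" by (rule summable_on_cmult_right[OF gap_summable])
  have "S \<le> (\<Sum>\<^sub>\<infinity>j. (C * S + cmod (z - z') * (2 * C)) * gap n j)"
    unfolding S_def by (rule infsum_mono[OF Ds gs[unfolded S_def]]) (use Dj in \<open>simp add: algebra_simps S_def\<close>)
  also have "\<dots> = (C * gap_sum n) * S + cmod (z - z') * (2 * C) * gap_sum n"
    by (subst infsum_cmult_right[OF gap_summable]) (simp add: gap_sum_def[symmetric] algebra_simps)
  also have "\<dots> \<le> 1/2 * S + cmod (z - z') * (2 * C) * gap_sum n"
    by (intro add_right_mono mult_right_mono half) (simp add: S_def infsum_nonneg)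
  finally have "S \<le> 4 * C * gap_sum n * cmod (z - z')" by (simp add: mult_ac)
  thus ?thesis by (simp add: S_def D_def)
qed

text \<open>\<open>Diag\<close> and \<open>Off\<close> are the contributions of the eliminated
  indices to the equations at the indices 0 and \<open>- n\<close>.\<close>

definition Diag :: "complex \<Rightarrow> complex" where "Diag z = (\<Sum>\<^sub>\<infinity>l. a (- l) * W z l)"
definition Off :: "complex \<Rightarrow> complex" where "Off z = (\<Sum>\<^sub>\<infinity>l. a (- n - l) * W z l)"

lemma functional_continuous:
  assumes c: "\<And>j. cmod (c j) \<le> K"
  shows "continuous_on (cball 0 1) (\<lambda>z. \<Sum>\<^sub>\<infinity>l. c l * W z l)"
proof -
  have K: "K \<ge> 0" using c[of 0] norm_ge_zero order_trans by blast
  have "(K * (4 * C * gap_sum n))-lipschitz_on (cball 0 1) (\<lambda>z. \<Sum>\<^sub>\<infinity>l. c l * W z l)"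
  proof (rule lipschitz_onI)
    fix z z' :: complex assume "z \<in> cball 0 1" "z' \<in> cball 0 1"
    hence z: "cmod z \<le> 1" "cmod z' \<le> 1" by auto
    have Ds: "(\<lambda>j. cmod (W z j - W z' j)) summable_on UNIV"
      by (rule summable_on_comparison_test[OF summable_on_add[OF W_summable[OF z(1)] W_summable[OF z(2)]]]) (auto simp: norm_triangle_ineq4)
    have "(\<Sum>\<^sub>\<infinity>l. c l * W z l) - (\<Sum>\<^sub>\<infinity>l. c l * W z' l) = (\<Sum>\<^sub>\<infinity>l. c l * (W z l - W z' l))"
      by (subst infsum_diff_complex[symmetric]) (auto intro!: mult_bounded_summable(2)[OF W_summable c] z simp: algebra_simps)
    also have "cmod \<dots> \<le> K * (\<Sum>\<^sub>\<infinity>l. cmod (W z l - W z' l))" by (rule mult_bounded_summable(3)[OF Ds c])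
    also have "\<dots> \<le> K * (4 * C * gap_sum n * cmod (z - z'))" by (intro mult_left_mono W_Lipschitz z K)
    finally show "dist (\<Sum>\<^sub>\<infinity>l. c l * W z l) (\<Sum>\<^sub>\<infinity>l. c l * W z' l) \<le> K * (4 * C * gap_sum n) * dist z z'"
      by (simp add: dist_norm mult_ac)
  qed (use K C_nonneg gap_sum_nonneg in auto)
  thus ?thesis by (rule lipschitz_on_continuous_on)
qed

lemma Diag_continuous: "continuous_on (cball 0 1) Diag" and Off_continuous: "continuous_on (cball 0 1) Off"
  unfolding Diag_def[abs_def] Off_def[abs_def] by (rule functional_continuous, rule a_le_C)+

lemma Diag_bound: "cmod z \<le> 1 \<Longrightarrow> cmod (Diag z) \<le> 2 * C\<^sup>2 * gap_sum n"
proof -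
  assume z: "cmod z \<le> 1"
  have "cmod (Diag z) \<le> C * (\<Sum>\<^sub>\<infinity>j. cmod (W z j))"
    unfolding Diag_def by (rule mult_bounded_summable(3)[OF W_summable[OF z]]) (rule a_le_C)
  also have "\<dots> \<le> C * (2 * C * gap_sum n)" by (intro mult_left_mono W_norm1 z C_nonneg)
  finally show ?thesis by (simp add: power2_eq_square mult_ac)
qed

text \<open>Insert the equation for \<open>W\<close> once. The leading part, with \<open>z\<close>
  replaced by 0 in the resolvent, is \<open>T\<close> up to the factor
  \<open>1 / (4 * pi\<^sup>2)\<close>; the change of \<open>z\<close> and the next iterate each
  carry two gap factors. The indices \<open>j\<close> and \<open>- n - j\<close> add up to
  \<open>- n\<close>, so submultiplicativity extracts \<open>weight n ^ m\<close> from every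
  term.\<close>

lemma Off_bound:
  assumes z: "cmod z \<le> 1" and T: "((\<lambda>j. (a j / of_int j) * (a (- n - j) / of_int (- n - j))) has_sum T) UNIV"
  shows "cmod (Off z) \<le> cmod T + (2 * C^3 + C\<^sup>2) * (gap_sum n)\<^sup>2 / weight n ^ m"
proof -
  define R where "R j = (\<Sum>\<^sub>\<infinity>l. a (j - l) * W z l)" for j
  have Rb: "cmod (R j) \<le> 2 * C\<^sup>2 * gap_sum n / weight j ^ m" for j
    using W_conv(3)[OF z, of j] C_nonneg by (simp add: R_def field_simps power2_eq_square)
  define t1 where "t1 j = (a j / of_int j) * (a (- n - j) / of_int (- n - j))" for j
  define t2 where "t2 j = - (a (- n - j) * a j) * (res z j - res 0 j)" for j
  define t3 where "t3 j = - (a (- n - j) * res z j * R j)" for j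
  have brn: "1 / (weight (- n - j) ^ m * weight j ^ m) \<le> 1 / weight n ^ m" for j
  proof -
    have "weight n ^ m \<le> weight (- n - j) ^ m * weight j ^ m" using weight_power_submult[of "- n - j" j m] by simp
    thus ?thesis by (intro divide_left_mono) auto
  qed
  have aa: "cmod (a (- n - j)) * (X / weight j ^ m) \<le> C * X / weight n ^ m" if "X \<ge> 0" for j X
  proof -
    have "cmod (a (- n - j)) * (X / weight j ^ m) \<le> (C / weight (- n - j) ^ m) * (X / weight j ^ m)"
      using that by (intro mult_right_mono a_bound) (auto simp: less_imp_le)
    also have "\<dots> = (C * X) * (1 / (weight (- n - j) ^ m * weight j ^ m))" by simp
    also have "\<dots> \<le> (C * X) * (1 / weight n ^ m)" using that C_nonneg by (intro mult_left_mono brn) auto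
    finally show ?thesis by simp
  qed
  have trm: "a (- n - j) * W z j = of_real (1 / (4 * pi\<^sup>2)) * t1 j + (t2 j + t3 j)" for j
  proof -
    have r0: "- (a (- n - j) * a j) * res 0 j = of_real (1 / (4 * pi\<^sup>2)) * t1 j"
    proof (cases "j = 0 \<or> j = - n")
      case True thus ?thesis by (auto simp: res_def t1_def)
    next
      case False
      hence "of_int j \<noteq> (0::complex)" "of_int (- n - j) \<noteq> (0::complex)" by (auto simp del: of_int_diff of_int_minus)
      moreover have "detuning n j = - (of_real (4 * pi\<^sup>2) * of_int j * of_int (- n - j))" by (simp add: detuning_def algebra_simps)
      ultimately show ?thesis using False by (simp add: res_def t1_def mult_ac)
    qed
    have "a (- n - j) * W z j = - (a (- n - j) * a j) * res 0 j + (t2 j + t3 j)"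
      by (subst W_eq[OF z]) (simp add: t2_def t3_def R_def algebra_simps)
    thus ?thesis unfolding r0 .
  qed
  have t3b: "cmod (t3 j) \<le> 2 * C^3 * gap_sum n / weight n ^ m * gap n j" for j
  proof -
    have "cmod (t3 j) = cmod (res z j) * (cmod (a (- n - j)) * cmod (R j))" by (simp add: t3_def norm_mult)
    also have "\<dots> \<le> gap n j * (cmod (a (- n - j)) * (2 * C\<^sup>2 * gap_sum n / weight j ^ m))"
      by (intro mult_mono mult_left_mono res_bound z Rb) auto
    also have "\<dots> \<le> gap n j * (C * (2 * C\<^sup>2 * gap_sum n) / weight n ^ m)"
      by (intro mult_left_mono aa) (auto simp: gap_sum_nonneg)
    finally show ?thesis by (simp add: power3_eq_cube power2_eq_square mult_ac)
  qed
  have t2b: "cmod (t2 j) \<le> C\<^sup>2 * gap_sum n / weight n ^ m * gap n j" for j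
  proof (cases "j = 0 \<or> j = - n")
    case True thus ?thesis by (auto simp: t2_def res_def)
  next
    case False
    hence nz: "detuning n j + z \<noteq> 0" "detuning n j + 0 \<noteq> 0" using detuning_bound(2)[of j n z] detuning_bound(2)[of j n 0] z by auto
    \<comment> \<open>The resolvent identity yields two gap factors, one of which is bounded by
      \<open>gap_sum n\<close>.\<close>
    have "res z j - res 0 j = - z * (1 / (detuning n j + z)) * (1 / (detuning n j + 0))" using nz False by (simp add: res_def field_simps)
    hence "cmod (res z j - res 0 j) = cmod z * cmod (1 / (detuning n j + z)) * cmod (1 / (detuning n j + 0))" by (simp add: norm_mult norm_divide)
    also have "\<dots> \<le> 1 * gap n j * gap n j" using detuning_bound(1)[of j n z] detuning_bound(1)[of j n 0] False z
      by (intro mult_mono) auto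
    also have "\<dots> \<le> gap_sum n * gap n j" using gap_le_sum by (simp add: mult_right_mono)
    finally have rr: "cmod (res z j - res 0 j) \<le> gap_sum n * gap n j" .
    have "cmod (t2 j) = (cmod (a (- n - j)) * cmod (a j)) * cmod (res z j - res 0 j)" by (simp add: t2_def norm_mult)
    also have "\<dots> \<le> (cmod (a (- n - j)) * (C / weight j ^ m)) * (gap_sum n * gap n j)"
      by (intro mult_mono mult_left_mono rr a_bound) (auto simp: less_imp_le C_nonneg)
    also have "\<dots> \<le> (C * C / weight n ^ m) * (gap_sum n * gap n j)"
      by (intro mult_right_mono aa C_nonneg) (auto simp: gap_sum_nonneg)
    finally show ?thesis by (simp add: power2_eq_square mult_ac)
  qed
  define B where "B = (2 * C^3 + C\<^sup>2) * gap_sum n / weight n ^ m"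
  have t23: "cmod (t2 j + t3 j) \<le> B * gap n j" for j
    using norm_triangle_ineq[of "t2 j" "t3 j"] t2b[of j] t3b[of j] by (simp add: B_def algebra_simps add_divide_distrib)
  have s23: "(\<lambda>j. cmod (t2 j + t3 j)) summable_on UNIV"
    by (rule summable_on_comparison_test[OF summable_on_cmult_right[OF gap_summable] t23]) auto
  have b23: "cmod (\<Sum>\<^sub>\<infinity>j. t2 j + t3 j) \<le> B * gap_sum n"
  proof -
    have "cmod (\<Sum>\<^sub>\<infinity>j. t2 j + t3 j) \<le> (\<Sum>\<^sub>\<infinity>j. cmod (t2 j + t3 j))" by (rule norm_infsum_bound[OF s23])
    also have "\<dots> \<le> (\<Sum>\<^sub>\<infinity>j. B * gap n j)" by (rule infsum_mono[OF s23 summable_on_cmult_right[OF gap_summable] t23])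
    finally show ?thesis by (simp add: infsum_cmult_right[OF gap_summable] gap_sum_def)
  qed
  have h1: "((\<lambda>j. of_real (1 / (4 * pi\<^sup>2)) * t1 j) has_sum of_real (1 / (4 * pi\<^sup>2)) * T) UNIV"
    using T unfolding t1_def by (rule has_sum_cmult_right)
  have "((\<lambda>j. of_real (1 / (4 * pi\<^sup>2)) * t1 j + (t2 j + t3 j)) has_sum (of_real (1 / (4 * pi\<^sup>2)) * T + (\<Sum>\<^sub>\<infinity>j. t2 j + t3 j))) UNIV"
    by (intro has_sum_add h1 has_sum_infsum abs_summable_summable[OF s23])
  hence "Off z = of_real (1 / (4 * pi\<^sup>2)) * T + (\<Sum>\<^sub>\<infinity>j. t2 j + t3 j)" unfolding Off_def trm by (rule infsumI)
  hence "cmod (Off z) \<le> cmod (of_real (1 / (4 * pi\<^sup>2)) * T) + B * gap_sum n"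
    using norm_triangle_ineq[of "of_real (1 / (4 * pi\<^sup>2)) * T" "\<Sum>\<^sub>\<infinity>j. t2 j + t3 j"] b23 by simp
  also have "cmod (of_real (1 / (4 * pi\<^sup>2)) * T) \<le> 1 * cmod T"
    unfolding norm_mult norm_of_real using power_mono[OF pi_ge_two, of 2] by (intro mult_right_mono) auto
  finally show ?thesis by (simp add: B_def power2_eq_square)
qed

end

section \<open>The two-dimensional resonant system\<close>

definition lattice_op :: "(int \<Rightarrow> complex) \<Rightarrow> int \<Rightarrow> complex \<Rightarrow> (int \<Rightarrow> complex) \<Rightarrow> int \<Rightarrow> complex" where
  "lattice_op a n z y j = (detuning n j + z) * y j + (\<Sum>\<^sub>\<infinity>l. a (j - l) * y l)"

lemma bij_reflect: "bij (\<lambda>l::int. - n - l)"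
  by (rule o_bij[of "\<lambda>l. - n - l"]) auto

lemma lattice_op_reflect: "lattice_op a n z (\<lambda>j. y (- n - j)) j = lattice_op (\<lambda>k. a (- k)) n z y (- n - j)"
proof -
  have "(\<Sum>\<^sub>\<infinity>l. a (j - l) * y (- n - l)) = (\<Sum>\<^sub>\<infinity>l. a (- (- n - j - l)) * y l)"
    using infsum_reindex_bij_betw[OF bij_reflect[of n], of "\<lambda>l. a (- (- n - j - l)) * y l"] by simp
  thus ?thesis by (simp add: lattice_op_def detuning_reflect)
qed

lemma (in lattice) lattice_op_linear:
  assumes "(\<lambda>l. cmod (x l)) summable_on UNIV" "(\<lambda>l. cmod (y l)) summable_on UNIV"
  shows "lattice_op a n z (\<lambda>l. c * x l + d * y l) j = c * lattice_op a n z x j + d * lattice_op a n z y j"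
proof -
  note sx = mult_bounded_summable(2)[OF assms(1), of "\<lambda>l. a (j - l)" C, OF a_le_C]
  note sy = mult_bounded_summable(2)[OF assms(2), of "\<lambda>l. a (j - l)" C, OF a_le_C]
  have "(\<Sum>\<^sub>\<infinity>l. a (j - l) * (c * x l + d * y l)) = (\<Sum>\<^sub>\<infinity>l. c * (a (j - l) * x l) + d * (a (j - l) * y l))"
    by (simp add: algebra_simps)
  also have "\<dots> = (\<Sum>\<^sub>\<infinity>l. c * (a (j - l) * x l)) + (\<Sum>\<^sub>\<infinity>l. d * (a (j - l) * y l))"
    by (intro infsum_add summable_on_cmult_right sx sy)
  also have "\<dots> = c * (\<Sum>\<^sub>\<infinity>l. a (j - l) * x l) + d * (\<Sum>\<^sub>\<infinity>l. a (j - l) * y l)"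
    by (simp add: infsum_cmult_right sx sy)
  finally show ?thesis by (simp add: lattice_op_def algebra_simps)
qed

context lattice
begin

abbreviation "a' \<equiv> (\<lambda>k. a (- k))"
abbreviation "W' \<equiv> lattice.W a' m C n"
abbreviation "Off' \<equiv> lattice.Off a' m C n"

text \<open>It solves all equations except those at the resonant indices, where its values are 1 and
  0; \<open>e1\<close> is its mirror image with values 0 and 1. The two span the candidates for
  solutions of the full system.\<close>

definition e0 :: "complex \<Rightarrow> int \<Rightarrow> complex" where
  "e0 z j = (if j = 0 then 1 else 0) + W z j"

lemma delta_summable: "(\<lambda>l. cmod (if l = (i::int) then 1 else 0)) summable_on UNIV"
proof -
  have "((\<lambda>l. cmod (if l = (i::int) then 1 else 0)) has_sum 1) UNIV"
    by (rule has_sum_finite_neutralI[of "{i}"]) auto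
  thus ?thesis by (rule has_sum_imp_summable)
qed

lemma e0_summable: "cmod z \<le> 1 \<Longrightarrow> (\<lambda>l. cmod (e0 z l)) summable_on UNIV"
proof -
  assume z: "cmod z \<le> 1"
  show ?thesis
    by (rule summable_on_comparison_test[OF summable_on_add[OF delta_summable[of 0] W_summable[OF z]]])
       (unfold e0_def, rule norm_triangle_ineq, simp)
qed

lemma conv_e0:
  assumes z: "cmod z \<le> 1"
  shows "(\<Sum>\<^sub>\<infinity>l. a (j - l) * e0 z l) = a j + (\<Sum>\<^sub>\<infinity>l. a (j - l) * W z l)"
proof -
  have "((\<lambda>l. a (j - l) * (if l = 0 then 1 else 0)) has_sum a j) UNIV"
    by (rule has_sum_finite_neutralI[of "{0}"]) auto
  hence "((\<lambda>l. a (j - l) * (if l = 0 then 1 else 0) + a (j - l) * W z l) has_sum (a j + (\<Sum>\<^sub>\<infinity>l. a (j - l) * W z l))) UNIV"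
    by (intro has_sum_add has_sum_infsum W_conv z) (auto simp: C_nonneg)
  moreover have "(\<lambda>l. a (j - l) * (if l = 0 then 1 else 0) + a (j - l) * W z l) = (\<lambda>l. a (j - l) * e0 z l)"
    by (auto simp: e0_def algebra_simps)
  ultimately show ?thesis by (metis infsumI)
qed

lemma lattice_op_e0:
  assumes z: "cmod z \<le> 1"
  shows "lattice_op a n z (e0 z) j = (if j = 0 then z + Diag z else if j = - n then a (- n) + Off z else 0)"
proof -
  consider "j = 0" | "j = - n" "j \<noteq> 0" | "j \<noteq> 0" "j \<noteq> - n" by blast
  thus ?thesis
  proof cases
    case 1
    thus ?thesis using W_resonant[OF z] unfolding lattice_op_def conv_e0[OF z] by (simp add: e0_def a0 Diag_def)
  next
    case 2
    thus ?thesis using W_resonant[OF z] n unfolding lattice_op_def conv_e0[OF z] by (simp add: e0_def Off_def)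
  next
    case 3
    have "(detuning n j + z) * W z j = - (a j + (\<Sum>\<^sub>\<infinity>l. a (j - l) * W z l))"
      using detuning_bound(2)[OF 3 z] 3 by (subst W_eq[OF z]) (simp add: res_def)
    thus ?thesis using 3 unfolding lattice_op_def conv_e0[OF z] by (simp add: e0_def)
  qed
qed

lemma e0_values: "cmod z \<le> 1 \<Longrightarrow> e0 z 0 = 1" "cmod z \<le> 1 \<Longrightarrow> e0 z (- n) = 0"
  using W_resonant[of z] n by (auto simp: e0_def)

text \<open>The lattice with \<open>a (- k)\<close> is the transpose. Pair the equation of
  \<open>W\<close> with the solution of the transposed problem and conversely: the diagonal terms
  agree, the convolution terms agree after exchanging the sums, and the remaining source terms are
  the two corrections.\<close>

lemma Diag_reflect:
  assumes z: "cmod z \<le> 1"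
  shows "lattice.Diag a' m C n z = Diag z"
proof -
  interpret R: lattice a' m C n by (rule reflect)
  define V where "V = W' z"
  define U where "U = W z"
  have Us: "(\<lambda>j. cmod (U j)) summable_on UNIV" unfolding U_def by (rule W_summable[OF z])
  have Vs: "(\<lambda>j. cmod (V j)) summable_on UNIV" unfolding V_def by (rule R.W_summable[OF z])
  have eU: "(detuning n j + z) * U j * V j = - (a j + (\<Sum>\<^sub>\<infinity>l. a (j - l) * U l)) * V j" for j
  proof (cases "j = 0 \<or> j = - n")
    case True thus ?thesis using R.W_resonant[OF z] by (auto simp: V_def)
  next
    case False
    thus ?thesis using detuning_bound(2)[of j n z] z unfolding U_def by (subst W_eq[OF z]) (simp add: res_def)
  qed
  have eV: "(detuning n j + z) * V j * U j = - (a (- j) + (\<Sum>\<^sub>\<infinity>l. a (l - j) * V l)) * U j" for j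
  proof (cases "j = 0 \<or> j = - n")
    case True thus ?thesis using W_resonant[OF z] by (auto simp: U_def)
  next
    case False
    thus ?thesis using detuning_bound(2)[of j n z] z unfolding V_def by (subst R.W_eq[OF z]) (simp add: R.res_def)
  qed
  have eq: "a j * V j + (\<Sum>\<^sub>\<infinity>l. a (j - l) * U l) * V j = a (- j) * U j + (\<Sum>\<^sub>\<infinity>l. a (l - j) * V l) * U j" for j
  proof -
    have "(detuning n j + z) * U j * V j = (detuning n j + z) * V j * U j" by (simp only: mult_ac)
    from eU[of j, symmetric, THEN trans, OF this, THEN trans, OF eV]
    show ?thesis by (simp only: mult_minus_left neg_equal_iff_equal distrib_right)
  qed
  have prod: "(\<lambda>(j,l). a (j - l) * U l * V j) summable_on UNIV \<times> UNIV"
  proof (rule abs_summable_summable)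
    have "(\<lambda>(j,l). C * (cmod (V j) * cmod (U l))) summable_on UNIV \<times> UNIV"
    proof (rule summable_on_SigmaI[where g="\<lambda>j. C * (cmod (V j) * infsum (\<lambda>l. cmod (U l)) UNIV)"])
      show "((\<lambda>y. case (j, y) of (j, l) \<Rightarrow> C * (cmod (V j) * cmod (U l))) has_sum C * (cmod (V j) * infsum (\<lambda>l. cmod (U l)) UNIV)) UNIV" for j
        unfolding prod.case by (intro has_sum_cmult_right has_sum_infsum Us)
      show "(\<lambda>j. C * (cmod (V j) * (\<Sum>\<^sub>\<infinity>l. cmod (U l)))) summable_on UNIV"
        by (intro summable_on_cmult_right summable_on_cmult_left Vs)
    qed (auto simp: C_nonneg)
    thus "(\<lambda>x. norm (case x of (j, l) \<Rightarrow> a (j - l) * U l * V j)) summable_on UNIV \<times> UNIV"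
    proof (rule summable_on_comparison_test)
      fix x :: "int \<times> int"
      show "norm (case x of (j, l) \<Rightarrow> a (j - l) * U l * V j) \<le> (case x of (j, l) \<Rightarrow> C * (cmod (V j) * cmod (U l)))"
        using mult_right_mono[OF a_le_C[of "fst x - snd x"], of "cmod (U (snd x)) * cmod (V (fst x))"]
        by (simp add: case_prod_unfold norm_mult mult_ac)
    qed auto
  qed
  have sw: "(\<Sum>\<^sub>\<infinity>j. \<Sum>\<^sub>\<infinity>l. a (j - l) * U l * V j) = (\<Sum>\<^sub>\<infinity>l. \<Sum>\<^sub>\<infinity>j. a (j - l) * U l * V j)"
    by (rule infsum_swap_banach) (use prod in simp)
  have cU: "\<And>j. cmod (\<Sum>\<^sub>\<infinity>l. a (j - l) * U l) \<le> C * (\<Sum>\<^sub>\<infinity>l. cmod (U l))"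
    by (rule mult_bounded_summable(3)[OF Us]) (rule a_le_C)
  have cV: "\<And>j. cmod (\<Sum>\<^sub>\<infinity>l. a (l - j) * V l) \<le> C * (\<Sum>\<^sub>\<infinity>l. cmod (V l))"
    by (rule mult_bounded_summable(3)[OF Vs]) (rule a_le_C)
  have s1: "(\<lambda>j. a j * V j) summable_on UNIV" by (rule mult_bounded_summable(2)[OF Vs a_le_C])
  have s2: "(\<lambda>j. (\<Sum>\<^sub>\<infinity>l. a (j - l) * U l) * V j) summable_on UNIV" by (rule mult_bounded_summable(2)[OF Vs cU])
  have s3: "(\<lambda>j. a (- j) * U j) summable_on UNIV" by (rule mult_bounded_summable(2)[OF Us a_le_C])
  have s4: "(\<lambda>j. (\<Sum>\<^sub>\<infinity>l. a (l - j) * V l) * U j) summable_on UNIV" by (rule mult_bounded_summable(2)[OF Us cV])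
  have U1: "(\<Sum>\<^sub>\<infinity>l. a (j - l) * U l * V j) = (\<Sum>\<^sub>\<infinity>l. a (j - l) * U l) * V j" for j
    by (rule infsum_cmult_left) (rule mult_bounded_summable(2)[OF Us a_le_C])
  have V1: "(\<Sum>\<^sub>\<infinity>j. a (j - l) * U l * V j) = (\<Sum>\<^sub>\<infinity>j. a (j - l) * V j) * U l" for l
  proof -
    have "(\<Sum>\<^sub>\<infinity>j. a (j - l) * U l * V j) = (\<Sum>\<^sub>\<infinity>j. (a (j - l) * V j) * U l)" by (simp add: mult_ac)
    also have "\<dots> = (\<Sum>\<^sub>\<infinity>j. a (j - l) * V j) * U l" by (rule infsum_cmult_left) (rule mult_bounded_summable(2)[OF Vs a_le_C])
    finally show ?thesis .
  qed
  have "(\<Sum>\<^sub>\<infinity>j. a j * V j) + (\<Sum>\<^sub>\<infinity>j. (\<Sum>\<^sub>\<infinity>l. a (j - l) * U l) * V j) = (\<Sum>\<^sub>\<infinity>j. a (- j) * U j) + (\<Sum>\<^sub>\<infinity>j. (\<Sum>\<^sub>\<infinity>l. a (l - j) * V l) * U j)"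
    unfolding infsum_add[OF s1 s2, symmetric] infsum_add[OF s3 s4, symmetric] eq ..
  hence "(\<Sum>\<^sub>\<infinity>j. a j * V j) = (\<Sum>\<^sub>\<infinity>j. a (- j) * U j)" using sw unfolding U1 V1 by simp
  thus ?thesis by (simp add: R.Diag_def Diag_def U_def V_def)
qed

definition e1 :: "complex \<Rightarrow> int \<Rightarrow> complex" where
  "e1 z j = lattice.e0 a' m C n z (- n - j)"

lemma lattice_op_e1:
  assumes z: "cmod z \<le> 1"
  shows "lattice_op a n z (e1 z) j = (if j = 0 then a n + Off' z else if j = - n then z + Diag z else 0)"
proof -
  interpret R: lattice a' m C n by (rule reflect)
  have "lattice_op a n z (e1 z) j = lattice_op a' n z (R.e0 z) (- n - j)"
    unfolding e1_def[abs_def] by (rule lattice_op_reflect)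
  thus ?thesis using n by (auto simp: R.lattice_op_e0[OF z] Diag_reflect[OF z])
qed

lemma e1_summable: "cmod z \<le> 1 \<Longrightarrow> (\<lambda>l. cmod (e1 z l)) summable_on UNIV"
proof -
  assume z: "cmod z \<le> 1"
  interpret R: lattice a' m C n by (rule reflect)
  show ?thesis unfolding e1_def
    using summable_on_reindex_bij_betw[OF bij_reflect[of n], of "\<lambda>l. cmod (R.e0 z l)"] R.e0_summable[OF z] by simp
qed

lemma e1_values: "cmod z \<le> 1 \<Longrightarrow> e1 z 0 = 0" "cmod z \<le> 1 \<Longrightarrow> e1 z (- n) = 1"
proof -
  assume z: "cmod z \<le> 1"
  interpret R: lattice a' m C n by (rule reflect)
  show "e1 z 0 = 0" "e1 z (- n) = 1" using R.e0_values[OF z] by (simp_all add: e1_def)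
qed

text \<open>Subtracting a multiple of \<open>e1\<close> removes both resonant values, the
  contraction estimate then forces the rest to vanish, and the equation at 0 becomes
  \<open>B * (a n + Off' z) = 0\<close>. A solution is thus determined by its value at 0.\<close>

lemma lattice_unique:
  assumes z: "cmod z \<le> 1" and y: "(\<lambda>l. cmod (y l)) summable_on UNIV" and eq: "\<And>j. lattice_op a n z y j = 0"
    and y0: "y 0 = 0" and nz: "a n + Off' z \<noteq> 0"
  shows "y j = 0"
proof -
  define B where "B = y (- n)"
  define x where "x l = 1 * y l + (- B) * e1 z l" for l
  have xs: "(\<lambda>l. cmod (x l)) summable_on UNIV"
  proof (rule summable_on_comparison_test[OF summable_on_add[OF y summable_on_cmult_right[OF e1_summable[OF z], of "cmod B"]]])
    fix l show "cmod (x l) \<le> cmod (y l) + cmod B * cmod (e1 z l)"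
      using norm_triangle_ineq[of "y l" "- B * e1 z l"] by (simp add: x_def norm_mult)
  qed auto
  have latx: "lattice_op a n z x i = - B * lattice_op a n z (e1 z) i" for i
    using lattice_op_linear[OF y e1_summable[OF z], of z 1 "- B" i] eq[of i] by (simp add: x_def[abs_def])
  have x0: "x 0 = 0" "x (- n) = 0" using e1_values[OF z] y0 by (simp_all add: x_def B_def)
  define S where "S = (\<Sum>\<^sub>\<infinity>l. cmod (x l))"
  have xb: "cmod (x i) \<le> (C * S) * gap n i" for i
  proof (cases "i = 0 \<or> i = - n")
    case True thus ?thesis using x0 by auto
  next
    case False
    hence "lattice_op a n z x i = 0" using latx[of i] lattice_op_e1[OF z, of i] by simp
    hence "(detuning n i + z) * x i = - (\<Sum>\<^sub>\<infinity>l. a (i - l) * x l)" by (simp add: lattice_op_def eq_neg_iff_add_eq_0)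
    hence "x i = (1 / (detuning n i + z)) * (- (\<Sum>\<^sub>\<infinity>l. a (i - l) * x l))"
      using detuning_bound(2)[of i n z] False z by (simp add: field_simps)
    hence "cmod (x i) = cmod (1 / (detuning n i + z)) * cmod (\<Sum>\<^sub>\<infinity>l. a (i - l) * x l)" by (simp only: norm_mult norm_minus_cancel)
    also have "\<dots> \<le> gap n i * (C * S)" unfolding S_def
      using detuning_bound(1)[of i n z] False z mult_bounded_summable(3)[OF xs, of "\<lambda>l. a (i - l)" C] a_le_C by (intro mult_mono) auto
    finally show ?thesis by (simp add: mult.commute)
  qed
  have "S \<le> (\<Sum>\<^sub>\<infinity>i. (C * S) * gap n i)" unfolding S_def
    by (rule infsum_mono[OF xs summable_on_cmult_right[OF gap_summable]]) (use xb in \<open>simp add: S_def\<close>)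
  also have "\<dots> = (C * gap_sum n) * S" by (subst infsum_cmult_right[OF gap_summable]) (simp add: gap_sum_def)
  also have "\<dots> \<le> 1/2 * S" by (intro mult_right_mono half) (simp add: S_def infsum_nonneg)
  finally have S0: "S \<le> 0" by simp
  have "x i = 0" for i
  proof -
    have "sum (\<lambda>l. cmod (x l)) {i} \<le> S" unfolding S_def by (rule finite_sum_le_infsum[OF xs]) auto
    hence "cmod (x i) \<le> S" by simp
    hence "cmod (x i) \<le> 0" using S0 by linarith
    thus ?thesis by simp
  qed
  hence "lattice_op a n z x 0 = 0" by (simp add: lattice_op_def)
  hence "B * (a n + Off' z) = 0" using latx[of 0] lattice_op_e1[OF z, of 0] by simp
  hence "B = 0" using nz by simp
  thus ?thesis using \<open>\<And>i. x i = 0\<close>[of j] by (simp add: x_def)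
qed

text \<open>For a fixed point argument in the manner of Brouwer continuity in \<open>z\<close>
  suffices, so no derivative of the couplings has to be estimated. The constant 3 is the product of
  3/2 and 2, since each coupling lies between one half and three halves of its leading coefficient
  in modulus.\<close>

theorem resonant_solution:
  assumes small: "2 * C\<^sup>2 * gap_sum n + 4 * sqrt (cmod (a n) * cmod (a (- n))) \<le> 1"
    and off': "\<And>z. cmod z \<le> 1 \<Longrightarrow> cmod (Off' z) \<le> cmod (a n) / 2"
    and off: "\<And>z. cmod z \<le> 1 \<Longrightarrow> cmod (Off z) \<le> cmod (a (- n)) / 2"
    and nz: "a n \<noteq> 0" "a (- n) \<noteq> 0"
  shows "\<exists>z y. cmod z \<le> 1 \<and> (\<lambda>l. cmod (y l)) summable_on UNIV \<and> (\<forall>j. lattice_op a n z y j = 0) \<and>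
     y 0 \<noteq> 0 \<and> y (- n) \<noteq> 0 \<and>
     (cmod (y (- n)))\<^sup>2 * cmod (a n) \<le> 3 * (cmod (y 0))\<^sup>2 * cmod (a (- n)) \<and>
     (cmod (y 0))\<^sup>2 * cmod (a (- n)) \<le> 3 * (cmod (y (- n)))\<^sup>2 * cmod (a n) \<and>
     (\<forall>j. j \<noteq> 0 \<and> j \<noteq> - n \<longrightarrow> cmod (y j) \<le> 2 * C * (cmod (y 0) + cmod (y (- n))) * gap n j) \<and>
     (\<forall>y'. (\<lambda>l. cmod (y' l)) summable_on UNIV \<and> (\<forall>j. lattice_op a n z y' j = 0) \<and> y' 0 = 0 \<longrightarrow> (\<forall>j. y' j = 0))"
proof -
  interpret R: lattice a' m C n by (rule reflect)
  define \<eta>1 where "\<eta>1 z = Off' z / a n" for z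
  define \<eta>2 where "\<eta>2 z = Off z / a (- n)" for z
  have \<eta>: "cmod (\<eta>1 z) \<le> 1/2" "cmod (\<eta>2 z) \<le> 1/2" if "cmod z \<le> 1" for z
    using off'[OF that] off[OF that] nz by (simp_all add: \<eta>1_def \<eta>2_def norm_divide divide_le_eq)
  have Re1: "Re (1 + w) > 0" if "cmod w \<le> 1/2" for w
    using abs_Re_le_cmod[of w] that by auto
  have cs: "cmod (csqrt (1 + w)) \<le> 2" if "cmod w \<le> 1/2" for w
  proof -
    have "(cmod (csqrt (1 + w)))\<^sup>2 = cmod (1 + w)" by (simp add: norm_power[symmetric])
    also have "\<dots> \<le> 2\<^sup>2" using norm_triangle_ineq[of 1 w] that by simp
    finally show ?thesis by (rule power2_le_imp_le) simp
  qed
  \<comment> \<open>A continuous branch of the root: the constant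
    \<open>csqrt (a n * a (- n))\<close> may have any argument, and the other factors are roots of
    numbers with positive real part, away from the cut.\<close>
  define \<tau> where "\<tau> z = csqrt (a n * a (- n)) * (csqrt (1 + \<eta>1 z) * csqrt (1 + \<eta>2 z))" for z
  have \<tau>2: "(\<tau> z)\<^sup>2 = (a n + Off' z) * (a (- n) + Off z)" for z
  proof -
    have "(\<tau> z)\<^sup>2 = (a n * (1 + \<eta>1 z)) * (a (- n) * (1 + \<eta>2 z))" by (simp add: \<tau>_def power_mult_distrib mult_ac)
    moreover have "a n * (1 + \<eta>1 z) = a n + Off' z" "a (- n) * (1 + \<eta>2 z) = a (- n) + Off z"
      using nz by (simp_all add: \<eta>1_def \<eta>2_def distrib_left)
    ultimately show ?thesis by simp
  qed
  have \<tau>b: "cmod (\<tau> z) \<le> 4 * sqrt (cmod (a n) * cmod (a (- n)))" if z: "cmod z \<le> 1" for z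
  proof -
    have "cmod (csqrt (a n * a (- n))) = sqrt (cmod (a n) * cmod (a (- n)))"
    proof -
      have "(cmod (csqrt (a n * a (- n))))\<^sup>2 = cmod (a n) * cmod (a (- n))" by (simp add: norm_power[symmetric] norm_mult)
      thus ?thesis by (metis norm_ge_zero real_sqrt_unique)
    qed
    moreover have "cmod (csqrt (1 + \<eta>1 z)) * cmod (csqrt (1 + \<eta>2 z)) \<le> 2 * 2" by (intro mult_mono cs \<eta> z) auto
    ultimately show ?thesis unfolding \<tau>_def norm_mult
      using mult_left_mono[of "cmod (csqrt (1 + \<eta>1 z)) * cmod (csqrt (1 + \<eta>2 z))" 4 "sqrt (cmod (a n) * cmod (a (- n)))"] by (simp add: mult.commute)
  qed
  have \<tau>c: "continuous_on (cball 0 1) \<tau>"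
  proof -
    have c1: "continuous_on (cball 0 1) (\<lambda>z. 1 + \<eta>1 z)" unfolding \<eta>1_def by (intro continuous_intros R.Off_continuous) (use nz in auto)
    have c2: "continuous_on (cball 0 1) (\<lambda>z. 1 + \<eta>2 z)" unfolding \<eta>2_def by (intro continuous_intros Off_continuous) (use nz in auto)
    have np: "1 + w \<notin> \<real>\<^sub>\<le>\<^sub>0" if "cmod w \<le> 1/2" for w using Re1[OF that] by (auto simp: complex_nonpos_Reals_iff)
    have c3: "continuous_on {w. w \<notin> \<real>\<^sub>\<le>\<^sub>0} csqrt"
      by (rule continuous_at_imp_continuous_on) (auto intro: continuous_at_csqrt)
    have c4: "continuous_on (cball 0 1) (\<lambda>z. csqrt (1 + \<eta>1 z))" "continuous_on (cball 0 1) (\<lambda>z. csqrt (1 + \<eta>2 z))"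
      by (rule continuous_on_compose2[OF c3 c1], use np \<eta> in auto, rule continuous_on_compose2[OF c3 c2], use np \<eta> in auto)
    show ?thesis unfolding \<tau>_def by (intro continuous_on_mult continuous_on_const c4)
  qed
  have "\<exists>z\<in>cball 0 1. - Diag z + \<tau> z = z"
  proof (rule brouwer[where f = "\<lambda>z. - Diag z + \<tau> z"])
    show "(\<lambda>z. - Diag z + \<tau> z) \<in> cball 0 1 \<rightarrow> cball 0 1"
    proof
      fix z :: complex assume "z \<in> cball 0 1"
      hence z: "cmod z \<le> 1" by simp
      have "cmod (- Diag z + \<tau> z) \<le> 1"
        using norm_triangle_ineq[of "- Diag z" "\<tau> z"] Diag_bound[OF z] \<tau>b[OF z] small by simp
      thus "- Diag z + \<tau> z \<in> cball 0 1" by simp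
    qed
    show "continuous_on (cball 0 1) (\<lambda>z. - Diag z + \<tau> z)" by (intro continuous_intros Diag_continuous \<tau>c)
  qed auto
  then obtain z where z: "cmod z \<le> 1" and zt: "z + Diag z = \<tau> z" by (auto simp: algebra_simps)
  \<comment> \<open>With \<open>B = - (z + Diag z)\<close> the equation at 0 holds identically for
    \<open>A * e0 + B * e1\<close>, and the one at \<open>- n\<close> reads
    \<open>(\<tau> z)\<^sup>2 = A * b2\<close>.\<close>
  define A where "A = a n + Off' z"
  define B where "B = - \<tau> z"
  have nA: "cmod (a n) / 2 \<le> cmod A" "cmod A \<le> 3/2 * cmod (a n)"
    using norm_triangle_ineq[of "a n" "Off' z"] norm_diff_ineq[of "a n" "Off' z"] off'[OF z] by (simp_all add: A_def)
  define b2 where "b2 = a (- n) + Off z"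
  have nb: "cmod (a (- n)) / 2 \<le> cmod b2" "cmod b2 \<le> 3/2 * cmod (a (- n))"
    using norm_triangle_ineq[of "a (- n)" "Off z"] norm_diff_ineq[of "a (- n)" "Off z"] off[OF z] by (simp_all add: b2_def)
  have pos: "cmod (a n) > 0" "cmod (a (- n)) > 0" using nz by auto
  have A0: "A \<noteq> 0" using nA pos by auto
  have b0: "b2 \<noteq> 0" using nb pos by auto
  have B2: "B\<^sup>2 = A * b2" using \<tau>2[of z] by (simp add: B_def A_def b2_def)
  have B0: "B \<noteq> 0" using B2 A0 b0 by auto
  have nB: "(cmod B)\<^sup>2 = cmod A * cmod b2" using B2 by (simp add: norm_power[symmetric] norm_mult)
  define y where "y j = A * e0 z j + B * e1 z j" for j
  have ys: "(\<lambda>l. cmod (y l)) summable_on UNIV"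
  proof (rule summable_on_comparison_test[OF summable_on_add[OF summable_on_cmult_right[OF e0_summable[OF z], of "cmod A"] summable_on_cmult_right[OF e1_summable[OF z], of "cmod B"]]])
    fix l show "cmod (y l) \<le> cmod A * cmod (e0 z l) + cmod B * cmod (e1 z l)"
      using norm_triangle_ineq[of "A * e0 z l" "B * e1 z l"] by (simp add: y_def norm_mult)
  qed auto
  have "lattice_op a n z y j = 0" for j
  proof -
    have "lattice_op a n z y j = A * lattice_op a n z (e0 z) j + B * lattice_op a n z (e1 z) j"
      unfolding y_def[abs_def] by (rule lattice_op_linear[OF e0_summable[OF z] e1_summable[OF z]])
    also have "\<dots> = 0"
      using B2 n by (auto simp: lattice_op_e0[OF z] lattice_op_e1[OF z] zt A_def[symmetric] b2_def[symmetric] B_def power2_eq_square)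
    finally show ?thesis .
  qed
  moreover have yv: "y 0 = A" "y (- n) = B" using e0_values[OF z] e1_values[OF z] by (simp_all add: y_def)
  moreover have "(cmod B)\<^sup>2 * cmod (a n) \<le> 3 * (cmod A)\<^sup>2 * cmod (a (- n))"
  proof -
    have "(cmod B)\<^sup>2 * cmod (a n) = cmod A * (cmod b2 * cmod (a n))" by (simp add: nB)
    also have "\<dots> \<le> cmod A * ((3/2 * cmod (a (- n))) * (2 * cmod A))" using nA nb by (intro mult_left_mono mult_mono) auto
    finally show ?thesis by (simp add: power2_eq_square mult_ac)
  qed
  moreover have "(cmod A)\<^sup>2 * cmod (a (- n)) \<le> 3 * (cmod B)\<^sup>2 * cmod (a n)"
  proof -
    have "(cmod A)\<^sup>2 * cmod (a (- n)) = cmod A * (cmod A * cmod (a (- n)))" by (simp add: power2_eq_square)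
    also have "\<dots> \<le> cmod A * ((3/2 * cmod (a n)) * (2 * cmod b2))" using nA nb by (intro mult_left_mono mult_mono) auto
    finally show ?thesis by (simp add: nB mult_ac)
  qed
  moreover have "cmod (y j) \<le> 2 * C * (cmod A + cmod B) * gap n j" if "j \<noteq> 0" "j \<noteq> - n" for j
  proof -
    have "y j = A * W z j + B * W' z (- n - j)" using that by (simp add: y_def e0_def e1_def R.e0_def)
    hence "cmod (y j) \<le> cmod A * cmod (W z j) + cmod B * cmod (W' z (- n - j))"
      using norm_triangle_ineq[of "A * W z j" "B * W' z (- n - j)"] by (simp add: norm_mult)
    also have "\<dots> \<le> cmod A * (2 * C * gap n j) + cmod B * (2 * C * gap n j)"
      using W_bound'[OF z, of j] R.W_bound'[OF z, of "- n - j"] by (intro add_mono mult_left_mono) (auto simp: gap_reflect)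
    finally show ?thesis by (simp add: algebra_simps)
  qed
  moreover have "\<forall>j. y' j = 0" if "(\<lambda>l. cmod (y' l)) summable_on UNIV" "\<forall>j. lattice_op a n z y' j = 0" "y' 0 = 0" for y'
    using lattice_unique[OF z that(1) _ that(3)] that(2) A0 by (simp add: A_def)
  ultimately show ?thesis using z ys A0 B0 by (intro exI[of _ z] exI[of _ y]) auto
qed

end

section \<open>Asymptotics of the resonant solutions\<close>

lemma decay_bounded:
  fixes a :: "int \<Rightarrow> complex"
  assumes dec: "\<And>e. e > 0 \<Longrightarrow> \<exists>N. \<forall>k. \<bar>k\<bar> \<ge> N \<longrightarrow> \<bar>real_of_int k\<bar> ^ m * cmod (a k) < e"
  shows "\<exists>C\<ge>0. \<forall>k. cmod (a k) * weight k ^ m \<le> C"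
proof -
  obtain N where N: "\<And>k. \<bar>k\<bar> \<ge> N \<Longrightarrow> \<bar>real_of_int k\<bar> ^ m * cmod (a k) < 1" using dec[of 1] by auto
  define S where "S = {- \<bar>N\<bar> - 1..\<bar>N\<bar> + 1}"
  define C where "C = 2 ^ m + (\<Sum>k\<in>S. cmod (a k) * weight k ^ m)"
  have nn: "0 \<le> cmod (a k) * weight k ^ m" for k by simp
  have s0: "0 \<le> (\<Sum>k\<in>S. cmod (a k) * weight k ^ m)" by (intro sum_nonneg nn)
  have "cmod (a k) * weight k ^ m \<le> C" for k
  proof (cases "k \<in> S")
    case True
    have "cmod (a k) * weight k ^ m \<le> (\<Sum>k\<in>S. cmod (a k) * weight k ^ m)"
      by (rule member_le_sum[OF True nn]) (simp add: S_def)
    thus ?thesis by (simp add: C_def add_increasing)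
  next
    case False
    hence k: "\<bar>k\<bar> \<ge> N" "\<bar>k\<bar> \<ge> 1" by (auto simp: S_def)
    have "weight k \<le> 2 * \<bar>real_of_int k\<bar>" using k(2) by (simp add: weight_def)
    hence "cmod (a k) * weight k ^ m \<le> cmod (a k) * (2 * \<bar>real_of_int k\<bar>) ^ m" by (intro mult_left_mono power_mono) auto
    also have "\<dots> = 2 ^ m * (\<bar>real_of_int k\<bar> ^ m * cmod (a k))" by (simp add: power_mult_distrib mult_ac)
    also have "\<dots> \<le> 2 ^ m * 1" using N[OF k(1)] by (intro mult_left_mono) auto
    finally show ?thesis using s0 by (simp add: C_def)
  qed
  moreover have "C \<ge> 0" using s0 by (simp add: C_def)
  ultimately show ?thesis by blast
qed

text \<open>For \<open>m \<ge> 1\<close> the sequence \<open>a j / j\<close> is absolutely summable,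
  and one of \<open>j\<close> and \<open>p - j\<close> has modulus at least
  \<open>\<bar>p\<bar> / 2\<close>, so that this factor alone supplies the full decay. Only
  \<open>m = 0\<close> depends on cancellation.\<close>

lemma convolution_square_decay:
  fixes a :: "int \<Rightarrow> complex"
  assumes m: "m \<ge> 1" and dec: "\<And>e. e > 0 \<Longrightarrow> \<exists>N. \<forall>k. \<bar>k\<bar> \<ge> N \<longrightarrow> \<bar>real_of_int k\<bar> ^ m * cmod (a k) < e"
    and T: "\<And>p. ((\<lambda>j. (a j / of_int j) * (a (p - j) / of_int (p - j))) has_sum T p) UNIV" and e: "e > 0"
  shows "\<exists>N. \<forall>p. \<bar>p\<bar> \<ge> N \<longrightarrow> \<bar>real_of_int p\<bar> ^ (m + 1) * cmod (T p) < e"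
proof -
  obtain C where C: "C \<ge> 0" "\<And>k. cmod (a k) * weight k ^ m \<le> C" using decay_bounded[OF dec] by auto
  define b where "b j = a j / of_int j" for j
  have bs: "(\<lambda>j. cmod (b j)) summable_on UNIV"
  proof (rule summable_on_comparison_test)
    show "(\<lambda>j::int. C * (1 / (\<bar>real_of_int j\<bar> * \<bar>real_of_int (j + 0)\<bar>))) summable_on UNIV"
      by (intro summable_on_cmult_right summable_int_inverse_square_pair)
    fix j :: int
    show "cmod (b j) \<le> C * (1 / (\<bar>real_of_int j\<bar> * \<bar>real_of_int (j + 0)\<bar>))"
    proof (cases "j = 0")
      case False
      have "\<bar>real_of_int j\<bar> \<le> weight j ^ 1" by (simp add: weight_def)
      also have "\<dots> \<le> weight j ^ m" using m weight_ge_1 by (intro power_increasing) auto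
      finally have "cmod (a j) * \<bar>real_of_int j\<bar> \<le> C" using C(2)[of j] mult_left_mono[of "\<bar>real_of_int j\<bar>" "weight j ^ m" "cmod (a j)"] by simp
      hence "cmod (a j) \<le> C / \<bar>real_of_int j\<bar>" using False by (subst pos_le_divide_eq) auto
      from divide_right_mono[OF this, of "\<bar>real_of_int j\<bar>"] show ?thesis by (simp add: b_def norm_divide)
    qed (simp add: b_def)
  qed auto
  define S where "S = (\<Sum>\<^sub>\<infinity>j. cmod (b j))"
  have S0: "S \<ge> 0" unfolding S_def by (intro infsum_nonneg) simp
  \<comment> \<open>The power of 2 undoes \<open>h = \<bar>p\<bar> / 2\<close>, \<open>2 * S\<close>
    is the sum of all \<open>cmod (b j) + cmod (b (p - j))\<close>, and adding 1 gives
    strictness.\<close>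
  define e' where "e' = e / (2 ^ (m + 1) * (2 * S + 1))"
  have e': "e' > 0" using e S0 by (simp add: e'_def)
  obtain N where N: "\<And>k. \<bar>k\<bar> \<ge> N \<Longrightarrow> \<bar>real_of_int k\<bar> ^ m * cmod (a k) < e'" using dec[OF e'] by auto
  show ?thesis
  proof (intro exI[of _ "2 * \<bar>N\<bar> + 2"] allI impI)
    fix p :: int assume p: "2 * \<bar>N\<bar> + 2 \<le> \<bar>p\<bar>"
    define h where "h = \<bar>real_of_int p\<bar> / 2"
    have h0: "h > 0" using p by (simp add: h_def)
    have big: "h ^ (m + 1) * cmod (b k) \<le> e'" if k: "h \<le> \<bar>real_of_int k\<bar>" for k
    proof -
      have k0: "k \<noteq> 0" using k h0 by auto
      have "\<bar>k\<bar> \<ge> N" using k p unfolding h_def by linarith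
      from N[OF this] have lt: "\<bar>real_of_int k\<bar> ^ m * cmod (a k) < e'" .
      have "h ^ (m + 1) * cmod (b k) \<le> \<bar>real_of_int k\<bar> ^ (m + 1) * cmod (b k)"
        using k h0 by (intro mult_right_mono power_mono) auto
      also have "\<dots> = \<bar>real_of_int k\<bar> ^ m * cmod (a k)" using k0 by (simp add: b_def norm_divide)
      finally show ?thesis using lt by simp
    qed
    have bp: "(\<lambda>j. cmod (b (p - j))) summable_on UNIV" "(\<Sum>\<^sub>\<infinity>j. cmod (b (p - j))) = S"
    proof -
      have "bij (\<lambda>j::int. p - j)" by (rule o_bij[of "\<lambda>l. p - l"]) auto
      thus "(\<lambda>j. cmod (b (p - j))) summable_on UNIV" "(\<Sum>\<^sub>\<infinity>j. cmod (b (p - j))) = S"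
        using summable_on_reindex_bij_betw[of "\<lambda>j. p - j" UNIV UNIV "\<lambda>j. cmod (b j)"] infsum_reindex_bij_betw[of "\<lambda>j. p - j" UNIV UNIV "\<lambda>j. cmod (b j)"] bs
        by (simp_all add: S_def)
    qed
    have term_le: "cmod (b j * b (p - j)) \<le> (e' / h ^ (m + 1)) * (cmod (b j) + cmod (b (p - j)))" for j
    proof -
      have "h \<le> \<bar>real_of_int j\<bar> \<or> h \<le> \<bar>real_of_int (p - j)\<bar>"
      proof -
        have "\<bar>real_of_int p\<bar> \<le> \<bar>real_of_int j\<bar> + \<bar>real_of_int (p - j)\<bar>" by simp
        thus ?thesis unfolding h_def by linarith
      qed
      hence "cmod (b j) \<le> e' / h ^ (m + 1) \<or> cmod (b (p - j)) \<le> e' / h ^ (m + 1)"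
        using big[of j] big[of "p - j"] h0 by (auto simp: pos_le_divide_eq mult.commute)
      thus ?thesis
      proof
        assume "cmod (b j) \<le> e' / h ^ (m + 1)"
        from mult_right_mono[OF this, of "cmod (b (p - j))"] have "cmod (b j * b (p - j)) \<le> (e' / h ^ (m + 1)) * cmod (b (p - j))" by (simp add: norm_mult)
        also have "\<dots> \<le> (e' / h ^ (m + 1)) * (cmod (b j) + cmod (b (p - j)))" using e' h0 by (intro mult_left_mono) auto
        finally show ?thesis .
      next
        assume "cmod (b (p - j)) \<le> e' / h ^ (m + 1)"
        from mult_left_mono[OF this, of "cmod (b j)"] have "cmod (b j * b (p - j)) \<le> (e' / h ^ (m + 1)) * cmod (b j)" by (simp add: norm_mult mult.commute)
        also have "\<dots> \<le> (e' / h ^ (m + 1)) * (cmod (b j) + cmod (b (p - j)))" using e' h0 by (intro mult_left_mono) auto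
        finally show ?thesis .
      qed
    qed
    have ss: "(\<lambda>j. (e' / h ^ (m + 1)) * (cmod (b j) + cmod (b (p - j)))) summable_on UNIV"
      by (intro summable_on_cmult_right summable_on_add bs bp)
    have sn: "(\<lambda>j. cmod (b j * b (p - j))) summable_on UNIV"
      by (rule summable_on_comparison_test[OF ss term_le]) auto
    have "T p = (\<Sum>\<^sub>\<infinity>j. b j * b (p - j))" using infsumI[OF T[of p]] by (simp add: b_def)
    hence "cmod (T p) \<le> (\<Sum>\<^sub>\<infinity>j. cmod (b j * b (p - j)))" using norm_infsum_bound[OF sn] by simp
    also have "\<dots> \<le> (\<Sum>\<^sub>\<infinity>j. (e' / h ^ (m + 1)) * (cmod (b j) + cmod (b (p - j))))" by (rule infsum_mono[OF sn ss term_le])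
    also have "\<dots> = (e' / h ^ (m + 1)) * (S + S)"
      by (subst infsum_cmult_right[OF summable_on_add[OF bs bp(1)]]) (simp add: infsum_add[OF bs bp(1)] bp(2) S_def)
    finally have "h ^ (m + 1) * cmod (T p) \<le> e' * (2 * S)" using h0 by (simp add: field_simps)
    hence "2 ^ (m + 1) * (h ^ (m + 1) * cmod (T p)) \<le> 2 ^ (m + 1) * (e' * (2 * S))" by (intro mult_left_mono) auto
    moreover have "2 ^ (m + 1) * (h ^ (m + 1) * cmod (T p)) = \<bar>real_of_int p\<bar> ^ (m + 1) * cmod (T p)"
      by (simp add: h_def power_divide)
    moreover have "2 ^ (m + 1) * (e' * (2 * S)) < e"
    proof -
      have "2 ^ (m + 1) * (e' * (2 * S)) < 2 ^ (m + 1) * (e' * (2 * S + 1))" using e' by (intro mult_strict_left_mono) auto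
      also have "\<dots> = e" using S0 by (simp add: e'_def)
      finally show ?thesis .
    qed
    ultimately show "\<bar>real_of_int p\<bar> ^ (m + 1) * cmod (T p) < e" by linarith
  qed
qed

text \<open>The second limit is the reason for an exponent below -1/2: twice -3/4 plus 1 is
  negative.\<close>

lemma gap_sum_limits:
  "(\<lambda>n. gap_sum (int n)) \<longlonglongrightarrow> 0" "(\<lambda>n. real n * (gap_sum (int n))\<^sup>2) \<longlonglongrightarrow> 0"
proof -
  obtain K where K: "\<And>n. n \<ge> 1 \<Longrightarrow> gap_sum n \<le> K * real_of_int n powr (-3/4)" using gap_sum_bound by blast
  have Klim: "(\<lambda>n. K * real n powr (-3/4)) \<longlonglongrightarrow> 0"
    by (intro tendsto_mult_right_zero tendsto_neg_powr filterlim_real_sequentially) simp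
  show g0: "(\<lambda>n. gap_sum (int n)) \<longlonglongrightarrow> 0"
  proof (rule tendsto_sandwich[OF _ _ tendsto_const Klim])
    show "\<forall>\<^sub>F n in sequentially. 0 \<le> gap_sum (int n)" by (simp add: gap_sum_nonneg)
    show "\<forall>\<^sub>F n in sequentially. gap_sum (int n) \<le> K * real n powr (-3/4)"
      using eventually_ge_at_top[of 1] by eventually_elim (use K[of "int _"] in simp)
  qed
  show ng0: "(\<lambda>n. real n * (gap_sum (int n))\<^sup>2) \<longlonglongrightarrow> 0"
  proof (rule tendsto_sandwich[OF _ _ tendsto_const])
    show "\<forall>\<^sub>F n in sequentially. 0 \<le> real n * (gap_sum (int n))\<^sup>2" by simp
    show "\<forall>\<^sub>F n in sequentially. real n * (gap_sum (int n))\<^sup>2 \<le> K\<^sup>2 * real n powr (-1/2)"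
      using eventually_ge_at_top[of 1]
    proof eventually_elim
      fix n :: nat assume n: "1 \<le> n"
      have "(gap_sum (int n))\<^sup>2 \<le> (K * real n powr (-3/4))\<^sup>2" using K[of "int n"] n gap_sum_nonneg by (intro power_mono) auto
      hence "real n * (gap_sum (int n))\<^sup>2 \<le> real n * (K * real n powr (-3/4))\<^sup>2" by (intro mult_left_mono) auto
      also have "\<dots> = K\<^sup>2 * (real n powr 1 * (real n powr (-3/4) * real n powr (-3/4)))" using n by (simp add: power2_eq_square mult_ac)
      also have "\<dots> = K\<^sup>2 * real n powr (-1/2)" by (simp only: powr_add[symmetric]) simp
      finally show "real n * (gap_sum (int n))\<^sup>2 \<le> K\<^sup>2 * real n powr (-1/2)" .
    qed
    show "(\<lambda>n. K\<^sup>2 * real n powr (-1/2)) \<longlonglongrightarrow> 0"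
      by (intro tendsto_mult_right_zero tendsto_neg_powr filterlim_real_sequentially) simp
  qed
qed

text \<open>All that the estimates of the eigenfunction use; the last clause is geometric simplicity
  in a form independent of the index 0.\<close>

definition resonant_at :: "(int \<Rightarrow> complex) \<Rightarrow> real \<Rightarrow> int \<Rightarrow> complex \<Rightarrow> (int \<Rightarrow> complex) \<Rightarrow> bool" where
  "resonant_at a C n z y \<longleftrightarrow> (\<lambda>l. cmod (y l)) summable_on UNIV \<and> (\<forall>j. lattice_op a n z y j = 0) \<and>
     y 0 \<noteq> 0 \<and> y (- n) \<noteq> 0 \<and>
     (cmod (y (- n)))\<^sup>2 * cmod (a n) \<le> 3 * (cmod (y 0))\<^sup>2 * cmod (a (- n)) \<and>
     (cmod (y 0))\<^sup>2 * cmod (a (- n)) \<le> 3 * (cmod (y (- n)))\<^sup>2 * cmod (a n) \<and>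
     (\<forall>j. j \<noteq> 0 \<and> j \<noteq> - n \<longrightarrow> cmod (y j) \<le> 2 * C * (cmod (y 0) + cmod (y (- n))) * gap n j) \<and>
     (\<forall>y'. (\<lambda>l. cmod (y' l)) summable_on UNIV \<and> (\<forall>j. lattice_op a n z y' j = 0) \<longrightarrow> (\<exists>c. \<forall>j. y' j = c * y j))"

text \<open>The corrections of the couplings are \<open>o (1 / n ^ (m + 1))\<close>, the couplings
  exceed \<open>c0 / n ^ (m + 1)\<close>. Corrections up to half a coupling are admissible: one
  quarter of \<open>c0\<close> is allotted to \<open>T\<close>, one quarter to the higher
  iterates.\<close>

theorem resonant_eventually:
  assumes q: "sobolev_W1 m q" and bc: "\<And>j. j < m \<Longrightarrow> (deriv_01 ^^ j) q 0 = (deriv_01 ^^ j) q 1" and c0: "c0 > 0"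
    and a: "\<And>k. a k = (if k = 0 then 0 else fcoeff q k)"
  shows "\<exists>C. C \<ge> 0 \<and> (\<forall>k. cmod (a k) * weight k ^ m \<le> C) \<and>
     (\<forall>\<^sub>F n in sequentially. c0 / real n ^ (m + 1) < cmod (a (int n)) \<and> c0 / real n ^ (m + 1) < cmod (a (- int n)) \<longrightarrow>
        (\<exists>z y. resonant_at a C (int n) z y))"
proof -
  have qi: "integrable leb01 q" using q unfolding sobolev_W1_def by (elim conjE allE[of _ 0]) auto
  have dec: "\<exists>N. \<forall>k. \<bar>k\<bar> \<ge> N \<longrightarrow> \<bar>real_of_int k\<bar> ^ m * cmod (a k) < e" if e: "e > 0" for e
  proof -
    obtain N where N: "\<And>k. \<bar>k\<bar> \<ge> N \<Longrightarrow> \<bar>real_of_int k\<bar> ^ m * cmod (fcoeff q k) < e" using fcoeff_sobolev_decay[OF q bc e] by blast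
    have "\<bar>real_of_int k\<bar> ^ m * cmod (a k) < e" if "\<bar>k\<bar> \<ge> N" for k using N[OF that] e by (simp add: a)
    thus ?thesis by blast
  qed
  obtain C where C: "C \<ge> 0" "\<And>k. cmod (a k) * weight k ^ m \<le> C" using decay_bounded[OF dec] by auto
  obtain T where T: "\<And>p. ((\<lambda>j. (a j / of_int j) * (a (p - j) / of_int (p - j))) has_sum T p) UNIV"
    and T0: "\<And>e. e > 0 \<Longrightarrow> \<exists>N. \<forall>p. \<bar>p\<bar> \<ge> N \<longrightarrow> \<bar>real_of_int p\<bar> * cmod (T p) < e"
    using fcoeff_antiderivative_square[OF qi a] by blast
  have Tdec: "\<exists>N. \<forall>p. \<bar>p\<bar> \<ge> N \<longrightarrow> \<bar>real_of_int p\<bar> ^ (m + 1) * cmod (T p) < e" if e: "e > 0" for e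
  proof (cases "m = 0")
    case True thus ?thesis using T0[OF e] by simp
  next
    case False
    thus ?thesis by (intro convolution_square_decay[OF _ dec T e]) auto
  qed
  define D where "D = 2 * C^3 + C\<^sup>2"
  have D0: "D \<ge> 0" using C(1) by (simp add: D_def)
  note g0 = gap_sum_limits(1) and ng0 = gap_sum_limits(2)
  have fromint: "\<forall>\<^sub>F n in sequentially. P (int n) \<and> P (- int n)" if exN: "\<exists>N. \<forall>k. \<bar>k\<bar> \<ge> N \<longrightarrow> P k" for P
  proof -
    obtain N where N: "\<And>k. \<bar>k\<bar> \<ge> N \<Longrightarrow> P k" using exN by blast
    show ?thesis using eventually_ge_at_top[of "nat N"] by eventually_elim (auto intro!: N)
  qed
  \<comment> \<open>The bound 1/8 makes four times the square root in \<open>small\<close> at most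
    1/2; \<open>e2\<close> provides the other half.\<close>
  have a0lim: "\<forall>\<^sub>F n in sequentially. cmod (a (int n)) < 1/8 \<and> cmod (a (- int n)) < 1/8"
  proof (rule fromint)
    obtain N where "\<And>k. \<bar>k\<bar> \<ge> N \<Longrightarrow> cmod (fcoeff q k) < 1/8" using Riemann_Lebesgue[OF qi, of "1/8"] by auto
    thus "\<exists>N. \<forall>k. \<bar>k\<bar> \<ge> N \<longrightarrow> cmod (a k) < 1/8" by (intro exI[of _ N]) (simp add: a)
  qed
  have T4: "\<forall>\<^sub>F n in sequentially. \<bar>real_of_int (int n)\<bar> ^ (m+1) * cmod (T (int n)) < c0/4 \<and> \<bar>real_of_int (- int n)\<bar> ^ (m+1) * cmod (T (- int n)) < c0/4"
    by (rule fromint, rule Tdec) (use c0 in simp)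
  have e1: "\<forall>\<^sub>F n in sequentially. C * gap_sum (int n) < 1/2"
    by (rule order_tendstoD(2)[OF tendsto_mult_right_zero[OF g0]]) simp
  have e2: "\<forall>\<^sub>F n in sequentially. 2 * C\<^sup>2 * gap_sum (int n) < 1/2"
    by (rule order_tendstoD(2)[OF tendsto_mult_right_zero[OF g0]]) simp
  have e3: "\<forall>\<^sub>F n in sequentially. D * (real n * (gap_sum (int n))\<^sup>2) < c0/4"
    by (rule order_tendstoD(2)[OF tendsto_mult_right_zero[OF ng0]]) (use c0 in simp)
  have "\<forall>\<^sub>F n in sequentially. c0 / real n ^ (m + 1) < cmod (a (int n)) \<and> c0 / real n ^ (m + 1) < cmod (a (- int n)) \<longrightarrow>
        (\<exists>z y. resonant_at a C (int n) z y)"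
    using eventually_ge_at_top[of 1] a0lim T4 e1 e2 e3
  proof eventually_elim
    case (elim n)
    show ?case
    proof (intro impI, elim conjE)
      assume lo: "c0 / real n ^ (m + 1) < cmod (a (int n))" "c0 / real n ^ (m + 1) < cmod (a (- int n))"
      have n1: "n \<ge> 1" by fact
      interpret L: lattice a m C "int n"
        by unfold_locales (use elim C a in auto)
      interpret R: lattice "\<lambda>k. a (- k)" m C "int n" by (rule L.reflect)
      have npos: "real n ^ (m + 1) > 0" using n1 by simp
      \<comment> \<open>\<open>n ^ m\<close> is compensated by \<open>weight n ^ m\<close>, which
        leaves \<open>n * (gap_sum n)\<^sup>2\<close>.\<close>
      have dbound: "D * (gap_sum (int n))\<^sup>2 / weight (int n) ^ m * real n ^ (m + 1) \<le> c0/4"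
      proof -
        have "real n ^ m \<le> weight (int n) ^ m" by (intro power_mono) (auto simp: weight_def)
        hence "real n ^ m / weight (int n) ^ m \<le> 1" by (simp add: divide_le_eq_1)
        from mult_left_mono[OF this, of "D * (real n * (gap_sum (int n))\<^sup>2)"] D0
        have "D * (real n * (gap_sum (int n))\<^sup>2) * (real n ^ m / weight (int n) ^ m) \<le> D * (real n * (gap_sum (int n))\<^sup>2)" by simp
        moreover have "D * (gap_sum (int n))\<^sup>2 / weight (int n) ^ m * real n ^ (m + 1) = D * (real n * (gap_sum (int n))\<^sup>2) * (real n ^ m / weight (int n) ^ m)" by simp
        ultimately show ?thesis using elim by linarith
      qed
      have offgen: "x \<le> y / 2" if "x \<le> cmod t + D * (gap_sum (int n))\<^sup>2 / weight (int n) ^ m" "real n ^ (m + 1) * cmod t < c0/4" "c0 / real n ^ (m + 1) < y" for x y t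
      proof -
        have "x * real n ^ (m + 1) \<le> (cmod t + D * (gap_sum (int n))\<^sup>2 / weight (int n) ^ m) * real n ^ (m + 1)"
          using that(1) npos by (intro mult_right_mono) auto
        also have "\<dots> \<le> c0/2" using that(2) dbound by (simp only: distrib_right mult.commute[of "cmod t"])
        finally have "x * real n ^ (m + 1) \<le> c0/2" .
        moreover have "c0 < y * real n ^ (m + 1)" using that(3) npos by (simp only: pos_divide_less_eq)
        ultimately have "x * real n ^ (m + 1) \<le> (y/2) * real n ^ (m + 1)" by simp
        thus ?thesis using npos by (simp only: mult_le_cancel_right_pos)
      qed
      have off: "cmod (L.Off z) \<le> cmod (a (- int n)) / 2" if z: "cmod z \<le> 1" for z
      proof (rule offgen[OF _ _ lo(2)])
        show "cmod (L.Off z) \<le> cmod (T (- int n)) + D * (gap_sum (int n))\<^sup>2 / weight (int n) ^ m"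
          unfolding D_def by (rule L.Off_bound[OF z T])
        show "real n ^ (m + 1) * cmod (T (- int n)) < c0/4" using elim by simp
      qed
      \<comment> \<open>A change of sign of \<open>j\<close> turns the sum for the reflected lattice
        into the one at \<open>n\<close>; the two signs in the denominators cancel.\<close>
      have T': "((\<lambda>j. (a (- j) / of_int j) * (a (- (- int n - j)) / of_int (- int n - j))) has_sum T (int n)) UNIV"
      proof -
        have "((\<lambda>j. (a (- j) / of_int (- j)) * (a (int n - (- j)) / of_int (int n - (- j)))) has_sum T (int n)) UNIV"
          using has_sum_reindex_bij_betw[OF bij_uminus, of "\<lambda>j. (a j / of_int j) * (a (int n - j) / of_int (int n - j))"] T[of "int n"] by simp
        moreover have "(a (- j) / of_int (- j)) * (a (int n - (- j)) / of_int (int n - (- j))) = (a (- j) / of_int j) * (a (- (- int n - j)) / of_int (- int n - j))" for j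
        proof -
          have "of_int (- int n - j) = - (of_int (int n - (- j)) :: complex)" "of_int (- j) = - (of_int j :: complex)" "- (- int n - j) = int n - (- j)" by simp_all
          thus ?thesis by (simp only: divide_minus_right mult_minus_left mult_minus_right)
        qed
        ultimately show ?thesis by simp
      qed
      have off': "cmod (R.Off z) \<le> cmod (a (int n)) / 2" if z: "cmod z \<le> 1" for z
      proof (rule offgen[OF _ _ lo(1)])
        show "cmod (R.Off z) \<le> cmod (T (int n)) + D * (gap_sum (int n))\<^sup>2 / weight (int n) ^ m"
          unfolding D_def by (rule R.Off_bound[OF z T'])
        show "real n ^ (m + 1) * cmod (T (int n)) < c0/4" using elim by simp
      qed
      have c0n: "c0 / real n ^ (m + 1) > 0" using c0 npos by simp
      have nz: "a (int n) \<noteq> 0" "a (- int n) \<noteq> 0" using lo c0n by auto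
      have sq: "sqrt (cmod (a (int n)) * cmod (a (- int n))) \<le> 1/8"
      proof -
        have "cmod (a (int n)) * cmod (a (- int n)) \<le> (1/8) * (1/8)" using elim by (intro mult_mono) auto
        hence "cmod (a (int n)) * cmod (a (- int n)) \<le> (1/8)\<^sup>2" by (simp add: power2_eq_square)
        thus ?thesis by (intro real_le_lsqrt) auto
      qed
      have small: "2 * C\<^sup>2 * gap_sum (int n) + 4 * sqrt (cmod (a (int n)) * cmod (a (- int n))) \<le> 1"
        using sq elim by linarith
      obtain z y where zy: "(\<lambda>l. cmod (y l)) summable_on UNIV" "\<forall>j. lattice_op a (int n) z y j = 0" "y 0 \<noteq> 0" "y (- int n) \<noteq> 0"
        "(cmod (y (- int n)))\<^sup>2 * cmod (a (int n)) \<le> 3 * (cmod (y 0))\<^sup>2 * cmod (a (- int n))"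
        "(cmod (y 0))\<^sup>2 * cmod (a (- int n)) \<le> 3 * (cmod (y (- int n)))\<^sup>2 * cmod (a (int n))"
        "\<forall>j. j \<noteq> 0 \<and> j \<noteq> - int n \<longrightarrow> cmod (y j) \<le> 2 * C * (cmod (y 0) + cmod (y (- int n))) * gap (int n) j"
        and uniq: "\<forall>y'. (\<lambda>l. cmod (y' l)) summable_on UNIV \<and> (\<forall>j. lattice_op a (int n) z y' j = 0) \<and> y' 0 = 0 \<longrightarrow> (\<forall>j. y' j = 0)"
        by (rule exE[OF L.resonant_solution[OF small off' off nz]], assumption, assumption, elim exE conjE, rule that, assumption+)
      have "\<exists>c. \<forall>j. y' j = c * y j" if y': "(\<lambda>l. cmod (y' l)) summable_on UNIV" "\<forall>j. lattice_op a (int n) z y' j = 0" for y'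
      proof -
        \<comment> \<open>Subtracting \<open>c * y\<close> leaves a solution that vanishes at index
          0, hence zero by \<open>uniq\<close>.\<close>
        define c where "c = y' 0 / y 0"
        define x where "x l = 1 * y' l + (- c) * y l" for l
        have xs: "(\<lambda>l. cmod (x l)) summable_on UNIV"
        proof (rule summable_on_comparison_test[OF summable_on_add[OF y'(1) summable_on_cmult_right[OF zy(1), of "cmod c"]]])
          fix l show "cmod (x l) \<le> cmod (y' l) + cmod c * cmod (y l)"
            using norm_triangle_ineq[of "y' l" "- c * y l"] by (simp add: x_def norm_mult)
        qed auto
        have lx: "lattice_op a (int n) z x j = 0" for j
          using L.lattice_op_linear[OF y'(1) zy(1), of z 1 "- c" j] y'(2) zy(2) by (simp add: x_def[abs_def])
        have x0: "x 0 = 0" using zy(3) by (simp add: x_def c_def)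
        have "\<forall>j. x j = 0"
          by (rule mp[OF spec[OF uniq, of x]]) (intro conjI allI xs lx x0)
        thus ?thesis by (intro exI[of _ c]) (simp add: x_def)
      qed
      hence "resonant_at a C (int n) z y" unfolding resonant_at_def by (intro conjI allI impI zy) (rule zy(2)[THEN spec], rule zy(7)[THEN spec, THEN mp], assumption, elim conjE, assumption)
      thus "\<exists>z y. resonant_at a C (int n) z y" by blast
    qed
  qed
  thus ?thesis using C by blast
qed

section \<open>Eigenfunctions\<close>

definition hexp :: "int \<Rightarrow> real \<Rightarrow> complex" where
  "hexp n x = exp ((pi * \<i> * of_int n) * complex_of_real x)"

lemma hexp_at_0 [simp]: "hexp n 0 = 1" by (simp add: hexp_def)
lemma norm_hexp [simp]: "cmod (hexp n x) = 1" by (simp add: hexp_def)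
lemma hexp_add: "hexp (m + n) x = hexp m x * hexp n x" by (simp add: hexp_def exp_add[symmetric] algebra_simps)
lemma hexp_double: "hexp (2 * k) x = fexp k x" by (simp add: hexp_def fexp_def mult_ac)
lemma hexp_0 [simp]: "hexp 0 x = 1" by (simp add: hexp_def)
lemma hexp_minus: "hexp (- n) x * hexp n x = 1" "hexp n x * hexp (- n) x = 1" by (simp_all add: hexp_add[symmetric])
lemma hexp_deriv: "(hexp n has_vector_derivative (pi * \<i> * of_int n) * hexp n x) (at x within S)"
  unfolding hexp_def[abs_def] by (rule exp_has_deriv)
lemma ac01_hexp: "ac01 (hexp n)" unfolding hexp_def[abs_def] by (rule ac01_exp)
lemma continuous_hexp [continuous_intros]: "continuous_on S (hexp n)"
  unfolding hexp_def[abs_def] by (intro continuous_intros)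
lemma hexp_at_1: "hexp n 1 = (if even n then 1 else -1)"
proof (cases "even n")
  case True
  then obtain k where "n = 2 * k" by blast
  thus ?thesis using True by (simp add: hexp_double)
next
  case False
  then obtain k where n: "n = 2 * k + 1" by (meson oddE)
  have "hexp 1 1 = -1" by (simp add: hexp_def mult.commute)
  thus ?thesis using False n by (simp add: hexp_add hexp_double)
qed

text \<open>Both boundary conditions multiply \<open>u\<close> and its derivative by this sign from
  0 to 1, which allows a common treatment of the two cases.\<close>

definition bsign :: "boundary_type \<Rightarrow> complex" where
  "bsign b = (case b of Periodic \<Rightarrow> 1 | Antiperiodic \<Rightarrow> -1)"

lemma boundary_cond_iff: "boundary_cond b u \<longleftrightarrow> u 1 = bsign b * u 0 \<and> deriv_01 u 1 = bsign b * deriv_01 u 0"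
  by (cases b) (auto simp: bsign_def algebra_simps eq_neg_iff_add_eq_0)

lemma op_domainD:
  assumes "u \<in> op_domain b q"
  shows "\<And>x. x \<notin> {0..1} \<Longrightarrow> u x = 0" "ac01 u" "ac01 (deriv_01 u)"
    "\<And>x. x \<in> {0..1} \<Longrightarrow> (u has_vector_derivative deriv_01 u x) (at x within {0..1})"
    "u 1 = bsign b * u 0" "deriv_01 u 1 = bsign b * deriv_01 u 0"
    "L2 (schroedinger q u)" "continuous_on {0..1} u"
  using assms unfolding op_domain_def boundary_cond_iff abs_continuous_01_eq differentiable_on_def
  by (auto intro: deriv_01_works ac01_continuous_on)

text \<open>The boundary terms of Lagrange's identity cancel because the square of the sign is 1.\<close>

lemma second_derivative_symmetric:
  fixes f g f' g' f'' g'' :: "real \<Rightarrow> complex"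
  assumes f: "ac01 f'" "AE x in leb01. (f' has_vector_derivative f'' x) (at x within {0..1})"
      "\<And>x. x \<in> {0..1} \<Longrightarrow> (f has_vector_derivative f' x) (at x within {0..1})" "f 1 = s * f 0" "f' 1 = s * f' 0"
    and g: "ac01 g'" "AE x in leb01. (g' has_vector_derivative g'' x) (at x within {0..1})"
      "\<And>x. x \<in> {0..1} \<Longrightarrow> (g has_vector_derivative g' x) (at x within {0..1})" "g 1 = s * g 0" "g' 1 = s * g' 0"
    and s: "s * s = 1"
  shows "(\<integral>x. f'' x * g x \<partial>leb01) = (\<integral>x. f x * g'' x \<partial>leb01)"
proof -
  have fa: "ac01 f" by (rule ac01_C1[OF f(3) ac01_continuous_on[OF f(1)]])
  have ga: "ac01 g" by (rule ac01_C1[OF g(3) ac01_continuous_on[OF g(1)]])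
  have fd: "AE x in leb01. (f has_vector_derivative f' x) (at x within {0..1})" using f(3) by (intro AE_I2) auto
  have gd: "AE x in leb01. (g has_vector_derivative g' x) (at x within {0..1})" using g(3) by (intro AE_I2) auto
  have ss: "s * x * (s * y) = x * y" for x y using s by (metis mult.assoc mult.left_commute mult_1)
  have "(\<integral>x. f'' x * g x \<partial>leb01) = - (\<integral>x. f' x * g' x \<partial>leb01)"
    using integration_by_parts_01[OF f(1,2) ga gd] by (simp add: f(4,5) g(4,5) ss)
  moreover have "(\<integral>x. f' x * g' x \<partial>leb01) = - (\<integral>x. f x * g'' x \<partial>leb01)"
    using integration_by_parts_01[OF fa fd g(1,2)] by (simp add: f(4,5) g(4,5) ss)
  ultimately show ?thesis by simp
qed

lemma bsign_square: "bsign b * bsign b = 1" by (cases b) (simp_all add: bsign_def)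

lemma schroedinger_integrable:
  assumes q: "integrable leb01 q" and u: "u \<in> op_domain b q" and g: "continuous_on {0..1} g"
  shows "integrable leb01 (\<lambda>x. schroedinger q u x * g x)"
  by (rule integrable_leb01_mult_continuous(1)[OF L1_le_L2_norm(1)[OF op_domainD(7)[OF u]] g])

text \<open>The pairing is bilinear, without conjugation: for complex \<open>q\<close> this is the
  symmetry that survives, and it makes the integral of \<open>u\<^sup>2\<close>, not a norm, govern
  the coefficient functionals.\<close>

theorem schroedinger_symmetric:
  assumes q: "integrable leb01 q" and u: "u \<in> op_domain b q" and v: "v \<in> op_domain b q"
  shows "(\<integral>x. schroedinger q u x * v x \<partial>leb01) = (\<integral>x. u x * schroedinger q v x \<partial>leb01)"
proof -
  note U = op_domainD[OF u] and V = op_domainD[OF v]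
  note U2 = ac01_FTC(1,2)[OF U(3)] and V2 = ac01_FTC(1,2)[OF V(3)]
  have iu: "integrable leb01 (\<lambda>x. deriv_01 (deriv_01 u) x * v x)" by (rule integrable_leb01_mult_continuous(1)[OF U2(2) V(8)])
  have iv: "integrable leb01 (\<lambda>x. u x * deriv_01 (deriv_01 v) x)" by (rule integrable_leb01_mult_continuous(2)[OF V2(2) U(8)])
  have iq: "integrable leb01 (\<lambda>x. q x * u x * v x)" by (intro integrable_leb01_mult_continuous(1) q U(8) V(8))
  have "(\<integral>x. schroedinger q u x * v x \<partial>leb01) = (\<integral>x. deriv_01 (deriv_01 u) x * v x - q x * u x * v x \<partial>leb01)"
    by (simp add: schroedinger_def algebra_simps)
  also have "\<dots> = (\<integral>x. deriv_01 (deriv_01 u) x * v x \<partial>leb01) - (\<integral>x. q x * u x * v x \<partial>leb01)"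
    by (rule Bochner_Integration.integral_diff[OF iu iq])
  also have "(\<integral>x. deriv_01 (deriv_01 u) x * v x \<partial>leb01) = (\<integral>x. u x * deriv_01 (deriv_01 v) x \<partial>leb01)"
    by (rule second_derivative_symmetric[OF U(3) U2(1) U(4) U(5,6) V(3) V2(1) V(4) V(5,6) bsign_square])
  also have "\<dots> - (\<integral>x. q x * u x * v x \<partial>leb01) = (\<integral>x. u x * deriv_01 (deriv_01 v) x - q x * u x * v x \<partial>leb01)"
    by (rule Bochner_Integration.integral_diff[OF iv iq, symmetric])
  also have "\<dots> = (\<integral>x. u x * schroedinger q v x \<partial>leb01)"
    by (simp add: schroedinger_def algebra_simps)
  finally show ?thesis .
qed

section \<open>Eigenfunctions and solutions of the lattice equation\<close>

lemma integral_leb01_cong_AE_mult: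
  fixes f g h :: "real \<Rightarrow> complex"
  assumes "AE x in leb01. f x = g x" "integrable leb01 (\<lambda>x. f x * h x)" "integrable leb01 (\<lambda>x. g x * h x)"
  shows "(\<integral>x. f x * h x \<partial>leb01) = (\<integral>x. g x * h x \<partial>leb01)"
  by (rule integral_cong_AE) (use assms in \<open>auto elim: eventually_mono\<close>)

text \<open>The point at distance \<open>z\<close> from the eigenvalue of \<open>hexp n\<close> for
  the constant potential \<open>fcoeff q 0\<close>; absorbing the mean of \<open>q\<close> here is
  what makes \<open>a 0 = 0\<close>.\<close>

definition near_ev :: "(real \<Rightarrow> complex) \<Rightarrow> int \<Rightarrow> complex \<Rightarrow> complex" where
  "near_ev q n z = z - of_real ((pi * of_int n)\<^sup>2) - fcoeff q 0"

lemma conv_diagonal_split: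
  assumes y: "(\<lambda>l. cmod (y l)) summable_on UNIV" and a: "\<And>k. a k = (if k = 0 then 0 else fcoeff q k)"
    and q: "integrable leb01 q"
  shows "fcoeff (\<lambda>x. q x * fseries y x) j = fcoeff q 0 * y j + (\<Sum>\<^sub>\<infinity>l. a (j - l) * y l)"
proof -
  define M where "M = (\<integral>x. cmod (q x) \<partial>leb01)"
  have ab: "cmod (a k) \<le> M" for k using fcoeff_bound[OF q, of k] by (auto simp: a M_def)
  have s: "(\<lambda>l. a (j - l) * y l) summable_on UNIV"
  proof (rule abs_summable_summable, rule summable_on_comparison_test)
    show "(\<lambda>l. M * cmod (y l)) summable_on UNIV" by (rule summable_on_cmult_right[OF y])
    show "norm (a (j - l) * y l) \<le> M * cmod (y l)" for l unfolding norm_mult by (intro mult_right_mono ab) auto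
  qed auto
  have "((\<lambda>l. if l = j then fcoeff q 0 * y j else 0) has_sum fcoeff q 0 * y j) UNIV"
    by (rule has_sum_finite_neutralI[of "{j}"]) auto
  hence "((\<lambda>l. (if l = j then fcoeff q 0 * y j else 0) + a (j - l) * y l) has_sum (fcoeff q 0 * y j + (\<Sum>\<^sub>\<infinity>l. a (j - l) * y l))) UNIV"
    by (intro has_sum_add has_sum_infsum s)
  moreover have "(\<lambda>l. (if l = j then fcoeff q 0 * y j else 0) + a (j - l) * y l) = (\<lambda>l. y l * fcoeff q (j - l))" by (auto simp: a)
  ultimately have "((\<lambda>l. y l * fcoeff q (j - l)) has_sum (fcoeff q 0 * y j + (\<Sum>\<^sub>\<infinity>l. a (j - l) * y l))) UNIV" by simp
  from has_sum_unique[OF fcoeff_mult_fseries[OF q y, of j] this] show ?thesis .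
qed

text \<open>Test the differential equation against \<open>hexp (- (n + 2 * j))\<close>, which
  satisfies the same boundary conditions. The products of \<open>detuning\<close> with the
  coefficients are bounded, so the coefficients decay like \<open>gap\<close> and their series
  converges absolutely.\<close>

lemma eigenfunction_lattice:
  assumes q: "integrable leb01 q" and a: "\<And>k. a k = (if k = 0 then 0 else fcoeff q k)"
    and u: "u \<in> op_domain b q" and eq: "AE x in leb01. schroedinger q u x = near_ev q n z * u x"
    and bn: "bsign b = (if even n then 1 else -1)"
  defines "y \<equiv> fcoeff (\<lambda>x. hexp (- n) x * u x)"
  shows "(\<lambda>l. cmod (y l)) summable_on UNIV" "\<And>j. lattice_op a n z y j = 0" "\<And>x. x \<in> {0..1} \<Longrightarrow> u x = hexp n x * fseries y x"
proof -
  note U = op_domainD[OF u]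
  note U2 = ac01_FTC(1,2)[OF U(3)]
  have bn': "bsign b = hexp k 1" if "even (k - n)" for k using that by (auto simp: bn hexp_at_1)
  have key: "(detuning n j + (near_ev q n z + of_real ((pi * of_int n)\<^sup>2))) * y j = - fcoeff (\<lambda>x. q x * (hexp (- n) x * u x)) j" for j
  proof -
    define k where "k = - (n + 2 * j)"
    define c where "c = (pi * \<i> * of_int k :: complex)"
    have phk: "hexp k x = hexp (- n) x * fexp (- j) x" for x
      by (simp add: k_def hexp_double[symmetric] hexp_add[symmetric])
    have sk: "hexp k 1 = bsign b" using bn'[of k] by (simp add: k_def)
    have d2: "((\<lambda>x. c * hexp k x) has_vector_derivative c * (c * hexp k x)) (at x within S)" for x S
      using has_vector_derivative_mult_right[OF hexp_deriv[of k x S], of c] by (simp add: c_def)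
    have "(\<integral>x. deriv_01 (deriv_01 u) x * hexp k x \<partial>leb01) = (\<integral>x. u x * (c * (c * hexp k x)) \<partial>leb01)"
    proof (rule second_derivative_symmetric[OF U(3) U2(1) U(4) U(5,6) _ _ _ _ _ bsign_square])
      show "ac01 (\<lambda>x. c * hexp k x)" by (intro ac01_mult ac01_const ac01_hexp)
      show "AE x in leb01. ((\<lambda>x. c * hexp k x) has_vector_derivative c * (c * hexp k x)) (at x within {0..1})" by (intro AE_I2 d2)
      show "(hexp k has_vector_derivative c * hexp k x) (at x within {0..1})" for x unfolding c_def by (rule hexp_deriv)
    qed (auto simp: sk)
    also have "\<dots> = c\<^sup>2 * y j"
      unfolding y_def fcoeff_def by (subst integral_mult_right_zero[symmetric]) (simp add: phk power2_eq_square mult_ac)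
    finally have 1: "(\<integral>x. deriv_01 (deriv_01 u) x * hexp k x \<partial>leb01) = c\<^sup>2 * y j" .
    have i1: "integrable leb01 (\<lambda>x. deriv_01 (deriv_01 u) x * hexp k x)" by (rule integrable_leb01_mult_continuous(1)[OF U2(2) continuous_hexp])
    have i2: "integrable leb01 (\<lambda>x. q x * u x * hexp k x)" by (intro integrable_leb01_mult_continuous(1) q U(8) continuous_hexp)
    have i3: "integrable leb01 (\<lambda>x. near_ev q n z * u x * hexp k x)" by (intro integrable_leb01_continuous continuous_intros U(8))
    have i4: "integrable leb01 (\<lambda>x. schroedinger q u x * hexp k x)" by (rule schroedinger_integrable[OF q u continuous_hexp])
    have "(\<integral>x. schroedinger q u x * hexp k x \<partial>leb01) = (\<integral>x. (near_ev q n z * u x) * hexp k x \<partial>leb01)"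
      by (rule integral_leb01_cong_AE_mult[OF eq i4 i3])
    also have "\<dots> = near_ev q n z * y j"
      unfolding y_def fcoeff_def by (subst integral_mult_right_zero[symmetric]) (simp add: phk mult_ac)
    finally have 2: "(\<integral>x. schroedinger q u x * hexp k x \<partial>leb01) = near_ev q n z * y j" .
    have "(\<integral>x. schroedinger q u x * hexp k x \<partial>leb01) = (\<integral>x. deriv_01 (deriv_01 u) x * hexp k x - q x * u x * hexp k x \<partial>leb01)"
      by (simp add: schroedinger_def algebra_simps)
    also have "\<dots> = c\<^sup>2 * y j - (\<integral>x. q x * u x * hexp k x \<partial>leb01)"
      by (simp add: Bochner_Integration.integral_diff[OF i1 i2] 1)
    also have "(\<integral>x. q x * u x * hexp k x \<partial>leb01) = fcoeff (\<lambda>x. q x * (hexp (- n) x * u x)) j"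
      unfolding fcoeff_def by (simp add: phk mult_ac)
    finally have 3: "near_ev q n z * y j = c\<^sup>2 * y j - fcoeff (\<lambda>x. q x * (hexp (- n) x * u x)) j" using 2 by simp
    \<comment> \<open>Both sides are \<open>(pi * (n + 2 * j))\<^sup>2\<close>.\<close>
    have 4: "detuning n j + of_real ((pi * of_int n)\<^sup>2) = - c\<^sup>2"
      by (simp add: c_def k_def detuning_def power_mult_distrib power2_eq_square algebra_simps)
    have "(detuning n j + (near_ev q n z + of_real ((pi * of_int n)\<^sup>2))) * y j = (detuning n j + of_real ((pi * of_int n)\<^sup>2)) * y j + near_ev q n z * y j"
      by (simp only: distrib_right add_ac)
    thus ?thesis unfolding 4 3 by simp
  qed
  define v where "v x = hexp (- n) x * u x" for x
  have vc: "continuous_on {0..1} v" unfolding v_def by (intro continuous_intros U(8))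
  have v01: "v 0 = v 1" using U(5) by (simp add: v_def hexp_at_1 bn)
  have qv: "integrable leb01 (\<lambda>x. q x * v x)" by (rule integrable_leb01_mult_continuous(1)[OF q vc])
  have yv: "y k = fcoeff v k" for k by (simp add: y_def v_def[abs_def])
  define M where "M = (\<integral>x. cmod (q x * v x) \<partial>leb01)"
  define w where "w = near_ev q n z + of_real ((pi * of_int n)\<^sup>2)"
  define M1 where "M1 = M + (cmod w) * (\<integral>x. cmod (v x) \<partial>leb01)"
  have db: "cmod (detuning n j) * cmod (y j) \<le> M1" for j
  proof -
    have "detuning n j * y j = - fcoeff (\<lambda>x. q x * v x) j - w * y j" using key[of j] by (simp add: v_def[abs_def] w_def algebra_simps)
    hence "cmod (detuning n j) * cmod (y j) = cmod (- fcoeff (\<lambda>x. q x * v x) j - w * y j)" by (simp only: norm_mult[symmetric])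
    also have "\<dots> \<le> cmod (fcoeff (\<lambda>x. q x * v x) j) + cmod w * cmod (y j)"
      using norm_triangle_ineq4[of "- fcoeff (\<lambda>x. q x * v x) j" "w * y j"] by (simp add: norm_mult)
    also have "\<dots> \<le> M1" unfolding M1_def M_def yv
      by (intro add_mono mult_left_mono fcoeff_bound qv integrable_leb01_continuous vc) auto
    finally show ?thesis .
  qed
  show ys: "(\<lambda>l. cmod (y l)) summable_on UNIV"
  proof -
    have s: "(\<lambda>l. M1 * gap n l) summable_on UNIV" by (rule summable_on_cmult_right[OF gap_summable])
    have "(\<lambda>l. cmod (y l)) summable_on (UNIV - {0, - n})"
    proof (rule summable_on_comparison_test[OF summable_on_subset_banach[OF s]])
      fix l assume l: "l \<in> UNIV - {0, - n}"
      hence "1 \<le> \<bar>real_of_int l\<bar> * \<bar>real_of_int (l + n)\<bar>"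
        using mult_mono[of 1 "\<bar>real_of_int l\<bar>" 1 "\<bar>real_of_int (l + n)\<bar>"] by (simp del: of_int_add) linarith
      define \<delta> where "\<delta> = \<bar>real_of_int l\<bar> * \<bar>real_of_int (l + n)\<bar>"
      have d1: "\<delta> \<ge> 1" unfolding \<delta>_def by fact
      have "cmod (detuning n l) = 4 * pi\<^sup>2 * \<delta>" unfolding detuning_def norm_of_real \<delta>_def by (simp add: abs_mult)
      moreover have "1 * \<delta> \<le> (4 * pi\<^sup>2) * \<delta>" using power_mono[OF pi_ge_two, of 2] d1 by (intro mult_right_mono) auto
      ultimately have "\<delta> * cmod (y l) \<le> cmod (detuning n l) * cmod (y l)" by (intro mult_right_mono) auto
      hence "\<delta> * cmod (y l) \<le> M1" using db[of l] by linarith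
      hence "cmod (y l) \<le> M1 / \<delta>" using d1 by (subst pos_le_divide_eq) (auto simp: mult.commute)
      thus "cmod (y l) \<le> M1 * gap n l" by (simp add: gap_def \<delta>_def)
    qed auto
    moreover have "(\<lambda>l. cmod (y l)) summable_on {0, - n}" by (rule summable_on_finite) simp
    ultimately have "(\<lambda>l. cmod (y l)) summable_on ((UNIV - {0, - n}) \<union> {0, - n})" by (rule summable_on_union)
    moreover have "(UNIV - {0, - n}) \<union> {0, - n} = (UNIV :: int set)" by auto
    ultimately show ?thesis by simp
  qed
  have vser: "v x = fseries y x" if "x \<in> {0..1}" for x
    by (rule fseries_unique[OF vc v01 ys _ that]) (simp add: yv)
  show "u x = hexp n x * fseries y x" if "x \<in> {0..1}" for x
    using vser[OF that] hexp_minus(2)[of n x] by (simp add: v_def mult.assoc[symmetric] flip: vser[OF that])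
  show "lattice_op a n z y j = 0" for j
  proof -
    have "fcoeff (\<lambda>x. q x * v x) j = fcoeff (\<lambda>x. q x * fseries y x) j"
      unfolding fcoeff_def[of "\<lambda>x. q x * v x"] fcoeff_def[of "\<lambda>x. q x * fseries y x"] by (intro Bochner_Integration.integral_cong refl) (simp add: vser)
    also have "\<dots> = fcoeff q 0 * y j + (\<Sum>\<^sub>\<infinity>l. a (j - l) * y l)" by (rule conv_diagonal_split[OF ys a q])
    finally show ?thesis using key[of j] by (simp add: v_def[abs_def] near_ev_def lattice_op_def algebra_simps)
  qed
qed

text \<open>For a continuous integrand the derivative exists at every point of [0,1], as
  \<open>op_domain\<close> demands of \<open>u\<close>; the theorem on Lebesgue points gives it
  almost everywhere.\<close>

lemma prim_continuous_deriv:
  fixes V :: "real \<Rightarrow> complex"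
  assumes V: "continuous_on {0..1} V" and x: "x \<in> {0..1}"
  shows "(prim V has_vector_derivative V x) (at x within {0..1})"
proof -
  have eq: "prim V t = integral {0..t} V" if t: "t \<in> {0..1}" for t
  proof -
    have "prim V t = (\<integral>s. indicator {0..1} s *\<^sub>R (indicator {0..t} s *\<^sub>R V s) \<partial>lebesgue)" unfolding prim_def integral_leb01_ext ..
    also have "\<dots> = (\<integral>s. indicator {0..t} s *\<^sub>R V s \<partial>lebesgue)" using t by (intro Bochner_Integration.integral_cong) (auto simp: indicator_def)
    also have "\<dots> = integral {0..t} V"
    proof -
      have "V absolutely_integrable_on {0..t}"
        by (rule absolutely_integrable_continuous_real) (rule continuous_on_subset[OF V], use t in auto)
      from set_lebesgue_integral_eq_integral(2)[OF this] show ?thesis by (simp add: set_lebesgue_integral_def)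
    qed
    finally show ?thesis .
  qed
  have d: "((\<lambda>u. integral {0..u} V) has_vector_derivative V x) (at x within {0..1})"
    by (rule integral_has_vector_derivative[OF V x])
  show ?thesis by (rule has_vector_derivative_transform[OF x _ d]) (rule eq)
qed

text \<open>Each integration leaves one constant. In the antiperiodic case the boundary condition
  determines it. In the periodic case the condition says that the integrand has mean zero, which is
  hypothesis \<open>s\<close> for \<open>g\<close> and is achieved for \<open>V\<close> by the
  choice of \<open>c1\<close>.\<close>

lemma second_antiderivative:
  fixes g :: "real \<Rightarrow> complex"
  assumes g: "integrable leb01 g" and s: "bsign b = 1 \<Longrightarrow> integral\<^sup>L leb01 g = 0"
  shows "\<exists>U V. ac01 V \<and> (AE x in leb01. (V has_vector_derivative g x) (at x within {0..1})) \<and>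
     (\<forall>x\<in>{0..1}. (U has_vector_derivative V x) (at x within {0..1})) \<and> U 1 = bsign b * U 0 \<and> V 1 = bsign b * V 0"
proof -
  define G where "G = prim g"
  note G = integral_by_parts_zero_mean[OF g, folded G_def]
  have G01: "G 0 = 0" "G 1 = integral\<^sup>L leb01 g" by (simp_all add: G_def prim_1)
  have c1ex: "\<exists>c1. G 1 + c1 = bsign b * c1 \<and> (bsign b = 1 \<longrightarrow> integral\<^sup>L leb01 (\<lambda>x. c1 + G x) = 0)"
  proof (cases b)
    case Periodic
    have "integral\<^sup>L leb01 (\<lambda>x. - integral\<^sup>L leb01 G + G x) = 0"
    proof -
      have "integral\<^sup>L leb01 (\<lambda>x. - integral\<^sup>L leb01 G + G x) = integral\<^sup>L leb01 (\<lambda>x. - integral\<^sup>L leb01 G) + integral\<^sup>L leb01 G"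
        by (intro Bochner_Integration.integral_add integrable_const01 integrable_leb01_continuous G(3))
      moreover have "integral\<^sup>L leb01 (\<lambda>x. - integral\<^sup>L leb01 G) = - integral\<^sup>L leb01 G" unfolding integral_leb01_ext[of "\<lambda>x. - integral\<^sup>L leb01 G"] by (subst integral_scaleR_left) auto
      ultimately show ?thesis by simp
    qed
    thus ?thesis using s Periodic G01 by (intro exI[of _ "- integral\<^sup>L leb01 G"]) (simp add: bsign_def)
  next
    case Antiperiodic
    thus ?thesis by (intro exI[of _ "- G 1 / 2"]) (simp add: bsign_def)
  qed
  obtain c1 where c1: "G 1 + c1 = bsign b * c1" "bsign b = 1 \<Longrightarrow> integral\<^sup>L leb01 (\<lambda>x. c1 + G x) = 0" using c1ex by blast
  define V where "V x = c1 + G x" for x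
  have Va: "ac01 V" by (rule ac01_dominated[OF G(1), of 1]) (auto simp: V_def)
  have Vd: "AE x in leb01. (V has_vector_derivative g x) (at x within {0..1})"
    using G(2)
  proof eventually_elim
    fix x assume "(G has_vector_derivative g x) (at x within {0..1})"
    from has_vector_derivative_add[OF has_vector_derivative_const[of c1] this]
    show "(V has_vector_derivative g x) (at x within {0..1})" by (simp add: V_def[abs_def])
  qed
  have V01: "V 1 = bsign b * V 0" using c1(1) G01 by (simp add: V_def add.commute)
  define c2 where "c2 = (if bsign b = 1 then 0 else - prim V 1 / 2)"
  define U where "U x = c2 + prim V x" for x
  have "(U has_vector_derivative V x) (at x within {0..1})" if "x \<in> {0..1}" for x
    using has_vector_derivative_add[OF has_vector_derivative_const[of c2] prim_continuous_deriv[OF ac01_continuous_on[OF Va] that]]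
    by (simp add: U_def[abs_def])
  moreover have "U 1 = bsign b * U 0"
  proof (cases b)
    case Periodic
    thus ?thesis using c1(2) by (simp add: U_def c2_def bsign_def prim_1 V_def[abs_def])
  next
    case Antiperiodic
    thus ?thesis by (simp add: U_def c2_def bsign_def)
  qed
  ultimately show ?thesis using Va Vd V01 by blast
qed

text \<open>Summability of \<open>y\<close> makes the series continuous but does not justify
  differentiating it twice term by term. Instead the desired second derivative \<open>g\<close> is
  integrated twice under the boundary conditions; the result has the Fourier coefficients of the
  series and therefore equals it.\<close>

theorem lattice_eigenfunction:
  assumes q: "integrable leb01 q" and a: "\<And>k. a k = (if k = 0 then 0 else fcoeff q k)"
    and ys: "(\<lambda>l. cmod (y l)) summable_on UNIV" and latt: "\<And>j. lattice_op a n z y j = 0"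
    and bn: "bsign b = (if even n then 1 else -1)"
  defines "u \<equiv> (\<lambda>x. if x \<in> {0..1} then hexp n x * fseries y x else 0)"
  shows "u \<in> op_domain b q" "AE x in leb01. schroedinger q u x = near_ev q n z * u x"
proof -
  define U0 where "U0 x = hexp n x * fseries y x" for x
  have U0c: "continuous_on {0..1} U0" unfolding U0_def by (intro continuous_intros fseries_continuous[OF ys])
  define g where "g x = q x * U0 x + near_ev q n z * U0 x" for x
  have qU: "integrable leb01 (\<lambda>x. q x * U0 x)" by (rule integrable_leb01_mult_continuous(1)[OF q U0c])
  have mU: "integrable leb01 (\<lambda>x. near_ev q n z * U0 x)" by (intro integrable_leb01_continuous continuous_intros U0c)
  have gi: "integrable leb01 g" unfolding g_def by (rule Bochner_Integration.integrable_add[OF qU mU])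
  have phk: "hexp (- (n + 2 * j)) x = hexp (- n) x * fexp (- j) x" for j x
    by (simp add: hexp_double[symmetric] hexp_add[symmetric])
  have U0ph: "U0 x * hexp (- (n + 2 * j)) x = fseries y x * fexp (- j) x" for j x
  proof -
    have "U0 x * hexp (- (n + 2 * j)) x = (hexp n x * hexp (- n) x) * (fseries y x * fexp (- j) x)" unfolding U0_def phk by (simp only: mult_ac)
    thus ?thesis by (simp add: hexp_minus)
  qed
  have gk: "(\<integral>x. g x * hexp (- (n + 2 * j)) x \<partial>leb01) = - of_real ((pi * of_int (n + 2 * j))\<^sup>2) * y j" for j
  proof -
    have "(\<integral>x. g x * hexp (- (n + 2 * j)) x \<partial>leb01) = (\<integral>x. (q x * fseries y x + near_ev q n z * fseries y x) * fexp (- j) x \<partial>leb01)"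
    proof (intro Bochner_Integration.integral_cong refl)
      fix x
      have "g x * hexp (- (n + 2 * j)) x = (q x + near_ev q n z) * (U0 x * hexp (- (n + 2 * j)) x)" by (simp add: g_def algebra_simps)
      thus "g x * hexp (- (n + 2 * j)) x = (q x * fseries y x + near_ev q n z * fseries y x) * fexp (- j) x" unfolding U0ph by (simp add: algebra_simps)
    qed
    also have "\<dots> = fcoeff (\<lambda>x. q x * fseries y x + near_ev q n z * fseries y x) j" by (simp add: fcoeff_def)
    also have "\<dots> = fcoeff (\<lambda>x. q x * fseries y x) j + near_ev q n z * fcoeff (fseries y) j"
    proof -
      have i1: "integrable leb01 (\<lambda>x. q x * fseries y x)" by (rule integrable_leb01_mult_continuous(1)[OF q fseries_continuous[OF ys]])
      have i2: "integrable leb01 (\<lambda>x. near_ev q n z * fseries y x)" by (intro integrable_leb01_continuous continuous_intros fseries_continuous[OF ys])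
      show ?thesis by (simp add: fcoeff_add[OF i1 i2] fcoeff_cmult)
    qed
    also have "\<dots> = (fcoeff q 0 * y j + (\<Sum>\<^sub>\<infinity>l. a (j - l) * y l)) + near_ev q n z * y j"
      by (simp add: conv_diagonal_split[OF ys a q] fcoeff_fseries[OF ys])
    also have "(\<Sum>\<^sub>\<infinity>l. a (j - l) * y l) = - (detuning n j + z) * y j" using latt[of j] by (simp only: lattice_op_def mult_minus_left add_eq_0_iff)
    also have "(fcoeff q 0 * y j + - (detuning n j + z) * y j) + near_ev q n z * y j = - of_real ((pi * of_int (n + 2 * j))\<^sup>2) * y j"
      by (simp add: near_ev_def detuning_def power2_eq_square algebra_simps)
    finally show ?thesis .
  qed
  \<comment> \<open>In the periodic case the index \<open>- n / 2\<close> belongs to the constant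
    function, and there the lattice equation states that \<open>g\<close> has mean zero.\<close>
  have zero_mean: "integral\<^sup>L leb01 g = 0" if "bsign b = 1"
  proof -
    have "even n" using that bn by (auto split: if_splits)
    then obtain k where k: "n = 2 * k" by blast
    have "- (n + 2 * (- k)) = 0" using k by simp
    thus ?thesis using gk[of "- k"] k by simp
  qed
  obtain U1 V where V: "ac01 V" "AE x in leb01. (V has_vector_derivative g x) (at x within {0..1})"
    "\<forall>x\<in>{0..1}. (U1 has_vector_derivative V x) (at x within {0..1})" "U1 1 = bsign b * U1 0" "V 1 = bsign b * V 0"
    using second_antiderivative[OF gi zero_mean] by blast
  text \<open>Only in the periodic case is the mean of \<open>U\<close> undetermined; there it is adjusted to \<open>y\<close>.\<close>
  define k0 where "k0 = - (n div 2)"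
  have U1c: "continuous_on {0..1} U1"
    by (rule ac01_continuous_on[OF ac01_C1[OF bspec[OF V(3)] ac01_continuous_on[OF V(1)]]])
  define d where "d = (if even n then y k0 - (\<integral>x. U1 x \<partial>leb01) else 0)"
  define U where "U x = U1 x + d" for x
  have Uc: "continuous_on {0..1} U" unfolding U_def by (intro continuous_intros U1c)
  have Ud: "(U has_vector_derivative V x) (at x within {0..1})" if "x \<in> {0..1}" for x
    using has_vector_derivative_add[OF bspec[OF V(3) that] has_vector_derivative_const[of d]] by (simp add: U_def[abs_def])
  have U01: "U 1 = bsign b * U 0"
    using V(4) bn by (auto simp: U_def d_def)
  have coef: "(\<integral>x. U x * hexp (- (n + 2 * j)) x \<partial>leb01) = y j" for j
  proof (cases "n + 2 * j = 0")
    case True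
    hence e: "even n" by presburger
    have jk: "j = k0" using True by (simp add: k0_def)
    have "(\<integral>x. U x * hexp (- (n + 2 * j)) x \<partial>leb01) = (\<integral>x. U1 x + d \<partial>leb01)" using True by (simp add: U_def)
    also have "\<dots> = (\<integral>x. U1 x \<partial>leb01) + (\<integral>x. d \<partial>leb01)" by (intro Bochner_Integration.integral_add integrable_const01 integrable_leb01_continuous U1c)
    also have "(\<integral>x. d \<partial>leb01) = d" unfolding integral_leb01_ext by (subst integral_scaleR_left) auto
    finally show ?thesis using e jk by (simp add: d_def)
  next
    case False
    define k where "k = - (n + 2 * j)"
    define c where "c = (pi * \<i> * of_int k :: complex)"
    have "k \<noteq> 0" unfolding k_def using False by linarith
    hence c0: "c \<noteq> 0" by (simp add: c_def)
    have sk: "hexp k 1 = bsign b" by (simp add: k_def hexp_at_1 bn)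
    have d2: "((\<lambda>x. c * hexp k x) has_vector_derivative c * (c * hexp k x)) (at x within S)" for x S
      using has_vector_derivative_mult_right[OF hexp_deriv[of k x S], of c] by (simp add: c_def)
    have "(\<integral>x. g x * hexp k x \<partial>leb01) = (\<integral>x. U x * (c * (c * hexp k x)) \<partial>leb01)"
    proof (rule second_derivative_symmetric[OF V(1,2) Ud U01 V(5) _ _ _ _ _ bsign_square])
      show "ac01 (\<lambda>x. c * hexp k x)" by (intro ac01_mult ac01_const ac01_hexp)
      show "AE x in leb01. ((\<lambda>x. c * hexp k x) has_vector_derivative c * (c * hexp k x)) (at x within {0..1})" by (intro AE_I2 d2)
      show "(hexp k has_vector_derivative c * hexp k x) (at x within {0..1})" for x unfolding c_def by (rule hexp_deriv)
    qed (auto simp: sk)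
    also have "\<dots> = c\<^sup>2 * (\<integral>x. U x * hexp k x \<partial>leb01)"
      by (subst integral_mult_right_zero[symmetric]) (simp add: power2_eq_square mult_ac)
    finally have "c\<^sup>2 * (\<integral>x. U x * hexp k x \<partial>leb01) = - of_real ((pi * of_int (n + 2 * j))\<^sup>2) * y j" using gk[of j] by (simp add: k_def)
    also have "- of_real ((pi * of_int (n + 2 * j))\<^sup>2) = c\<^sup>2" by (simp add: c_def k_def power2_eq_square algebra_simps)
    finally show ?thesis using c0 by (simp add: k_def)
  qed
  \<comment> \<open>Multiplication by \<open>hexp (- n)\<close> makes the boundary values equal, so
    that uniqueness of Fourier coefficients applies.\<close>
  have UU: "U x = U0 x" if x: "x \<in> {0..1}" for x
  proof -
    have "hexp (- n) x * U x = fseries y x"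
    proof (rule fseries_unique[OF _ _ ys _ x])
      show "continuous_on {0..1} (\<lambda>x. hexp (- n) x * U x)" by (intro continuous_intros Uc)
      show "hexp (- n) 0 * U 0 = hexp (- n) 1 * U 1" using U01 bn by (simp add: hexp_at_1)
      show "fcoeff (\<lambda>x. hexp (- n) x * U x) k = y k" for k
        using coef[of k] unfolding fcoeff_def phk by (simp add: mult_ac)
    qed
    hence "hexp n x * (hexp (- n) x * U x) = U0 x" by (simp add: U0_def)
    thus ?thesis by (simp add: mult.assoc[symmetric] hexp_minus)
  qed
  have uU: "u x = U x" if "x \<in> {0..1}" for x using UU[OF that] that by (simp add: u_def U0_def)
  have ud: "(u has_vector_derivative V x) (at x within {0..1})" if x: "x \<in> {0..1}" for x
    by (rule has_vector_derivative_transform[OF x uU Ud[OF x]])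
  have du: "deriv_01 u x = V x" if "x \<in> {0..1}" for x by (rule deriv_01_eq[OF that ud[OF that]])
  have ua: "ac01 u" by (rule ac01_C1[OF ud ac01_continuous_on[OF V(1)]])
  have dua: "ac01 (deriv_01 u)" by (rule ac01_dominated[OF V(1), of 1]) (auto simp: du)
  have AEd: "AE x in leb01. deriv_01 (deriv_01 u) x = g x"
    using V(2) AE_space
  proof eventually_elim
    fix x assume h: "(V has_vector_derivative g x) (at x within {0..1})" "x \<in> space leb01"
    have x: "x \<in> {0..1}" using h(2) by simp
    have "(deriv_01 u has_vector_derivative g x) (at x within {0..1})"
      by (rule has_vector_derivative_transform[OF x du h(1)])
    thus "deriv_01 (deriv_01 u) x = g x" by (rule deriv_01_eq[OF x])
  qed
  show eq: "AE x in leb01. schroedinger q u x = near_ev q n z * u x"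
    using AEd AE_space
  proof eventually_elim
    fix x assume h: "deriv_01 (deriv_01 u) x = g x" "x \<in> space leb01"
    have "u x = U0 x" using h(2) uU UU by simp
    thus "schroedinger q u x = near_ev q n z * u x" using h(1) by (simp add: schroedinger_def g_def)
  qed
  have uc: "continuous_on {0..1} u" by (rule ac01_continuous_on[OF ua])
  have L2u: "L2 (\<lambda>x. near_ev q n z * u x)" by (intro L2_continuous continuous_intros uc)
  have "L2 (schroedinger q u)"
  proof -
    have m: "schroedinger q u \<in> borel_measurable leb01"
    proof -
      have "integrable leb01 (\<lambda>x. deriv_01 (deriv_01 u) x - q x * u x)"
        by (intro Bochner_Integration.integrable_diff ac01_FTC(2)[OF dua] integrable_leb01_mult_continuous(1) q uc)
      thus ?thesis unfolding schroedinger_def[abs_def] by (rule borel_measurable_integrable)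
    qed
    moreover have "integrable leb01 (\<lambda>x. (cmod (schroedinger q u x))\<^sup>2)"
    proof (rule integrable_cong_AE_imp)
      show "integrable leb01 (\<lambda>x. (cmod (near_ev q n z * u x))\<^sup>2)" using L2u by (simp add: L2_def)
      show "AE x in leb01. (cmod (near_ev q n z * u x))\<^sup>2 = (cmod (schroedinger q u x))\<^sup>2" using eq by eventually_elim simp
    qed (use m in measurable)
    ultimately show ?thesis by (simp add: L2_def)
  qed
  moreover have "u 1 = bsign b * u 0" "deriv_01 u 1 = bsign b * deriv_01 u 0" using U01 V(5) uU du by auto
  moreover have "u differentiable_on {0..1}"
    unfolding differentiable_on_def by (intro ballI differentiableI_vector[OF ud])
  ultimately show "u \<in> op_domain b q"
    unfolding op_domain_def abs_continuous_01_eq boundary_cond_iff using ua dua by (auto simp: u_def)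
qed

section \<open>Root subspaces and coefficient functionals\<close>

text \<open>Baire's theorem in the space of bounded continuous functions: some closed set
  \<open>T N\<close> contains a ball of radius \<open>e\<close>, and differences of its points bound
  every \<open>\<Lambda> k\<close> by \<open>2 * N / e\<close>.\<close>

lemma uniform_boundedness:
  fixes \<Lambda> :: "nat \<Rightarrow> (real \<Rightarrow>\<^sub>C complex) \<Rightarrow> complex"
  assumes lin: "\<And>k. bounded_linear (\<Lambda> k)" and pw: "\<And>g. \<exists>K. \<forall>k. cmod (\<Lambda> k g) \<le> K"
  shows "\<exists>K. \<forall>k g. cmod (\<Lambda> k g) \<le> K * norm g"
proof -
  define T where "T N = {g. \<forall>k. cmod (\<Lambda> k g) \<le> real N}" for N :: nat
  have cl: "closed (T N)" for N
  proof -
    have "closed {g. cmod (\<Lambda> k g) \<le> real N}" for k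
      by (intro closed_Collect_le continuous_intros linear_continuous_on[OF lin])
    hence "closed (\<Inter>k. {g. cmod (\<Lambda> k g) \<le> real N})" by blast
    moreover have "T N = (\<Inter>k. {g. cmod (\<Lambda> k g) \<le> real N})" by (auto simp: T_def)
    ultimately show ?thesis by simp
  qed
  have un: "(\<Union>N. T N) = UNIV"
  proof -
    have "\<exists>N. g \<in> T N" for g
    proof -
      obtain K where K: "\<And>k. cmod (\<Lambda> k g) \<le> K" using pw[of g] by blast
      obtain N where "K \<le> real N" using real_arch_simple by blast
      hence "\<forall>k. cmod (\<Lambda> k g) \<le> real N" using K order_trans by blast
      thus ?thesis by (auto simp: T_def)
    qed
    thus ?thesis by blast
  qed
  have "\<exists>N. interior (T N) \<noteq> {}"
  proof (rule ccontr)
    assume "\<not> (\<exists>N. interior (T N) \<noteq> {})"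
    hence "Met_TC.mtopology interior_of (\<Union>(range T)) = {}"
      using cl complete_UNIV by (intro Met_TC.metric_Baire_category_alt) auto
    thus False using un by simp
  qed
  then obtain N x where "x \<in> interior (T N)" by blast
  then obtain e where e: "e > 0" "cball x e \<subseteq> T N" by (meson mem_interior_cball)
  have "cmod (\<Lambda> k g) \<le> (2 * real N / e) * norm g" for k g
  proof (cases "g = 0")
    case True thus ?thesis using linear_0[OF bounded_linear.linear[OF lin]] by simp
  next
    case False
    interpret L: bounded_linear "\<Lambda> k" by (rule lin)
    define h where "h = (e / norm g) *\<^sub>R g"
    have "norm h = e" using False e by (simp add: h_def)
    hence "x + h \<in> cball x e" "x \<in> cball x e" using e by (simp_all add: dist_norm)
    hence "x + h \<in> T N" "x \<in> T N" using e(2) by blast+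
    hence "cmod (\<Lambda> k (x + h)) \<le> real N" "cmod (\<Lambda> k x) \<le> real N" by (simp_all add: T_def)
    moreover have "\<Lambda> k h = \<Lambda> k (x + h) - \<Lambda> k x" by (simp add: L.add)
    ultimately have "cmod (\<Lambda> k h) \<le> 2 * real N" using norm_triangle_ineq4[of "\<Lambda> k (x + h)" "\<Lambda> k x"] by simp
    hence "(e / norm g) * cmod (\<Lambda> k g) \<le> 2 * real N" using e by (simp add: h_def L.scaleR)
    thus ?thesis using e False by (simp add: field_simps)
  qed
  thus ?thesis by blast
qed

section \<open>The bilinear pairing and root subspaces\<close>

definition pair01 :: "(real \<Rightarrow> complex) \<Rightarrow> (real \<Rightarrow> complex) \<Rightarrow> complex" where
  "pair01 f g = (\<integral>x. f x * g x \<partial>leb01)"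

lemma pair01_commute: "pair01 f g = pair01 g f" by (simp add: pair01_def mult.commute)

lemma pair01_bound:
  assumes f: "integrable leb01 f" and g: "continuous_on {0..1} g" "\<And>x. x \<in> {0..1} \<Longrightarrow> cmod (g x) \<le> M"
  shows "cmod (pair01 f g) \<le> M * (\<integral>x. cmod (f x) \<partial>leb01)"
proof -
  have "cmod (pair01 f g) \<le> (\<integral>x. cmod (f x * g x) \<partial>leb01)" unfolding pair01_def by (rule integral_norm_bound)
  also have "\<dots> \<le> (\<integral>x. M * cmod (f x) \<partial>leb01)"
  proof (rule integral_mono)
    fix x assume "x \<in> space leb01"
    hence "cmod (g x) \<le> M" using g(2) by simp
    from mult_left_mono[OF this, of "cmod (f x)"] show "cmod (f x * g x) \<le> M * cmod (f x)" by (simp add: norm_mult mult.commute)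
  qed (use f integrable_leb01_mult_continuous(1)[OF f g(1)] in auto)
  finally show ?thesis by simp
qed

text \<open>A one-dimensional eigenspace together with a nonzero pairing; the latter excludes
  associated functions, so that the eigenvalue is also algebraically simple.\<close>

definition simple_eigenpair :: "boundary_type \<Rightarrow> (real \<Rightarrow> complex) \<Rightarrow> complex \<Rightarrow> (real \<Rightarrow> complex) \<Rightarrow> bool" where
  "simple_eigenpair b q \<mu> u \<longleftrightarrow> u \<in> op_domain b q \<and> (AE x in leb01. schroedinger q u x = \<mu> * u x) \<and> pair01 u u \<noteq> 0 \<and>
     (\<forall>v\<in>op_domain b q. (AE x in leb01. schroedinger q v x = \<mu> * v x) \<longrightarrow> (\<exists>c. v = cscale c u))"

lemma root_kernel_domain: "v \<in> root_kernel b q \<mu> k \<Longrightarrow> v \<in> op_domain b q \<or> v = (\<lambda>x. 0)"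
  by (cases k) auto

text \<open>Symmetry moves the operator from \<open>v\<close> to \<open>u\<close>, where it acts as
  multiplication by \<open>\<mu>\<close>.\<close>

lemma pair_root_kernel:
  assumes q: "integrable leb01 q" and u: "u \<in> op_domain b q" "AE x in leb01. schroedinger q u x = \<mu> * u x"
    and v: "v \<in> op_domain b q" "AE x in leb01. schroedinger q v x - \<mu>' * v x = w x"
    and w: "integrable leb01 (\<lambda>x. w x * u x)"
  shows "(\<mu> - \<mu>') * pair01 v u = pair01 w u"
proof -
  note uc = op_domainD(8)[OF u(1)] and vc = op_domainD(8)[OF v(1)]
  have i1: "integrable leb01 (\<lambda>x. schroedinger q v x * u x)" by (rule schroedinger_integrable[OF q v(1) uc])
  have i2: "integrable leb01 (\<lambda>x. \<mu>' * v x * u x)" by (intro integrable_leb01_continuous continuous_intros uc vc)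
  have i3: "integrable leb01 (\<lambda>x. (schroedinger q v x - \<mu>' * v x) * u x)"
    using Bochner_Integration.integrable_diff[OF i1 i2] by (simp add: algebra_simps)
  have "pair01 w u = (\<integral>x. (schroedinger q v x - \<mu>' * v x) * u x \<partial>leb01)"
    unfolding pair01_def by (rule integral_leb01_cong_AE_mult[OF v(2) i3 w, symmetric])
  also have "\<dots> = (\<integral>x. schroedinger q v x * u x - \<mu>' * v x * u x \<partial>leb01)" by (simp add: algebra_simps)
  also have "\<dots> = (\<integral>x. schroedinger q v x * u x \<partial>leb01) - (\<integral>x. \<mu>' * v x * u x \<partial>leb01)" by (rule Bochner_Integration.integral_diff[OF i1 i2])
  also have "(\<integral>x. schroedinger q v x * u x \<partial>leb01) = (\<integral>x. v x * schroedinger q u x \<partial>leb01)" by (rule schroedinger_symmetric[OF q v(1) u(1)])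
  also have "\<dots> = (\<integral>x. schroedinger q u x * v x \<partial>leb01)" by (simp add: mult.commute)
  also have "\<dots> = (\<integral>x. (\<mu> * u x) * v x \<partial>leb01)"
    by (rule integral_leb01_cong_AE_mult[OF u(2) schroedinger_integrable[OF q u(1) vc]]) (intro integrable_leb01_continuous continuous_intros uc vc)
  also have "\<dots> = \<mu> * pair01 v u" unfolding pair01_def by (subst integral_mult_right_zero[symmetric]) (simp add: mult_ac)
  also have "(\<integral>x. \<mu>' * v x * u x \<partial>leb01) = \<mu>' * pair01 v u" unfolding pair01_def by (subst integral_mult_right_zero[symmetric]) (simp add: mult_ac)
  finally show ?thesis by (simp add: algebra_simps)
qed

lemma root_kernel_mult_integrable:
  assumes "v \<in> root_kernel b q \<mu> k" "continuous_on {0..1} u"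
  shows "integrable leb01 (\<lambda>x. v x * u x)"
  using root_kernel_domain[OF assms(1)]
  by (auto intro!: integrable_leb01_continuous continuous_on_mult assms(2) dest: op_domainD(8))

text \<open>Along a chain of associated functions the pairing with \<open>u\<close> is multiplied by
  \<open>1 / (\<mu> - \<mu>')\<close> at each step, starting from 0.\<close>

lemma other_root_orthogonal:
  assumes q: "integrable leb01 q" and u: "u \<in> op_domain b q" "AE x in leb01. schroedinger q u x = \<mu> * u x"
    and ne: "\<mu>' \<noteq> \<mu>"
  shows "v \<in> root_kernel b q \<mu>' k \<Longrightarrow> pair01 v u = 0"
proof (induction k arbitrary: v)
  case 0 thus ?case by (simp add: pair01_def)
next
  case (Suc k)
  then obtain w where w: "w \<in> root_kernel b q \<mu>' k" "AE x in leb01. schroedinger q v x - \<mu>' * v x = w x" and v: "v \<in> op_domain b q" by auto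
  have "(\<mu> - \<mu>') * pair01 v u = pair01 w u"
    by (rule pair_root_kernel[OF q u v w(2) root_kernel_mult_integrable[OF w(1) op_domainD(8)[OF u(1)]]])
  thus ?case using Suc.IH[OF w(1)] ne by simp
qed

text \<open>If \<open>L - \<mu>\<close> maps \<open>v\<close> to \<open>c * u\<close>, pairing with
  \<open>u\<close> gives \<open>0 = c * pair01 u u\<close>, hence \<open>c = 0\<close>: no chain of
  associated functions starts.\<close>

lemma simple_root_kernel:
  assumes q: "integrable leb01 q" and s: "simple_eigenpair b q \<mu> u"
  shows "v \<in> root_kernel b q \<mu> k \<Longrightarrow> \<exists>c. v = cscale c u"
proof (induction k arbitrary: v)
  case 0
  thus ?case by (intro exI[of _ 0]) (simp add: cscale_def)
next
  case (Suc k)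
  note S = s[unfolded simple_eigenpair_def]
  obtain w where w: "w \<in> root_kernel b q \<mu> k" "AE x in leb01. schroedinger q v x - \<mu> * v x = w x" and v: "v \<in> op_domain b q" using Suc.prems by auto
  have u: "u \<in> op_domain b q" "AE x in leb01. schroedinger q u x = \<mu> * u x" using S by auto
  obtain c where c: "w = cscale c u" using Suc.IH[OF w(1)] by blast
  have "(\<mu> - \<mu>) * pair01 v u = pair01 w u"
    by (rule pair_root_kernel[OF q u v w(2) root_kernel_mult_integrable[OF w(1) op_domainD(8)[OF u(1)]]])
  moreover have "pair01 w u = c * pair01 u u" unfolding pair01_def c cscale_def by (subst integral_mult_right_zero[symmetric]) (simp add: mult_ac)
  ultimately have "c = 0" using S by simp
  hence "AE x in leb01. schroedinger q v x = \<mu> * v x" using w(2) c by (auto simp: cscale_def elim: eventually_mono)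
  thus ?case using S v by blast
qed

text \<open>Exactly one basis element is a multiple of \<open>u\<close>, and the others are
  orthogonal to \<open>u\<close>, so pairing the expansion of \<open>g\<close> with \<open>u\<close>
  isolates one coefficient. The corresponding term is the difference of two consecutive remainders,
  whose norms have a bound depending on \<open>g\<close> alone. Convergence in \<open>L1\<close>
  suffices because \<open>u\<close> is bounded.\<close>

theorem basis_coefficient_bound:
  assumes q: "integrable leb01 q" and rf: "root_function_system b q \<phi>" and sb: "schauder_basis_L2 \<phi>"
    and g: "continuous_on {0..1} g"
  shows "\<exists>K. \<forall>\<mu> u. simple_eigenpair b q \<mu> u \<longrightarrow> cmod (pair01 g u) * (\<integral>x. cmod (u x) \<partial>leb01) \<le> K * cmod (pair01 u u)"
proof -
  have L2\<phi>: "\<And>i. L2 (\<phi> i)" using sb by (simp add: schauder_basis_L2_def)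
  have \<phi>i: "\<And>i. integrable leb01 (\<phi> i)" by (rule L1_le_L2_norm(1)[OF L2\<phi>])
  obtain c where c: "(\<lambda>N. L2_norm (\<lambda>x. g x - (\<Sum>i<N. c i * \<phi> i x))) \<longlonglongrightarrow> 0"
    using sb L2_continuous[OF g] unfolding schauder_basis_L2_def by blast
  define r where "r N x = g x - (\<Sum>i<N. c i * \<phi> i x)" for N x
  have rsuc: "r (Suc N) x = r N x - c N * \<phi> N x" for N x by (simp add: r_def)
  have L2r: "L2 (r N)" for N
  proof (induction N)
    case 0 thus ?case using L2_continuous[OF g] by (simp add: r_def[abs_def])
  next
    case (Suc N)
    have m: "r (Suc N) \<in> borel_measurable leb01"
      unfolding rsuc[abs_def] by (intro borel_measurable_diff borel_measurable_times borel_measurable_const) (use Suc L2\<phi>[of N] in \<open>auto simp: L2_def\<close>)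
    have "integrable leb01 (\<lambda>x. (cmod (r (Suc N) x))\<^sup>2)"
    proof (rule Bochner_Integration.integrable_bound)
      show "integrable leb01 (\<lambda>x. 2 * (cmod (r N x))\<^sup>2 + 2 * (cmod (c N))\<^sup>2 * (cmod (\<phi> N x))\<^sup>2)"
        using Suc L2\<phi>[of N] by (auto simp: L2_def)
      show "(\<lambda>x. (cmod (r (Suc N) x))\<^sup>2) \<in> borel_measurable leb01" using m by measurable
      show "AE x in leb01. norm ((cmod (r (Suc N) x))\<^sup>2) \<le> norm (2 * (cmod (r N x))\<^sup>2 + 2 * (cmod (c N))\<^sup>2 * (cmod (\<phi> N x))\<^sup>2)"
      proof (rule AE_I2)
        fix x
        have "cmod (r (Suc N) x) \<le> cmod (r N x) + cmod (c N) * cmod (\<phi> N x)"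
          unfolding rsuc using norm_triangle_ineq4[of "r N x" "c N * \<phi> N x"] by (simp add: norm_mult)
        hence "(cmod (r (Suc N) x))\<^sup>2 \<le> (cmod (r N x) + cmod (c N) * cmod (\<phi> N x))\<^sup>2" by (intro power_mono) auto
        also have "\<dots> \<le> 2 * (cmod (r N x))\<^sup>2 + 2 * (cmod (c N) * cmod (\<phi> N x))\<^sup>2"
        proof -
          have "0 \<le> (cmod (r N x) - cmod (c N) * cmod (\<phi> N x))\<^sup>2" by simp
          thus ?thesis by (simp add: power2_eq_square algebra_simps)
        qed
        finally show "norm ((cmod (r (Suc N) x))\<^sup>2) \<le> norm (2 * (cmod (r N x))\<^sup>2 + 2 * (cmod (c N))\<^sup>2 * (cmod (\<phi> N x))\<^sup>2)"
          by (simp add: power_mult_distrib)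
      qed
    qed
    thus ?case using m by (simp add: L2_def)
  qed
  have ri: "integrable leb01 (r N)" for N by (rule L1_le_L2_norm(1)[OF L2r])
  have rlim: "(\<lambda>N. \<integral>x. cmod (r N x) \<partial>leb01) \<longlonglongrightarrow> 0"
  proof (rule tendsto_sandwich[OF _ _ tendsto_const c[folded r_def]])
    show "\<forall>\<^sub>F N in sequentially. (\<integral>x. cmod (r N x) \<partial>leb01) \<le> L2_norm (\<lambda>x. r N x)"
      using L1_le_L2_norm(2)[OF L2r] by (intro always_eventually) auto
  qed simp
  obtain K where K: "\<And>N. (\<integral>x. cmod (r N x) \<partial>leb01) \<le> K"
  proof -
    have "Bseq (\<lambda>N. \<integral>x. cmod (r N x) \<partial>leb01)" using rlim by (intro convergent_imp_Bseq) (auto simp: convergent_def)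
    then obtain K where "\<And>N. norm (\<integral>x. cmod (r N x) \<partial>leb01) \<le> K" by (auto simp: Bseq_def)
    thus ?thesis using that[of K] by (metis abs_le_D1 real_norm_def)
  qed
  have "cmod (pair01 g u) * (\<integral>x. cmod (u x) \<partial>leb01) \<le> (2 * K) * cmod (pair01 u u)" if s: "simple_eigenpair b q \<mu> u" for \<mu> u
  proof -
    note S = s[unfolded simple_eigenpair_def]
    have u: "u \<in> op_domain b q" "AE x in leb01. schroedinger q u x = \<mu> * u x" "pair01 u u \<noteq> 0" using S by auto
    note uc = op_domainD(8)[OF u(1)]
    have u0: "u \<noteq> (\<lambda>x. 0)" using u(3) by (auto simp: pair01_def)
    have ev: "eigenvalue b q \<mu>" unfolding eigenvalue_def using u u0 by blast
    obtain B where inj: "inj \<phi>" and B: "\<And>\<nu>. eigenvalue b q \<nu> \<Longrightarrow> cfun.independent (B \<nu>)" "\<And>\<nu>. eigenvalue b q \<nu> \<Longrightarrow> cfun.span (B \<nu>) = root_subspace b q \<nu>"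
      "range \<phi> = (\<Union>\<nu>\<in>{\<nu>. eigenvalue b q \<nu>}. B \<nu>)"
      using rf unfolding root_function_system_def by blast
    have inB: "\<exists>d. v = cscale d u" if "v \<in> B \<mu>" for v
    proof -
      have "v \<in> root_subspace b q \<mu>" using cfun.span_base[OF that] B(2)[OF ev] by simp
      thus ?thesis using simple_root_kernel[OF q s] by (auto simp: root_subspace_def)
    qed
    have "u \<in> root_kernel b q \<mu> (Suc 0)" using u by (auto elim: eventually_mono)
    hence uspan: "u \<in> cfun.span (B \<mu>)" unfolding B(2)[OF ev] root_subspace_def by blast
    have "\<not> B \<mu> \<subseteq> {0}"
    proof
      assume "B \<mu> \<subseteq> {0}"
      hence "cfun.span (B \<mu>) \<subseteq> cfun.span {0}" by (rule cfun.span_mono)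
      hence "u = 0" using uspan by auto
      thus False using u0 by (simp add: zero_fun_def)
    qed
    then obtain v where v: "v \<in> B \<mu>" "v \<noteq> 0" by blast
    obtain d where d: "v = cscale d u" using inB[OF v(1)] by blast
    have d0: "d \<noteq> 0" using v(2) d by (auto simp: cscale_def zero_fun_def)
    obtain i where i: "\<phi> i = v" using v(1) B(3) ev by (metis (no_types, lifting) UN_I mem_Collect_eq rangeE)
    \<comment> \<open>A second element of \<open>B \<mu>\<close> would be a multiple of
      \<open>v\<close>, against independence; elements of other root subspaces are
      orthogonal.\<close>
    have other: "pair01 (\<phi> j) u = 0" if ji: "j \<noteq> i" for j
    proof -
      obtain \<nu> where \<nu>: "eigenvalue b q \<nu>" "\<phi> j \<in> B \<nu>" using B(3) by (metis (no_types, lifting) UN_E mem_Collect_eq rangeI)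
      have "\<nu> \<noteq> \<mu>"
      proof
        assume "\<nu> = \<mu>"
        hence jB: "\<phi> j \<in> B \<mu>" using \<nu> by simp
        obtain d' where d': "\<phi> j = cscale d' u" using inB[OF jB] by blast
        have ne: "\<phi> j \<noteq> v" using inj ji i by (auto simp: inj_def)
        have "\<phi> j = cscale (d' / d) v" using d d' d0 by (simp add: cscale_def)
        moreover have "v \<in> cfun.span (B \<mu> - {\<phi> j})" using v ne by (intro cfun.span_base) auto
        ultimately have "\<phi> j \<in> cfun.span (B \<mu> - {\<phi> j})" using cfun.span_scale by metis
        hence "cfun.dependent (B \<mu>)" unfolding cfun.dependent_def using jB by blast
        thus False using B(1)[OF ev] by simp
      qed
      moreover have "\<phi> j \<in> root_subspace b q \<nu>" using cfun.span_base[OF \<nu>(2)] B(2)[OF \<nu>(1)] by simp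
      ultimately show ?thesis using other_root_orthogonal[OF q u(1,2)] by (auto simp: root_subspace_def)
    qed
    have \<phi>u: "integrable leb01 (\<lambda>x. \<phi> j x * u x)" for j by (rule integrable_leb01_mult_continuous(1)[OF \<phi>i uc])
    have ru: "integrable leb01 (\<lambda>x. r N x * u x)" for N by (rule integrable_leb01_mult_continuous(1)[OF ri uc])
    have pr: "pair01 (r N) u = pair01 g u - (if i < N then c i * d * pair01 u u else 0)" for N
    proof (induction N)
      case 0 thus ?case by (simp add: r_def[abs_def])
    next
      case (Suc N)
      have "pair01 (r (Suc N)) u = (\<integral>x. r N x * u x - c N * (\<phi> N x * u x) \<partial>leb01)"
        unfolding pair01_def rsuc by (simp add: algebra_simps)
      also have "\<dots> = pair01 (r N) u - c N * pair01 (\<phi> N) u"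
        unfolding pair01_def using ru \<phi>u by (subst Bochner_Integration.integral_diff) auto
      also have "pair01 (\<phi> N) u = (if N = i then d * pair01 u u else 0)"
      proof (cases "N = i")
        case True
        have "pair01 v u = d * pair01 u u" unfolding pair01_def d cscale_def by (subst integral_mult_right_zero[symmetric]) (simp add: mult_ac)
        thus ?thesis using True i by simp
      qed (simp add: other)
      finally show ?case using Suc by auto
    qed
    obtain M where M: "M \<ge> 0" "\<forall>x\<in>{0..1}. cmod (u x) \<le> M" using continuous_01_bounded[OF uc] by blast
    have "(\<lambda>N. pair01 (r N) u) \<longlonglongrightarrow> 0"
    proof (rule Lim_null_comparison)
      show "\<forall>\<^sub>F N in sequentially. norm (pair01 (r N) u) \<le> M * (\<integral>x. cmod (r N x) \<partial>leb01)"
        by (intro always_eventually allI pair01_bound ri uc) (use M in auto)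
      show "(\<lambda>N. M * (\<integral>x. cmod (r N x) \<partial>leb01)) \<longlonglongrightarrow> 0" by (rule tendsto_mult_right_zero[OF rlim])
    qed
    moreover have "(\<lambda>N. pair01 (r N) u) \<longlonglongrightarrow> pair01 g u - c i * d * pair01 u u"
    proof (rule tendsto_eventually)
      show "\<forall>\<^sub>F N in sequentially. pair01 (r N) u = pair01 g u - c i * d * pair01 u u"
        using eventually_gt_at_top[of i] by eventually_elim (simp add: pr)
    qed
    ultimately have "pair01 g u - c i * d * pair01 u u = 0" by (metis LIMSEQ_unique)
    hence gu: "pair01 g u = c i * d * pair01 u u" by simp
    have ui: "integrable leb01 u" by (rule integrable_leb01_continuous[OF uc])
    have "cmod (c i * d) * (\<integral>x. cmod (u x) \<partial>leb01) = (\<integral>x. cmod (c i * \<phi> i x) \<partial>leb01)"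
      by (subst integral_mult_right_zero[symmetric]) (simp add: i d cscale_def norm_mult mult_ac)
    also have "\<dots> \<le> (\<integral>x. cmod (r i x) + cmod (r (Suc i) x) \<partial>leb01)"
    proof (rule integral_mono)
      fix x
      have "c i * \<phi> i x = r i x - r (Suc i) x" by (simp add: rsuc)
      thus "cmod (c i * \<phi> i x) \<le> cmod (r i x) + cmod (r (Suc i) x)" by (metis norm_triangle_ineq4)
    qed (use \<phi>i ri in auto)
    also have "\<dots> = (\<integral>x. cmod (r i x) \<partial>leb01) + (\<integral>x. cmod (r (Suc i) x) \<partial>leb01)"
      by (rule Bochner_Integration.integral_add) (use ri in auto)
    also have "\<dots> \<le> 2 * K" using K[of i] K[of "Suc i"] by simp
    finally have "cmod (c i * d) * (\<integral>x. cmod (u x) \<partial>leb01) \<le> 2 * K" .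
    from mult_right_mono[OF this, of "cmod (pair01 u u)"] show ?thesis by (simp add: gu norm_mult mult_ac)
  qed
  thus ?thesis by blast
qed

section \<open>Contradiction with uniform boundedness\<close>

lemma pair01_fseries:
  assumes y: "(\<lambda>l. cmod (y l)) summable_on UNIV"
  shows "((\<lambda>l. y l * y (- n - l)) has_sum pair01 (\<lambda>x. hexp n x * fseries y x) (\<lambda>x. hexp n x * fseries y x)) UNIV"
proof -
  have "pair01 (\<lambda>x. hexp n x * fseries y x) (\<lambda>x. hexp n x * fseries y x) = fcoeff (\<lambda>x. fseries y x * fseries y x) (- n)"
    unfolding pair01_def fcoeff_def
  proof (intro Bochner_Integration.integral_cong refl)
    fix x
    have "fexp (- (- n)) x = hexp n x * hexp n x" using hexp_add[of n n x] hexp_double[of n x] by (simp only: mult_2 minus_minus)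
    thus "hexp n x * fseries y x * (hexp n x * fseries y x) = fseries y x * fseries y x * fexp (- (- n)) x" by (simp only: mult_ac)
  qed
  moreover have "((\<lambda>l. y l * fcoeff (fseries y) (- n - l)) has_sum fcoeff (\<lambda>x. fseries y x * fseries y x) (- n)) UNIV"
    by (rule fcoeff_mult_fseries[OF integrable_leb01_continuous[OF fseries_continuous[OF y]] y])
  ultimately show ?thesis by (simp add: fcoeff_fseries[OF y])
qed

text \<open>The functionals pair with \<open>u k\<close> and are scaled by the \<open>L1\<close>
  norm of \<open>u k\<close> over the modulus of \<open>pair01 (u k) (u k)\<close>. Pointwise bounds
  become uniform, but on the normalized conjugate of \<open>u k\<close> the modulus is at least
  \<open>1 / (3 * \<epsilon> k)\<close>.\<close>

lemma uniform_small_pairing_contradiction: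
  fixes u :: "nat \<Rightarrow> real \<Rightarrow> complex" and M \<epsilon> :: "nat \<Rightarrow> real"
  assumes pw: "\<And>g. continuous_on {0..1} g \<Longrightarrow> \<exists>K. \<forall>k. cmod (pair01 g (u k)) * (\<integral>x. cmod (u k x) \<partial>leb01) \<le> K * cmod (pair01 (u k) (u k))"
    and uc: "\<And>k. continuous_on {0..1} (u k)" and nz: "\<And>k. pair01 (u k) (u k) \<noteq> 0"
    and M: "\<And>k. M k > 0" "\<And>k. M k \<le> (\<integral>x. cmod (u k x) \<partial>leb01)" "\<And>k x. x \<in> {0..1} \<Longrightarrow> cmod (u k x) \<le> 3 * M k"
    and small: "\<And>k. cmod (pair01 (u k) (u k)) \<le> \<epsilon> k * (M k)\<^sup>2" and \<epsilon>: "\<epsilon> \<longlonglongrightarrow> 0"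
  shows False
proof -
  define N1 where "N1 k = (\<integral>x. cmod (u k x) \<partial>leb01)" for k
  define P where "P k = cmod (pair01 (u k) (u k))" for k
  have P0: "P k > 0" for k using nz by (simp add: P_def)
  have N1p: "N1 k > 0" for k using M(1)[of k] M(2)[of k] by (simp add: N1_def)
  define \<Lambda> where "\<Lambda> k G = pair01 (apply_bcontfun G) (u k) * of_real (N1 k / P k)" for k and G :: "real \<Rightarrow>\<^sub>C complex"
  have ui: "integrable leb01 (u k)" for k by (rule integrable_leb01_continuous[OF uc])
  have Gc: "continuous_on {0..1} (apply_bcontfun G)" for G :: "real \<Rightarrow>\<^sub>C complex" by (rule continuous_on_apply_bcontfun)
  have Gu: "integrable leb01 (\<lambda>x. apply_bcontfun G x * u k x)" for G :: "real \<Rightarrow>\<^sub>C complex" and k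
    by (rule integrable_leb01_mult_continuous(2)[OF ui Gc])
  have bl: "bounded_linear (\<Lambda> k)" for k
  proof (rule bounded_linear_intro[where K="N1 k * (N1 k / P k)"])
    fix G H :: "real \<Rightarrow>\<^sub>C complex"
    have "pair01 (apply_bcontfun (G + H)) (u k) = pair01 (apply_bcontfun G) (u k) + pair01 (apply_bcontfun H) (u k)"
      unfolding pair01_def plus_bcontfun.rep_eq distrib_right by (rule Bochner_Integration.integral_add[OF Gu Gu])
    thus "\<Lambda> k (G + H) = \<Lambda> k G + \<Lambda> k H" by (simp add: \<Lambda>_def distrib_right add_divide_distrib)
  next
    fix r and G :: "real \<Rightarrow>\<^sub>C complex"
    have "pair01 (apply_bcontfun (r *\<^sub>R G)) (u k) = r *\<^sub>R pair01 (apply_bcontfun G) (u k)"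
      unfolding pair01_def scaleR_bcontfun.rep_eq by (simp add: scaleR_conv_of_real mult.assoc)
    thus "\<Lambda> k (r *\<^sub>R G) = r *\<^sub>R \<Lambda> k G" by (simp add: \<Lambda>_def scaleR_conv_of_real)
  next
    fix G :: "real \<Rightarrow>\<^sub>C complex"
    have "cmod (pair01 (u k) (apply_bcontfun G)) \<le> norm G * N1 k"
      unfolding N1_def by (rule pair01_bound[OF ui Gc norm_bounded])
    hence "cmod (\<Lambda> k G) \<le> (norm G * N1 k) * (N1 k / P k)"
      unfolding \<Lambda>_def norm_mult pair01_commute[of "apply_bcontfun G"] using N1p[of k] P0[of k]
      by (intro mult_mono) (auto simp: norm_divide)
    thus "norm (\<Lambda> k G) \<le> norm G * (N1 k * (N1 k / P k))" by (simp add: mult_ac)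
  qed
  have "\<exists>K. \<forall>k G. cmod (\<Lambda> k G) \<le> K * norm G"
  proof (rule uniform_boundedness[OF bl])
    fix G :: "real \<Rightarrow>\<^sub>C complex"
    obtain K where K: "\<And>k. cmod (pair01 (apply_bcontfun G) (u k)) * N1 k \<le> K * P k" using pw[OF Gc[of G]] unfolding N1_def P_def by blast
    have "cmod (\<Lambda> k G) \<le> K" for k
    proof -
      have "cmod (\<Lambda> k G) = (cmod (pair01 (apply_bcontfun G) (u k)) * N1 k) / P k"
        using N1p[of k] P0[of k] by (simp add: \<Lambda>_def norm_mult norm_divide)
      thus ?thesis using K[of k] P0[of k] by (simp add: divide_le_eq)
    qed
    thus "\<exists>K. \<forall>k. cmod (\<Lambda> k G) \<le> K" by blast
  qed
  then obtain K where K: "\<And>k G. cmod (\<Lambda> k G) \<le> K * norm G" by blast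
  have "1/3 \<le> \<bar>K\<bar> * \<epsilon> k" for k
  proof -
    \<comment> \<open>The conjugate of \<open>u k\<close>, divided by its bound and continued
      constantly beyond [0,1], is a bounded continuous function of norm at most 1.\<close>
    define h where "h x = cnj (u k (max 0 (min 1 x))) / of_real (3 * M k)" for x :: real
    have Mk: "3 * M k > 0" using M(1) by simp
    have hb: "cmod (h x) \<le> 1" for x
      using M(3)[of "max 0 (min 1 x)" k] Mk by (simp add: h_def norm_divide)
    have hc: "continuous_on UNIV h"
      unfolding h_def using Mk by (intro continuous_intros continuous_on_compose2[OF uc[of k]]) auto
    have hB: "h \<in> bcontfun" unfolding bcontfun_def using hc hb by (auto simp: bounded_iff)
    have ah: "apply_bcontfun (Bcontfun h) = h" by (rule Bcontfun_inverse[OF hB])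
    have nh: "norm (Bcontfun h) \<le> 1" by (rule norm_bound) (simp add: ah hb)
    have u2: "integrable leb01 (\<lambda>x. (cmod (u k x))\<^sup>2)" using L2_continuous[OF uc] by (simp add: L2_def)
    have "pair01 h (u k) = (\<integral>x. of_real ((cmod (u k x))\<^sup>2 / (3 * M k)) \<partial>leb01)"
      unfolding pair01_def
    proof (intro Bochner_Integration.integral_cong refl)
      fix x assume "x \<in> space leb01"
      hence "max 0 (min 1 x) = x" by simp
      thus "h x * u k x = of_real ((cmod (u k x))\<^sup>2 / (3 * M k))" unfolding h_def of_real_divide complex_norm_square by (simp add: mult.commute)
    qed
    also have "\<dots> = of_real ((\<integral>x. (cmod (u k x))\<^sup>2 \<partial>leb01) / (3 * M k))" by (subst integral_complex_of_real) simp
    finally have "cmod (pair01 h (u k)) = (\<integral>x. (cmod (u k x))\<^sup>2 \<partial>leb01) / (3 * M k)"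
      using Mk by (simp only: norm_of_real) (simp add: abs_of_nonneg)
    moreover have "(N1 k)\<^sup>2 \<le> (\<integral>x. (cmod (u k x))\<^sup>2 \<partial>leb01)"
    proof -
      have "N1 k \<le> sqrt (\<integral>x. (cmod (u k x))\<^sup>2 \<partial>leb01)" using L1_le_L2_norm(2)[OF L2_continuous[OF uc]] by (simp add: N1_def L2_norm_def)
      hence "(N1 k)\<^sup>2 \<le> (sqrt (\<integral>x. (cmod (u k x))\<^sup>2 \<partial>leb01))\<^sup>2" using N1p[of k] by (intro power_mono) auto
      thus ?thesis by simp
    qed
    moreover have "(M k)\<^sup>2 \<le> (N1 k)\<^sup>2" using M(1)[of k] M(2)[of k] by (intro power_mono) (auto simp: N1_def)
    ultimately have pge: "M k / 3 \<le> cmod (pair01 h (u k))" using Mk by (simp add: le_divide_eq power2_eq_square)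
    have "cmod (\<Lambda> k (Bcontfun h)) \<le> K * norm (Bcontfun h)" by (rule K)
    also have "\<dots> \<le> \<bar>K\<bar> * 1" by (intro mult_mono nh) auto
    finally have "cmod (pair01 h (u k)) * N1 k \<le> \<bar>K\<bar> * P k"
      using N1p[of k] P0[of k] by (simp add: \<Lambda>_def ah norm_mult norm_divide divide_le_eq)
    moreover have "M k / 3 * M k \<le> cmod (pair01 h (u k)) * N1 k" using pge M(1)[of k] M(2)[of k] by (intro mult_mono) (auto simp: N1_def)
    moreover have "\<bar>K\<bar> * P k \<le> \<bar>K\<bar> * (\<epsilon> k * (M k)\<^sup>2)" using small[of k] by (intro mult_left_mono) (auto simp: P_def)
    ultimately have "(1/3) * (M k)\<^sup>2 \<le> (\<bar>K\<bar> * \<epsilon> k) * (M k)\<^sup>2" by (simp add: power2_eq_square mult_ac)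
    thus ?thesis using M(1)[of k] by (simp add: mult_le_cancel_right)
  qed
  moreover have "(\<lambda>k. \<bar>K\<bar> * \<epsilon> k) \<longlonglongrightarrow> 0" by (rule tendsto_mult_right_zero[OF \<epsilon>])
  hence "\<forall>\<^sub>F k in sequentially. \<bar>K\<bar> * \<epsilon> k < 1/3" by (rule order_tendstoD(2)) simp
  then obtain k where "\<bar>K\<bar> * \<epsilon> k < 1/3" by (auto simp: eventually_sequentially)
  ultimately show False by (meson not_le)
qed

section \<open>Unbalanced eigenfunctions\<close>

text \<open>\<open>M\<close> measures \<open>u\<close> from both sides: every Fourier coefficient is
  bounded by the \<open>L1\<close> norm, and the moduli of the coefficients sum to at most
  \<open>3 * M\<close>, where \<open>2 * M\<close> comes from the resonant indices and
  \<open>M\<close> from the others by \<open>small\<close>.\<close>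

lemma resonant_eigenpair:
  fixes n :: nat
  assumes q: "integrable leb01 q" and a: "\<And>k. a k = (if k = 0 then 0 else fcoeff q k)"
    and bn: "bsign b = (if even n then 1 else -1)" and R: "resonant_at a C (int n) z y"
    and C: "C \<ge> 0" and n: "n \<ge> 1" and small: "4 * C * gap_sum (int n) \<le> 1"
  defines "u \<equiv> (\<lambda>x. if x \<in> {0..1} then hexp (int n) x * fseries y x else 0)"
    and "M \<equiv> max (cmod (y 0)) (cmod (y (- int n)))"
  shows "M > 0" "M \<le> (\<integral>x. cmod (u x) \<partial>leb01)" "\<And>x. x \<in> {0..1} \<Longrightarrow> cmod (u x) \<le> 3 * M" "continuous_on {0..1} u"
    "cmod (pair01 u u - 2 * y 0 * y (- int n)) \<le> 16 * C\<^sup>2 * (gap_sum (int n))\<^sup>2 * M\<^sup>2"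
    "pair01 u u \<noteq> 0 \<Longrightarrow> simple_eigenpair b q (near_ev q (int n) z) u"
proof -
  define m where "m = int n"
  have m1: "m \<ge> 1" using n by (simp add: m_def)
  have bm: "bsign b = (if even m then 1 else -1)" using bn by (simp add: m_def)
  note R' = R[unfolded resonant_at_def, folded m_def]
  have ys: "(\<lambda>l. cmod (y l)) summable_on UNIV" and latt: "\<And>j. lattice_op a m z y j = 0" and nz: "y 0 \<noteq> 0" "y (- m) \<noteq> 0"
    and off: "\<And>j. j \<noteq> 0 \<Longrightarrow> j \<noteq> - m \<Longrightarrow> cmod (y j) \<le> 2 * C * (cmod (y 0) + cmod (y (- m))) * gap m j"
    and uniq: "\<And>y'. (\<lambda>l. cmod (y' l)) summable_on UNIV \<Longrightarrow> (\<And>j. lattice_op a m z y' j = 0) \<Longrightarrow> \<exists>c. \<forall>j. y' j = c * y j"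
    using R' by simp_all
  have Mm: "M = max (cmod (y 0)) (cmod (y (- m)))" by (simp add: M_def m_def)
  have um: "u = (\<lambda>x. if x \<in> {0..1} then hexp m x * fseries y x else 0)" unfolding u_def m_def ..
  have sm: "4 * C * gap_sum m \<le> 1" using small by (simp add: m_def)
  show M0: "M > 0" using nz by (simp add: Mm less_max_iff_disj)
  have le2: "cmod (y 0) + cmod (y (- m)) \<le> 2 * M" by (simp add: Mm)
  have off': "cmod (y j) \<le> 4 * C * M * gap m j" if "j \<noteq> 0" "j \<noteq> - m" for j
  proof -
    have "2 * C * (cmod (y 0) + cmod (y (- m))) * gap m j \<le> 2 * C * (2 * M) * gap m j"
      using C by (intro mult_right_mono mult_left_mono le2) auto
    from order_trans[OF off[OF that] this] show ?thesis by (simp add: mult_ac)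
  qed
  have sc: "continuous_on S (fseries y)" for S by (rule fseries_continuous[OF ys])
  have u01: "u x = hexp m x * fseries y x" if "x \<in> {0..1}" for x using that by (simp add: um)
  show uc: "continuous_on {0..1} u"
    by (rule continuous_on_eq[of _ "\<lambda>x. hexp m x * fseries y x"]) (auto intro!: continuous_intros sc simp: um)
  have nu: "(\<integral>x. cmod (u x) \<partial>leb01) = (\<integral>x. cmod (fseries y x) \<partial>leb01)"
    by (intro Bochner_Integration.integral_cong refl) (simp add: um norm_mult)
  have "cmod (y j) \<le> (\<integral>x. cmod (u x) \<partial>leb01)" for j
    using fcoeff_bound[OF integrable_leb01_continuous[OF sc[where S="{0..1}"]], of j] by (simp add: fcoeff_fseries[OF ys] nu)
  thus "M \<le> (\<integral>x. cmod (u x) \<partial>leb01)" by (simp add: Mm)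
  have ysum: "(\<Sum>\<^sub>\<infinity>l. cmod (y l)) \<le> 3 * M"
  proof -
    have hs: "((\<lambda>l. if l = 0 \<or> l = - m then cmod (y l) else 0) has_sum (cmod (y 0) + cmod (y (- m)))) UNIV"
      by (rule has_sum_finite_neutralI[of "{0, - m}"]) (use m1 in auto)
    have s2: "(\<lambda>l. 4 * C * M * gap m l) summable_on UNIV" by (rule summable_on_cmult_right[OF gap_summable])
    have "(\<Sum>\<^sub>\<infinity>l. cmod (y l)) \<le> (\<Sum>\<^sub>\<infinity>l. (if l = 0 \<or> l = - m then cmod (y l) else 0) + 4 * C * M * gap m l)"
    proof (rule infsum_mono[OF ys summable_on_add[OF has_sum_imp_summable[OF hs] s2]])
      fix l show "cmod (y l) \<le> (if l = 0 \<or> l = - m then cmod (y l) else 0) + 4 * C * M * gap m l"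
        using off'[of l] C M0 by auto
    qed
    also have "\<dots> = (cmod (y 0) + cmod (y (- m))) + 4 * C * M * gap_sum m"
      by (subst infsum_add[OF has_sum_imp_summable[OF hs] s2], subst infsumI[OF hs]) (simp add: infsum_cmult_right[OF gap_summable] gap_sum_def)
    also have "4 * C * M * gap_sum m = (4 * C * gap_sum m) * M" by (simp only: mult_ac)
    also have "cmod (y 0) + cmod (y (- m)) + (4 * C * gap_sum m) * M \<le> 2 * M + 1 * M"
      using M0 by (intro add_mono le2 mult_right_mono sm) auto
    finally show ?thesis by simp
  qed
  show "cmod (u x) \<le> 3 * M" if "x \<in> {0..1}" for x
    using order_trans[OF fseries_bound[OF ys] ysum] by (simp add: u01[OF that] norm_mult)
  have pu: "pair01 u u = pair01 (\<lambda>x. hexp m x * fseries y x) (\<lambda>x. hexp m x * fseries y x)"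
    unfolding pair01_def by (intro Bochner_Integration.integral_cong refl) (simp add: um)
  \<comment> \<open>The pairing couples \<open>l\<close> with \<open>- m - l\<close>, hence the two
    resonant indices with each other, which produces \<open>2 * y 0 * y (- m)\<close>; every other
    term contains two gap factors.\<close>
  define f where "f l = y l * y (- m - l)" for l
  have fs: "(f has_sum pair01 u u) UNIV" unfolding pu f_def[abs_def] by (rule pair01_fseries[OF ys])
  have hs: "((\<lambda>l. if l = 0 \<or> l = - m then f l else 0) has_sum (2 * y 0 * y (- m))) UNIV"
    by (rule has_sum_finite_neutralI[of "{0, - m}"]) (use m1 in \<open>auto simp: f_def mult_ac\<close>)
  define e where "e l = f l + - (if l = 0 \<or> l = - m then f l else 0)" for l
  have "((\<lambda>l. - (if l = 0 \<or> l = - m then f l else 0)) has_sum - (2 * y 0 * y (- m))) UNIV"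
    by (rule has_sum_uminusI[OF hs])
  from has_sum_add[OF fs this] have es: "(e has_sum (pair01 u u - 2 * y 0 * y (- m))) UNIV"
    unfolding e_def[abs_def] by simp
  define K where "K = (4 * C * M)\<^sup>2 * gap_sum m"
  have eb: "cmod (e l) \<le> K * gap m l" for l
  proof (cases "l = 0 \<or> l = - m")
    case True
    thus ?thesis by (auto simp: e_def K_def gap_sum_nonneg)
  next
    case False
    hence l: "l \<noteq> 0" "l \<noteq> - m" "- m - l \<noteq> 0" "- m - l \<noteq> - m" by auto
    have "cmod (e l) = cmod (y l) * cmod (y (- m - l))" using False by (simp add: e_def f_def norm_mult)
    also have "\<dots> \<le> (4 * C * M * gap m l) * (4 * C * M * gap m (- m - l))"
      using off'[OF l(1,2)] off'[OF l(3,4)] C M0 by (intro mult_mono) auto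
    also have "\<dots> = (4 * C * M)\<^sup>2 * gap m l * gap m l" by (simp add: gap_reflect power2_eq_square mult_ac)
    also have "\<dots> \<le> (4 * C * M)\<^sup>2 * gap m l * gap_sum m" by (intro mult_left_mono gap_le_sum) auto
    finally show ?thesis by (simp add: K_def mult_ac)
  qed
  have sK: "(\<lambda>l. K * gap m l) summable_on UNIV" by (rule summable_on_cmult_right[OF gap_summable])
  have se: "(\<lambda>l. cmod (e l)) summable_on UNIV" by (rule summable_on_comparison_test[OF sK eb]) auto
  have "cmod (pair01 u u - 2 * y 0 * y (- m)) \<le> (\<Sum>\<^sub>\<infinity>l. cmod (e l))" using norm_infsum_bound[OF se] infsumI[OF es] by simp
  also have "\<dots> \<le> (\<Sum>\<^sub>\<infinity>l. K * gap m l)" by (rule infsum_mono[OF se sK eb])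
  also have "\<dots> = K * gap_sum m" by (simp add: infsum_cmult_right[OF gap_summable] gap_sum_def)
  finally show "cmod (pair01 u u - 2 * y 0 * y (- int n)) \<le> 16 * C\<^sup>2 * (gap_sum (int n))\<^sup>2 * M\<^sup>2"
    by (simp add: K_def m_def power2_eq_square mult_ac)
  have E: "u \<in> op_domain b q" "AE x in leb01. schroedinger q u x = near_ev q m z * u x"
    unfolding um by (rule lattice_eigenfunction[where y = y, OF q a ys latt bm])+
  assume p0: "pair01 u u \<noteq> 0"
  have "\<exists>c. v = cscale c u" if v: "v \<in> op_domain b q" "AE x in leb01. schroedinger q v x = near_ev q m z * v x" for v
  proof -
    note V = eigenfunction_lattice[OF q a v bm]
    obtain c where c: "\<And>j. fcoeff (\<lambda>x. hexp (- m) x * v x) j = c * y j" using uniq[OF V(1,2)] by blast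
    have "v x = c * u x" for x
    proof (cases "x \<in> {0..1}")
      case True
      have "fseries (fcoeff (\<lambda>x. hexp (- m) x * v x)) x = c * fseries y x"
        unfolding fseries_def c by (subst infsum_cmult_right'[symmetric]) (simp add: mult_ac)
      thus ?thesis using V(3)[OF True] u01[OF True] by simp
    next
      case False
      thus ?thesis using op_domainD(1)[OF v(1) False] by (auto simp: um)
    qed
    thus ?thesis by (intro exI[of _ c]) (simp add: cscale_def fun_eq_iff)
  qed
  thus "simple_eigenpair b q (near_ev q (int n) z) u"
    unfolding simple_eigenpair_def m_def[symmetric] using E p0 by blast
qed

text \<open>\<open>fcoeff\<close> integrates against the exponential with the opposite sign, so
  \<open>alpha\<close> sits at the negative index.\<close>

lemma alpha_eq: "alpha q n = fcoeff q (- int n)" and beta_eq: "beta q n = fcoeff q (int n)"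
  unfolding alpha_def beta_def fcoeff_def fexp_def
  by (intro Bochner_Integration.integral_cong refl; simp add: mult_ac)+

text \<open>Indices up to \<open>N\<close> produce finitely many ratios, so divergence of the ratio
  alone drives \<open>n\<close> to infinity.\<close>

lemma ratio_limit_imp_unbounded:
  fixes f :: "nat \<Rightarrow> real" and n :: "nat \<Rightarrow> nat"
  assumes "filterlim (\<lambda>k. f (n k)) at_top sequentially"
  shows "filterlim n at_top sequentially"
  unfolding filterlim_at_top
proof
  fix N :: nat
  define B where "B = Max (f ` {..N}) + 1"
  have "\<forall>\<^sub>F k in sequentially. B \<le> f (n k)" using assms by (simp add: filterlim_at_top)
  thus "\<forall>\<^sub>F k in sequentially. N \<le> n k"
  proof eventually_elim
    fix k assume k: "B \<le> f (n k)"
    show "N \<le> n k"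
    proof (rule ccontr)
      assume "\<not> N \<le> n k"
      hence "f (n k) \<le> Max (f ` {..N})" by (intro Max_ge) auto
      thus False using k by (simp add: B_def)
    qed
  qed
qed

text \<open>For the moduli of the two resonant coefficients of an eigenfunction: the first bound makes the
  product small compared with the larger square, the second keeps it from being too small.\<close>

lemma unbalanced_product:
  fixes A B \<alpha> \<beta> :: real
  assumes pos: "A > 0" "B > 0" "\<alpha> > 0" "\<beta> > 0" and 1: "B\<^sup>2 * \<beta> \<le> 3 * A\<^sup>2 * \<alpha>" and 2: "A\<^sup>2 * \<alpha> \<le> 3 * B\<^sup>2 * \<beta>"
  shows "(A * B)\<^sup>2 * (\<alpha> / \<beta> + \<beta> / \<alpha>) \<le> 6 * (max A B) ^ 4"
    and "\<lbrakk>c > 0; \<alpha> \<ge> c * \<beta>; \<beta> \<ge> c * \<alpha>\<rbrakk> \<Longrightarrow> c * (max A B) ^ 4 \<le> 3 * (A * B)\<^sup>2"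
proof -
  define M where "M = max A B"
  have M: "A \<le> M" "B \<le> M" "M > 0" using pos by (auto simp: M_def)
  have A2: "A\<^sup>2 \<le> M\<^sup>2" "B\<^sup>2 \<le> M\<^sup>2" using M pos by (auto intro!: power_mono)
  have b1: "B\<^sup>2 * (\<beta> / \<alpha>) \<le> 3 * A\<^sup>2" using 1 pos by (simp add: field_simps)
  have b2: "A\<^sup>2 * (\<alpha> / \<beta>) \<le> 3 * B\<^sup>2" using 2 pos by (simp add: field_simps)
  have "(A * B)\<^sup>2 * (\<alpha> / \<beta> + \<beta> / \<alpha>) = (A\<^sup>2 * (\<alpha> / \<beta>)) * B\<^sup>2 + (B\<^sup>2 * (\<beta> / \<alpha>)) * A\<^sup>2"
    by (simp add: power_mult_distrib algebra_simps)
  also have "\<dots> \<le> (3 * B\<^sup>2) * B\<^sup>2 + (3 * A\<^sup>2) * A\<^sup>2" by (intro add_mono mult_right_mono b1 b2) auto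
  also have "\<dots> \<le> (3 * M\<^sup>2) * M\<^sup>2 + (3 * M\<^sup>2) * M\<^sup>2" using A2 by (intro add_mono mult_mono) auto
  finally show "(A * B)\<^sup>2 * (\<alpha> / \<beta> + \<beta> / \<alpha>) \<le> 6 * (max A B) ^ 4" by (simp add: M_def[symmetric] power2_eq_square power4_eq_xxxx)
  assume c: "c > 0" "\<alpha> \<ge> c * \<beta>" "\<beta> \<ge> c * \<alpha>"
  have "c * B\<^sup>2 \<le> 3 * A\<^sup>2"
  proof -
    have "(c * B\<^sup>2) * \<alpha> \<le> B\<^sup>2 * \<beta>" using mult_left_mono[OF c(3), of "B\<^sup>2"] by (simp add: mult_ac)
    also have "\<dots> \<le> (3 * A\<^sup>2) * \<alpha>" using 1 by simp
    finally show ?thesis using pos(3) by simp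
  qed
  hence k1: "c * B ^ 4 \<le> 3 * (A * B)\<^sup>2" using mult_right_mono[of "c * B\<^sup>2" "3 * A\<^sup>2" "B\<^sup>2"] by (simp add: power_mult_distrib power2_eq_square power4_eq_xxxx mult_ac)
  have "c * A\<^sup>2 \<le> 3 * B\<^sup>2"
  proof -
    have "(c * A\<^sup>2) * \<beta> \<le> A\<^sup>2 * \<alpha>" using mult_left_mono[OF c(2), of "A\<^sup>2"] by (simp add: mult_ac)
    also have "\<dots> \<le> (3 * B\<^sup>2) * \<beta>" using 2 by simp
    finally show ?thesis using pos(4) by simp
  qed
  hence k2: "c * A ^ 4 \<le> 3 * (A * B)\<^sup>2" using mult_right_mono[of "c * A\<^sup>2" "3 * B\<^sup>2" "A\<^sup>2"] by (simp add: power_mult_distrib power2_eq_square power4_eq_xxxx mult_ac)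
  show "c * (max A B) ^ 4 \<le> 3 * (A * B)\<^sup>2" using k1 k2 by (simp add: max_def)
qed

theorem theorem2:
  fixes m :: nat and q :: "real \<Rightarrow> complex" and b :: boundary_type
    and c\<^sub>0 :: real and n :: "nat \<Rightarrow> nat" and u :: "nat \<Rightarrow> real \<Rightarrow> complex"
  assumes "sobolev_W1 m q"
    and "\<And>j. j < m \<Longrightarrow> (deriv_01 ^^ j) q 0 = (deriv_01 ^^ j) q 1"
    and "c\<^sub>0 > 0"
    and "\<And>k. n k > 0"
    and "b = Periodic \<Longrightarrow> (\<forall>k. even (n k))"
    and "b = Antiperiodic \<Longrightarrow> (\<forall>k. odd (n k))"
    and "\<And>k. cmod (alpha q (n k)) > c\<^sub>0 / real (n k) ^ (m + 1)"
    and "\<And>k. cmod (beta q (n k)) > c\<^sub>0 / real (n k) ^ (m + 1)"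
    and "filterlim (\<lambda>k. cmod (alpha q (n k) / beta q (n k)) + cmod (beta q (n k) / alpha q (n k)))
           at_top sequentially"
    and "root_function_system b q u"
  shows "\<not> schauder_basis_L2 u"
proof
  assume sb: "schauder_basis_L2 u"
  have q: "integrable leb01 q" using assms(1) unfolding sobolev_W1_def by (elim conjE allE[of _ 0]) auto
  define a where "a k = (if k = 0 then 0 else fcoeff q k)" for k
  obtain C where C: "C \<ge> 0" "\<And>k. cmod (a k) * weight k ^ m \<le> C"
    and ev: "\<forall>\<^sub>F n in sequentially. c\<^sub>0 / real n ^ (m + 1) < cmod (a (int n)) \<and> c\<^sub>0 / real n ^ (m + 1) < cmod (a (- int n)) \<longrightarrow>
        (\<exists>z y. resonant_at a C (int n) z y)"
    using resonant_eventually[OF assms(1,2,3) a_def] by blast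
  have an: "a (int (n k)) = beta q (n k)" "a (- int (n k)) = alpha q (n k)" for k
    using assms(4)[of k] by (simp_all add: a_def alpha_eq beta_eq)
  have bn: "bsign b = (if even (n k) then 1 else -1)" for k
    using assms(5,6) by (cases b) (auto simp: bsign_def)
  define rat where "rat j = cmod (alpha q j / beta q j) + cmod (beta q j / alpha q j)" for j
  have ratlim: "filterlim (\<lambda>k. rat (n k)) at_top sequentially" using assms(9) by (simp add: rat_def)
  have ninf: "filterlim n at_top sequentially" by (rule ratio_limit_imp_unbounded[where f = rat and n = n, OF ratlim])
  define \<sigma> where "\<sigma> j = gap_sum (int j)" for j
  have s0: "\<sigma> j \<ge> 0" for j by (simp add: \<sigma>_def gap_sum_nonneg)
  have slim: "\<sigma> \<longlonglongrightarrow> 0" "(\<lambda>j. real j * (\<sigma> j)\<^sup>2) \<longlonglongrightarrow> 0" unfolding \<sigma>_def[abs_def] by (rule gap_sum_limits)+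
  have s2lim: "(\<lambda>j. (\<sigma> j)\<^sup>2) \<longlonglongrightarrow> 0" using tendsto_power[OF slim(1), of 2] by simp
  \<comment> \<open>\<open>768 = 3 * 16\<^sup>2\<close>: the remainder
    \<open>16 * C\<^sup>2 * \<sigma>\<^sup>2\<close> enters squared, with the factor 3 from the
    lower bound for \<open>(A * B)\<^sup>2\<close> and \<open>C * j\<close> from the denominator of
    \<open>c\<close>.\<close>
  have prodlim: "(\<lambda>j. (768 * C^5) * ((real j * (\<sigma> j)\<^sup>2) * (\<sigma> j)\<^sup>2)) \<longlonglongrightarrow> 0"
    using tendsto_mult_right_zero[OF tendsto_mult_zero[OF slim(2) s2lim], of "768 * C^5"] by simp
  have e1: "\<forall>\<^sub>F j in sequentially. 4 * C * \<sigma> j < 1"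
    by (rule order_tendstoD(2)[OF tendsto_mult_right_zero[OF slim(1)]]) simp
  have e2: "\<forall>\<^sub>F j in sequentially. (768 * C^5) * ((real j * (\<sigma> j)\<^sup>2) * (\<sigma> j)\<^sup>2) < 4 * c\<^sub>0"
    by (rule order_tendstoD(2)[OF prodlim]) (use assms(3) in simp)
  have "\<forall>\<^sub>F j in sequentially. (c\<^sub>0 / real j ^ (m + 1) < cmod (a (int j)) \<and> c\<^sub>0 / real j ^ (m + 1) < cmod (a (- int j)) \<longrightarrow>
        (\<exists>z y. resonant_at a C (int j) z y)) \<and> 4 * C * \<sigma> j < 1 \<and> (768 * C^5) * ((real j * (\<sigma> j)\<^sup>2) * (\<sigma> j)\<^sup>2) < 4 * c\<^sub>0"
    using ev e1 e2 by eventually_elim simp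
  from eventually_compose_filterlim[OF this ninf]
  obtain k0 where k0: "\<And>k. k \<ge> k0 \<Longrightarrow> (c\<^sub>0 / real (n k) ^ (m + 1) < cmod (a (int (n k))) \<and> c\<^sub>0 / real (n k) ^ (m + 1) < cmod (a (- int (n k))) \<longrightarrow>
        (\<exists>z y. resonant_at a C (int (n k)) z y)) \<and> 4 * C * \<sigma> (n k) < 1 \<and> (768 * C^5) * ((real (n k) * (\<sigma> (n k))\<^sup>2) * (\<sigma> (n k))\<^sup>2) < 4 * c\<^sub>0"
    unfolding eventually_sequentially by blast
  \<comment> \<open>The first part bounds \<open>2 * A * B\<close>, small by imbalance, the second
    the nonresonant remainder, both relative to \<open>M\<^sup>2\<close>. The shift by
    \<open>k0\<close> makes the eventual estimates valid for every \<open>k\<close>.\<close>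
  define \<epsilon> where "\<epsilon> k = 2 * sqrt (6 / rat (n (k + k0))) + 16 * C\<^sup>2 * (\<sigma> (n (k + k0)))\<^sup>2" for k
  have \<epsilon>lim: "\<epsilon> \<longlonglongrightarrow> 0"
  proof -
    have r: "filterlim (\<lambda>k. rat (n (k + k0))) at_top sequentially" by (rule filterlim_compose[OF ratlim filterlim_add_const_nat_at_top])
    have "(\<lambda>k. 6 / rat (n (k + k0))) \<longlonglongrightarrow> 0" by (rule tendsto_divide_0[OF tendsto_const filterlim_at_top_imp_at_infinity[OF r]])
    from tendsto_real_sqrt[OF this] have 1: "(\<lambda>k. sqrt (6 / rat (n (k + k0)))) \<longlonglongrightarrow> 0" by simp
    have 2: "(\<lambda>k. (\<sigma> (n (k + k0)))\<^sup>2) \<longlonglongrightarrow> 0"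
      by (rule filterlim_compose[OF s2lim filterlim_compose[OF ninf filterlim_add_const_nat_at_top]])
    show ?thesis unfolding \<epsilon>_def[abs_def]
      using tendsto_add[OF tendsto_mult_right_zero[OF 1, of 2] tendsto_mult_right_zero[OF 2, of "16 * C\<^sup>2"]] by simp
  qed
  have main: "\<exists>w M \<mu>. simple_eigenpair b q \<mu> w \<and> M > 0 \<and> M \<le> (\<integral>x. cmod (w x) \<partial>leb01) \<and> (\<forall>x\<in>{0..1}. cmod (w x) \<le> 3 * M) \<and>
     continuous_on {0..1} w \<and> cmod (pair01 w w) \<le> \<epsilon> k * M\<^sup>2" for k
  proof -
    define j where "j = n (k + k0)"
    have j1: "j \<ge> 1" using assms(4)[of "k + k0"] by (simp add: j_def)
    have lo: "c\<^sub>0 / real j ^ (m + 1) < cmod (a (int j))" "c\<^sub>0 / real j ^ (m + 1) < cmod (a (- int j))"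
      using assms(7,8)[of "k + k0"] by (simp_all add: an j_def)
    have hj: "4 * C * \<sigma> j < 1" "(768 * C^5) * ((real j * (\<sigma> j)\<^sup>2) * (\<sigma> j)\<^sup>2) < 4 * c\<^sub>0"
      using k0[of "k + k0"] by (simp_all add: j_def)
    obtain z y where R: "resonant_at a C (int j) z y" using k0[of "k + k0"] lo unfolding j_def by auto
    define w where "w = (\<lambda>x. if x \<in> {0..1} then hexp (int j) x * fseries y x else 0)"
    define A B where "A = cmod (y 0)" and "B = cmod (y (- int j))"
    define M where "M = max A B"
    note E = resonant_eigenpair[OF q a_def bn[of "k + k0", folded j_def] R C(1) j1 less_imp_le[OF hj(1)[unfolded \<sigma>_def]], folded w_def A_def B_def, folded M_def]
    have jp: "real j ^ (m + 1) > 0" using j1 by simp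
    have cj: "c\<^sub>0 / real j ^ (m + 1) > 0" using assms(3) jp by simp
    have pos: "cmod (a (- int j)) > 0" "cmod (a (int j)) > 0" using lo cj by linarith+
    have AB: "A > 0" "B > 0" "B\<^sup>2 * cmod (a (int j)) \<le> 3 * A\<^sup>2 * cmod (a (- int j))" "A\<^sup>2 * cmod (a (- int j)) \<le> 3 * B\<^sup>2 * cmod (a (int j))"
      using R by (simp_all add: resonant_at_def A_def B_def)
    note ub = unbalanced_product[OF AB(1,2) pos AB(3,4), folded M_def]
    have rj: "rat j = cmod (a (- int j)) / cmod (a (int j)) + cmod (a (int j)) / cmod (a (- int j))"
      using an[of "k + k0"] by (simp add: rat_def j_def norm_divide)
    have rpos: "rat j > 0" unfolding rj using pos by (intro add_pos_pos divide_pos_pos)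
    have upper: "A * B \<le> sqrt (6 / rat j) * M\<^sup>2"
    proof -
      have "(A * B)\<^sup>2 * rat j \<le> 6 * M ^ 4" using ub(1) unfolding rj .
      hence "(A * B)\<^sup>2 \<le> 6 / rat j * M ^ 4" using rpos by (simp add: field_simps)
      also have "\<dots> = (sqrt (6 / rat j) * M\<^sup>2)\<^sup>2" using rpos by (simp add: power_mult_distrib flip: power_mult)
      finally show ?thesis by (rule power2_le_imp_le) (use rpos in auto)
    qed
    have Cp: "C > 0"
    proof -
      have "0 < cmod (a (int j)) * weight (int j) ^ m" using pos by simp
      thus ?thesis using C(2)[of "int j"] by linarith
    qed
    \<comment> \<open>The lower bound for one coefficient is played against the decay of the other:
      their quotient is at least of order \<open>1 / j\<close>, which limits the imbalance.\<close>
    have ratio: "x \<ge> c\<^sub>0 / (C * real j) * v" if x: "c\<^sub>0 / real j ^ (m + 1) < x" and v: "v * weight (int j) ^ m \<le> C" "v \<ge> 0" for x v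
    proof -
      have "real j ^ m \<le> weight (int j) ^ m" by (intro power_mono) (auto simp: weight_def)
      hence "v * real j ^ m \<le> C" using v mult_left_mono[of "real j ^ m" "weight (int j) ^ m" v] by linarith
      hence "v \<le> C / real j ^ m" using j1 by (simp add: field_simps)
      hence "c\<^sub>0 / (C * real j) * v \<le> c\<^sub>0 / (C * real j) * (C / real j ^ m)" using assms(3) Cp by (intro mult_left_mono) auto
      also have "\<dots> = c\<^sub>0 / real j ^ (m + 1)" using Cp by (simp add: field_simps)
      finally show ?thesis using x by linarith
    qed
    define c where "c = c\<^sub>0 / (C * real j)"
    have cp: "c > 0" using assms(3) Cp j1 by (simp add: c_def)
    have low: "c * M ^ 4 \<le> 3 * (A * B)\<^sup>2"
      by (rule ub(2)[OF cp]) (unfold c_def, rule ratio[OF lo(2) C(2)], simp, rule ratio[OF lo(1)], use C(2)[of "- int j"] in simp, simp)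
    define S where "S = 16 * C\<^sup>2 * (\<sigma> j)\<^sup>2"
    have Elow: "cmod (pair01 w w - 2 * y 0 * y (- int j)) \<le> S * M\<^sup>2" using E(5) by (simp add: S_def \<sigma>_def)
    have n2: "cmod (2 * y 0 * y (- int j)) = 2 * (A * B)" by (simp add: A_def B_def norm_mult)
    \<comment> \<open>If the pairing vanished, \<open>2 * A * B\<close> would be at most
      \<open>S * M\<^sup>2\<close>. By \<open>low\<close> it is at least of order
      \<open>j powr (-1/2)\<close> times \<open>M\<^sup>2\<close>, whereas
      \<open>S\<^sup>2 * j\<close> is too small for that by the choice of \<open>k0\<close>.\<close>
    have p0: "pair01 w w \<noteq> 0"
    proof
      assume "pair01 w w = 0"
      hence "2 * (A * B) \<le> S * M\<^sup>2" using Elow n2 by (simp add: norm_minus_commute)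
      hence "(2 * (A * B))\<^sup>2 \<le> (S * M\<^sup>2)\<^sup>2" using AB by (intro power_mono) auto
      hence "4 * (A * B)\<^sup>2 \<le> S\<^sup>2 * M ^ 4" by (simp add: power_mult_distrib flip: power_mult)
      hence "4 * (c * M ^ 4) \<le> (3 * S\<^sup>2) * M ^ 4" using low by simp
      hence "4 * c \<le> 3 * S\<^sup>2" using E(1) by (simp add: mult.assoc[symmetric])
      hence "4 * c\<^sub>0 \<le> 3 * S\<^sup>2 * (C * real j)" using Cp j1 by (simp add: c_def pos_divide_le_eq)
      also have "\<dots> = (768 * C^5) * ((real j * (\<sigma> j)\<^sup>2) * (\<sigma> j)\<^sup>2)" by (simp add: S_def power2_eq_square eval_nat_numeral)
      finally show False using hj(2) by simp
    qed
    have "cmod (pair01 w w) \<le> 2 * (A * B) + S * M\<^sup>2"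
      using norm_triangle_sub[of "pair01 w w" "2 * y 0 * y (- int j)"] Elow n2 by linarith
    also have "\<dots> \<le> 2 * (sqrt (6 / rat j) * M\<^sup>2) + S * M\<^sup>2" using upper by simp
    also have "\<dots> = \<epsilon> k * M\<^sup>2" by (simp add: \<epsilon>_def j_def S_def algebra_simps)
    finally have "cmod (pair01 w w) \<le> \<epsilon> k * M\<^sup>2" .
    moreover have "M \<le> (\<integral>x. cmod (w x) \<partial>leb01)" unfolding w_def by (rule E(2))
    moreover have "\<forall>x\<in>{0..1}. cmod (w x) \<le> 3 * M" unfolding w_def by (rule ballI, rule E(3))
    ultimately show ?thesis using E(1) E(4) E(6)[OF p0]
      by (intro exI[of _ w] exI[of _ M] exI[of _ "near_ev q (int j) z"] conjI)
  qed
  obtain w M \<mu> where w: "\<And>k. simple_eigenpair b q (\<mu> k) (w k)" "\<And>k. M k > (0::real)" "\<And>k. M k \<le> (\<integral>x. cmod (w k x) \<partial>leb01)"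
    "\<And>k x. x \<in> {0..1} \<Longrightarrow> cmod (w k x) \<le> 3 * M k" "\<And>k. continuous_on {0..1} (w k)" "\<And>k. cmod (pair01 (w k) (w k)) \<le> \<epsilon> k * (M k)\<^sup>2"
    using main by metis
  show False
  proof (rule uniform_small_pairing_contradiction[OF _ w(5) _ w(2,3,4,6) \<epsilon>lim])
    show "pair01 (w k) (w k) \<noteq> 0" for k using w(1)[of k] by (simp add: simple_eigenpair_def)
    show "\<exists>K. \<forall>k. cmod (pair01 g (w k)) * (\<integral>x. cmod (w k x) \<partial>leb01) \<le> K * cmod (pair01 (w k) (w k))" if g: "continuous_on {0..1} g" for g
      using basis_coefficient_bound[OF q assms(10) sb g] w(1) by blast
  qed
qed

end
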